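(* Let $[\cdot]$ stand either for $\{\cdot\}$ throughout (Roumieu case) or for $(\cdot)$ throughout (Beurling case). Let $E$ be a convenient vector space, $U\subseteq E$ a $c^\infty$-open subset, and $f:U\to\mathbb{C}$ a function. (a) Let $\mathfrak{M}$ be an [admissible] weight matrix (R-admissible in the Roumieu case, B-admissible in the Beurling case). If $f^j,f^{j+1}\in\mathcal{E}^{[\mathfrak{M}]}(U)$ for some positive integer $j$, then $f\in\mathcal{E}^{[\mathfrak{M}]}(U)$. (b) Let $\omega$ be a concave weight function. If $f^j,f^{j+1}\in\mathcal{E}^{[\omega]}(U)$ for some positive integer $j$, then $f\in\mathcal{E}^{[\omega]}(U)$.
   Context: Weight sequences and matrices. A weight sequence is a positive sequence $M=(M_k)_{k\ge 0}$ that is log-convex, with $M_0=1\le M_1$ and $M_k^{1/k}\to\infty$. A weight matrix $\mathfrak{M}$ is a (nonempty) family of weight sequences that is totally ordered with respect to the pointwise order relation on sequences. With $M$ one associates the sequence $m=(m_k)$ given by $k!\,m_k = M_k$ (similarly $n$ for $N$). If $m_k^{1/k}\to\infty$, define for $t>0$ $$h_m(t):=\inf_{k\in\mathbb{N}} m_k t^k,\quad \overline{\Gamma}_m(t):=\min\{k\in\mathbb N : h_m(t)=m_kt^k\},\quad \underline{\Gamma}_m(t):=\min\Big\{k\in\mathbb N: \frac{m_{k+1}}{m_k}\ge \frac1t\Big\},$$ where $\mathbb{N}=\{0,1,2,\dots\}$. For positive sequences $M,N$ set $\operatorname{mg}(M,N):=\sup_{j,k\ge 0,\ j+k\ge 1}\big(\frac{M_{j+k}}{N_jN_k}\big)^{1/(j+k)}\in(0,\infty]$.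 Admissibility. A weight matrix $\mathfrak{M}$ with $m_k^{1/k}\to\infty$ for all $M\in\mathfrak{M}$ is called: - R-admissible (= {admissible}) if: for every $M\in\mathfrak{M}$ there are $N\in\mathfrak{M}$ and $C\ge1$ with $\overline{\Gamma}_n(Ct)\le\underline{\Gamma}_m(t)$ for all $t>0$; and for every $M\in\mathfrak{M}$ there is $N\in\mathfrak{M}$ with $\operatorname{mg}(M,N)<\infty$. - B-admissible (= (admissible)) if: for every $M\in\mathfrak{M}$ there are $N\in\mathfrak{M}$ and $C\ge1$ with $\overline{\Gamma}_m(Ct)\le\underline{\Gamma}_n(t)$ for all $t>0$; and for every $M\in\mathfrak{M}$ there is $N\in\mathfrak{M}$ with $\operatorname{mg}(N,M)<\infty$. Weight functions. A weight function is a continuous increasing function $\omega:[0,\infty)\to[0,\infty)$ such that $\omega(2t)=O(\omega(t))$, $\omega(t)=o(t)$ and $\log t=o(\omega(t))$ as $t\to\infty$, and $\varphi_\omega(t):=\omega(e^t)$ is convex on $[0,\infty)$. Let $\varphi_\omega^*(y):=\sup_{x\ge0}(xy-\varphi_\omega(x))$, $y\ge0$. Function classes on a Banach space $F$. For $W\subseteq F$ open and $f\in C^\infty(W,\mathbb{C})$ (smooth in the real Fréchet sense), $K\subseteq W$, $\rho>0$, put $\|f\|^M_{K,\rho}:=\sup_{x\in K}\sup_{k\in\mathbb{N}}\frac{\|f^{(k)}(x)\|_{L^k(F,\mathbb{C})}}{\rho^kM_k}$, where $f^{(k)}$ is the $k$-th Fréchet derivative with the operator norm on bounded $k$-linear maps.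 $\mathcal{E}^{\{\mathfrak{M}\}}(W)$ is the set of $f\in C^\infty(W,\mathbb{C})$ such that for every compact $K\subseteq W$ there exist $M\in\mathfrak{M}$ and $\rho>0$ with $\|f\|^M_{K,\rho}<\infty$; $\mathcal{E}^{(\mathfrak{M})}(W)$ is the set of $f\in C^\infty(W,\mathbb{C})$ such that $\|f\|^M_{K,\rho}<\infty$ for all compact $K\subseteq W$, all $M\in\mathfrak{M}$ and all $\rho>0$. $\mathcal{E}^{\{\omega\}}(W)$ (resp. $\mathcal{E}^{(\omega)}(W)$) is the set of $f\in C^\infty(W,\mathbb{C})$ such that for every compact $K\subseteq W$ there exists $\rho>0$ (resp. for every compact $K\subseteq W$ and every $\rho>0$) one has $\sup_{x\in K}\sup_{k\in\mathbb{N}}\|f^{(k)}(x)\|_{L^k(F,\mathbb{C})}\exp(-\frac1\rho\varphi_\omega^*(\rho k))<\infty$. Convenient setting. A convenient vector space is a locally convex space $E$ that is Mackey complete. The $c^\infty$-topology on $E$ is the final topology with respect to all smooth curves $\mathbb{R}\to E$. A function $f:U\to\mathbb{C}$ on a $c^\infty$-open set $U\subseteq E$ is smooth if $f\circ c$ is smooth for every smooth curve $c:\mathbb{R}\to E$ with values in $U$. For a closed absolutely convex bounded subset $B$ of $E$, let $E_B$ be the linear span of $B$ with the Minkowski functional $p_B(x)=\inf\{t>0:x\in tB\}$ as norm (a Banach space), $i_B:E_B\to E$ the inclusion, and $U_B:=U\cap E_B$. Then $\mathcal{E}^{[\mathfrak{M}]}(U)$ is the set of all smooth $f:U\to\mathbb{C}$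 such that $f\circ i_B\in\mathcal{E}^{[\mathfrak{M}]}(U_B)$ for each closed absolutely convex bounded subset $B$ of $E$; $\mathcal{E}^{[\omega]}(U)$ is defined in the same way with $[\omega]$ in place of $[\mathfrak{M}]$. *)

theory Defs
  imports "HOL-Analysis.Analysis" "HOL-Library.Landau_Symbols"
begin

section \<open>Weight sequences and weight matrices\<close>

definition weight_sequence :: "(nat \<Rightarrow> real) \<Rightarrow> bool" where
  "weight_sequence M \<longleftrightarrow>
     (\<forall>k. 0 < M k) \<and>
     (\<forall>k. (M (Suc k))\<^sup>2 \<le> M k * M (Suc (Suc k))) \<and>
     M 0 = 1 \<and> 1 \<le> M 1 \<and>
     filterlim (\<lambda>k. root k (M k)) at_top sequentially"

text \<open>The order on \<^typ>\<open>nat \<Rightarrow> real\<close> is the pointwise one.\<close>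

definition weight_matrix :: "(nat \<Rightarrow> real) set \<Rightarrow> bool" where
  "weight_matrix \<MM> \<longleftrightarrow>
     \<MM> \<noteq> {} \<and> (\<forall>M\<in>\<MM>. weight_sequence M) \<and> (\<forall>M\<in>\<MM>. \<forall>N\<in>\<MM>. M \<le> N \<or> N \<le> M)"

definition fact_quot :: "(nat \<Rightarrow> real) \<Rightarrow> nat \<Rightarrow> real" where
  "fact_quot M k = M k / fact k"

text \<open>The next three notions are applied to \<open>m = fact_quot M\<close>. They are meaningful for positive
  \<open>m\<close> with \<open>m\<^sub>k\<^sup>1\<^sup>/\<^sup>k \<longlonglongrightarrow> \<infinity>\<close> and for \<open>t > 0\<close>: then the infimum is attained, and the two sets of
  indices are nonempty, so that \<open>LEAST\<close> is a genuine minimum.\<close>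

definition h_fun :: "(nat \<Rightarrow> real) \<Rightarrow> real \<Rightarrow> real" where
  "h_fun m t = (INF k. m k * t ^ k)"

definition Gamma_upper :: "(nat \<Rightarrow> real) \<Rightarrow> real \<Rightarrow> nat" where
  "Gamma_upper m t = (LEAST k. h_fun m t = m k * t ^ k)"

definition Gamma_lower :: "(nat \<Rightarrow> real) \<Rightarrow> real \<Rightarrow> nat" where
  "Gamma_lower m t = (LEAST k. m (Suc k) / m k \<ge> 1 / t)"

definition mg :: "(nat \<Rightarrow> real) \<Rightarrow> (nat \<Rightarrow> real) \<Rightarrow> ennreal" where
  "mg M N = (SUP (j, k) \<in> {(j, k). 1 \<le> j + k}. ennreal (root (j + k) (M (j + k) / (N j * N k))))"

text \<open>The two readings of the bracket \<open>[\<cdot>]\<close>: \<open>Roumieu\<close> is \<open>{\<cdot>}\<close> and \<open>Beurling\<close> is \<open>(\<cdot>)\<close>.\<close>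

datatype bracket = Roumieu | Beurling

definition R_admissible :: "(nat \<Rightarrow> real) set \<Rightarrow> bool" where
  "R_admissible \<MM> \<longleftrightarrow>
     weight_matrix \<MM> \<and>
     (\<forall>M\<in>\<MM>. filterlim (\<lambda>k. root k (fact_quot M k)) at_top sequentially) \<and>
     (\<forall>M\<in>\<MM>. \<exists>N\<in>\<MM>. \<exists>C\<ge>1. \<forall>t>0.
        Gamma_upper (fact_quot N) (C * t) \<le> Gamma_lower (fact_quot M) t) \<and>
     (\<forall>M\<in>\<MM>. \<exists>N\<in>\<MM>. mg M N < \<infinity>)"

definition B_admissible :: "(nat \<Rightarrow> real) set \<Rightarrow> bool" where
  "B_admissible \<MM> \<longleftrightarrow>
     weight_matrix \<MM> \<and>
     (\<forall>M\<in>\<MM>. filterlim (\<lambda>k. root k (fact_quot M k)) at_top sequentially) \<and>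
     (\<forall>M\<in>\<MM>. \<exists>N\<in>\<MM>. \<exists>C\<ge>1. \<forall>t>0.
        Gamma_upper (fact_quot M) (C * t) \<le> Gamma_lower (fact_quot N) t) \<and>
     (\<forall>M\<in>\<MM>. \<exists>N\<in>\<MM>. mg N M < \<infinity>)"

fun admissible :: "bracket \<Rightarrow> (nat \<Rightarrow> real) set \<Rightarrow> bool" where
  "admissible Roumieu \<MM> = R_admissible \<MM>"
| "admissible Beurling \<MM> = B_admissible \<MM>"


section \<open>Weight functions\<close>

text \<open>A function on \<open>[0,\<infinity>)\<close> is a total function on the reals of which only the values
  on \<open>{0..}\<close> matter.\<close>

definition weight_function :: "(real \<Rightarrow> real) \<Rightarrow> bool" where
  "weight_function \<omega> \<longleftrightarrow>
     (\<forall>t\<ge>0. 0 \<le> \<omega> t) \<and> continuous_on {0..} \<omega> \<and> mono_on {0..} \<omega> \<and>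
     (\<lambda>t. \<omega> (2 * t)) \<in> O[at_top](\<omega>) \<and>
     \<omega> \<in> o[at_top](\<lambda>t. t) \<and>
     ln \<in> o[at_top](\<omega>) \<and>
     convex_on {0..} (\<lambda>t. \<omega> (exp t))"

text \<open>The supremum is finite for \<open>y \<ge> 0\<close> if \<open>\<omega>\<close> is a weight function, because \<open>log t = o(\<omega>(t))\<close>.\<close>

definition phi_conj :: "(real \<Rightarrow> real) \<Rightarrow> real \<Rightarrow> real" where
  "phi_conj \<omega> y = (SUP x\<in>{0..}. x * y - \<omega> (exp x))"


section \<open>Smooth functions and ultradifferentiable classes on a normed space\<close>

text \<open>The normed spaces \<open>E\<^sub>B\<close> below are subspaces of \<open>E\<close> with their own norms, hence not types.
  So a normed space is a pair of a linear subspace \<open>V\<close> of a real vector space and a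
  norm \<open>p\<close> on \<open>V\<close> (values of \<open>p\<close> outside \<open>V\<close> are irrelevant).

  Elements of \<open>L\<^sup>k(V, \<complex>)\<close> are represented by functions on argument lists of length \<open>k\<close>.\<close>

definition op_norm :: "'v set \<Rightarrow> ('v \<Rightarrow> real) \<Rightarrow> nat \<Rightarrow> ('v list \<Rightarrow> complex) \<Rightarrow> ennreal" where
  "op_norm V p k T =
     (SUP vs \<in> {vs. length vs = k \<and> (\<forall>v\<in>set vs. v \<in> V \<and> p v \<le> 1)}. ennreal (cmod (T vs)))"

definition multilinear_on ::
    "'v::real_vector set \<Rightarrow> nat \<Rightarrow> ('v list \<Rightarrow> complex) \<Rightarrow> bool" where
  "multilinear_on V k T \<longleftrightarrow>
     (\<forall>vs. length vs = k \<longrightarrow> set vs \<subseteq> V \<longrightarrow>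
       (\<forall>i<k. \<forall>u\<in>V. \<forall>w\<in>V. \<forall>a b.
          T (vs[i := a *\<^sub>R u + b *\<^sub>R w]) = a *\<^sub>R T (vs[i := u]) + b *\<^sub>R T (vs[i := w])))"

text \<open>\<open>frechet_derivs V p W f D\<close>: \<open>D k x\<close> is the \<open>k\<close>-th Frechet derivative of \<open>f\<close> at \<open>x\<close>,
  for all \<open>k\<close> and all \<open>x\<close> in the open subset \<open>W\<close> of \<open>V\<close>. The last conjunct says that
  \<open>D k : W \<rightarrow> L\<^sup>k(V, \<complex>)\<close> is Frechet differentiable with respect to the operator norm; its
  derivative at \<open>x\<close>, a map \<open>V \<rightarrow> L\<^sup>k(V, \<complex>)\<close>, sends \<open>h\<close> to \<open>\<lambda>vs. D (Suc k) x (h # vs)\<close>.\<close>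

definition frechet_derivs ::
    "'v::real_vector set \<Rightarrow> ('v \<Rightarrow> real) \<Rightarrow> 'v set \<Rightarrow> ('v \<Rightarrow> complex) \<Rightarrow>
     (nat \<Rightarrow> 'v \<Rightarrow> 'v list \<Rightarrow> complex) \<Rightarrow> bool" where
  "frechet_derivs V p W f D \<longleftrightarrow>
     (\<forall>x\<in>W. D 0 x [] = f x) \<and>
     (\<forall>k. \<forall>x\<in>W. multilinear_on V k (D k x) \<and> op_norm V p k (D k x) < \<infinity>) \<and>
     (\<forall>k. \<forall>x\<in>W. \<forall>\<epsilon>>0. \<exists>\<delta>>0. \<forall>h\<in>V. p h < \<delta> \<longrightarrow> x + h \<in> W \<longrightarrow>
        op_norm V p k (\<lambda>vs. D k (x + h) vs - D k x vs - D (Suc k) x (h # vs))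
          \<le> ennreal (\<epsilon> * p h))"

definition frechet_smooth ::
    "'v::real_vector set \<Rightarrow> ('v \<Rightarrow> real) \<Rightarrow> 'v set \<Rightarrow> ('v \<Rightarrow> complex) \<Rightarrow> bool" where
  "frechet_smooth V p W f \<longleftrightarrow> (\<exists>D. frechet_derivs V p W f D)"

text \<open>For smooth \<open>f\<close> and open \<open>W\<close> the choice is unique at points of \<open>W\<close> and argument lists
  of the right length in \<open>V\<close>.\<close>

definition frechet_deriv ::
    "'v::real_vector set \<Rightarrow> ('v \<Rightarrow> real) \<Rightarrow> 'v set \<Rightarrow> ('v \<Rightarrow> complex) \<Rightarrow>
     nat \<Rightarrow> 'v \<Rightarrow> 'v list \<Rightarrow> complex" where
  "frechet_deriv V p W f = (SOME D. frechet_derivs V p W f D)"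

text \<open>The distance is cut off outside \<open>V\<close> since \<^locale>\<open>Metric_space\<close> requires symmetry and
  nonnegativity everywhere.\<close>

definition norm_topology :: "'v::real_vector set \<Rightarrow> ('v \<Rightarrow> real) \<Rightarrow> 'v topology" where
  "norm_topology V p =
     Metric_space.mtopology V (\<lambda>x y. if x \<in> V \<and> y \<in> V then p (x - y) else 0)"

definition M_norm ::
    "'v::real_vector set \<Rightarrow> ('v \<Rightarrow> real) \<Rightarrow> 'v set \<Rightarrow> (nat \<Rightarrow> real) \<Rightarrow> 'v set \<Rightarrow> real \<Rightarrow>
     ('v \<Rightarrow> complex) \<Rightarrow> ennreal" where
  "M_norm V p W M K \<rho> f =
     (SUP x\<in>K. SUP k. op_norm V p k (frechet_deriv V p W f k x) / ennreal (\<rho> ^ k * M k))"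

definition omega_norm ::
    "'v::real_vector set \<Rightarrow> ('v \<Rightarrow> real) \<Rightarrow> 'v set \<Rightarrow> (real \<Rightarrow> real) \<Rightarrow> 'v set \<Rightarrow> real \<Rightarrow>
     ('v \<Rightarrow> complex) \<Rightarrow> ennreal" where
  "omega_norm V p W \<omega> K \<rho> f =
     (SUP x\<in>K. SUP k. op_norm V p k (frechet_deriv V p W f k x) *
        ennreal (exp (- (1 / \<rho>) * phi_conj \<omega> (\<rho> * real k))))"

fun E_matrix_normed ::
    "bracket \<Rightarrow> (nat \<Rightarrow> real) set \<Rightarrow> 'v::real_vector set \<Rightarrow> ('v \<Rightarrow> real) \<Rightarrow> 'v set \<Rightarrow>
     ('v \<Rightarrow> complex) set" where
  "E_matrix_normed Roumieu \<MM> V p W =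
     {f. frechet_smooth V p W f \<and>
         (\<forall>K. compactin (norm_topology V p) K \<and> K \<subseteq> W \<longrightarrow>
            (\<exists>M\<in>\<MM>. \<exists>\<rho>>0. M_norm V p W M K \<rho> f < \<infinity>))}"
| "E_matrix_normed Beurling \<MM> V p W =
     {f. frechet_smooth V p W f \<and>
         (\<forall>K. compactin (norm_topology V p) K \<and> K \<subseteq> W \<longrightarrow>
            (\<forall>M\<in>\<MM>. \<forall>\<rho>>0. M_norm V p W M K \<rho> f < \<infinity>))}"

fun E_omega_normed ::
    "bracket \<Rightarrow> (real \<Rightarrow> real) \<Rightarrow> 'v::real_vector set \<Rightarrow> ('v \<Rightarrow> real) \<Rightarrow> 'v set \<Rightarrow>
     ('v \<Rightarrow> complex) set" where
  "E_omega_normed Roumieu \<omega> V p W =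
     {f. frechet_smooth V p W f \<and>
         (\<forall>K. compactin (norm_topology V p) K \<and> K \<subseteq> W \<longrightarrow>
            (\<exists>\<rho>>0. omega_norm V p W \<omega> K \<rho> f < \<infinity>))}"
| "E_omega_normed Beurling \<omega> V p W =
     {f. frechet_smooth V p W f \<and>
         (\<forall>K. compactin (norm_topology V p) K \<and> K \<subseteq> W \<longrightarrow>
            (\<forall>\<rho>>0. omega_norm V p W \<omega> K \<rho> f < \<infinity>))}"


section \<open>Convenient vector spaces\<close>

text \<open>Locally convex spaces are real and Hausdorff. The last conjunct on \<open>T\<close> is \<^const>\<open>convex\<close>
  unfolded, since \<^const>\<open>convex\<close> is not available inside a class specification.\<close>

class locally_convex_space = real_vector + topological_ab_group_add + t2_space +
  assumes tendsto_scaleR_nhds: "LIM x (nhds r \<times>\<^sub>F nhds a). fst x *\<^sub>R snd x :> nhds (r *\<^sub>R a)"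
    and locally_convex:
      "open S \<Longrightarrow> 0 \<in> S \<Longrightarrow>
        \<exists>T. open T \<and> 0 \<in> T \<and> T \<subseteq> S \<and>
            (\<forall>x\<in>T. \<forall>y\<in>T. \<forall>u\<ge>0. \<forall>v\<ge>0. u + v = 1 \<longrightarrow> u *\<^sub>R x + v *\<^sub>R y \<in> T)"

definition (in locally_convex_space) lcs_bounded :: "'a set \<Rightarrow> bool" where
  "lcs_bounded B \<longleftrightarrow>
     (\<forall>S. open S \<and> 0 \<in> S \<longrightarrow> (\<exists>r>0. \<forall>s\<ge>r. B \<subseteq> (\<lambda>x. s *\<^sub>R x) ` S))"

definition (in locally_convex_space) mackey_Cauchy :: "(nat \<Rightarrow> 'a) \<Rightarrow> bool" where
  "mackey_Cauchy X \<longleftrightarrow>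
     (\<exists>B \<mu>. lcs_bounded B \<and>
        ((\<lambda>(i, j). \<mu> i j :: real) \<longlongrightarrow> 0) (sequentially \<times>\<^sub>F sequentially) \<and>
        (\<forall>i j. X i - X j \<in> (\<lambda>b. \<mu> i j *\<^sub>R b) ` B))"

class convenient_space = locally_convex_space +
  assumes mackey_complete: "mackey_Cauchy X \<Longrightarrow> convergent X"

definition smooth_curve :: "(real \<Rightarrow> 'a::{real_vector, topological_space}) \<Rightarrow> bool" where
  "smooth_curve c \<longleftrightarrow>
     (\<exists>d :: nat \<Rightarrow> real \<Rightarrow> 'a. d 0 = c \<and>
        (\<forall>k t. ((\<lambda>s. (1 / s) *\<^sub>R (d k (t + s) - d k t)) \<longlongrightarrow> d (Suc k) t) (at 0)))"

definition c_infty_open :: "'e::locally_convex_space set \<Rightarrow> bool" where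
  "c_infty_open U \<longleftrightarrow> (\<forall>c. smooth_curve c \<longrightarrow> open (c -` U))"

text \<open>A function on \<open>U\<close> is a total function of which only the values on \<open>U\<close> matter.\<close>

definition convenient_smooth :: "'e::locally_convex_space set \<Rightarrow> ('e \<Rightarrow> complex) \<Rightarrow> bool" where
  "convenient_smooth U f \<longleftrightarrow> (\<forall>c. smooth_curve c \<and> range c \<subseteq> U \<longrightarrow> smooth_curve (f \<circ> c))"

text \<open>The empty set is excluded: its Minkowski functional would be an infimum over the empty set.\<close>

definition absolutely_convex :: "'v::real_vector set \<Rightarrow> bool" where
  "absolutely_convex B \<longleftrightarrow>
     B \<noteq> {} \<and> convex B \<and> (\<forall>x\<in>B. \<forall>a. \<bar>a\<bar> \<le> 1 \<longrightarrow> a *\<^sub>R x \<in> B)"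

definition minkowski :: "'v::real_vector set \<Rightarrow> 'v \<Rightarrow> real" where
  "minkowski B x = Inf {t. t > 0 \<and> x \<in> (\<lambda>b. t *\<^sub>R b) ` B}"

text \<open>The normed space \<open>E\<^sub>B\<close> is the pair of \<open>span B\<close> and \<open>minkowski B\<close>; since the inclusion
  \<open>i\<^sub>B\<close> is the identity, \<open>f \<circ> i\<^sub>B\<close> is \<open>f\<close>, considered on \<open>U\<^sub>B = U \<inter> span B\<close>.\<close>

definition E_matrix ::
    "bracket \<Rightarrow> (nat \<Rightarrow> real) set \<Rightarrow> 'e::locally_convex_space set \<Rightarrow> ('e \<Rightarrow> complex) set" where
  "E_matrix br \<MM> U =
     {f. convenient_smooth U f \<and>
         (\<forall>B. closed B \<and> absolutely_convex B \<and> lcs_bounded B \<longrightarrow>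
            f \<in> E_matrix_normed br \<MM> (span B) (minkowski B) (U \<inter> span B))}"

definition E_omega ::
    "bracket \<Rightarrow> (real \<Rightarrow> real) \<Rightarrow> 'e::locally_convex_space set \<Rightarrow> ('e \<Rightarrow> complex) set" where
  "E_omega br \<omega> U =
     {f. convenient_smooth U f \<and>
         (\<forall>B. closed B \<and> absolutely_convex B \<and> lcs_bounded B \<longrightarrow>
            f \<in> E_omega_normed br \<omega> (span B) (minkowski B) (U \<inter> span B))}"

end

theory Submission
 imports Defs "HOL-Complex_Analysis.Complex_Analysis"
begin

text \<open>A quantitative form of Joris' theorem. Along a line, \<open>g\<^sup>j\<close> and \<open>g\<^sup>j\<^sup>+\<^sup>1\<close> are approximated on a small
 complex disc by Taylor polynomials \<open>P\<close> and \<open>Q\<close>, so that \<open>Q\<^sup>j\<close> is close to \<open>P\<^sup>j\<^sup>+\<^sup>1\<close>; the degree is the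
 index at which a log-convex weight, scaled by the radius of the disc, turns from decreasing to increasing.
 The regularised quotient \<open>\<Phi> = Q cnj P / (|P|\<^sup>2 + \<tau>\<^sup>2)\<close> is almost holomorphic: its antiholomorphic
 derivative is small in \<open>L\<^sup>1\<close>, because \<open>4 |P'|\<^sup>2 \<tau>\<^sup>2 / (|P|\<^sup>2 + \<tau>\<^sup>2)\<^sup>2\<close> is the Laplacian of \<open>ln (|P|\<^sup>2 + \<tau>\<^sup>2)\<close>
 and has an integral of order \<open>ln (1/\<tau>)\<close>. So the Cauchy integral of \<open>\<Phi>\<close> over a circle is a holomorphic
 function close to \<open>g\<close>. Comparing these functions on the discs of radius \<open>t2\<^sup>-\<^sup>i\<close> yields Taylor expansions
 of \<open>g\<close> with bounds on the coefficients that are uniform in the base point and the direction of the line.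
 Such expansions force Frechet differentiability of every order, and finite differences turn the
 bounds on lines into bounds on the operator norms.

 Admissibility of the matrix, or concavity of \<open>\<omega>\<close>, provides a log-convex sequence between \<open>M\<^sub>k/k!\<close> and
 \<open>C\<^sup>k N\<^sub>k/k!\<close>, which is the weight used above. In a convenient space, \<open>U \<inter> E\<^sub>B\<close> is open in \<open>E\<^sub>B\<close> because
 a fast converging sequence in \<open>E\<^sub>B\<close> lies on a smooth curve.\<close>

section \<open>Cauchy integrals of almost holomorphic functions\<close>

text \<open>The naive quotient of the two powers breaks down at the zeros of \<open>g\<close>, about
  which nothing is known; hence the regularisation by \<tau>. Its price is a fixed root of the
  error. If \<open>Q^j - P^(j+1)\<close> has size \<open>\<theta>^(2j(2j+1))\<close>, a root is
  found up to \<theta>, and a further exponent \<open>j + 1\<close> is lost when closeness of two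
  consecutive powers is turned into closeness of the bases. With \<open>L = 2j(2j+1)(j+1)\<close>,
  the k-th Taylor coefficient of \<open>g\<close> is thus governed by the L-th root of
  \<open>l (L (k + 1))\<close> in place of \<open>l k\<close>. Moderate growth of the matrix, or for
  \<omega> a change of the parameter \<rho>, undoes this loss. The constants of the one-dimensional
  argument depend on the bounds for the powers, not on the functions. This uniformity makes the step
  from lines to Frechet derivatives possible: expansions from different base points and in different
  directions are compared at common points. As lines leave a compact set, bounds on compact sets
  have to be extended to neighbourhoods, which in turn asks for a countable cofinal part of the
  matrix in the Roumieu case.\<close>

lemma dbar_homotopy:
 fixes \<Phi> A B :: "complex => complex"
 assumes der: "\<And>z. (\<Phi> has_derivative (\<lambda>h. A z * h + B z * cnj h)) (at z)"
  and cA: "continuous_on UNIV A" and cB: "continuous_on UNIV B"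
  and z: "cmod (z - s) < R"
 shows "cmod (contour_integral (circlepath s R) (\<lambda>\<zeta>. \<Phi> \<zeta> / (\<zeta> - z)) - 2 * pi * \<i> * \<Phi> z)
   \<le> 4 * pi * R * integral {0..1} (\<lambda>t. integral {0..1} (\<lambda>x. cmod (B (z + of_real t * (circlepath s R x - z)))))"
proof -
 have R: "R > 0" using z norm_ge_zero[of "z - s"] by linarith
 define v where "v x = circlepath s R x - z" for x
 define v' where "v' x = 2 * pi * \<i> * R * exp (2 * of_real pi * \<i> * of_real x)" for x :: real
 have vd: "(v has_vector_derivative v' x) (at x within S)" for x S
  using has_vector_derivative_circlepath[of s R x S] unfolding v_def v'_def
  by (auto intro!: derivative_eq_intros)
 have v0: "v x \<noteq> 0" if "x \<in> {0..1}" for x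
 proof -
  have "cmod (circlepath s R x - s) = R" using R by (simp add: circlepath norm_mult)
  then show ?thesis using z unfolding v_def by auto
 qed
 have n': "cmod (v' x) = 2 * pi * R" for x using R by (simp add: v'_def norm_mult)
 have cv: "continuous_on S v" for S
  using vd by (meson continuous_on_eq_continuous_within has_vector_derivative_continuous)
 have cv': "continuous_on S v'" for S unfolding v'_def by (intro continuous_intros)
 have c\<Phi>: "continuous_on UNIV \<Phi>"
  using has_derivative_continuous[OF der] by (simp add: continuous_at_imp_continuous_on)
 note cc = continuous_on_compose2[OF c\<Phi>] continuous_on_compose2[OF cA] continuous_on_compose2[OF cB]
 have dline: "((\<lambda>t. \<Phi> (z + of_real t * v x)) has_vector_derivative
   (A (z + of_real t * v x) * v x + B (z + of_real t * v x) * cnj (v x))) (at t within S)" for x t S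
 proof -
  have "((\<lambda>t. z + of_real t * v x) has_derivative (\<lambda>h. of_real h * v x)) (at t within S)"
   by (auto intro!: derivative_eq_intros)
  from has_derivative_compose[OF this der]
  show ?thesis unfolding has_vector_derivative_def
   by (rule has_derivative_eq_rhs) (auto simp: fun_eq_iff algebra_simps scaleR_conv_of_real)
 qed
 have dcirc: "((\<lambda>x. \<Phi> (z + of_real t * v x)) has_vector_derivative
   of_real t * (A (z + of_real t * v x) * v' x + B (z + of_real t * v x) * cnj (v' x))) (at x within S)" for x t S
 proof -
  have "((\<lambda>x. z + of_real t * v x) has_derivative (\<lambda>h. of_real t * (h *\<^sub>R v' x))) (at x within S)"
   using vd[of x S] unfolding has_vector_derivative_def
   by (auto intro!: derivative_eq_intros)
  from has_derivative_compose[OF this der]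
  show ?thesis unfolding has_vector_derivative_def
   by (rule has_derivative_eq_rhs) (auto simp: fun_eq_iff algebra_simps scaleR_conv_of_real)
 qed
 \<comment> \<open>The circle is shrunk to \<open>z\<close>: \<open>I 1\<close> is the contour
   integral and \<open>I 0\<close> is \<open>2 pi i \<Phi> z\<close>, so it remains to bound the
   derivative \<open>J\<close> of \<open>I\<close>.\<close>
 define I where "I t = integral {0..1} (\<lambda>x. \<Phi> (z + of_real t * v x) * v' x / v x)" for t
 define J where "J t = integral {0..1} (\<lambda>x. B (z + of_real t * v x) * (cnj (v x) * v' x / v x - cnj (v' x)))" for t
 have cI: "continuous_on {0..1} (\<lambda>x. \<Phi> (z + of_real t * v x) * v' x / v x)" for t
  using v0 by (intro continuous_intros cv cv' cc) auto
 have cv2: "continuous_on S (\<lambda>y. v (snd y))" for S :: "(real \<times> real) set"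
  by (rule continuous_on_compose2[OF cv[of UNIV]]) (auto intro!: continuous_intros)
 have cv2': "continuous_on S (\<lambda>y. v' (snd y))" for S :: "(real \<times> real) set"
  by (rule continuous_on_compose2[OF cv'[of UNIV]]) (auto intro!: continuous_intros)
 have Id: "(I has_vector_derivative integral {0..1} (\<lambda>x. (A (z + of_real t * v x) * v x + B (z + of_real t * v x) * cnj (v x)) * v' x / v x)) (at t within {0..1})"
  if "t \<in> {0..1}" for t
  unfolding I_def interval_cbox
 proof (rule leibniz_rule_vector_derivative)
  fix t x assume "x \<in> cbox 0 (1::real)"
  have "((\<lambda>t. \<Phi> (z + of_real t * v x) * (v' x / v x)) has_vector_derivative (A (z + of_real t * v x) * v x + B (z + of_real t * v x) * cnj (v x)) * (v' x / v x)) (at t within cbox 0 1)"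
   by (rule has_vector_derivative_mult_left[OF dline])
  then show "((\<lambda>t. \<Phi> (z + of_real t * v x) * v' x / v x) has_vector_derivative (A (z + of_real t * v x) * v x + B (z + of_real t * v x) * cnj (v x)) * v' x / v x) (at t within cbox 0 1)"
   by simp
 next
  fix t show "(\<lambda>x. \<Phi> (z + of_real t * v x) * v' x / v x) integrable_on cbox 0 1"
   using integrable_continuous_interval[OF cI] by simp
 next
  show "continuous_on (cbox 0 1 \<times> cbox 0 1) (\<lambda>(t, x). (A (z + complex_of_real t * v x) * v x + B (z + complex_of_real t * v x) * cnj (v x)) * v' x / v x)"
   unfolding split_beta using v0 by (intro continuous_intros cc cv2 cv2') auto
 qed (use that in auto)
 \<comment> \<open>The derivative contains \<open>A\<close>, for which no bound is available. The
   loop traced by \<open>z + t v x\<close> is closed, so the x-derivative of \<Phi> along it has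
   integral 0; this identity, divided by \<open>t\<close>, cancels \<open>A\<close> and leaves
   \<open>B\<close> alone.\<close>
 have IJ: "integral {0..1} (\<lambda>x. (A (z + of_real t * v x) * v x + B (z + of_real t * v x) * cnj (v x)) * v' x / v x) = J t"
  if "t \<in> {0<..<1}" for t
 proof -
  have "((\<lambda>x. of_real t * (A (z + of_real t * v x) * v' x + B (z + of_real t * v x) * cnj (v' x))) has_integral (\<Phi> (z + of_real t * v 1) - \<Phi> (z + of_real t * v 0))) {0..1}"
   by (rule fundamental_theorem_of_calculus) (use dcirc in auto)
  moreover have "v 1 = v 0" by (simp add: v_def circlepath)
  ultimately have 0: "((\<lambda>x. of_real t * (A (z + of_real t * v x) * v' x + B (z + of_real t * v x) * cnj (v' x))) has_integral 0) {0..1}" by simp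
  have 1: "((\<lambda>x. A (z + of_real t * v x) * v' x + B (z + of_real t * v x) * cnj (v' x)) has_integral 0) {0..1}"
   using has_integral_mult_right[OF 0, of "1 / of_real t"] that by simp
  have "(\<lambda>x. B (z + of_real t * v x) * (cnj (v x) * v' x / v x - cnj (v' x))) integrable_on {0..1}"
   using v0 by (intro integrable_continuous_interval continuous_intros cc cv cv') auto
  then have "((\<lambda>x. B (z + of_real t * v x) * (cnj (v x) * v' x / v x - cnj (v' x))) has_integral J t) {0..1}"
   unfolding J_def by (rule integrable_integral)
  note sum = has_integral_add[OF this 1]
  have "((\<lambda>x. (A (z + of_real t * v x) * v x + B (z + of_real t * v x) * cnj (v x)) * v' x / v x) has_integral J t) {0..1}"
  proof -
   have eq: "b * (c * w / u - d) + (a * w + b * d) = (a * u + b * c) * w / u" if "u \<noteq> 0" for a b c d w u :: complex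
    using that by (simp add: field_simps)
   show ?thesis
    by (rule has_integral_eq[OF eq[OF v0] sum, simplified])
  qed
  then show ?thesis by (rule integral_unique)
 qed
 \<comment> \<open>Because of the division by \<open>t\<close>, the derivative is known in the open
   interval; at the end points continuity of \<open>I\<close> suffices.\<close>
 have JI: "(J has_integral (I 1 - I 0)) {0..1}"
 proof (rule fundamental_theorem_of_calculus_interior)
  show "continuous_on {0..1} I"
   using Id by (meson continuous_on_eq_continuous_within has_vector_derivative_continuous)
  show "(I has_vector_derivative J t) (at t)" if "t \<in> {0<..<1}" for t
   using Id[of t] IJ[OF that] that by (simp add: at_within_Icc_at)
 qed auto
 have cN: "continuous_on ({0..1} \<times> {0..1}) (\<lambda>(t, x). cmod (B (z + of_real t * v x)))"
  unfolding split_beta by (intro continuous_intros cc cv2) auto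
 have Jb: "cmod (J t) \<le> 4 * pi * R * integral {0..1} (\<lambda>x. cmod (B (z + of_real t * v x)))" for t
 proof -
  have "cmod (J t) \<le> integral {0..1} (\<lambda>x. 4 * pi * R * cmod (B (z + of_real t * v x)))"
   unfolding J_def
  proof (rule integral_norm_bound_integral)
   show "(\<lambda>x. B (z + of_real t * v x) * (cnj (v x) * v' x / v x - cnj (v' x))) integrable_on {0..1}"
    using v0 by (intro integrable_continuous_interval continuous_intros cc cv cv') auto
   show "(\<lambda>x. 4 * pi * R * cmod (B (z + of_real t * v x))) integrable_on {0..1}"
    by (intro integrable_continuous_interval continuous_intros cc cv cv') auto
   fix x :: real assume x: "x \<in> {0..1}"
   have "cmod (cnj (v x) * v' x / v x - cnj (v' x)) \<le> cmod (cnj (v x) * v' x / v x) + cmod (cnj (v' x))"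
    by (rule norm_triangle_ineq4)
   also have "... = 4 * pi * R" using v0[OF x] by (simp add: norm_mult norm_divide n')
   finally have "cmod (B (z + of_real t * v x)) * cmod (cnj (v x) * v' x / v x - cnj (v' x)) \<le> cmod (B (z + of_real t * v x)) * (4 * pi * R)"
    by (intro mult_left_mono) auto
   then show "cmod (B (z + of_real t * v x) * (cnj (v x) * v' x / v x - cnj (v' x))) \<le> 4 * pi * R * cmod (B (z + of_real t * v x))"
    by (simp add: norm_mult mult_ac)
  qed
  then show ?thesis by simp
 qed
 have "cmod (integral {0..1} J) \<le> integral {0..1} (\<lambda>t. 4 * pi * R * integral {0..1} (\<lambda>x. cmod (B (z + of_real t * v x))))"
 proof (rule integral_norm_bound_integral)
  have "continuous_on {0..1} (\<lambda>t. integral (cbox 0 1) (\<lambda>x. cmod (B (z + of_real t * v x))))"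
   by (rule integral_continuous_on_param) (use cN in simp)
  then show "(\<lambda>t. 4 * pi * R * integral {0..1} (\<lambda>x. cmod (B (z + of_real t * v x)))) integrable_on {0..1}"
   by (intro integrable_continuous_interval continuous_intros) simp
 qed (use JI Jb in auto)
 then have b: "cmod (I 1 - I 0) \<le> 4 * pi * R * integral {0..1} (\<lambda>t. integral {0..1} (\<lambda>x. cmod (B (z + of_real t * v x))))"
  using JI by (simp add: integral_unique)
 have I1: "I 1 = contour_integral (circlepath s R) (\<lambda>\<zeta>. \<Phi> \<zeta> / (\<zeta> - z))"
  unfolding I_def contour_integral_integral
  by (intro integral_cong) (auto simp: v_def v'_def vector_derivative_circlepath mult_ac)
 have "((\<lambda>u. 1 / (u - z)) has_contour_integral (2 * of_real pi * \<i> * 1)) (circlepath s R)"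
  by (rule Cauchy_integral_circlepath_simple) (use z in auto)
 then have "contour_integral (circlepath s R) (\<lambda>u. 1 / (u - z)) = 2 * pi * \<i>"
  by (simp add: contour_integral_unique)
 moreover have "integral {0..1} (\<lambda>x. v' x / v x) = contour_integral (circlepath s R) (\<lambda>u. 1 / (u - z))"
  unfolding contour_integral_integral
  by (intro integral_cong) (auto simp: v_def v'_def vector_derivative_circlepath mult_ac)
 moreover have "I 0 = \<Phi> z * integral {0..1} (\<lambda>x. v' x / v x)"
  unfolding I_def by (simp flip: integral_mult_right)
 ultimately have I0: "I 0 = 2 * pi * \<i> * \<Phi> z" by simp
 show ?thesis using b unfolding I0 I1 v_def by simp
qed

section \<open>Area integrals over squares in the complex plane\<close>

lemma lborel_complex_pair: "(lborel :: complex measure) = distr (lborel \<Otimes>\<^sub>M lborel) borel (\<lambda>(x, y). Complex x y)"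
proof (rule lborel_eqI)
 have m: "(\<lambda>(x, y). Complex x y) \<in> borel_measurable (lborel \<Otimes>\<^sub>M lborel)"
 proof -
  have "(\<lambda>p. complex_of_real (fst p) + \<i> * complex_of_real (snd p)) \<in> borel_measurable (lborel \<Otimes>\<^sub>M lborel)"
   by measurable
  then show ?thesis by (simp add: split_beta Complex_eq)
 qed
 fix l u :: complex assume lu: "\<And>b. b \<in> Basis ==> l \<bullet> b \<le> u \<bullet> b"
 have lu': "Re l \<le> Re u" "Im l \<le> Im u" using lu[of 1] lu[of \<i>] by (auto simp: Basis_complex_def)
 have "(\<lambda>(x, y). Complex x y) -` box l u \<inter> space (lborel \<Otimes>\<^sub>M lborel) = {Re l<..<Re u} \<times> {Im l<..<Im u}"
  by (auto simp: box_def Basis_complex_def space_pair_measure)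
 then have "emeasure (distr (lborel \<Otimes>\<^sub>M lborel) borel (\<lambda>(x, y). Complex x y)) (box l u)
   = emeasure (lborel \<Otimes>\<^sub>M lborel) ({Re l<..<Re u} \<times> {Im l<..<Im u})"
  using m by (subst emeasure_distr) auto
 also have "... = ennreal (Re u - Re l) * ennreal (Im u - Im l)"
  using lu' by (subst lborel.emeasure_pair_measure_Times) auto
 also have "... = (\<Prod>b\<in>Basis. (u - l) \<bullet> b)"
  using lu' by (simp add: Basis_complex_def ennreal_mult)
 finally show "emeasure (distr (lborel \<Otimes>\<^sub>M lborel) borel (\<lambda>(x, y). Complex x y)) (box l u) = (\<Prod>b\<in>Basis. (u - l) \<bullet> b)" .
qed simp

lemma nn_integral_complex_iterated:
 assumes "f \<in> borel_measurable borel"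
 shows "(\<integral>\<^sup>+z. f z \<partial>lborel) = (\<integral>\<^sup>+x. \<integral>\<^sup>+y. f (Complex x y) \<partial>lborel \<partial>lborel)"
proof -
 have m: "(\<lambda>(x, y). Complex x y) \<in> borel_measurable (lborel \<Otimes>\<^sub>M lborel)"
 proof -
  have "(\<lambda>p. complex_of_real (fst p) + \<i> * complex_of_real (snd p)) \<in> borel_measurable (lborel \<Otimes>\<^sub>M lborel)"
   by measurable
  then show ?thesis by (simp add: split_beta Complex_eq)
 qed
 have "(\<integral>\<^sup>+z. f z \<partial>lborel) = (\<integral>\<^sup>+p. f (case p of (x, y) => Complex x y) \<partial>(lborel \<Otimes>\<^sub>M lborel))"
  by (subst lborel_complex_pair) (rule nn_integral_distr[OF m], use assms in simp)
 also have "... = (\<integral>\<^sup>+x. \<integral>\<^sup>+y. f (Complex x y) \<partial>lborel \<partial>lborel)"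
  by (subst lborel.nn_integral_fst[symmetric]) (use measurable_compose[OF m] assms in auto)
 finally show ?thesis .
qed

lemma nn_integral_interval_eq:
 fixes h :: "real => real"
 assumes "continuous_on UNIV h" "\<And>x. x \<in> {a..b} ==> 0 \<le> h x"
 shows "(\<integral>\<^sup>+x. indicator {a..b} x * ennreal (h x) \<partial>lborel) = ennreal (integral {a..b} h)"
proof -
 have m: "h \<in> borel_measurable borel" by (rule borel_measurable_continuous_onI[OF assms(1)])
 have "(h has_integral integral {a..b} h) {a..b}"
  by (rule integrable_integral, rule integrable_continuous_interval) (rule continuous_on_subset[OF assms(1)], simp)
 then have "((\<lambda>x. indicator {a..b} x * max 0 (h x)) has_integral integral {a..b} h) {a..b}"
  by (rule has_integral_eq[rotated]) (use assms(2) in auto)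
 then have "((\<lambda>x. indicator {a..b} x * max 0 (h x)) has_integral integral {a..b} h) UNIV"
  by (rule has_integral_on_superset) auto
 from nn_integral_has_integral_lborel[OF _ _ this]
 have "integral\<^sup>N lborel (\<lambda>x. ennreal (indicator {a..b} x * max 0 (h x))) = ennreal (integral {a..b} h)"
  using m by auto
 moreover have "ennreal (indicator {a..b} x * max 0 (h x)) = indicator {a..b} x * ennreal (h x)" for x
  using assms(2) by (auto simp: indicator_def max_def)
 ultimately show ?thesis by simp
qed

text \<open>Two integrations by parts without boundary terms: \<open>(25 - t^2)^2\<close> vanishes
  to second order at both ends, and \<open>12 t^2 - 100\<close> is its second derivative. The
  polynomial serves as a cut-off function.\<close>

lemma integral_by_parts_bump:
 fixes \<phi> \<phi>' \<phi>'' :: "real => real"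
 assumes "\<And>t. (\<phi> has_real_derivative \<phi>' t) (at t)" "\<And>t. (\<phi>' has_real_derivative \<phi>'' t) (at t)"
  and "continuous_on UNIV \<phi>''"
 shows "integral {-5..5} (\<lambda>t. (25 - t\<^sup>2)\<^sup>2 * \<phi>'' t) = integral {-5..5} (\<lambda>t. (12 * t\<^sup>2 - 100) * \<phi> t)"
proof -
 have c: "continuous_on S \<phi>" "continuous_on S \<phi>''" for S
  using assms(1) DERIV_isCont continuous_at_imp_continuous_on apply blast
  using assms(3) continuous_on_subset by blast
 have "((\<lambda>t. (25 - t\<^sup>2)\<^sup>2 * \<phi>'' t - (12 * t\<^sup>2 - 100) * \<phi> t) has_integral
   ((25 - 5\<^sup>2)\<^sup>2 * \<phi>' 5 - (4 * 5 ^ 3 - 100 * 5) * \<phi> 5) - ((25 - (-5)\<^sup>2)\<^sup>2 * \<phi>' (-5) - (4 * (-5) ^ 3 - 100 * (-5)) * \<phi> (-5))) {-5..5}"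
 proof (rule fundamental_theorem_of_calculus)
  fix t :: real
  have "((\<lambda>t. (25 - t\<^sup>2)\<^sup>2 * \<phi>' t - (4 * t ^ 3 - 100 * t) * \<phi> t) has_real_derivative ((25 - t\<^sup>2)\<^sup>2 * \<phi>'' t - (12 * t\<^sup>2 - 100) * \<phi> t)) (at t)"
   by (rule derivative_eq_intros assms refl | simp)+ (simp add: algebra_simps power2_eq_square power3_eq_cube)
  then show "((\<lambda>t. (25 - t\<^sup>2)\<^sup>2 * \<phi>' t - (4 * t ^ 3 - 100 * t) * \<phi> t) has_vector_derivative ((25 - t\<^sup>2)\<^sup>2 * \<phi>'' t - (12 * t\<^sup>2 - 100) * \<phi> t)) (at t within {-5..5})"
   by (simp add: has_real_derivative_iff_has_vector_derivative has_vector_derivative_at_within)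
 qed auto
 then have "integral {-5..5} (\<lambda>t. (25 - t\<^sup>2)\<^sup>2 * \<phi>'' t - (12 * t\<^sup>2 - 100) * \<phi> t) = 0"
  by (simp add: integral_unique)
 moreover have "integral {-5..5} (\<lambda>t. (25 - t\<^sup>2)\<^sup>2 * \<phi>'' t - (12 * t\<^sup>2 - 100) * \<phi> t)
   = integral {-5..5} (\<lambda>t. (25 - t\<^sup>2)\<^sup>2 * \<phi>'' t) - integral {-5..5} (\<lambda>t. (12 * t\<^sup>2 - 100) * \<phi> t)"
  by (intro integral_diff integrable_continuous_interval continuous_intros c)
 ultimately show ?thesis by simp
qed

text \<open>Tested against the cut-off \<open>(25 - x^2)^2 (25 - y^2)^2\<close>, the Laplacian moves
  onto the cut-off, and only the size of the logarithm remains. It is of order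
  \<open>ln (1/\<tau>)\<close>, however often \<open>P\<close> vanishes.\<close>

lemma laplacian_ln_bound:
 fixes P :: "complex => complex" and A \<tau> :: real
 assumes hol: "P holomorphic_on UNIV" and \<tau>: "0 < \<tau>" "\<tau> \<le> 1"
  and bd: "\<And>z. cmod z \<le> 8 ==> cmod (P z) \<le> A"
 shows "(\<integral>\<^sup>+z. indicator (cbox (Complex (-3) (-3)) (Complex 3 3)) z *
   ennreal ((cmod (deriv P z))\<^sup>2 * \<tau>\<^sup>2 / ((cmod (P z))\<^sup>2 + \<tau>\<^sup>2)\<^sup>2) \<partial>lborel)
  \<le> ennreal (100 * (ln (A\<^sup>2 + 1) + 2 * ln (1 / \<tau>)))"
proof -
 define P' where "P' = deriv P"
 define P'' where "P'' = deriv P'"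
 have hol': "P' holomorphic_on UNIV" unfolding P'_def by (rule holomorphic_deriv[OF hol]) simp
 have hol'': "P'' holomorphic_on UNIV" unfolding P''_def by (rule holomorphic_deriv[OF hol']) simp
 have dP: "(P has_field_derivative P' z) (at z)" for z
  unfolding P'_def by (rule holomorphic_derivI[OF hol]) auto
 have dP': "(P' has_field_derivative P'' z) (at z)" for z
  unfolding P''_def by (rule holomorphic_derivI[OF hol']) auto
 have cP: "continuous_on UNIV P" "continuous_on UNIV P'" "continuous_on UNIV P''"
  using hol hol' hol'' holomorphic_on_imp_continuous_on by auto
 define V where "V z = (Re (P z))\<^sup>2 + (Im (P z))\<^sup>2 + \<tau>\<^sup>2" for z
 have Vpos: "V z > 0" for z using \<tau> unfolding V_def by (simp add: add_nonneg_pos)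
 have V: "V z = (cmod (P z))\<^sup>2 + \<tau>\<^sup>2" for z by (simp add: V_def cmod_power2)
 define u where "u z = ln (V z)" for z
 \<comment> \<open>\<open>ud d\<close> and \<open>udd d\<close> are the first and second derivatives
   of \<open>u\<close> along the real direction \<open>d\<close>; the Laplacian is the sum over
   \<open>d = 1\<close> and \<open>d = \<i>\<close>.\<close>
 define ud where "ud d z = 2 * (Re (P z) * Re (d * P' z) + Im (P z) * Im (d * P' z)) / V z" for d z
 define udd where "udd d z = 2 * ((Re (d * P' z))\<^sup>2 + (Im (d * P' z))\<^sup>2 + Re (P z) * Re (d * d * P'' z) + Im (P z) * Im (d * d * P'' z)) / V z
    - 4 * (Re (P z) * Re (d * P' z) + Im (P z) * Im (d * P' z))\<^sup>2 / (V z)\<^sup>2" for d z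
 have line: "((\<lambda>t. Re (f (\<zeta> + of_real t * d))) has_real_derivative Re (d * f' (\<zeta> + of_real t * d))) (at t)"
    "((\<lambda>t. Im (f (\<zeta> + of_real t * d))) has_real_derivative Im (d * f' (\<zeta> + of_real t * d))) (at t)"
  if "\<And>z. (f has_field_derivative f' z) (at z)" for f f' \<zeta> d t
 proof -
  have 1: "((\<lambda>t. \<zeta> + of_real t * d) has_vector_derivative d) (at t)"
   by (auto intro!: derivative_eq_intros simp: has_vector_derivative_def scaleR_conv_of_real)
  have 2: "((\<lambda>t. f (\<zeta> + of_real t * d)) has_vector_derivative d * f' (\<zeta> + of_real t * d)) (at t)"
   using field_vector_diff_chain_at[OF 1 that] by (simp add: o_def)
  show "((\<lambda>t. Re (f (\<zeta> + of_real t * d))) has_real_derivative Re (d * f' (\<zeta> + of_real t * d))) (at t)"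
    "((\<lambda>t. Im (f (\<zeta> + of_real t * d))) has_real_derivative Im (d * f' (\<zeta> + of_real t * d))) (at t)"
   using bounded_linear.has_vector_derivative[OF bounded_linear_Re 2] bounded_linear.has_vector_derivative[OF bounded_linear_Im 2]
   by (auto simp: has_real_derivative_iff_has_vector_derivative)
 qed
 note dd = line[where f=P and f'=P', OF dP]
 have line2: "((\<lambda>t. Re (d * P' (\<zeta> + of_real t * d))) has_real_derivative Re (d * d * P'' (\<zeta> + of_real t * d))) (at t)"
    "((\<lambda>t. Im (d * P' (\<zeta> + of_real t * d))) has_real_derivative Im (d * d * P'' (\<zeta> + of_real t * d))) (at t)" for \<zeta> d t
  using line[where f="\<lambda>z. d * P' z" and f'="\<lambda>z. d * P'' z", OF DERIV_cmult[OF dP']]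
  by (simp_all add: mult.assoc)
 have dV: "((\<lambda>t. V (\<zeta> + of_real t * d)) has_real_derivative
   2 * (Re (P (\<zeta> + of_real t * d)) * Re (d * P' (\<zeta> + of_real t * d)) + Im (P (\<zeta> + of_real t * d)) * Im (d * P' (\<zeta> + of_real t * d)))) (at t)" for \<zeta> d t
  unfolding V_def power2_eq_square
 proof -
  have alg: "b * a + b * a + (e * c + e * c) + (0 * \<tau> + 0 * \<tau>) = 2 * (a * b + c * e)" for a b c e :: real
   by (simp add: algebra_simps)
  show "((\<lambda>t. Re (P (\<zeta> + of_real t * d)) * Re (P (\<zeta> + of_real t * d)) + Im (P (\<zeta> + of_real t * d)) * Im (P (\<zeta> + of_real t * d)) + \<tau> * \<tau>) has_real_derivative
   2 * (Re (P (\<zeta> + of_real t * d)) * Re (d * P' (\<zeta> + of_real t * d)) + Im (P (\<zeta> + of_real t * d)) * Im (d * P' (\<zeta> + of_real t * d)))) (at t)"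
   by (rule DERIV_cong, (rule DERIV_add DERIV_mult dd DERIV_const)+) (rule alg)
 qed
 have V0: "V z \<noteq> 0" for z using Vpos by (metis less_irrefl)
 have du: "((\<lambda>t. u (\<zeta> + of_real t * d)) has_real_derivative ud d (\<zeta> + of_real t * d)) (at t)" for \<zeta> d t
  unfolding u_def ud_def
  by (rule DERIV_cong, rule DERIV_chain2[OF DERIV_ln[OF Vpos] dV]) (simp only: divide_inverse mult.commute)
 have dud: "((\<lambda>t. ud d (\<zeta> + of_real t * d)) has_real_derivative udd d (\<zeta> + of_real t * d)) (at t)" for \<zeta> d t
 proof -
  have n: "((\<lambda>t. 2 * (Re (P (\<zeta> + of_real t * d)) * Re (d * P' (\<zeta> + of_real t * d)) + Im (P (\<zeta> + of_real t * d)) * Im (d * P' (\<zeta> + of_real t * d))))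
   has_real_derivative 2 * ((Re (d * P' (\<zeta> + of_real t * d)))\<^sup>2 + (Im (d * P' (\<zeta> + of_real t * d)))\<^sup>2 + Re (P (\<zeta> + of_real t * d)) * Re (d * d * P'' (\<zeta> + of_real t * d)) + Im (P (\<zeta> + of_real t * d)) * Im (d * d * P'' (\<zeta> + of_real t * d)))) (at t)"
   by (rule DERIV_cong, (rule DERIV_add DERIV_mult dd line2 DERIV_cmult)+) (simp only: algebra_simps power2_eq_square)
  have alg: "(2 * a * v - 2 * b * (2 * b)) / (v * v) = 2 * a / v - 4 * b\<^sup>2 / v\<^sup>2" if "v \<noteq> 0" for a b v :: real
   using that by (simp add: field_simps power2_eq_square)
  show ?thesis unfolding ud_def udd_def
   by (rule DERIV_cong[OF DERIV_divide[OF n dV V0] alg[OF V0]])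
 qed
 \<comment> \<open>The terms with \<open>P''\<close> cancel, since \<open>d * d\<close> is 1 for one
   direction and -1 for the other.\<close>
 have lap: "udd 1 z + udd \<i> z = 4 * ((cmod (P' z))\<^sup>2 * \<tau>\<^sup>2 / (V z)\<^sup>2)" for z
 proof -
  have "V z \<noteq> 0" using Vpos by (metis less_irrefl)
  then have "udd 1 z + udd \<i> z = (4 * ((cmod (P' z))\<^sup>2 * V z) - 4 * ((cmod (P' z))\<^sup>2 * ((Re (P z))\<^sup>2 + (Im (P z))\<^sup>2))) / (V z)\<^sup>2"
   unfolding udd_def cmod_power2 by (simp add: field_simps power2_eq_square)
  also have "... = 4 * ((cmod (P' z))\<^sup>2 * \<tau>\<^sup>2 / (V z)\<^sup>2)" unfolding V_def by (simp add: field_simps)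
  finally show ?thesis .
 qed
 have cu: "continuous_on UNIV u" unfolding u_def V_def
  using Vpos by (intro continuous_intros cP) (metis V_def less_irrefl)
 have cudd: "continuous_on UNIV (udd d)" for d unfolding udd_def V_def
  using Vpos by (intro continuous_intros cP) (metis V_def less_irrefl power_eq_0_iff)+
 define \<alpha> where "\<alpha> t = (25 - t\<^sup>2)\<^sup>2" for t :: real
 define \<beta> where "\<beta> t = 12 * t\<^sup>2 - 100" for t :: real
 define D where "D z = (cmod (P' z))\<^sup>2 * \<tau>\<^sup>2 / (V z)\<^sup>2" for z
 have D0: "D z \<ge> 0" for z by (simp add: D_def)
 have cD: "continuous_on UNIV D" unfolding D_def V_def
  using Vpos by (intro continuous_intros cP) (metis V_def less_irrefl power_eq_0_iff)+
 define U where "U = ln (A\<^sup>2 + 1) + 2 * ln (1 / \<tau>)"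
 have A: "A \<ge> 0" using order_trans[OF norm_ge_zero bd[of 0]] by simp
 \<comment> \<open>The corners of the square of half side 5 have modulus less than 8; this is the
   origin of the radius in the hypothesis.\<close>
 have Ub: "\<bar>u (Complex x y)\<bar> \<le> U" if "x \<in> {-5..5}" "y \<in> {-5..5}" for x y
 proof -
  let ?z = "Complex x y"
  have "\<bar>x\<bar>\<^sup>2 \<le> 5\<^sup>2" "\<bar>y\<bar>\<^sup>2 \<le> 5\<^sup>2" using that by (intro power_mono; auto)+
  then have "cmod ?z \<le> 8" by (simp add: cmod_def real_le_lsqrt)
  then have "cmod (P ?z) \<le> A" by (rule bd)
  then have "(cmod (P ?z))\<^sup>2 \<le> A\<^sup>2" by (intro power_mono) auto
  moreover have "\<tau>\<^sup>2 \<le> 1" using \<tau> by (simp add: power_le_one)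
  ultimately have 1: "V ?z \<le> A\<^sup>2 + 1" unfolding V by simp
  have "\<tau>\<^sup>2 \<le> V ?z" unfolding V by simp
  then have "ln (\<tau>\<^sup>2) \<le> u ?z" unfolding u_def using \<tau> by (intro ln_mono) auto
  then have 2: "- 2 * ln (1 / \<tau>) \<le> u ?z" using \<tau> by (simp add: ln_div ln_realpow)
  have 3: "u ?z \<le> ln (A\<^sup>2 + 1)" unfolding u_def using 1 Vpos by (intro ln_mono) auto
  have "ln (A\<^sup>2 + 1) \<ge> 0" "ln (1 / \<tau>) \<ge> 0" using \<tau> by auto
  with 2 3 show ?thesis unfolding U_def by linarith
 qed
 have U0: "U \<ge> 0" using Ub[of 0 0] by simp
 have cC: "continuous_on S (\<lambda>x. Complex x y)" "continuous_on S (\<lambda>y. Complex x y)" "continuous_on S' (\<lambda>p. Complex (fst p) (snd p))" "continuous_on S' (\<lambda>p. Complex (snd p) (fst p))" for S x y S'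
  by (auto simp: Complex_eq intro!: continuous_intros)
 note cu' = continuous_on_compose2[OF cu cC(1)] continuous_on_compose2[OF cu cC(2)]
 note cD' = continuous_on_compose2[OF cD cC(1)] continuous_on_compose2[OF cD cC(2)] continuous_on_compose2[OF cD cC(3)] continuous_on_compose2[OF cD cC(4)]
 note cudd' = continuous_on_compose2[OF cudd cC(1)] continuous_on_compose2[OF cudd cC(2)] continuous_on_compose2[OF cudd cC(3)] continuous_on_compose2[OF cudd cC(4)]
 have ibp1: "integral {-5..5} (\<lambda>x. \<alpha> x * udd 1 (Complex x y)) = integral {-5..5} (\<lambda>x. \<beta> x * u (Complex x y))" for y
 proof -
  have e: "Complex x y = Complex 0 y + of_real x * 1" for x by (simp add: Complex_eq)
  show ?thesis unfolding \<alpha>_def \<beta>_def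
   by (rule integral_by_parts_bump[where \<phi>'="\<lambda>x. ud 1 (Complex x y)"])
    (use du[of "Complex 0 y" 1, folded e] dud[where \<zeta>="Complex 0 y" and d=1, folded e] cudd' in auto)
 qed
 have ibp2: "integral {-5..5} (\<lambda>y. \<alpha> y * udd \<i> (Complex x y)) = integral {-5..5} (\<lambda>y. \<beta> y * u (Complex x y))" for x
 proof -
  have e: "Complex x y = Complex x 0 + of_real y * \<i>" for y by (simp add: Complex_eq mult.commute)
  show ?thesis unfolding \<alpha>_def \<beta>_def
   by (rule integral_by_parts_bump[where \<phi>'="\<lambda>y. ud \<i> (Complex x y)"])
    (use du[of "Complex x 0" \<i>, folded e] dud[where \<zeta>="Complex x 0" and d="\<i>", folded e] cudd' in auto)
 qed
 have sq25: "t\<^sup>2 \<le> 25" if "t \<in> {-5..5}" for t :: real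
  using power_mono[of "\<bar>t\<bar>" 5 2] that by auto
 have \<alpha>b: "\<bar>\<alpha> t\<bar> \<le> 625" if "t \<in> {-5..5}" for t
  using power_mono[of "25 - t\<^sup>2" 25 2] sq25[OF that] by (simp add: \<alpha>_def)
 have \<beta>b: "\<bar>\<beta> t\<bar> \<le> 200" if "t \<in> {-5..5}" for t
  using sq25[OF that] zero_le_power2[of t] unfolding \<beta>_def by linarith
 have c\<alpha>: "continuous_on S \<alpha>" "continuous_on S \<beta>" for S unfolding \<alpha>_def \<beta>_def by (intro continuous_intros)+
 \<comment> \<open>12500000 is the product of 10, 625, 10 and 200: two side lengths and the bounds
   of \<alpha> and \<beta>. Two such terms, divided by 262144 = 4 * 256^2, stay below
   \<open>100 U\<close>; here 256 is the minimum of \<alpha> on \<open>[-3, 3]\<close>.\<close>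
 have small: "\<bar>integral {-5..5} (\<lambda>s. \<alpha> s * integral {-5..5} (\<lambda>t. \<beta> t * f s t))\<bar> \<le> 12500000 * U"
  if "\<And>s. continuous_on {-5..5} (f s)" "\<And>s t. s \<in> {-5..5} ==> t \<in> {-5..5} ==> \<bar>f s t\<bar> \<le> U"
   "continuous_on {-5..5} (\<lambda>s. integral {-5..5} (\<lambda>t. \<beta> t * f s t))" for f :: "real => real => real"
 proof -
  have i: "\<bar>integral {-5..5} (\<lambda>t. \<beta> t * f s t)\<bar> \<le> 2000 * U" if s: "s \<in> {-5..5}" for s
  proof -
   have "norm (integral {-5..5} (\<lambda>t. \<beta> t * f s t)) \<le> integral {-5..5} (\<lambda>t::real. 200 * U)"
    using that(1) \<open>\<And>s. continuous_on {-5..5} (f s)\<close> \<beta>b \<open>\<And>s t. s \<in> {-5..5} ==> t \<in> {-5..5} ==> \<bar>f s t\<bar> \<le> U\<close>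
    by (intro integral_norm_bound_integral integrable_continuous_interval continuous_intros c\<alpha>)
      (auto simp: abs_mult intro!: mult_mono)
   then show ?thesis by simp
  qed
  have pt: "norm (\<alpha> s * integral {-5..5} (\<lambda>t. \<beta> t * f s t)) \<le> 1250000 * U" if s: "s \<in> {-5..5}" for s
   using mult_mono[OF \<alpha>b[OF s] i[OF s]] by (simp add: abs_mult)
  have "norm (integral {-5..5} (\<lambda>s. \<alpha> s * integral {-5..5} (\<lambda>t. \<beta> t * f s t))) \<le> integral {-5..5} (\<lambda>s::real. 1250000 * U)"
   using that(3) by (intro integral_norm_bound_integral integrable_continuous_interval continuous_intros c\<alpha> pt)
  then show ?thesis by simp
 qed
 define I where "I = integral {-5..5} (\<lambda>x. integral {-5..5} (\<lambda>y. \<alpha> x * \<alpha> y * (4 * D (Complex x y))))"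
 have "I = integral {-5..5} (\<lambda>x. integral {-5..5} (\<lambda>y. \<alpha> y * (\<alpha> x * udd 1 (Complex x y))) + integral {-5..5} (\<lambda>y. \<alpha> x * (\<alpha> y * udd \<i> (Complex x y))))"
  unfolding I_def
 proof (intro integral_cong)
  fix x
  show "integral {-5..5} (\<lambda>y. \<alpha> x * \<alpha> y * (4 * D (Complex x y))) = integral {-5..5} (\<lambda>y. \<alpha> y * (\<alpha> x * udd 1 (Complex x y))) + integral {-5..5} (\<lambda>y. \<alpha> x * (\<alpha> y * udd \<i> (Complex x y)))"
  proof -
   have "\<alpha> x * \<alpha> y * (4 * D z) = \<alpha> y * (\<alpha> x * udd 1 z) + \<alpha> x * (\<alpha> y * udd \<i> z)" for y z
    unfolding D_def lap[symmetric] by (simp add: distrib_left)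
   then show ?thesis
    by (subst integral_add[symmetric]) (auto intro!: integrable_continuous_interval continuous_intros c\<alpha> cudd')
  qed
 qed
 also have "... = integral {-5..5} (\<lambda>x. integral {-5..5} (\<lambda>y. \<alpha> y * (\<alpha> x * udd 1 (Complex x y)))) + integral {-5..5} (\<lambda>x. integral {-5..5} (\<lambda>y. \<alpha> x * (\<alpha> y * udd \<i> (Complex x y))))"
 proof (rule integral_add; rule integrable_continuous_interval; unfold interval_cbox; rule integral_continuous_on_param)
 qed (auto simp: split_beta intro!: continuous_intros cudd' continuous_on_compose2[OF c\<alpha>(1)[of UNIV]])
 also have "integral {-5..5} (\<lambda>x. integral {-5..5} (\<lambda>y. \<alpha> y * (\<alpha> x * udd 1 (Complex x y)))) = integral {-5..5} (\<lambda>y. integral {-5..5} (\<lambda>x. \<alpha> y * (\<alpha> x * udd 1 (Complex x y))))"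
  unfolding interval_cbox
  by (rule integral_swap_continuous)
   (auto simp: split_beta intro!: continuous_intros cudd' continuous_on_compose2[OF c\<alpha>(1)[of UNIV]])
 finally have I_eq: "I = integral {-5..5} (\<lambda>y. \<alpha> y * integral {-5..5} (\<lambda>x. \<beta> x * u (Complex x y))) + integral {-5..5} (\<lambda>x. \<alpha> x * integral {-5..5} (\<lambda>y. \<beta> y * u (Complex x y)))"
  by (simp add: ibp1 ibp2)
 have I_le: "I \<le> 25000000 * U"
 proof -
  have "\<bar>integral {-5..5} (\<lambda>y. \<alpha> y * integral {-5..5} (\<lambda>x. \<beta> x * u (Complex x y)))\<bar> \<le> 12500000 * U"
   by (rule small, use Ub cu' in \<open>auto simp: \<close>, unfold interval_cbox, rule integral_continuous_on_param)
    (auto simp: split_beta intro!: continuous_intros continuous_on_compose2[OF cu cC(4)] continuous_on_compose2[OF c\<alpha>(2)[of UNIV]])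
  moreover have "\<bar>integral {-5..5} (\<lambda>x. \<alpha> x * integral {-5..5} (\<lambda>y. \<beta> y * u (Complex x y)))\<bar> \<le> 12500000 * U"
   by (rule small, use Ub cu' in \<open>auto simp: \<close>, unfold interval_cbox, rule integral_continuous_on_param)
    (auto simp: split_beta intro!: continuous_intros continuous_on_compose2[OF cu cC(3)] continuous_on_compose2[OF c\<alpha>(2)[of UNIV]])
  ultimately show ?thesis unfolding I_eq by linarith
 qed
 have \<alpha>0: "\<alpha> t \<ge> 0" for t by (simp add: \<alpha>_def)
 have \<alpha>l: "256 \<le> \<alpha> t" if "t \<in> {-3..3}" for t
 proof -
  have "t\<^sup>2 \<le> 9" using power_mono[of "\<bar>t\<bar>" 3 2] that by auto
  then show ?thesis using power_mono[of 16 "25 - t\<^sup>2" 2] by (simp add: \<alpha>_def)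
 qed
 have "(\<integral>\<^sup>+z. indicator (cbox (Complex (-3) (-3)) (Complex 3 3)) z * ennreal (D z) \<partial>lborel)
   = (\<integral>\<^sup>+x. \<integral>\<^sup>+y. indicator (cbox (Complex (-3) (-3)) (Complex 3 3)) (Complex x y) * ennreal (D (Complex x y)) \<partial>lborel \<partial>lborel)"
  by (rule nn_integral_complex_iterated) (use borel_measurable_continuous_onI[OF cD] in measurable)
 also have "... \<le> (\<integral>\<^sup>+x. indicator {-5..5} x * ennreal (integral {-5..5} (\<lambda>y. \<alpha> x * \<alpha> y * (4 * D (Complex x y)) / 262144)) \<partial>lborel)"
 proof (rule nn_integral_mono)
  fix x :: real
  have "(\<integral>\<^sup>+y. indicator (cbox (Complex (-3) (-3)) (Complex 3 3)) (Complex x y) * ennreal (D (Complex x y)) \<partial>lborel)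
   \<le> (\<integral>\<^sup>+y. indicator {-5..5} x * (indicator {-5..5} y * ennreal (\<alpha> x * \<alpha> y * (4 * D (Complex x y)) / 262144)) \<partial>lborel)"
  proof (rule nn_integral_mono)
   fix y :: real
   show "indicator (cbox (Complex (-3) (-3)) (Complex 3 3)) (Complex x y) * ennreal (D (Complex x y)) \<le> indicator {-5..5} x * (indicator {-5..5} y * ennreal (\<alpha> x * \<alpha> y * (4 * D (Complex x y)) / 262144))"
   proof (cases "x \<in> {-3..3} \<and> y \<in> {-3..3}")
    case True
    have "256 * 256 \<le> \<alpha> x * \<alpha> y" using True by (intro mult_mono \<alpha>l) (auto simp: \<alpha>0)
    then have "256 * 256 * (4 * D (Complex x y)) \<le> \<alpha> x * \<alpha> y * (4 * D (Complex x y))"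
     using D0 by (intro mult_right_mono) auto
    then have "D (Complex x y) \<le> \<alpha> x * \<alpha> y * (4 * D (Complex x y)) / 262144" by simp
    then show ?thesis using True by (auto simp: indicator_def intro!: ennreal_leI)
   next
    case False
    then have "Complex x y \<notin> cbox (Complex (-3) (-3)) (Complex 3 3)" by (auto simp: in_cbox_complex_iff)
    then show ?thesis by simp
   qed
  qed
  also have "... = indicator {-5..5} x * (\<integral>\<^sup>+y. (indicator {-5..5} y * ennreal (\<alpha> x * \<alpha> y * (4 * D (Complex x y)) / 262144)) \<partial>lborel)"
  proof (rule nn_integral_cmult)
   have "(\<lambda>y. \<alpha> x * \<alpha> y * (4 * D (Complex x y)) / 262144) \<in> borel_measurable borel"
    by (intro borel_measurable_continuous_onI continuous_intros c\<alpha> cD') auto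
   then show "(\<lambda>y. indicator {-5..5} y * ennreal (\<alpha> x * \<alpha> y * (4 * D (Complex x y)) / 262144)) \<in> borel_measurable lborel"
    by measurable
  qed
  also have "... = indicator {-5..5} x * ennreal (integral {-5..5} (\<lambda>y. \<alpha> x * \<alpha> y * (4 * D (Complex x y)) / 262144))"
   using D0 \<alpha>0 by (subst nn_integral_interval_eq) (auto intro!: continuous_intros c\<alpha> cD')
  finally show "(\<integral>\<^sup>+y. indicator (cbox (Complex (-3) (-3)) (Complex 3 3)) (Complex x y) * ennreal (D (Complex x y)) \<partial>lborel) \<le> indicator {-5..5} x * ennreal (integral {-5..5} (\<lambda>y. \<alpha> x * \<alpha> y * (4 * D (Complex x y)) / 262144))" .
 qed
 also have "... = ennreal (integral {-5..5} (\<lambda>x. integral {-5..5} (\<lambda>y. \<alpha> x * \<alpha> y * (4 * D (Complex x y)) / 262144)))"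
 proof (rule nn_integral_interval_eq)
  show "continuous_on UNIV (\<lambda>x. integral {- 5..5} (\<lambda>y. \<alpha> x * \<alpha> y * (4 * D (Complex x y)) / 262144))"
   unfolding interval_cbox by (rule integral_continuous_on_param)
    (auto simp: split_beta intro!: continuous_intros cD' continuous_on_compose2[OF c\<alpha>(1)[of UNIV]])
  show "0 \<le> integral {- 5..5} (\<lambda>y. \<alpha> x * \<alpha> y * (4 * D (Complex x y)) / 262144)" for x
   using D0 \<alpha>0 by (intro integral_nonneg integrable_continuous_interval continuous_intros c\<alpha> cD') auto
 qed
 also have "integral {-5..5} (\<lambda>x. integral {-5..5} (\<lambda>y. \<alpha> x * \<alpha> y * (4 * D (Complex x y)) / 262144)) = I / 262144"
  unfolding I_def by (simp only: integral_divide)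
 also have "ennreal (I / 262144) \<le> ennreal (100 * U)"
  using I_le U0 by (intro ennreal_leI) auto
 finally show ?thesis unfolding D_def V U_def P'_def .
qed

lemma nn_integral_lborel_affine_complex:
 fixes f :: "complex => ennreal"
 assumes "f \<in> borel_measurable borel" "c > 0"
 shows "(\<integral>\<^sup>+z. f (a + of_real c * z) \<partial>lborel) = ennreal (1 / c\<^sup>2) * (\<integral>\<^sup>+z. f z \<partial>lborel)"
proof -
 have m: "(\<lambda>z. a + c *\<^sub>R z) \<in> lborel \<rightarrow>\<^sub>M borel" by measurable
 have "(\<integral>\<^sup>+z. f z \<partial>lborel) = (\<integral>\<^sup>+z. f z \<partial>density (distr lborel borel (\<lambda>x. a + c *\<^sub>R x)) (\<lambda>_. \<bar>c\<bar>^DIM(complex)))"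
  using lborel_affine[of c a] assms(2) by simp
 also have "... = (\<integral>\<^sup>+z. ennreal (c\<^sup>2) * f z \<partial>distr lborel borel (\<lambda>x. a + c *\<^sub>R x))"
  using assms by (subst nn_integral_density) (auto simp: DIM_complex)
 also have "... = (\<integral>\<^sup>+z. ennreal (c\<^sup>2) * f (a + c *\<^sub>R z) \<partial>lborel)"
  using assms m by (subst nn_integral_distr) auto
 also have "... = ennreal (c\<^sup>2) * (\<integral>\<^sup>+z. f (a + of_real c * z) \<partial>lborel)"
  using measurable_compose[OF m assms(1)] by (subst nn_integral_cmult) (auto simp: scaleR_conv_of_real)
 finally have "ennreal (1 / c\<^sup>2) * (\<integral>\<^sup>+z. f z \<partial>lborel) = ennreal (1 / c\<^sup>2) * ennreal (c\<^sup>2) * (\<integral>\<^sup>+z. f (a + of_real c * z) \<partial>lborel)"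
  by (simp add: mult.assoc)
 also have "ennreal (1 / c\<^sup>2) * ennreal (c\<^sup>2) = 1" using assms(2) by (simp flip: ennreal_mult)
 finally show ?thesis by simp
qed

abbreviation sqr :: "real => complex set" where
 "sqr a \<equiv> cbox (Complex (- a) (- a)) (Complex a a)"

lemma sqr_iff: "z \<in> sqr a \<longleftrightarrow> \<bar>Re z\<bar> \<le> a \<and> \<bar>Im z\<bar> \<le> a"
 by (auto simp: in_cbox_complex_iff)

lemma sqr_norm: "z \<in> sqr a ==> cmod z \<le> 3 / 2 * a"
proof -
 assume z: "z \<in> sqr a"
 then have a: "a \<ge> 0" and "\<bar>Re z\<bar>\<^sup>2 \<le> a\<^sup>2" "\<bar>Im z\<bar>\<^sup>2 \<le> a\<^sup>2"
  using power_mono[of "\<bar>Re z\<bar>" a 2] power_mono[of "\<bar>Im z\<bar>" a 2] by (auto simp: sqr_iff)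
 moreover have "(3 / 2 * a)\<^sup>2 = 9 / 4 * a\<^sup>2" by (simp add: power_mult_distrib power2_eq_square)
 ultimately have "(cmod z)\<^sup>2 \<le> (3 / 2 * a)\<^sup>2"
  unfolding cmod_power2 power2_abs using zero_le_power2[of a] by linarith
 then show ?thesis by (rule power2_le_imp_le) (use a in simp)
qed

lemma nn_integral_sqr_const: "a \<ge> 0 ==> (\<integral>\<^sup>+z. indicator (sqr a) z * c \<partial>lborel) = ennreal (4 * a\<^sup>2) * c"
 by (subst nn_integral_multc) (simp_all add: emeasure_lborel_cbox_eq Basis_complex_def power2_eq_square)

lemma circlepath_0: "circlepath s R x = s + circlepath 0 R x"
 by (simp add: circlepath)

text \<open>For a single circle the homotopy estimate does not suffice: as \<open>t\<close>
  approaches 1 its points run through the circle itself, where an area bound for \<open>B\<close>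
  says nothing. Averaging over the centre \<open>s\<close> repairs this, and some centre is nearly
  as good as the average.\<close>

lemma dbar_L1_solution:
 fixes \<Phi> A B :: "complex => complex"
 assumes der: "\<And>z. (\<Phi> has_derivative (\<lambda>h. A z * h + B z * cnj h)) (at z)"
  and cA: "continuous_on UNIV A" and cB: "continuous_on UNIV B"
  and bd: "\<And>z. cmod z \<le> 3 ==> cmod (\<Phi> z) \<le> C"
  and b: "(\<integral>\<^sup>+z. indicator (sqr 3) z * ennreal (cmod (B z)) \<partial>lborel) \<le> ennreal b" "b > 0"
 obtains F where "F holomorphic_on ball 0 1" "\<And>z. z \<in> ball 0 1 ==> cmod (F z) \<le> 8 * C"
  "(\<integral>\<^sup>+z. indicator (sqr (1/2)) z * ennreal (cmod (F z - \<Phi> z)) \<partial>lborel) \<le> ennreal (17 * b)"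
proof -
 let ?Z = "sqr (1/2)"
 define F where "F s z = contour_integral (circlepath s 2) (\<lambda>\<zeta>. \<Phi> \<zeta> / (\<zeta> - z)) / (2 * pi * \<i>)" for s z
 have c\<Phi>: "continuous_on S \<Phi>" for S
  using has_derivative_continuous[OF der] by (simp add: continuous_at_imp_continuous_on)
 have [measurable]: "B \<in> borel_measurable borel" by (rule borel_measurable_continuous_onI[OF cB])
 have [measurable]: "circlepath 0 2 \<in> borel_measurable borel"
  by (rule borel_measurable_continuous_onI) (auto simp: circlepath intro!: continuous_intros)
 define N where "N t x s z = ennreal (cmod (B (of_real (1 - t) * z + (of_real t * s + of_real t * circlepath 0 2 x))))" for t x s z
 have Nm1[measurable]: "(\<lambda>p. N (f p) (g p) (h p) (k p)) \<in> borel_measurable M"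
  if [measurable]: "f \<in> borel_measurable M" "g \<in> borel_measurable M" "h \<in> borel_measurable M" "k \<in> borel_measurable M" for f g h k and M :: "'z measure"
  unfolding N_def by measurable
 have nz: "cmod z \<le> 3/4" if "z \<in> ?Z" for z using sqr_norm[OF that] by simp
 have pt: "ennreal (cmod (F s z - \<Phi> z)) \<le> 4 * (\<integral>\<^sup>+t. indicator {0..1} t * (\<integral>\<^sup>+x. indicator {0..1} x * N t x s z \<partial>lborel) \<partial>lborel)"
  if s: "s \<in> ?Z" and z: "z \<in> ?Z" for s z
 proof -
  have "cmod (z - s) < 2" using nz[OF s] nz[OF z] norm_triangle_ineq4[of z s] by linarith
  from dbar_homotopy[OF der cA cB this]
  have h: "cmod (contour_integral (circlepath s 2) (\<lambda>\<zeta>. \<Phi> \<zeta> / (\<zeta> - z)) - 2 * pi * \<i> * \<Phi> z)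
   \<le> 8 * pi * integral {0..1} (\<lambda>t. integral {0..1} (\<lambda>x. cmod (B (z + of_real t * (circlepath s 2 x - z)))))" by simp
  have "F s z - \<Phi> z = (contour_integral (circlepath s 2) (\<lambda>\<zeta>. \<Phi> \<zeta> / (\<zeta> - z)) - 2 * pi * \<i> * \<Phi> z) / (2 * pi * \<i>)"
   unfolding F_def by (simp add: field_simps)
  then have "cmod (F s z - \<Phi> z) = cmod (contour_integral (circlepath s 2) (\<lambda>\<zeta>. \<Phi> \<zeta> / (\<zeta> - z)) - 2 * pi * \<i> * \<Phi> z) / (2 * pi)"
   by (simp add: norm_divide norm_mult)
  also have "... \<le> 4 * integral {0..1} (\<lambda>t. integral {0..1} (\<lambda>x. cmod (B (z + of_real t * (circlepath s 2 x - z)))))"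
   using h by (simp add: field_simps)
  finally have 1: "cmod (F s z - \<Phi> z) \<le> 4 * integral {0..1} (\<lambda>t. integral {0..1} (\<lambda>x. cmod (B (z + of_real t * (circlepath s 2 x - z)))))" .
  have cN: "continuous_on UNIV (\<lambda>(t, x). cmod (B (z + of_real t * (circlepath s 2 x - z))))"
   unfolding split_beta circlepath by (intro continuous_intros continuous_on_compose2[OF cB]) auto
  have cN1: "continuous_on UNIV (\<lambda>x. cmod (B (z + of_real t * (circlepath s 2 x - z))))" for t
   unfolding split_beta circlepath by (intro continuous_intros continuous_on_compose2[OF cB]) auto
  have "ennreal (integral {0..1} (\<lambda>t. integral {0..1} (\<lambda>x. cmod (B (z + of_real t * (circlepath s 2 x - z))))))
   = (\<integral>\<^sup>+t. indicator {0..1} t * ennreal (integral {0..1} (\<lambda>x. cmod (B (z + of_real t * (circlepath s 2 x - z))))) \<partial>lborel)"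
  proof (rule nn_integral_interval_eq[symmetric])
   show "continuous_on UNIV (\<lambda>t. integral {0..1} (\<lambda>x. cmod (B (z + of_real t * (circlepath s 2 x - z)))))"
    unfolding interval_cbox by (rule integral_continuous_on_param) (rule continuous_on_subset[OF cN], simp)
   show "0 \<le> integral {0..1} (\<lambda>x. cmod (B (z + of_real t * (circlepath s 2 x - z))))" for t
    by (intro integral_nonneg integrable_continuous_interval continuous_on_subset[OF cN1]) auto
  qed
  also have "... = (\<integral>\<^sup>+t. indicator {0..1} t * (\<integral>\<^sup>+x. indicator {0..1} x * N t x s z \<partial>lborel) \<partial>lborel)"
  proof -
   have e: "z + of_real t * (circlepath s 2 x - z) = of_real (1 - t) * z + (of_real t * s + of_real t * circlepath 0 2 x)" for t x
    by (subst circlepath_0) (simp add: algebra_simps)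
   show ?thesis
    by (subst nn_integral_interval_eq[OF cN1, symmetric]) (auto simp only: N_def e norm_ge_zero)
  qed
  finally have 2: "ennreal (integral {0..1} (\<lambda>t. integral {0..1} (\<lambda>x. cmod (B (z + of_real t * (circlepath s 2 x - z)))))) = (\<integral>\<^sup>+t. indicator {0..1} t * (\<integral>\<^sup>+x. indicator {0..1} x * N t x s z \<partial>lborel) \<partial>lborel)" .
  have "ennreal (cmod (F s z - \<Phi> z)) \<le> ennreal (4 * integral {0..1} (\<lambda>t. integral {0..1} (\<lambda>x. cmod (B (z + of_real t * (circlepath s 2 x - z))))))"
   using 1 by (rule ennreal_leI)
  also have "... = 4 * ennreal (integral {0..1} (\<lambda>t. integral {0..1} (\<lambda>x. cmod (B (z + of_real t * (circlepath s 2 x - z))))))"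
   by (subst ennreal_mult') auto
  finally show ?thesis unfolding 2 .
 qed
 \<comment> \<open>An affine substitution in the plane with coefficient at least 1/2 costs at most
   the factor 4.\<close>
 have affine: "(\<integral>\<^sup>+z. indicator S z * ennreal (cmod (B (of_real c * z + a))) \<partial>lborel) \<le> ennreal (4 * b)"
  if c: "c \<ge> 1/2" and S: "\<And>z. z \<in> S ==> of_real c * z + a \<in> sqr 3" for S a c
 proof -
  have "(\<integral>\<^sup>+z. indicator S z * ennreal (cmod (B (of_real c * z + a))) \<partial>lborel)
    \<le> (\<integral>\<^sup>+z. indicator (sqr 3) (a + of_real c * z) * ennreal (cmod (B (a + of_real c * z))) \<partial>lborel)"
   using S by (intro nn_integral_mono) (auto simp: indicator_def add.commute)
  also have "... = ennreal (1 / c\<^sup>2) * (\<integral>\<^sup>+z. indicator (sqr 3) z * ennreal (cmod (B z)) \<partial>lborel)"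
   using c by (intro nn_integral_lborel_affine_complex) auto
  also have "... \<le> ennreal 4 * ennreal b"
  proof (intro mult_mono b ennreal_leI)
   have "(1/2)\<^sup>2 \<le> c\<^sup>2" using c by (intro power_mono) auto
   then show "1 / c\<^sup>2 \<le> 4" using c by (simp add: field_simps power2_eq_square)
  qed auto
  also have "... = ennreal (4 * b)" using b by (simp add: ennreal_mult')
  finally show ?thesis .
 qed
 have inbig: "of_real (1 - t) * z + (of_real t * s + of_real t * circlepath 0 2 x) \<in> sqr 3"
  if "t \<in> {0..1}" "s \<in> ?Z" "z \<in> ?Z" for t s z x
 proof -
  have c2: "cmod (circlepath 0 2 x) = 2" by (simp add: circlepath norm_mult)
  have "cmod (of_real t * circlepath 0 2 x) \<le> 2"
   using that by (simp only: norm_mult c2) (simp add: abs_if)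
  then have r: "\<bar>Re (of_real t * circlepath 0 2 x)\<bar> \<le> 2" "\<bar>Im (of_real t * circlepath 0 2 x)\<bar> \<le> 2"
   using abs_Re_le_cmod abs_Im_le_cmod order_trans by blast+
  have "\<bar>(1 - t) * u\<bar> \<le> 1/2" "\<bar>t * u\<bar> \<le> 1/2" if "\<bar>u\<bar> \<le> 1/2" for u
   using mult_mono[of "\<bar>1-t\<bar>" 1 "\<bar>u\<bar>" "1/2"] mult_mono[of "\<bar>t\<bar>" 1 "\<bar>u\<bar>" "1/2"] that \<open>t \<in> {0..1}\<close>
   by (auto simp: abs_mult)
  note u = this[of "Re z"] this[of "Im z"] this[of "Re s"] this[of "Im s"]
  have e: "Re (of_real (1 - t) * z + (of_real t * s + of_real t * circlepath 0 2 x)) = (1 - t) * Re z + t * Re s + Re (of_real t * circlepath 0 2 x)"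
   "Im (of_real (1 - t) * z + (of_real t * s + of_real t * circlepath 0 2 x)) = (1 - t) * Im z + t * Im s + Im (of_real t * circlepath 0 2 x)"
   by simp_all
  have a: "\<bar>Re z\<bar> \<le> 1/2" "\<bar>Im z\<bar> \<le> 1/2" "\<bar>Re s\<bar> \<le> 1/2" "\<bar>Im s\<bar> \<le> 1/2" using that by (auto simp: sqr_iff)
  show ?thesis unfolding sqr_iff e using r u(1)[OF a(1)] u(3)[OF a(2)] u(6)[OF a(3)] u(8)[OF a(4)] by linarith
 qed
 \<comment> \<open>One of \<open>1 - t\<close> and \<open>t\<close> is at least 1/2. In the first
   case the substitution is made in \<open>z\<close>, in the second, after Fubini, in
   \<open>s\<close>.\<close>
 have sz: "(\<integral>\<^sup>+s. indicator ?Z s * (\<integral>\<^sup>+z. indicator ?Z z * N t x s z \<partial>lborel) \<partial>lborel) \<le> ennreal (4 * b)"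
  if t: "t \<in> {0..1}" for t x
 proof (cases "t \<le> 1/2")
  case True
  have "(\<integral>\<^sup>+s. indicator ?Z s * (\<integral>\<^sup>+z. indicator ?Z z * N t x s z \<partial>lborel) \<partial>lborel) \<le> (\<integral>\<^sup>+s. indicator ?Z s * ennreal (4 * b) \<partial>lborel)"
  proof (rule nn_integral_mono)
   fix s show "indicator ?Z s * (\<integral>\<^sup>+z. indicator ?Z z * N t x s z \<partial>lborel) \<le> indicator ?Z s * ennreal (4 * b)"
    using True affine[of "1 - t" ?Z "of_real t * s + of_real t * circlepath 0 2 x"] inbig[OF t]
    by (cases "s \<in> ?Z") (auto simp: N_def)
  qed
  also have "... = ennreal (4 * b)"
   by (subst nn_integral_sqr_const) (auto simp: power2_eq_square)
  finally show ?thesis .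
 next
  case False
  have "(\<integral>\<^sup>+s. indicator ?Z s * (\<integral>\<^sup>+z. indicator ?Z z * N t x s z \<partial>lborel) \<partial>lborel)
    = (\<integral>\<^sup>+s. (\<integral>\<^sup>+z. indicator ?Z s * (indicator ?Z z * N t x s z) \<partial>lborel) \<partial>lborel)"
   by (subst nn_integral_cmult[symmetric]) auto
  also have "... = (\<integral>\<^sup>+z. (\<integral>\<^sup>+s. indicator ?Z s * (indicator ?Z z * N t x s z) \<partial>lborel) \<partial>lborel)"
   by (rule lborel_pair.Fubini'[symmetric]) measurable
  also have "... \<le> (\<integral>\<^sup>+z. indicator ?Z z * ennreal (4 * b) \<partial>lborel)"
  proof (rule nn_integral_mono)
   fix z :: complex
   have e: "of_real (1 - t) * z + (of_real t * s + of_real t * circlepath 0 2 x) = of_real t * s + (of_real (1 - t) * z + of_real t * circlepath 0 2 x)" for s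
    by simp
   show "(\<integral>\<^sup>+s. indicator ?Z s * (indicator ?Z z * N t x s z) \<partial>lborel) \<le> indicator ?Z z * ennreal (4 * b)"
   proof (cases "z \<in> ?Z")
    case True
    have "(\<integral>\<^sup>+s. indicator ?Z s * ennreal (cmod (B (of_real t * s + (of_real (1 - t) * z + of_real t * circlepath 0 2 x)))) \<partial>lborel) \<le> ennreal (4 * b)"
    proof (rule affine)
     show "of_real t * s + (of_real (1 - t) * z + of_real t * circlepath 0 2 x) \<in> sqr 3" if "s \<in> ?Z" for s
      using inbig[OF t that True, of x] unfolding e .
    qed (use False in simp)
    then show ?thesis unfolding N_def e using True by simp
   qed simp
  qed
  also have "... = ennreal (4 * b)"
   by (subst nn_integral_sqr_const) (auto simp: power2_eq_square)
  finally show ?thesis .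
 qed
 have T: "(\<integral>\<^sup>+s. indicator ?Z s * (\<integral>\<^sup>+z. indicator ?Z z * ennreal (cmod (F s z - \<Phi> z)) \<partial>lborel) \<partial>lborel) \<le> ennreal (16 * b)"
 proof -
  have "(\<integral>\<^sup>+s. indicator ?Z s * (\<integral>\<^sup>+z. indicator ?Z z * ennreal (cmod (F s z - \<Phi> z)) \<partial>lborel) \<partial>lborel)
   \<le> (\<integral>\<^sup>+s. indicator ?Z s * (\<integral>\<^sup>+z. indicator ?Z z * (4 * (\<integral>\<^sup>+t. indicator {0..1} t * (\<integral>\<^sup>+x. indicator {0..1} x * N t x s z \<partial>lborel) \<partial>lborel)) \<partial>lborel) \<partial>lborel)"
  proof (rule nn_integral_mono)
   fix s show "indicator ?Z s * (\<integral>\<^sup>+z. indicator ?Z z * ennreal (cmod (F s z - \<Phi> z)) \<partial>lborel)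
    \<le> indicator ?Z s * (\<integral>\<^sup>+z. indicator ?Z z * (4 * (\<integral>\<^sup>+t. indicator {0..1} t * (\<integral>\<^sup>+x. indicator {0..1} x * N t x s z \<partial>lborel) \<partial>lborel)) \<partial>lborel)"
    using pt[of s] by (cases "s \<in> ?Z") (auto intro!: nn_integral_mono simp: indicator_def)
  qed
  also have "... = (\<integral>\<^sup>+s. (\<integral>\<^sup>+z. (\<integral>\<^sup>+t. (\<integral>\<^sup>+x. indicator ?Z s * (indicator ?Z z * (4 * (indicator {0..1} t * (indicator {0..1} x * N t x s z)))) \<partial>lborel) \<partial>lborel) \<partial>lborel) \<partial>lborel)"
   by (simp add: nn_integral_cmult)
  also have "... = (\<integral>\<^sup>+s. (\<integral>\<^sup>+t. (\<integral>\<^sup>+z. (\<integral>\<^sup>+x. indicator ?Z s * (indicator ?Z z * (4 * (indicator {0..1} t * (indicator {0..1} x * N t x s z)))) \<partial>lborel) \<partial>lborel) \<partial>lborel) \<partial>lborel)"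
   by (intro nn_integral_cong lborel_pair.Fubini') measurable
  also have "... = (\<integral>\<^sup>+t. (\<integral>\<^sup>+s. (\<integral>\<^sup>+z. (\<integral>\<^sup>+x. indicator ?Z s * (indicator ?Z z * (4 * (indicator {0..1} t * (indicator {0..1} x * N t x s z)))) \<partial>lborel) \<partial>lborel) \<partial>lborel) \<partial>lborel)"
   by (intro lborel_pair.Fubini') measurable
  also have "... = (\<integral>\<^sup>+t. (\<integral>\<^sup>+s. (\<integral>\<^sup>+x. (\<integral>\<^sup>+z. indicator ?Z s * (indicator ?Z z * (4 * (indicator {0..1} t * (indicator {0..1} x * N t x s z)))) \<partial>lborel) \<partial>lborel) \<partial>lborel) \<partial>lborel)"
   by (intro nn_integral_cong lborel_pair.Fubini') measurable
  also have "... = (\<integral>\<^sup>+t. (\<integral>\<^sup>+x. (\<integral>\<^sup>+s. (\<integral>\<^sup>+z. indicator ?Z s * (indicator ?Z z * (4 * (indicator {0..1} t * (indicator {0..1} x * N t x s z)))) \<partial>lborel) \<partial>lborel) \<partial>lborel) \<partial>lborel)"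
   by (intro nn_integral_cong lborel_pair.Fubini') measurable
  also have "... = (\<integral>\<^sup>+t. (\<integral>\<^sup>+x. 4 * (indicator {0..1} t * (indicator {0..1} x * (\<integral>\<^sup>+s. indicator ?Z s * (\<integral>\<^sup>+z. indicator ?Z z * N t x s z \<partial>lborel) \<partial>lborel))) \<partial>lborel) \<partial>lborel)"
  proof (intro nn_integral_cong)
   fix t x :: real
   have "indicator ?Z s * (indicator ?Z z * (4 * (indicator {0..1} t * (indicator {0..1} x * N t x s z)))) = (4 * indicator {0..1} t * indicator {0..1} x) * (indicator ?Z s * (indicator ?Z z * N t x s z))" for s z
    by (simp add: mult_ac)
   then show "(\<integral>\<^sup>+s. (\<integral>\<^sup>+z. indicator ?Z s * (indicator ?Z z * (4 * (indicator {0..1} t * (indicator {0..1} x * N t x s z)))) \<partial>lborel) \<partial>lborel) = 4 * (indicator {0..1} t * (indicator {0..1} x * (\<integral>\<^sup>+s. indicator ?Z s * (\<integral>\<^sup>+z. indicator ?Z z * N t x s z \<partial>lborel) \<partial>lborel)))"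
    by (simp add: nn_integral_cmult mult.assoc)
  qed
  also have "... \<le> (\<integral>\<^sup>+t. (\<integral>\<^sup>+x. 4 * (indicator {0..1} t * (indicator {0..1} x * ennreal (4 * b))) \<partial>(lborel::real measure)) \<partial>(lborel::real measure))"
  proof (intro nn_integral_mono)
   fix t x :: real
   show "4 * (indicator {0..1} t * (indicator {0..1} x * (\<integral>\<^sup>+s. indicator ?Z s * (\<integral>\<^sup>+z. indicator ?Z z * N t x s z \<partial>lborel) \<partial>lborel)))
    \<le> 4 * (indicator {0..1} t * (indicator {0..1} x * ennreal (4 * b)))"
    by (cases "t \<in> {0..1}") (simp_all add: mult_left_mono sz)
  qed
  also have "... = ennreal (16 * b)"
  proof -
   have "4 * ennreal (4 * b) = ennreal (16 * b)" using b by (subst ennreal_mult') (auto simp flip: ennreal_mult' ennreal_numeral)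
   then show ?thesis by (simp add: nn_integral_cmult nn_integral_multc mult.commute)
  qed
  finally show ?thesis .
 qed
 \<comment> \<open>The square of centres has area 1. If every centre gave more than
   \<open>17 b\<close>, the mean would exceed its bound \<open>16 b\<close>; the slack makes the
   contradiction strict.\<close>
 have "\<exists>s\<in>?Z. (\<integral>\<^sup>+z. indicator ?Z z * ennreal (cmod (F s z - \<Phi> z)) \<partial>lborel) \<le> ennreal (17 * b)"
 proof (rule ccontr)
  assume n: "\<not> ?thesis"
  have "ennreal (17 * b) = (\<integral>\<^sup>+s. indicator ?Z s * ennreal (17 * b) \<partial>lborel)"
   by (subst nn_integral_sqr_const) (auto simp: power2_eq_square)
  also have "... \<le> (\<integral>\<^sup>+s. indicator ?Z s * (\<integral>\<^sup>+z. indicator ?Z z * ennreal (cmod (F s z - \<Phi> z)) \<partial>lborel) \<partial>lborel)"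
   using n by (intro nn_integral_mono) (auto simp: indicator_def not_le)
  also note T
  finally show False using b by (simp add: ennreal_le_iff)
 qed
 then obtain s where s: "s \<in> ?Z" and Fs: "(\<integral>\<^sup>+z. indicator ?Z z * ennreal (cmod (F s z - \<Phi> z)) \<partial>lborel) \<le> ennreal (17 * b)" by blast
 have insb: "z \<in> ball s 2" if "z \<in> ball 0 1" for z
  using nz[OF s] norm_triangle_ineq4[of s z] that by (simp add: dist_norm)
 have int: "((\<lambda>u. \<Phi> u / (u - z) ^ 1) has_contour_integral (2 * pi * \<i> * F s z)) (circlepath s 2)" if "z \<in> ball s 2" for z
 proof -
  have "(\<lambda>u. \<Phi> u / (u - z)) contour_integrable_on circlepath s 2"
   using that by (intro contour_integrable_continuous_circlepath continuous_intros c\<Phi>) (auto simp: dist_norm norm_minus_commute)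
  then show ?thesis unfolding F_def using has_contour_integral_integral by simp
 qed
 show thesis
 proof
  show "F s holomorphic_on ball 0 1"
  proof (rule holomorphic_onI)
   fix z assume "z \<in> ball (0::complex) 1"
   from Cauchy_next_derivative_circlepath(2)[OF c\<Phi> int _ insb[OF this]]
   have "((\<lambda>z. 2 * pi * \<i> * F s z) has_field_derivative contour_integral (circlepath s 2) (\<lambda>u. \<Phi> u / (u - z) ^ Suc 1)) (at z)"
    by simp
   from DERIV_cmult[OF this, of "1 / (2 * pi * \<i>)"]
   show "F s field_differentiable at z within ball 0 1"
    by (auto simp: field_differentiable_def intro: DERIV_subset)
  qed
  show "cmod (F s z) \<le> 8 * C" if z: "z \<in> ball 0 1" for z
  proof -
   have C: "C \<ge> 0" using order_trans[OF norm_ge_zero bd[of 0]] by simp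
   have "cmod (2 * pi * \<i> * F s z) \<le> (4 * C) * (2 * pi * 2)"
   proof (rule has_contour_integral_bound_circlepath[OF int[OF insb[OF z]]])
    fix u assume u: "cmod (u - s) = 2"
    have "cmod u \<le> 3" using u nz[OF s] norm_triangle_ineq2[of u s] by simp
    then have p: "cmod (\<Phi> u) \<le> C" by (rule bd)
    \<comment> \<open>The circle has radius 2, its centre modulus at most 3/4, and \<open>z\<close>
      modulus at most 1. With length \<open>4 pi\<close> this gives the constant 8.\<close>
    have "cmod (u - z) \<ge> 1/4"
     using u nz[OF s] z norm_triangle_ineq[of "u - z" "z - s"] norm_triangle_ineq4[of z s] by simp
    then have "cmod (\<Phi> u) / cmod (u - z) \<le> C / (1/4)" using p C by (intro frac_le) auto
    then show "cmod (\<Phi> u / (u - z) ^ 1) \<le> 4 * C" by (simp add: norm_divide)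
   qed (use C in auto)
   then show ?thesis by (simp add: norm_mult)
  qed
 qed (rule Fs)
qed

text \<open>Cauchy's formula for \<open>z0\<close> on the circle of radius 1/4 about
  \<open>z0 + w\<close> is averaged over \<open>w\<close> in a small square. Fubini and translation
  invariance turn the mean of the circle integrals into an area integral; 16 is the inverse area of
  the square of the \<open>w\<close>, and 4 comes from the Cauchy kernel.\<close>

lemma holomorphic_bound_L1:
 assumes hol: "Y holomorphic_on ball 0 1" and z0: "cmod z0 \<le> 1/8"
  and c: "(\<integral>\<^sup>+z. indicator (sqr (1/2)) z * ennreal (cmod (Y z)) \<partial>lborel) \<le> ennreal c" "c \<ge> 0"
 shows "cmod (Y z0) \<le> 64 * c"
proof -
 let ?Z = "sqr (1/2)" and ?W = "sqr (1/8)"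
 define g where "g z = indicator ?Z z * ennreal (cmod (Y z))" for z
 have Z1: "?Z \<subseteq> ball 0 1" using sqr_norm[of _ "1/2"] by (force simp: dist_norm)
 have "continuous_on ?Z Y" using hol Z1 holomorphic_on_imp_continuous_on continuous_on_subset by blast
 then have "(\<lambda>z. indicator ?Z z *\<^sub>R cmod (Y z)) \<in> borel_measurable borel"
  by (intro borel_measurable_continuous_on_indicator continuous_intros) auto
 then have "(\<lambda>z. ennreal (indicator ?Z z *\<^sub>R cmod (Y z))) \<in> borel_measurable borel" by measurable
 moreover have "(\<lambda>z. ennreal (indicator ?Z z *\<^sub>R cmod (Y z))) = g" by (auto simp: g_def indicator_def fun_eq_iff)
 ultimately have gm[measurable]: "g \<in> borel_measurable borel" by (simp only:)
 have [measurable]: "circlepath 0 (1/4) \<in> borel_measurable borel"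
  by (rule borel_measurable_continuous_onI) (auto simp: circlepath intro!: continuous_intros)
 have pt: "ennreal (cmod (Y z0)) \<le> 4 * (\<integral>\<^sup>+x. indicator {0..1} x * g (z0 + w + circlepath 0 (1/4) x) \<partial>lborel)"
  if w: "w \<in> ?W" for w
 proof -
  let ?s = "z0 + w"
  have wn: "cmod w \<le> 3/16" using sqr_norm[OF w] by simp
  have sub: "cball ?s (1/4) \<subseteq> ball 0 1"
  proof
   fix u assume "u \<in> cball ?s (1/4)"
   then have "cmod (u - ?s) \<le> 1/4" by (simp add: dist_norm norm_minus_commute)
   then show "u \<in> ball 0 1" using wn z0 norm_triangle_ineq[of "u - ?s" ?s] norm_triangle_ineq[of z0 w] by simp
  qed
  have "((\<lambda>u. Y u / (u - z0)) has_contour_integral (2 * of_real pi * \<i> * Y z0)) (circlepath ?s (1/4))"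
   by (rule Cauchy_integral_circlepath_simple) (use hol sub holomorphic_on_subset wn in auto)
  then have e: "integral {0..1} (\<lambda>x. Y (circlepath ?s (1/4) x) / (circlepath ?s (1/4) x - z0) * vector_derivative (circlepath ?s (1/4)) (at x)) = 2 * of_real pi * \<i> * Y z0"
   and i: "(\<lambda>x. Y (circlepath ?s (1/4) x) / (circlepath ?s (1/4) x - z0) * vector_derivative (circlepath ?s (1/4)) (at x)) integrable_on {0..1}"
   by (simp_all only: has_contour_integral integral_unique has_integral_integrable)
  have cYc: "continuous_on {0..1} (\<lambda>x. Y (circlepath ?s (1/4) x))"
  proof (rule continuous_on_compose2[OF holomorphic_on_imp_continuous_on[OF hol]])
   show "continuous_on {0..1} (circlepath ?s (1/4))" by (auto simp: circlepath intro!: continuous_intros)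
   show "circlepath ?s (1/4) ` {0..1} \<subseteq> ball 0 1" using sub by (auto simp: circlepath norm_mult dist_norm)
  qed
  have "cmod (2 * of_real pi * \<i> * Y z0) \<le> integral {0..1} (\<lambda>x. 8 * pi * cmod (Y (circlepath ?s (1/4) x)))"
   unfolding e[symmetric]
  proof (rule integral_norm_bound_integral[OF i])
   show "(\<lambda>x. 8 * pi * cmod (Y (circlepath ?s (1/4) x))) integrable_on {0..1}"
    by (intro integrable_continuous_interval continuous_intros cYc)
   fix x :: real
   let ?u = "circlepath ?s (1/4) x"
   have u: "cmod (?u - ?s) = 1/4" by (simp add: circlepath norm_mult)
   have "cmod (?u - z0) \<ge> 1/16" using norm_triangle_ineq4[of "?u - z0" w] u wn by (simp add: algebra_simps)
   then have "cmod (Y ?u) / cmod (?u - z0) \<le> cmod (Y ?u) / (1/16)" by (intro frac_le) auto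
   then have "cmod (Y ?u) / cmod (?u - z0) * (pi / 2) \<le> cmod (Y ?u) / (1/16) * (pi / 2)" by (intro mult_right_mono) auto
   moreover have vd: "cmod (vector_derivative (circlepath ?s (1/4)) (at x)) = pi / 2" by (simp add: vector_derivative_circlepath norm_mult)
   ultimately show "cmod (Y ?u / (?u - z0) * vector_derivative (circlepath ?s (1/4)) (at x)) \<le> 8 * pi * cmod (Y ?u)"
    unfolding norm_mult norm_divide vd by simp
  qed
  then have 1: "cmod (Y z0) \<le> 4 * integral {0..1} (\<lambda>x. cmod (Y (circlepath ?s (1/4) x)))" by (simp add: norm_mult)
  define k where "k x = cmod (Y (circlepath ?s (1/4) x))" for x
  have ck: "continuous_on UNIV k"
   unfolding k_def
  proof (intro continuous_intros continuous_on_compose2[OF holomorphic_on_imp_continuous_on[OF hol]])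
   show "continuous_on UNIV (circlepath ?s (1/4))" by (auto simp: circlepath intro!: continuous_intros)
   show "circlepath ?s (1/4) ` UNIV \<subseteq> ball 0 1" using sub by (auto simp: circlepath norm_mult dist_norm)
  qed
  have gk: "g (?s + circlepath 0 (1/4) x) = ennreal (k x)" for x
  proof -
   have "\<bar>Re w\<bar> \<le> 1/8" "\<bar>Im w\<bar> \<le> 1/8" using w by (auto simp: sqr_iff)
   moreover have "\<bar>Re z0\<bar> \<le> 1/8" "\<bar>Im z0\<bar> \<le> 1/8" using z0 abs_Re_le_cmod abs_Im_le_cmod order_trans by blast+
   moreover have "cmod (circlepath 0 (1/4) x) = 1/4" by (simp add: circlepath norm_mult)
   then have "\<bar>Re (circlepath 0 (1/4) x)\<bar> \<le> 1/4" "\<bar>Im (circlepath 0 (1/4) x)\<bar> \<le> 1/4" using abs_Re_le_cmod abs_Im_le_cmod by metis+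
   ultimately have "?s + circlepath 0 (1/4) x \<in> ?Z" unfolding sqr_iff plus_complex.sel by linarith
   then show ?thesis unfolding g_def k_def by (subst circlepath_0) simp
  qed
  have "ennreal (cmod (Y z0)) \<le> ennreal (4 * integral {0..1} k)"
   using 1 unfolding k_def by (rule ennreal_leI)
  also have "... = 4 * ennreal (integral {0..1} k)" by (subst ennreal_mult') auto
  also have "ennreal (integral {0..1} k) = (\<integral>\<^sup>+x. indicator {0..1} x * g (?s + circlepath 0 (1/4) x) \<partial>lborel)"
   unfolding gk by (rule nn_integral_interval_eq[symmetric, OF ck]) (simp add: k_def)
  finally show ?thesis .
 qed
 have "ennreal (1/16) * ennreal (cmod (Y z0)) = (\<integral>\<^sup>+w. indicator ?W w * ennreal (cmod (Y z0)) \<partial>lborel)"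
  by (subst nn_integral_sqr_const) (auto simp: power2_eq_square)
 also have "... \<le> (\<integral>\<^sup>+w. (\<integral>\<^sup>+x. 4 * (indicator {0..1} x * g (z0 + w + circlepath 0 (1/4) x)) \<partial>lborel) \<partial>lborel)"
 proof (rule nn_integral_mono)
  fix w show "indicator ?W w * ennreal (cmod (Y z0)) \<le> (\<integral>\<^sup>+x. 4 * (indicator {0..1} x * g (z0 + w + circlepath 0 (1/4) x)) \<partial>lborel)"
   using pt[of w] by (cases "w \<in> ?W") (auto simp: nn_integral_cmult)
 qed
 also have "... = (\<integral>\<^sup>+x. (\<integral>\<^sup>+w. 4 * (indicator {0..1} x * g (z0 + w + circlepath 0 (1/4) x)) \<partial>lborel) \<partial>lborel)"
  by (rule lborel_pair.Fubini') measurable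
 also have "... = (\<integral>\<^sup>+x. 4 * (indicator {0..1} x * (\<integral>\<^sup>+w. g w \<partial>lborel)) \<partial>(lborel::real measure))"
 proof (intro nn_integral_cong)
  fix x :: real
  have "(\<integral>\<^sup>+w. g (z0 + w + circlepath 0 (1/4) x) \<partial>lborel) = (\<integral>\<^sup>+w. g w \<partial>lborel)"
   using nn_integral_lborel_affine_complex[OF gm, of 1 "z0 + circlepath 0 (1/4) x"] by (simp add: add_ac)
  then show "(\<integral>\<^sup>+w. 4 * (indicator {0..1} x * g (z0 + w + circlepath 0 (1/4) x)) \<partial>lborel) = 4 * (indicator {0..1} x * (\<integral>\<^sup>+w. g w \<partial>lborel))"
   by (simp add: nn_integral_cmult)
 qed
 also have "... = 4 * (\<integral>\<^sup>+w. g w \<partial>lborel)"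
  by (simp add: nn_integral_cmult nn_integral_multc)
 also have "... \<le> 4 * ennreal c" using c unfolding g_def by (intro mult_left_mono) auto
 also have "... = ennreal (4 * c)" by (subst ennreal_mult') auto
 finally have "ennreal (1/16 * cmod (Y z0)) \<le> ennreal (4 * c)" by (subst ennreal_mult') auto
 then show ?thesis using c by (simp add: ennreal_le_iff)
qed

section \<open>From an approximate relation between powers to an approximate root\<close>

lemma power_add_ge:
 fixes x y :: real
 assumes "x \<ge> 0" "y \<ge> 0" "j \<ge> 1"
 shows "x ^ j + y ^ j \<le> (x + y) ^ j"
 using assms(3)
proof (induction j rule: dec_induct)
 case (step n)
 have "x ^ Suc n + y ^ Suc n \<le> x * (x ^ n + y ^ n) + y * (x ^ n + y ^ n)"
  using assms by (simp add: algebra_simps)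
 also have "... = (x + y) * (x ^ n + y ^ n)" by (simp add: algebra_simps)
 also have "... \<le> (x + y) * (x + y) ^ n" using step assms by (intro mult_left_mono) auto
 finally show ?case by simp
qed simp

lemma norm_power_diff_le:
 fixes x y :: complex
 assumes "cmod x \<le> M" "cmod y \<le> M"
 shows "cmod (x ^ n - y ^ n) \<le> n * M ^ (n - 1) * cmod (x - y)"
proof -
 have M: "M \<ge> 0" using assms(1) norm_ge_zero order_trans by blast
 have "cmod (x ^ n - y ^ n) = cmod (x - y) * cmod (\<Sum>i<n. y ^ (n - Suc i) * x ^ i)"
  by (simp add: diff_power_eq_sum norm_mult power_diff_sumr2)
 also have "cmod (\<Sum>i<n. y ^ (n - Suc i) * x ^ i) \<le> (\<Sum>i<n. M ^ (n - 1))"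
 proof (rule sum_norm_le)
  fix i assume "i \<in> {..<n}"
  then have "n - 1 = (n - Suc i) + i" by auto
  then have "M ^ (n - 1) = M ^ (n - Suc i) * M ^ i" by (metis power_add)
  then show "cmod (y ^ (n - Suc i) * x ^ i) \<le> M ^ (n - 1)"
   using assms M by (simp add: norm_mult norm_power mult_mono power_mono)
 qed
 finally have "cmod (x ^ n - y ^ n) \<le> cmod (x - y) * (\<Sum>i<n. M ^ (n - 1))" by (simp add: mult_left_mono)
 then show ?thesis by (simp add: mult_ac)
qed

text \<open>The holomorphic errors to be bounded, such as \<open>F^j - P\<close>, are compared with
  expressions in \<Phi>. This splits the bound into a part \<open>k d\<close> that is small in the
  mean and a part \<open>e\<close> that is small everywhere.\<close>

lemma holomorphic_bound_L1':
 assumes hol: "Y holomorphic_on ball 0 1"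
  and d: "continuous_on (sqr (1/2)) d" "\<And>z. 0 \<le> d z"
  and c: "(\<integral>\<^sup>+z. indicator (sqr (1/2)) z * ennreal (d z) \<partial>lborel) \<le> ennreal c" "c \<ge> 0"
  and Y: "\<And>z. z \<in> sqr (1/2) ==> cmod (Y z) \<le> k * d z + e" "k \<ge> 0" "e \<ge> 0"
  and z0: "cmod z0 \<le> 1/8"
 shows "cmod (Y z0) \<le> 64 * (k * c + e)"
proof (rule holomorphic_bound_L1[OF hol z0])
 let ?Z = "sqr (1/2)"
 have "(\<lambda>z. indicator ?Z z *\<^sub>R d z) \<in> borel_measurable borel"
  by (intro borel_measurable_continuous_on_indicator d) auto
 then have "(\<lambda>z. ennreal (indicator ?Z z *\<^sub>R d z)) \<in> borel_measurable borel" by measurable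
 moreover have "(\<lambda>z. ennreal (indicator ?Z z *\<^sub>R d z)) = (\<lambda>z. indicator ?Z z * ennreal (d z))" by (auto simp: indicator_def fun_eq_iff)
 ultimately have m[measurable]: "(\<lambda>z. indicator ?Z z * ennreal (d z)) \<in> borel_measurable borel" by (simp only:)
 have "(\<integral>\<^sup>+z. indicator ?Z z * ennreal (cmod (Y z)) \<partial>lborel) \<le> (\<integral>\<^sup>+z. ennreal k * (indicator ?Z z * ennreal (d z)) + indicator ?Z z * ennreal e \<partial>lborel)"
 proof (rule nn_integral_mono)
  fix z :: complex
  show "indicator ?Z z * ennreal (cmod (Y z)) \<le> ennreal k * (indicator ?Z z * ennreal (d z)) + indicator ?Z z * ennreal e"
  proof (cases "z \<in> ?Z")
   case True
   have "ennreal (cmod (Y z)) \<le> ennreal (k * d z + e)" using Y(1)[OF True] by (rule ennreal_leI)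
   then show ?thesis using True Y d by (simp add: ennreal_mult)
  qed simp
 qed
 also have "... = ennreal k * (\<integral>\<^sup>+z. indicator ?Z z * ennreal (d z) \<partial>lborel) + ennreal e"
  by (simp add: nn_integral_add nn_integral_cmult nn_integral_sqr_const power2_eq_square del: nn_integral_indicator)
 also have "... \<le> ennreal k * ennreal c + ennreal e" using c by (intro add_right_mono mult_left_mono) auto
 also have "... = ennreal (k * c + e)" using c Y by (simp add: ennreal_mult)
 finally show "(\<integral>\<^sup>+z. indicator ?Z z * ennreal (cmod (Y z)) \<partial>lborel) \<le> ennreal (k * c + e)" .
qed (use c Y in auto)

text \<open>The antiholomorphic part carries the factor \<open>t / V^2\<close>. This smallness, with
  \<open>t = \<tau>^2\<close>, is what makes the regularised quotient almost holomorphic.\<close>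

lemma reg_quotient_has_derivative:
 fixes P Q P' Q' :: "complex => complex" and t :: real
 assumes P: "(P has_field_derivative P' z) (at z)" and Q: "(Q has_field_derivative Q' z) (at z)" and t: "t > 0"
 defines "V \<equiv> \<lambda>z. P z * cnj (P z) + of_real t"
 shows "((\<lambda>z. Q z * cnj (P z) / V z) has_derivative
  (\<lambda>h. (Q' z * cnj (P z) / V z - Q z * (cnj (P z))\<^sup>2 * P' z / (V z)\<^sup>2) * h + (Q z * of_real t * cnj (P' z) / (V z)\<^sup>2) * cnj h)) (at z)"
proof -
 have V: "V z = of_real ((cmod (P z))\<^sup>2 + t)" for z by (simp only: V_def of_real_add complex_norm_square)
 have V0: "V z \<noteq> 0" unfolding V of_real_eq_0_iff using t by (smt (verit) zero_le_power2)
 have P1: "(P has_derivative (\<lambda>h. P' z * h)) (at z)" and Q1: "(Q has_derivative (\<lambda>h. Q' z * h)) (at z)"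
  using P Q by (auto simp: has_field_derivative_def)
 have C1: "((\<lambda>z. cnj (P z)) has_derivative (\<lambda>h. cnj (P' z * h))) (at z)"
  by (rule has_derivative_cnj[OF P1])
 have VV: "(V has_derivative (\<lambda>h. P z * cnj (P' z * h) + P' z * h * cnj (P z))) (at z)"
  unfolding V_def using has_derivative_add[OF has_derivative_mult[OF P1 C1] has_derivative_const[of "of_real t"]] by simp
 have alg: "(- (q * pb) * (1 / v * (p * (rb * k) + r * h * pb) * (1 / v)) + (q * (rb * k) + q' * h * pb) / v)
   = (q' * pb / v - q * pb\<^sup>2 * r / v\<^sup>2) * h + (q * t * rb / v\<^sup>2) * k"
  if "v \<noteq> 0" "v = p * pb + t" for q q' pb v p rb k r h t :: complex
 proof -
  have "(- (q * pb) * (1 / v * (p * (rb * k) + r * h * pb) * (1 / v)) + (q * (rb * k) + q' * h * pb) / v)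
   = (- (q * pb) * (p * (rb * k) + r * h * pb) + (q * (rb * k) + q' * h * pb) * v) / v\<^sup>2"
   using that(1) by (simp add: field_simps power2_eq_square)
  also have "- (q * pb) * (p * (rb * k) + r * h * pb) + (q * (rb * k) + q' * h * pb) * v = (q' * pb * v - q * pb\<^sup>2 * r) * h + q * t * rb * k"
   unfolding that(2) by (simp add: algebra_simps power2_eq_square)
  also have "... / v\<^sup>2 = (q' * pb / v - q * pb\<^sup>2 * r / v\<^sup>2) * h + (q * t * rb / v\<^sup>2) * k"
   using that(1) by (simp add: field_simps power2_eq_square)
  finally show ?thesis .
 qed
 show ?thesis
  by (rule has_derivative_eq_rhs[OF has_derivative_divide[OF has_derivative_mult[OF Q1 C1] VV V0]])
   (use alg[OF V0 V_def[THEN meta_eq_to_obj_eq, THEN fun_cong]] in \<open>simp add: fun_eq_iff inverse_eq_divide\<close>)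
qed

text \<open>The exponent is made for three scales: \<open>\<sigma> = \<theta>^2\<close>, the
  regularisation \<open>\<tau> = \<sigma>^j\<close>, and the j-th root
  \<open>b0 = \<sigma> \<tau>^2\<close> of the error. So \<open>b0\<close> remains small after
  division by \<open>\<tau>^2\<close>, and \<sigma> has a factor \<theta> to spare for the logarithm
  of \<open>1/\<tau>\<close> in the area integral.\<close>

theorem approximate_root:
 fixes A :: real and j :: nat
 assumes j: "j \<ge> 1" and A: "A \<ge> 1"
 obtains C where "C \<ge> 1"
  "\<And>P Q \<theta>. P holomorphic_on UNIV ==> Q holomorphic_on UNIV ==> 0 < \<theta> ==> \<theta> \<le> 1 ==>
   (\<And>z. cmod z \<le> 8 ==> cmod (P z) \<le> A \<and> cmod (Q z) \<le> A \<and> cmod (Q z ^ j - P z ^ (j + 1)) \<le> A * \<theta> ^ (2 * j * (2 * j + 1))) ==>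
   (\<exists>F. F holomorphic_on ball 0 1 \<and>
    (\<forall>z. cmod z \<le> 1/8 --> cmod (F z) \<le> C \<and> cmod (F z ^ j - P z) \<le> C * \<theta> \<and> cmod (F z * P z - Q z) \<le> C * \<theta>))"
proof -
 \<comment> \<open>50 and 200 come from half of \<open>100 (ln (A^2 + 1) + 2 ln (1/\<tau>))\<close>
   together with \<open>ln (1/\<tau>) \<le> 2 j / \<theta>\<close>; 36 is the area of
   \<open>sqr 3\<close>.\<close>
 define C1 where "C1 = 50 * ln (A\<^sup>2 + 1) + 200 * j + 36 * (1/2 + A\<^sup>2)"
 define C where "C = 16 * A + 64 * (j * (16 * A) ^ (j - 1) * (17 * C1) + (j + A)) + 64 * (A * (17 * C1) + 2 * A)"
 have C1: "C1 > 0"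
  unfolding C1_def by (intro add_nonneg_pos add_nonneg_nonneg mult_nonneg_nonneg mult_pos_pos add_pos_nonneg) auto
 have C_parts: "16 * A \<ge> 1" "64 * (j * (16 * A) ^ (j - 1) * (17 * C1) + (j + A)) \<ge> 0" "64 * (A * (17 * C1) + 2 * A) \<ge> 0"
  using A C1 by auto
 show thesis
 proof (rule that[of C])
  show "C \<ge> 1" using C_parts unfolding C_def by linarith
  fix P Q :: "complex => complex" and \<theta> :: real
  assume holP: "P holomorphic_on UNIV" and holQ: "Q holomorphic_on UNIV" and \<theta>: "0 < \<theta>" "\<theta> \<le> 1"
   and bd: "\<And>z. cmod z \<le> 8 ==> cmod (P z) \<le> A \<and> cmod (Q z) \<le> A \<and> cmod (Q z ^ j - P z ^ (j + 1)) \<le> A * \<theta> ^ (2 * j * (2 * j + 1))"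
  define \<sigma> where "\<sigma> = \<theta>\<^sup>2"
  define \<tau> where "\<tau> = \<sigma> ^ j"
  define b0 where "b0 = \<sigma> ^ (2 * j + 1)"
  have \<sigma>: "0 < \<sigma>" "\<sigma> \<le> 1" "\<sigma> \<le> \<theta>"
   using \<theta> power_decreasing[of 1 2 \<theta>] by (auto simp: \<sigma>_def power_le_one)
  have \<tau>: "0 < \<tau>" "\<tau> \<le> 1" "\<tau> \<le> \<sigma>"
   using \<sigma> power_decreasing[of 1 j \<sigma>] j by (auto simp: \<tau>_def power_le_one)
  have b0: "b0 > 0" "b0 = \<sigma> * \<tau>\<^sup>2" using \<sigma> by (auto simp: b0_def \<tau>_def power_mult[symmetric] mult.commute)
  have b0\<tau>: "b0 / \<tau> \<le> \<sigma>" using \<tau> \<sigma> by (simp add: b0 power2_eq_square)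
  have b0\<sigma>: "b0 \<le> \<sigma>" using \<tau> \<sigma> by (simp add: b0 power_le_one)
  have \<delta>: "\<theta> ^ (2 * j * (2 * j + 1)) = b0 ^ j"
   unfolding b0_def \<sigma>_def power_mult[symmetric] by (rule arg_cong[where f="\<lambda>n. \<theta> ^ n"]) (simp add: algebra_simps)
  define P' where "P' = deriv P"
  define Q' where "Q' = deriv Q"
  have hol': "P' holomorphic_on UNIV" "Q' holomorphic_on UNIV"
   unfolding P'_def Q'_def using holP holQ by (auto intro: holomorphic_deriv)
  have dP: "(P has_field_derivative P' z) (at z)" and dQ: "(Q has_field_derivative Q' z) (at z)" for z
   unfolding P'_def Q'_def by (auto intro: holomorphic_derivI[OF holP] holomorphic_derivI[OF holQ])
  have cP: "continuous_on UNIV P" "continuous_on UNIV Q" "continuous_on UNIV P'" "continuous_on UNIV Q'"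
   using holP holQ hol' holomorphic_on_imp_continuous_on by auto
  define V where "V z = (cmod (P z))\<^sup>2 + \<tau>\<^sup>2" for z
  have Vpos: "V z > 0" for z using \<tau> unfolding V_def by (simp add: add_nonneg_pos)
  have V0: "V z \<noteq> 0" for z using Vpos by (metis less_irrefl)
  have Vc: "of_real (V z) = P z * cnj (P z) + of_real (\<tau>\<^sup>2)" for z by (simp only: V_def of_real_add complex_norm_square)
  define \<Phi> where "\<Phi> z = Q z * cnj (P z) / of_real (V z)" for z
  define DA where "DA z = Q' z * cnj (P z) / of_real (V z) - Q z * (cnj (P z))\<^sup>2 * P' z / (of_real (V z))\<^sup>2" for z
  define DB where "DB z = Q z * of_real (\<tau>\<^sup>2) * cnj (P' z) / (of_real (V z))\<^sup>2" for z
  have der: "(\<Phi> has_derivative (\<lambda>h. DA z * h + DB z * cnj h)) (at z)" for z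
   unfolding \<Phi>_def DA_def DB_def Vc
   by (rule reg_quotient_has_derivative[OF dP dQ]) (use \<tau> in simp)
  have cV: "continuous_on UNIV V" unfolding V_def by (intro continuous_intros cP)
  have cDA: "continuous_on UNIV DA" and cDB: "continuous_on UNIV DB" and c\<Phi>: "continuous_on UNIV \<Phi>"
   unfolding DA_def DB_def \<Phi>_def by (auto intro!: continuous_intros cP cV simp: V0)
  \<comment> \<open>\<open>a\<close> stands for the modulus of the unknown root:
    \<open>|P| = a^j\<close>, and up to \<open>A b0\<close> also
    \<open>|Q| \<le> a^(j+1)\<close>.\<close>
  define a where "a z = root j (cmod (P z))" for z
  have aj: "a z ^ j = cmod (P z)" "a z \<ge> 0" for z using j by (auto simp: a_def real_root_pow_pos2)
  have P\<tau>: "2 * (cmod (P z) * \<tau>) \<le> V z" for z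
   unfolding V_def using sum_squares_bound[of "cmod (P z)" \<tau>] by (simp add: algebra_simps)
  have P\<tau>': "cmod (P z) * \<tau> \<le> V z" for z using P\<tau>[of z] \<tau> by (smt (verit) mult_nonneg_nonneg norm_ge_zero)
  have PV: "cmod (P z) / V z \<le> 1 / \<tau>" for z using P\<tau>'[of z] \<tau> Vpos[of z] by (simp add: field_simps)
  have P\<tau>2: "cmod (P z) * \<tau>\<^sup>2 / V z \<le> \<tau>" for z
   using mult_right_mono[OF P\<tau>'[of z], of \<tau>] \<tau> Vpos[of z] by (simp add: field_simps power2_eq_square)
  have \<tau>V: "\<tau>\<^sup>2 / V z \<le> 1" "(cmod (P z))\<^sup>2 / V z \<le> 1" for z using Vpos[of z] by (auto simp: V_def)
  have \<tau>V2: "\<tau>\<^sup>2 / (V z)\<^sup>2 \<le> 1 / \<tau>\<^sup>2" for z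
  proof -
   have "\<tau>\<^sup>2 \<le> V z" by (simp add: V_def)
   then have "\<tau>\<^sup>2 * \<tau>\<^sup>2 \<le> V z * V z" using Vpos[of z] by (intro mult_mono) auto
   then show ?thesis using \<tau> Vpos[of z] by (simp add: field_simps power2_eq_square)
  qed
  have aA: "a z \<le> A" if "cmod z \<le> 8" for z
  proof (rule ccontr)
   assume "\<not> a z \<le> A"
   then have "a z > A" by simp
   moreover have "a z \<le> a z ^ j" using power_increasing[of 1 j "a z"] j A \<open>a z > A\<close> by simp
   ultimately show False using bd[OF that] by (simp add: aj)
  qed
  have Qb: "cmod (Q z) \<le> a z ^ (j + 1) + A * b0" if z: "cmod z \<le> 8" for z
  proof -
   have "cmod (Q z) ^ j = cmod (P z ^ (j + 1) + (Q z ^ j - P z ^ (j + 1)))" by (simp add: norm_power)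
   also have "... \<le> cmod (P z) ^ (j + 1) + A * b0 ^ j"
    using norm_triangle_ineq[of "P z ^ (j + 1)" "Q z ^ j - P z ^ (j + 1)"] conjunct2[OF conjunct2[OF bd[OF z]]] unfolding norm_power \<delta> by linarith
   also have "... \<le> (a z ^ (j + 1)) ^ j + (A * b0) ^ j"
   proof -
    have "A * b0 ^ j \<le> A ^ j * b0 ^ j" using power_increasing[of 1 j A] A j b0 by (intro mult_right_mono) auto
    moreover have "cmod (P z) ^ (j + 1) = (a z ^ (j + 1)) ^ j" unfolding aj(1)[symmetric] power_mult[symmetric] by (simp only: mult.commute)
    ultimately show ?thesis by (simp add: power_mult_distrib)
   qed
   \<comment> \<open>Superadditivity of the j-th power, so that a j-th root can be taken.\<close>
   also have "... \<le> (a z ^ (j + 1) + A * b0) ^ j"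
    using j A b0 aj by (intro power_add_ge) auto
   finally show ?thesis using power_mono_iff[of "cmod (Q z)" "a z ^ (j + 1) + A * b0" j] j A b0 aj by simp
  qed
  have \<Phi>b: "cmod (\<Phi> z) \<le> 2 * A" if z: "cmod z \<le> 8" for z
  proof -
   have "cmod (\<Phi> z) = cmod (Q z) * (cmod (P z) / V z)" using Vpos[of z] by (simp add: \<Phi>_def norm_mult norm_divide)
   also have "... \<le> (a z ^ (j + 1) + A * b0) * (cmod (P z) / V z)"
    using Qb[OF z] Vpos[of z] by (intro mult_right_mono) auto
   also have "... = a z * ((cmod (P z))\<^sup>2 / V z) + A * (b0 * (cmod (P z) / V z))"
    by (simp add: aj power2_eq_square algebra_simps)
   also have "... \<le> a z * 1 + A * (b0 * (1 / \<tau>))"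
    using aj A b0 \<tau>V PV by (intro add_mono mult_left_mono) auto
   also have "... \<le> A + A * 1" using aA[OF z] b0\<tau> \<sigma> A by (intro add_mono mult_left_mono) auto
   finally show ?thesis by simp
  qed
  have \<Phi>j: "cmod (\<Phi> z ^ j - P z) \<le> (j + A) * \<theta>" if z: "cmod z \<le> 8" for z
  proof -
   \<comment> \<open>Replacing \<open>Q^j\<close> by \<open>P^(j+1)\<close> in
     \<open>\<Phi>^j\<close> leaves \<open>P x^j\<close>; by Bernoulli's inequality
     \<open>x^j\<close> differs from 1 by at most \<open>j (1 - x)\<close>.\<close>
   define x where "x = (cmod (P z))\<^sup>2 / V z"
   have x: "0 \<le> x" "x \<le> 1" using \<tau>V Vpos[of z] by (auto simp: x_def)
   have "(V z - (cmod (P z))\<^sup>2) / V z = \<tau>\<^sup>2 / V z" by (simp add: V_def)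
   then have x3: "1 - x = \<tau>\<^sup>2 / V z" using V0[of z] by (simp add: x_def diff_divide_distrib)
   have "of_real x = P z * cnj (P z) / of_real (V z)" by (simp only: x_def of_real_divide complex_norm_square)
   then have "\<Phi> z ^ j - P z = (Q z ^ j - P z ^ (j + 1)) * (cnj (P z) / of_real (V z)) ^ j - P z * of_real (1 - x ^ j)"
    by (simp add: \<Phi>_def power_mult_distrib power_divide algebra_simps)
   then have "cmod (\<Phi> z ^ j - P z) \<le> cmod (Q z ^ j - P z ^ (j + 1)) * (cmod (P z) / V z) ^ j + cmod (P z) * \<bar>1 - x ^ j\<bar>"
    using norm_triangle_ineq4[of "(Q z ^ j - P z ^ (j + 1)) * (cnj (P z) / of_real (V z)) ^ j" "P z * of_real (1 - x ^ j)"] Vpos[of z]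
    by (simp only: norm_mult norm_power norm_divide norm_of_real complex_mod_cnj abs_of_pos)
   also have "... \<le> A * b0 ^ j * (1 / \<tau>) ^ j + cmod (P z) * (j * (\<tau>\<^sup>2 / V z))"
   proof (intro add_mono mult_mono power_mono)
    have "x ^ j \<ge> 1 + j * (x - 1)" using Bernoulli_inequality[of "x - 1" j] x by simp
    moreover have "x ^ j \<le> 1" using x by (simp add: power_le_one)
    ultimately show "\<bar>1 - x ^ j\<bar> \<le> j * (\<tau>\<^sup>2 / V z)" unfolding x3[symmetric] by (simp add: algebra_simps)
    show "cmod (Q z ^ j - P z ^ (j + 1)) \<le> A * b0 ^ j" using bd[OF z] unfolding \<delta> by blast
   qed (use A b0(1) \<tau> Vpos[of z] PV in auto)
   also have "... = A * (b0 / \<tau>) ^ j + j * (cmod (P z) * \<tau>\<^sup>2 / V z)" by (simp add: power_divide)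
   also have "... \<le> A * \<theta> + j * \<theta>"
   proof (intro add_mono mult_left_mono)
    have "(b0 / \<tau>) ^ j \<le> \<sigma> ^ j" using b0\<tau> b0 \<tau> by (intro power_mono) auto
    then show "(b0 / \<tau>) ^ j \<le> \<theta>" using \<tau> \<sigma> unfolding \<tau>_def by linarith
    show "cmod (P z) * \<tau>\<^sup>2 / V z \<le> \<theta>" using P\<tau>2[of z] \<tau> \<sigma> by linarith
   qed (use A in auto)
   finally show ?thesis by (simp add: algebra_simps)
  qed
  have \<Phi>P: "cmod (\<Phi> z * P z - Q z) \<le> 2 * A * \<theta>" if z: "cmod z \<le> 8" for z
  proof -
   have "\<Phi> z * P z - Q z = - Q z * of_real (\<tau>\<^sup>2) / of_real (V z)"
   proof -
    have "of_real (V z) \<noteq> (0::complex)" using V0 by simp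
    then have "\<Phi> z * P z - Q z = Q z * (P z * cnj (P z) - of_real (V z)) / of_real (V z)"
     by (simp add: \<Phi>_def field_simps)
    then show ?thesis by (simp add: Vc)
   qed
   then have "cmod (\<Phi> z * P z - Q z) = cmod (Q z) * (\<tau>\<^sup>2 / V z)" using Vpos[of z] by (simp add: norm_mult norm_divide norm_power)
   also have "... \<le> (a z ^ (j + 1) + A * b0) * (\<tau>\<^sup>2 / V z)" using Qb[OF z] Vpos[of z] by (intro mult_right_mono) auto
   also have "... = a z * (cmod (P z) * \<tau>\<^sup>2 / V z) + A * b0 * (\<tau>\<^sup>2 / V z)" by (simp add: aj algebra_simps)
   also have "... \<le> A * \<tau> + A * b0 * 1" using aA[OF z] P\<tau>2 \<tau>V A b0 Vpos[of z] by (intro add_mono mult_mono) auto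
   also have "... \<le> A * \<theta> + A * \<theta>" using A \<tau> \<sigma> b0\<sigma> by (intro add_mono) auto
   finally show ?thesis by simp
  qed
  have s3: "cmod z \<le> 9/2" if "z \<in> sqr 3" for z using sqr_norm[OF that] by simp
  have P'b: "cmod (P' z) \<le> A" if "cmod z \<le> 9/2" for z
  proof -
   have "cmod ((deriv ^^ 1) P z) \<le> fact 1 * A / 1 ^ 1"
   proof (rule Cauchy_inequality)
    show "P holomorphic_on ball z 1" "continuous_on (cball z 1) P" using holP cP(1) holomorphic_on_subset continuous_on_subset by blast+
    fix x assume "cmod (z - x) = 1"
    then have "cmod x \<le> 8" using that norm_triangle_ineq2[of x z] by (simp add: norm_minus_commute)
    then show "cmod (P x) \<le> A" using bd by blast
   qed simp
   then show ?thesis by (simp add: P'_def)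
  qed
  define D where "D z = (cmod (P' z))\<^sup>2 * \<tau>\<^sup>2 / (V z)\<^sup>2" for z
  \<comment> \<open>Balance of \<open>a\<close> against \<sigma>. If
    \<open>a \<le> \<sigma>\<close>, use \<open>|P| \<tau> \<le> V\<close>; otherwise
    \<open>\<tau> = \<sigma> \<sigma>^(j-1) \<le> \<sigma> a^(j-1)\<close>, and
    \<open>a^(2j) = |P|^2 \<le> V\<close>.\<close>
  have as: "a z ^ (j + 1) * \<tau> \<le> \<sigma> * V z" for z
  proof (cases "a z \<le> \<sigma>")
   case True
   then have "a z * (a z ^ j * \<tau>) \<le> \<sigma> * V z" using P\<tau>'[of z] aj \<tau> Vpos[of z] by (intro mult_mono) auto
   then show ?thesis by simp
  next
   case False
   obtain i where i: "j = Suc i" using j by (cases j) auto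
   have "\<sigma> ^ i \<le> a z ^ i" using False \<sigma> by (intro power_mono) auto
   then have "a z ^ (j + 1) * \<sigma> * \<sigma> ^ i \<le> a z ^ (j + 1) * \<sigma> * a z ^ i" using aj \<sigma> by (intro mult_left_mono) auto
   also have "... = \<sigma> * (a z ^ j)\<^sup>2" by (simp add: i power2_eq_square)
   also have "... \<le> \<sigma> * V z" using \<sigma> by (simp add: V_def aj)
   finally show ?thesis by (simp add: \<tau>_def i mult_ac)
  qed
  have DBb: "cmod (DB z) \<le> \<sigma>/2 * D z + \<sigma> * (1/2 + A\<^sup>2)" if z: "cmod z \<le> 9/2" for z
  proof -
   have "cmod (DB z) = cmod (Q z) * (cmod (P' z) * \<tau>\<^sup>2 / (V z)\<^sup>2)" by (simp add: DB_def norm_mult norm_divide norm_power)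
   also have "... \<le> (a z ^ (j + 1) + A * b0) * (cmod (P' z) * \<tau>\<^sup>2 / (V z)\<^sup>2)" using Qb[of z] z by (intro mult_right_mono) auto
   also have "... = (a z ^ (j + 1) * \<tau> / V z) * (cmod (P' z) * \<tau> / V z) + A * b0 * cmod (P' z) * (\<tau>\<^sup>2 / (V z)\<^sup>2)"
    by (simp add: algebra_simps add_divide_distrib power2_eq_square)
   \<comment> \<open>By \<open>y \<le> (1 + y^2)/2\<close> the linear factor
     \<open>|P'| \<tau> / V\<close> is replaced by its square \<open>D\<close>, whose integral is
     controlled by the Laplacian.\<close>
   also have "... \<le> \<sigma> * ((1 + (cmod (P' z) * \<tau> / V z)\<^sup>2) / 2) + A * b0 * A * (1 / \<tau>\<^sup>2)"
   proof (intro add_mono mult_mono)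
    show "a z ^ (j + 1) * \<tau> / V z \<le> \<sigma>" using as[of z] Vpos[of z] by (simp add: field_simps)
    show "cmod (P' z) * \<tau> / V z \<le> (1 + (cmod (P' z) * \<tau> / V z)\<^sup>2) / 2" using sum_squares_bound[of 1 "cmod (P' z) * \<tau> / V z"] by (simp add: mult.commute)
   qed (use P'b[OF z] \<tau>V2 A b0 \<sigma> \<tau> Vpos[of z] in auto)
   also have "A * b0 * A * (1 / \<tau>\<^sup>2) = A\<^sup>2 * \<sigma>" using \<tau> by (simp add: b0 power2_eq_square)
   also have "(cmod (P' z) * \<tau> / V z)\<^sup>2 = D z" by (simp add: D_def power_mult_distrib power_divide)
   finally show ?thesis by (simp add: algebra_simps add_divide_distrib)
  qed
  have cD: "continuous_on UNIV D" unfolding D_def by (auto intro!: continuous_intros cP cV simp: V0)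
  have [measurable]: "D \<in> borel_measurable borel" by (rule borel_measurable_continuous_onI[OF cD])
  have D0: "D z \<ge> 0" for z by (simp add: D_def)
  define L where "L = 100 * (ln (A\<^sup>2 + 1) + 2 * ln (1 / \<tau>))"
  have lnA: "ln (A\<^sup>2 + 1) \<ge> 0" "ln (1 / \<tau>) \<ge> 0" using \<tau> by auto
  \<comment> \<open>This crude bound is affordable: \<open>1/\<theta>\<close> cancels against
    \<open>\<sigma> = \<theta>^2\<close>, and one factor \<theta> is left.\<close>
  have lnt: "ln (1 / \<tau>) \<le> 2 * j / \<theta>"
  proof -
   have "ln (1 / \<tau>) = 2 * j * ln (1 / \<theta>)" using \<theta> by (simp add: \<tau>_def \<sigma>_def power_mult[symmetric] ln_div ln_realpow)
   also have "ln (1 / \<theta>) \<le> 1 / \<theta> - 1" using \<theta> by (intro ln_le_minus_one) auto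
   also have "2 * j * (1 / \<theta> - 1) \<le> 2 * j / \<theta>" by (simp add: algebra_simps)
   finally show ?thesis using j by simp
  qed
  have DL: "(\<integral>\<^sup>+z. indicator (sqr 3) z * ennreal (D z) \<partial>lborel) \<le> ennreal L"
   unfolding D_def V_def L_def P'_def
   by (rule laplacian_ln_bound[OF holP \<tau>(1,2)]) (use bd in auto)
  have "(\<integral>\<^sup>+z. indicator (sqr 3) z * ennreal (cmod (DB z)) \<partial>lborel)
   \<le> (\<integral>\<^sup>+z. ennreal (\<sigma>/2) * (indicator (sqr 3) z * ennreal (D z)) + indicator (sqr 3) z * ennreal (\<sigma> * (1/2 + A\<^sup>2)) \<partial>lborel)"
  proof (rule nn_integral_mono)
   fix z :: complex
   show "indicator (sqr 3) z * ennreal (cmod (DB z)) \<le> ennreal (\<sigma>/2) * (indicator (sqr 3) z * ennreal (D z)) + indicator (sqr 3) z * ennreal (\<sigma> * (1/2 + A\<^sup>2))"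
   proof (cases "z \<in> sqr 3")
    case True
    have "ennreal (cmod (DB z)) \<le> ennreal (\<sigma>/2 * D z + \<sigma> * (1/2 + A\<^sup>2))" using DBb[OF s3[OF True]] by (rule ennreal_leI)
    also have "... = ennreal (\<sigma>/2 * D z) + ennreal (\<sigma> * (1/2 + A\<^sup>2))"
     using D0 \<sigma> by (intro ennreal_plus mult_nonneg_nonneg add_nonneg_nonneg) auto
    also have "ennreal (\<sigma>/2 * D z) = ennreal (\<sigma>/2) * ennreal (D z)"
     using D0 \<sigma> by (intro ennreal_mult) auto
    finally show ?thesis using True by simp
   qed simp
  qed
  also have "... = ennreal (\<sigma>/2) * (\<integral>\<^sup>+z. indicator (sqr 3) z * ennreal (D z) \<partial>lborel) + ennreal 36 * ennreal (\<sigma> * (1/2 + A\<^sup>2))"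
   by (subst nn_integral_add) (auto simp: nn_integral_cmult nn_integral_sqr_const)
  also have "... \<le> ennreal (\<sigma>/2) * ennreal L + ennreal 36 * ennreal (\<sigma> * (1/2 + A\<^sup>2))"
   using DL by (intro add_right_mono mult_left_mono) auto
  also have "ennreal (\<sigma>/2) * ennreal L = ennreal (\<sigma>/2 * L)"
   using \<sigma> lnA unfolding L_def by (intro ennreal_mult[symmetric]) auto
  also have "ennreal 36 * ennreal (\<sigma> * (1/2 + A\<^sup>2)) = ennreal (36 * (\<sigma> * (1/2 + A\<^sup>2)))"
   using \<sigma> by (intro ennreal_mult[symmetric] mult_nonneg_nonneg) auto
  also have "ennreal (\<sigma>/2 * L) + ennreal (36 * (\<sigma> * (1/2 + A\<^sup>2))) = ennreal (\<sigma>/2 * L + 36 * (\<sigma> * (1/2 + A\<^sup>2)))"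
   using \<sigma> lnA unfolding L_def by (intro ennreal_plus[symmetric] mult_nonneg_nonneg) auto
  also have "... \<le> ennreal (C1 * \<theta>)"
  proof (rule ennreal_leI)
   have "\<sigma>/2 * L + 36 * (\<sigma> * (1/2 + A\<^sup>2)) = \<sigma> * (50 * ln (A\<^sup>2 + 1) + 36 * (1/2 + A\<^sup>2)) + \<sigma> * (100 * ln (1 / \<tau>))"
    by (simp add: L_def algebra_simps)
   also have "... \<le> \<theta> * (50 * ln (A\<^sup>2 + 1) + 36 * (1/2 + A\<^sup>2)) + \<sigma> * (100 * (2 * j / \<theta>))"
    using \<sigma> lnA lnt by (intro add_mono mult_right_mono mult_left_mono) auto
   also have "\<sigma> * (100 * (2 * j / \<theta>)) = \<theta> * (200 * j)" using \<theta> by (simp add: \<sigma>_def power2_eq_square)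
   finally show "\<sigma>/2 * L + 36 * (\<sigma> * (1/2 + A\<^sup>2)) \<le> C1 * \<theta>" by (simp add: C1_def algebra_simps)
  qed
  finally have DBL: "(\<integral>\<^sup>+z. indicator (sqr 3) z * ennreal (cmod (DB z)) \<partial>lborel) \<le> ennreal (C1 * \<theta>)" .
  obtain F where F: "F holomorphic_on ball 0 1" "\<And>z. z \<in> ball 0 1 ==> cmod (F z) \<le> 8 * (2 * A)"
   "(\<integral>\<^sup>+z. indicator (sqr (1/2)) z * ennreal (cmod (F z - \<Phi> z)) \<partial>lborel) \<le> ennreal (17 * (C1 * \<theta>))"
  proof (rule dbar_L1_solution[OF der cDA cDB _ DBL])
   show "cmod (\<Phi> z) \<le> 2 * A" if "cmod z \<le> 3" for z using \<Phi>b[of z] that by simp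
  qed (use C1 \<theta> in auto)
  have Z1: "z \<in> ball 0 1 \<and> cmod z \<le> 8" if "z \<in> sqr (1/2)" for z using sqr_norm[OF that] by simp
  have cd: "continuous_on (sqr (1/2)) (\<lambda>z. cmod (F z - \<Phi> z))"
   using Z1 by (intro continuous_intros continuous_on_subset[OF c\<Phi>] continuous_on_subset[OF holomorphic_on_imp_continuous_on[OF F(1)]]) auto
  have holsub: "P holomorphic_on ball 0 1" "Q holomorphic_on ball 0 1" using holP holQ holomorphic_on_subset by blast+
  show "\<exists>F. F holomorphic_on ball 0 1 \<and> (\<forall>z. cmod z \<le> 1/8 --> cmod (F z) \<le> C \<and> cmod (F z ^ j - P z) \<le> C * \<theta> \<and> cmod (F z * P z - Q z) \<le> C * \<theta>)"
  proof (intro exI[of _ F] conjI allI impI F(1))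
   fix z0 :: complex assume z0: "cmod z0 \<le> 1/8"
   show "cmod (F z0) \<le> C" using F(2)[of z0] z0 C_parts unfolding C_def by simp
   have "cmod (F z0 ^ j - P z0) \<le> 64 * (j * (16 * A) ^ (j - 1) * (17 * (C1 * \<theta>)) + (j + A) * \<theta>)"
   proof (rule holomorphic_bound_L1'[OF _ cd _ F(3) _ _ _ _ z0])
    show "(\<lambda>z. F z ^ j - P z) holomorphic_on ball 0 1" by (intro holomorphic_intros F holsub)
    fix z assume z: "z \<in> sqr (1/2)"
    have "cmod (F z ^ j - \<Phi> z ^ j) \<le> j * (16 * A) ^ (j - 1) * cmod (F z - \<Phi> z)"
     using F(2)[of z] Z1[OF z] \<Phi>b[of z] A by (intro norm_power_diff_le) auto
    then show "cmod (F z ^ j - P z) \<le> j * (16 * A) ^ (j - 1) * cmod (F z - \<Phi> z) + (j + A) * \<theta>"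
     using \<Phi>j[of z] Z1[OF z] norm_triangle_ineq[of "F z ^ j - \<Phi> z ^ j" "\<Phi> z ^ j - P z"] by simp
   qed (use C1 \<theta> A in auto)
   also have "... = 64 * (j * (16 * A) ^ (j - 1) * (17 * C1) + (j + A)) * \<theta>" by (simp add: algebra_simps)
   also have "... \<le> C * \<theta>" using \<theta> C_parts unfolding C_def by (intro mult_right_mono) linarith+
   finally show "cmod (F z0 ^ j - P z0) \<le> C * \<theta>" .
   have "cmod (F z0 * P z0 - Q z0) \<le> 64 * (A * (17 * (C1 * \<theta>)) + 2 * A * \<theta>)"
   proof (rule holomorphic_bound_L1'[OF _ cd _ F(3) _ _ _ _ z0])
    show "(\<lambda>z. F z * P z - Q z) holomorphic_on ball 0 1" by (intro holomorphic_intros F holsub)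
    fix z assume z: "z \<in> sqr (1/2)"
    have "cmod ((F z - \<Phi> z) * P z) \<le> A * cmod (F z - \<Phi> z)"
     using bd[of z] Z1[OF z] by (simp add: norm_mult mult.commute mult_right_mono)
    then show "cmod (F z * P z - Q z) \<le> A * cmod (F z - \<Phi> z) + 2 * A * \<theta>"
     using \<Phi>P[of z] Z1[OF z] norm_triangle_ineq[of "(F z - \<Phi> z) * P z" "\<Phi> z * P z - Q z"] by (simp add: algebra_simps)
   qed (use C1 \<theta> A in auto)
   also have "... = 64 * (A * (17 * C1) + 2 * A) * \<theta>" by (simp add: algebra_simps)
   also have "... \<le> C * \<theta>" using \<theta> C_parts unfolding C_def by (intro mult_right_mono) linarith+
   finally show "cmod (F z0 * P z0 - Q z0) \<le> C * \<theta>" .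
  qed
 qed
qed

section \<open>Log-convex weights and Taylor polynomials\<close>

text \<open>Such a weight bounds Taylor coefficients, so it corresponds to
  \<open>M k / fact k\<close> and not to \<open>M k\<close>. Unbounded ratios ensure that
  \<open>l k t^k\<close> turns upwards for every \<open>t > 0\<close>.\<close>

definition log_convex_weight :: "(nat => real) => bool" where
 "log_convex_weight l \<longleftrightarrow> l 0 = 1 \<and> (\<forall>k. 0 < l k) \<and> (\<forall>k. (l (Suc k))\<^sup>2 \<le> l k * l (Suc (Suc k))) \<and>
   (\<forall>c. \<exists>k. c * l k < l (Suc k))"

abbreviation joris_exponent :: "nat => nat" where
 "joris_exponent j \<equiv> 2 * j * (2 * j + 1) * (j + 1)"

text \<open>512 is the loss of radius in the multiscale argument, the shift to \<open>Suc k\<close>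
  pays for a geometric series over the scales, and \<open>(1/\<rho>)^k\<close> is the share of the
  coarsest scale.\<close>

abbreviation joris_rate :: "nat => (nat => real) => real => nat => real" where
 "joris_rate j l \<rho> k \<equiv> 512 ^ k * root (joris_exponent j) (l (joris_exponent j * Suc k)) + (1 / \<rho>) ^ k"

lemma log_convex_weight_scale:
 assumes "log_convex_weight l" "c > 0"
 shows "log_convex_weight (\<lambda>k. c ^ k * l k)"
 unfolding log_convex_weight_def
proof (intro conjI allI)
 show "(c ^ Suc k * l (Suc k))\<^sup>2 \<le> c ^ k * l k * (c ^ Suc (Suc k) * l (Suc (Suc k)))" for k
 proof -
  have "(c ^ Suc k)\<^sup>2 * (l (Suc k))\<^sup>2 \<le> (c ^ Suc k)\<^sup>2 * (l k * l (Suc (Suc k)))"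
   using assms by (intro mult_left_mono) (auto simp: log_convex_weight_def)
  then show ?thesis by (simp add: power2_eq_square algebra_simps)
 qed
 show "\<exists>k. d * (c ^ k * l k) < c ^ Suc k * l (Suc k)" for d
 proof -
  obtain k where "d / c * l k < l (Suc k)" using assms(1) unfolding log_convex_weight_def by blast
  then have "c ^ Suc k * (d / c * l k) < c ^ Suc k * l (Suc k)" using assms(2) by (intro mult_strict_left_mono) auto
  then show ?thesis using assms(2) by (intro exI[of _ k]) (simp add: field_simps)
 qed
qed (use assms in \<open>auto simp: log_convex_weight_def\<close>)

lemma log_convex_ratio_mono:
 assumes "log_convex_weight l" "i \<le> k"
 shows "l (Suc i) / l i \<le> l (Suc k) / l k"
proof -
 have "l (Suc k) / l k \<le> l (Suc (Suc k)) / l (Suc k)" for k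
  using assms(1) by (auto simp: log_convex_weight_def field_simps power2_eq_square)
 then show ?thesis using assms(2) by (rule lift_Suc_mono_le)
qed

text \<open>The formula is that of \<open>Gamma_lower\<close>. For log-convex \<open>l\<close> the
  products \<open>l k t^k\<close> decrease up to this index and increase afterwards, so it also
  minimises them.\<close>

definition turning_index :: "(nat => real) => real => nat" where
 "turning_index l t = (LEAST k. 1 / t \<le> l (Suc k) / l k)"

lemma turning_index:
 assumes l: "log_convex_weight l" and t: "t > 0"
 shows turning_index_decreasing: "k \<le> K ==> K \<le> turning_index l t ==> l K * t ^ K \<le> l k * t ^ k"
  and turning_index_min: "l (turning_index l t) * t ^ turning_index l t \<le> l K * t ^ K"
  and turning_index_pos: "t * l 1 < 1 ==> 0 < turning_index l t"
  and turning_index_antimono: "0 < t' ==> t' \<le> t ==> turning_index l t \<le> turning_index l t'"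
proof -
 let ?N = "turning_index l t"
 have pos: "l k > 0" for k using l by (auto simp: log_convex_weight_def)
 have ex: "\<exists>k. 1 / t \<le> l (Suc k) / l k" if "t > 0" for t
 proof -
  obtain k where "1 / t * l k < l (Suc k)" using l unfolding log_convex_weight_def by blast
  then show ?thesis using pos[of k] by (intro exI[of _ k]) (simp add: field_simps)
 qed
 have N: "1 / t \<le> l (Suc ?N) / l ?N" unfolding turning_index_def by (rule LeastI_ex[OF ex[OF t]])
 have less: "l (Suc k) / l k < 1 / t" if "k < ?N" for k
  using not_less_Least[of k "\<lambda>k. 1 / t \<le> l (Suc k) / l k"] that by (simp add: turning_index_def not_le)
 have dec: "l (Suc k) * t ^ Suc k \<le> l k * t ^ k" if "k < ?N" for k
 proof -
  have "l (Suc k) * t \<le> l k" using less[OF that] t pos[of k] by (simp add: field_simps)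
  then show ?thesis using mult_right_mono[of "l (Suc k) * t" "l k" "t ^ k"] t by (simp add: mult_ac)
 qed
 have inc: "l k * t ^ k \<le> l (Suc k) * t ^ Suc k" if "?N \<le> k" for k
 proof -
  have "1 / t \<le> l (Suc k) / l k" using N log_convex_ratio_mono[OF l that] by linarith
  then have "l k \<le> l (Suc k) * t" using t pos[of k] by (simp add: field_simps)
  then show ?thesis using mult_right_mono[of "l k" "l (Suc k) * t" "t ^ k"] t by (simp add: mult_ac)
 qed
 show d: "l K * t ^ K \<le> l k * t ^ k" if "k \<le> K" "K \<le> ?N" for k K
  using that
 proof (induction K rule: dec_induct)
  case (step K) then show ?case using dec[of K] by linarith
 qed simp
 show "l ?N * t ^ ?N \<le> l K * t ^ K"
 proof (cases "K \<le> ?N")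
  case True then show ?thesis by (rule d) simp
 next
  case False
  then have "?N \<le> K" by simp
  then show ?thesis
  proof (induction K rule: dec_induct)
   case (step K) then show ?case using inc[of K] by linarith
  qed simp
 qed
 show "0 < ?N" if "t * l 1 < 1"
 proof (rule ccontr)
  assume "\<not> 0 < ?N"
  then have "1 / t \<le> l 1 / l 0" using N by simp
  then show False using that t l by (auto simp: log_convex_weight_def field_simps)
 qed
 show "?N \<le> turning_index l t'" if "0 < t'" "t' \<le> t"
 proof -
  have "1 / t' \<le> l (Suc (turning_index l t')) / l (turning_index l t')"
   unfolding turning_index_def by (rule LeastI_ex[OF ex[OF that(1)]])
  moreover have "1 / t \<le> 1 / t'" using that by (simp add: frac_le)
  ultimately have "1 / t \<le> l (Suc (turning_index l t')) / l (turning_index l t')" by linarith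
  then show ?thesis unfolding turning_index_def[of l t] by (rule Least_le)
 qed
qed

text \<open>This is the monotonicity of \<open>(l k)^(1/k)\<close>, which follows from
  \<open>l 0 = 1\<close> and increasing ratios, written without roots.\<close>

lemma log_convex_power:
 assumes l: "log_convex_weight l" and kN: "k \<le> N" "0 < N"
 shows "l k ^ N \<le> l N ^ k"
proof -
 have pos: "l k > 0" for k using l by (auto simp: log_convex_weight_def)
 have step: "l k ^ Suc k \<le> l (Suc k) ^ k" for k
 proof (induction k)
  case 0 then show ?case using l by (simp add: log_convex_weight_def)
 next
  case (Suc k)
  have "(l (Suc k) ^ Suc k)\<^sup>2 = ((l (Suc k))\<^sup>2) ^ Suc k" by (simp only: power_mult[symmetric] mult.commute)
  also have "... \<le> (l k * l (Suc (Suc k))) ^ Suc k"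
   using l by (intro power_mono) (auto simp: log_convex_weight_def)
  also have "... = l k ^ Suc k * l (Suc (Suc k)) ^ Suc k" by (simp only: power_mult_distrib)
  also have "... \<le> l (Suc k) ^ k * l (Suc (Suc k)) ^ Suc k"
   using Suc pos[of "Suc (Suc k)"] by (intro mult_right_mono) auto
  finally have "l (Suc k) ^ k * (l (Suc k) ^ Suc (Suc k)) \<le> l (Suc k) ^ k * l (Suc (Suc k)) ^ Suc k"
   by (simp add: power2_eq_square mult_ac)
  then show ?case using pos[of "Suc k"] by (simp only: mult_le_cancel_left_pos zero_less_power)
 qed
 show ?thesis using kN(1)
 proof (induction N rule: dec_induct)
  case base then show ?case by simp
 next
  case (step N)
  show ?case
  proof (cases "N = 0")
   case True then show ?thesis using step l by (simp add: log_convex_weight_def)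
  next
   case False
   have "(l k ^ Suc N) ^ N = (l k ^ N) ^ Suc N" by (simp only: power_mult[symmetric] mult.commute)
   also have "... \<le> (l N ^ k) ^ Suc N" using step pos[of k] by (intro power_mono) auto
   also have "... = (l N ^ Suc N) ^ k" by (simp only: power_mult[symmetric] mult.commute)
   also have "... \<le> (l (Suc N) ^ N) ^ k" using \<open>\<And>k. l k ^ Suc k \<le> l (Suc k) ^ k\<close> pos[of N] by (intro power_mono) auto
   also have "... = (l (Suc N) ^ k) ^ N" by (simp only: power_mult[symmetric] mult.commute)
   finally have "(l k ^ Suc N) ^ N \<le> (l (Suc N) ^ k) ^ N" .
   then show ?thesis using power_mono_iff[of "l k ^ Suc N" "l (Suc N) ^ k" N] False pos[of k] pos[of "Suc N"]
    by (simp add: less_imp_le)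
  qed
 qed
qed

section \<open>Taylor polynomials and the approximate root at one scale\<close>

lemma taylor_bound_pos:
 fixes G :: "nat => real => complex"
 assumes der: "\<And>i x. x \<in> {0..b} ==> (G i has_vector_derivative G (Suc i) x) (at x within {0..b})"
  and B: "\<And>x. x \<in> {0..b} ==> cmod (G n x) \<le> B" and n: "n > 0" and b: "0 \<le> b"
 shows "cmod (G 0 b - (\<Sum>i<n. (b ^ i / fact i) *\<^sub>R G i 0)) \<le> B * b ^ n / fact (n - 1)"
proof -
 have B0: "B \<ge> 0" using order_trans[OF norm_ge_zero B[of 0]] b by simp
 have "((\<lambda>x. ((b - x) ^ (n - 1) / fact (n - 1)) *\<^sub>R G n x) has_integral G 0 b - (\<Sum>i<n. ((b - 0) ^ i / fact i) *\<^sub>R G i 0)) {0..b}"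
  by (rule Taylor_has_integral[of n G "G 0" 0 b]) (use der n b in auto)
 then have "cmod (G 0 b - (\<Sum>i<n. ((b - 0) ^ i / fact i) *\<^sub>R G i 0)) \<le> (b ^ (n - 1) / fact (n - 1) * B) * measure lborel (cbox 0 b)"
  unfolding interval_cbox
 proof (rule has_integral_bound[rotated])
  fix x assume "x \<in> cbox 0 b"
  then have x: "x \<in> {0..b}" by simp
  have "(b - x) ^ (n - 1) / fact (n - 1) \<le> b ^ (n - 1) / fact (n - 1)"
   using x by (intro divide_right_mono power_mono) auto
  then have "\<bar>(b - x) ^ (n - 1) / fact (n - 1)\<bar> \<le> b ^ (n - 1) / fact (n - 1)" using x by simp
  then show "norm (((b - x) ^ (n - 1) / fact (n - 1)) *\<^sub>R G n x) \<le> b ^ (n - 1) / fact (n - 1) * B"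
   unfolding norm_scaleR using B[OF x] b by (intro mult_mono) auto
 qed (use B0 b in auto)
 moreover have "b ^ n = b ^ (n - 1) * b" using n by (cases n) auto
 ultimately show ?thesis using b by (simp add: mult_ac)
qed

lemma taylor_bound_sym:
 fixes G :: "nat => real => complex"
 assumes der: "\<And>i x. \<bar>x\<bar> \<le> r ==> (G i has_vector_derivative G (Suc i) x) (at x within {-r..r})"
  and B: "\<And>x. \<bar>x\<bar> \<le> r ==> cmod (G n x) \<le> B" and n: "n > 0" and s: "\<bar>s\<bar> \<le> r"
 shows "cmod (G 0 s - (\<Sum>i<n. (s ^ i / fact i) *\<^sub>R G i 0)) \<le> B * \<bar>s\<bar> ^ n / fact (n - 1)"
proof (cases "s \<ge> 0")
 case True
 have "cmod (G 0 s - (\<Sum>i<n. (s ^ i / fact i) *\<^sub>R G i 0)) \<le> B * s ^ n / fact (n - 1)"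
  by (rule taylor_bound_pos) (use assms True in \<open>auto intro: has_vector_derivative_within_subset[OF der]\<close>)
 then show ?thesis using True by simp
next
 case False
 define H where "H i x = (-1) ^ i * G i (- x)" for i x
 have "cmod (H 0 (-s) - (\<Sum>i<n. ((-s) ^ i / fact i) *\<^sub>R H i 0)) \<le> B * (-s) ^ n / fact (n - 1)"
 proof (rule taylor_bound_pos)
  fix i x assume x: "x \<in> {0..-s}"
  have 1: "(uminus has_vector_derivative (-1)) (at x within {0..-s})"
   by (auto intro!: derivative_eq_intros)
  have 2: "(G i has_vector_derivative G (Suc i) (- x)) (at (- x) within uminus ` {0..-s})"
   by (rule has_vector_derivative_within_subset[OF der]) (use x s in auto)
  have "((G i \<circ> uminus) has_vector_derivative (-1) *\<^sub>R G (Suc i) (- x)) (at x within {0..-s})"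
   by (rule vector_diff_chain_within[OF 1 2])
  then have "((\<lambda>x. (-1) ^ i * (G i \<circ> uminus) x) has_vector_derivative (-1) ^ i * ((-1) *\<^sub>R G (Suc i) (- x))) (at x within {0..-s})"
   by (rule has_vector_derivative_mult_right)
  then show "(H i has_vector_derivative H (Suc i) x) (at x within {0..-s})"
   by (simp add: H_def[abs_def] o_def)
 next
  fix x assume "x \<in> {0..-s}" then show "cmod (H n x) \<le> B"
   using B[of "-x"] s by (simp add: H_def norm_mult norm_power)
 qed (use False n in auto)
 moreover have "((-s) ^ i / fact i) *\<^sub>R H i 0 = (s ^ i / fact i) *\<^sub>R G i 0" for i
  by (cases "even i") (auto simp: H_def)
 ultimately show ?thesis using False by (simp add: H_def)
qed

text \<open>One order at a time: the limit at 0 kills the constant coefficient, and the variable can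
  be divided out.\<close>

lemma poly_vanishing_order:
 fixes S :: "complex poly"
 assumes "\<epsilon> > 0" "\<And>s. 0 < s ==> s < \<epsilon> ==> cmod (poly S (of_real s)) \<le> K * s ^ n"
 shows "\<exists>T. S = monom 1 n * T"
 using assms(2)
proof (induction n arbitrary: S)
 case 0 then show ?case by (intro exI[of _ S]) (simp add: monom_eq_1)
next
 case (Suc n)
 obtain c S' where S: "S = pCons c S'" by (cases S)
 have "((\<lambda>s. poly S (of_real s)) \<longlongrightarrow> poly S (of_real 0)) (at_right 0)"
  by (intro tendsto_intros)
 moreover have "((\<lambda>s. poly S (of_real s)) \<longlongrightarrow> 0) (at_right 0)"
 proof (rule Lim_null_comparison)
  show "\<forall>\<^sub>F s in at_right 0. cmod (poly S (of_real s)) \<le> K * s ^ Suc n"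
   using Suc.prems assms(1) by (auto simp: eventually_at_right_field)
  have "((\<lambda>s. K * s ^ Suc n) \<longlongrightarrow> K * 0 ^ Suc n) (at_right (0::real))" by (intro tendsto_intros)
  then show "((\<lambda>s. K * s ^ Suc n) \<longlongrightarrow> 0) (at_right (0::real))" by simp
 qed
 ultimately have "poly S (of_real 0) = 0" by (rule tendsto_unique[rotated]) simp
 then have c: "c = 0" by (simp add: S)
 have "\<exists>T. S' = monom 1 n * T"
 proof (rule Suc.IH)
  fix s :: real assume s: "0 < s" "s < \<epsilon>"
  have "s * cmod (poly S' (of_real s)) \<le> s * (K * s ^ n)"
   using Suc.prems[OF s] s by (simp add: S c norm_mult mult_ac)
  then show "cmod (poly S' (of_real s)) \<le> K * s ^ n" using s by simp
 qed
 then obtain T where "S' = monom 1 n * T" by blast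
 then have "S = monom 1 (Suc n) * T" by (simp add: S c monom_Suc)
 then show ?case by blast
qed

text \<open>Schwarz' lemma of order \<open>n\<close>: the maximum principle for the cofactor
  \<open>T\<close> on the disc of radius \<rho>.\<close>

lemma poly_schwarz:
 fixes S T :: "complex poly"
 assumes ST: "S = monom 1 n * T" and \<rho>: "\<rho> > 0" and M: "\<And>z. cmod z \<le> \<rho> ==> cmod (poly S z) \<le> M"
  and z: "cmod z \<le> \<rho>"
 shows "cmod (poly S z) \<le> M * (cmod z / \<rho>) ^ n"
proof -
 have "cmod (poly T z) \<le> M / \<rho> ^ n"
 proof (rule maximum_modulus_frontier[of "poly T" "cball 0 \<rho>"])
  show "poly T holomorphic_on interior (cball 0 \<rho>)" by (intro holomorphic_intros)
  show "continuous_on (closure (cball 0 \<rho>)) (poly T)" by (intro continuous_intros)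
  fix w assume "w \<in> frontier (cball (0::complex) \<rho>)"
  then have w: "cmod w = \<rho>" using \<rho> by (simp add: frontier_cball)
  have "\<rho> ^ n * cmod (poly T w) \<le> M" using M[of w] w by (simp add: ST poly_monom norm_mult norm_power)
  then show "cmod (poly T w) \<le> M / \<rho> ^ n" using \<rho> by (simp add: field_simps)
 qed (use z in auto)
 then have "cmod z ^ n * cmod (poly T z) \<le> cmod z ^ n * (M / \<rho> ^ n)" by (intro mult_left_mono) auto
 then show ?thesis by (simp add: ST poly_monom norm_mult norm_power power_divide mult_ac)
qed

text \<open>This is where two consecutive powers are needed. In
  \<open>x^j (x - y) = (x^(j+1) - y^(j+1)) - y (x^j - y^j)\<close> one divides by \<open>x^j\<close>
  if \<open>|x| \<ge> \<epsilon>\<close>, which costs \<open>\<epsilon>^j\<close> of the available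
  \<open>\<epsilon>^(j+1)\<close>. If both numbers are below \<epsilon>, so is half their
  distance.\<close>

lemma close_powers_imp_close:
 fixes x y :: complex
 assumes K: "cmod x \<le> K" "cmod y \<le> K" and D: "D \<ge> 0" and e: "\<epsilon> > 0"
  and c: "cmod (x ^ j - y ^ j) \<le> D * \<epsilon> ^ (j + 1)" "cmod (x ^ (j + 1) - y ^ (j + 1)) \<le> D * \<epsilon> ^ (j + 1)"
 shows "cmod (x - y) \<le> (D * (1 + K) + 2) * \<epsilon>"
proof -
 have K0: "K \<ge> 0" using K(1) norm_ge_zero order_trans by blast
 have main: "cmod (x - y) \<le> (D * (1 + K) + 2) * \<epsilon>"
  if K: "cmod y \<le> K" and c: "cmod (x ^ j - y ^ j) \<le> D * \<epsilon> ^ (j + 1)" "cmod (x ^ (j + 1) - y ^ (j + 1)) \<le> D * \<epsilon> ^ (j + 1)"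
   and x: "cmod x \<ge> \<epsilon>" for x y :: complex
 proof -
  have "x ^ j * (x - y) = (x ^ (j + 1) - y ^ (j + 1)) - y * (x ^ j - y ^ j)" by (simp add: algebra_simps)
  then have "cmod x ^ j * cmod (x - y) \<le> cmod (x ^ (j + 1) - y ^ (j + 1)) + cmod y * cmod (x ^ j - y ^ j)"
   by (metis norm_mult norm_power norm_triangle_ineq4)
  also have "... \<le> D * \<epsilon> ^ (j + 1) + K * (D * \<epsilon> ^ (j + 1))" using c K K0 by (intro add_mono mult_mono) auto
  finally have 1: "cmod x ^ j * cmod (x - y) \<le> \<epsilon> ^ j * (D * (1 + K) * \<epsilon>)" by (simp add: algebra_simps)
  have "\<epsilon> ^ j * cmod (x - y) \<le> cmod x ^ j * cmod (x - y)" using x e by (intro mult_right_mono power_mono) auto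
  with 1 have "\<epsilon> ^ j * cmod (x - y) \<le> \<epsilon> ^ j * (D * (1 + K) * \<epsilon>)" by linarith
  then have "cmod (x - y) \<le> D * (1 + K) * \<epsilon>" using e by (simp only: mult_le_cancel_left_pos zero_less_power)
  also have "... \<le> (D * (1 + K) + 2) * \<epsilon>" using e by (simp add: algebra_simps)
  finally show ?thesis .
 qed
 consider "cmod x \<ge> \<epsilon>" | "cmod y \<ge> \<epsilon>" | "cmod x < \<epsilon>" "cmod y < \<epsilon>" by linarith
 then show ?thesis
 proof cases
  case 1 then show ?thesis using main K c by blast
 next
  case 2 then show ?thesis using main[of x y] K c by (simp add: norm_minus_commute)
 next
  case 3
  then have "cmod (x - y) \<le> 2 * \<epsilon>" using norm_triangle_ineq4[of x y] by linarith
  also have "... \<le> (D * (1 + K) + 2) * \<epsilon>" using e D K0 by (intro mult_right_mono) auto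
  finally show ?thesis .
 qed
qed

text \<open>Cauchy estimates on half the radius; on a quarter of the radius the tail is a geometric
  series of ratio at most 1/2.\<close>

lemma holomorphic_taylor_bound:
 assumes hol: "f holomorphic_on ball 0 R" and R: "R > 0" and B: "\<And>z. z \<in> ball 0 R ==> cmod (f z) \<le> B"
 obtains b :: "nat => complex" where "\<And>k. cmod (b k) \<le> B / (R / 2) ^ k"
  "\<And>n z. cmod z \<le> R / 4 ==> cmod (f z - (\<Sum>k\<le>n. b k * z ^ k)) \<le> 2 * B * (cmod z / (R / 2)) ^ (n + 1)"
proof -
 define b where "b k = (deriv ^^ k) f 0 / fact k" for k
 have B0: "B \<ge> 0" using order_trans[OF norm_ge_zero B[of 0]] R by simp
 have sub: "cball 0 (R / 2) \<subseteq> ball (0::complex) R" using R by auto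
 have bk: "cmod (b k) \<le> B / (R / 2) ^ k" for k
 proof -
  have "cmod ((deriv ^^ k) f 0) \<le> fact k * B / (R / 2) ^ k"
  proof (rule Cauchy_inequality)
   show "f holomorphic_on ball 0 (R / 2)" by (rule holomorphic_on_subset[OF hol]) (use R in auto)
   show "continuous_on (cball 0 (R / 2)) f" using hol sub holomorphic_on_imp_continuous_on continuous_on_subset by blast
  qed (use R B in auto)
  then show ?thesis by (simp add: b_def norm_divide field_simps)
 qed
 have "cmod (f z - (\<Sum>k\<le>n. b k * z ^ k)) \<le> 2 * B * (cmod z / (R / 2)) ^ (n + 1)" if z: "cmod z \<le> R / 4" for n z
 proof -
  define x where "x = cmod z / (R / 2)"
  have x: "0 \<le> x" "x \<le> 1 / 2" using z R by (auto simp: x_def field_simps)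
  have bz: "cmod (b k * z ^ k) \<le> B * x ^ k" for k
   using mult_right_mono[OF bk[of k], of "cmod z ^ k"] by (simp add: x_def norm_mult norm_power power_divide mult_ac)
  have "(\<lambda>k. b k * z ^ k) sums f z"
   using holomorphic_power_series[OF hol, of z] z R by (simp add: b_def)
  then have "(\<lambda>k. b (k + Suc n) * z ^ (k + Suc n)) sums (f z - (\<Sum>k<Suc n. b k * z ^ k))"
   by (rule sums_split_initial_segment)
  moreover have "(\<lambda>k. B * x ^ Suc n * (1 / 2) ^ k) sums (B * x ^ Suc n * (1 / (1 - 1 / 2)))"
   by (intro sums_mult geometric_sums) simp
  moreover have "cmod (b (k + Suc n) * z ^ (k + Suc n)) \<le> B * x ^ Suc n * (1 / 2) ^ k" for k
  proof -
   have "x ^ k \<le> (1 / 2) ^ k" using x by (intro power_mono) auto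
   then have "B * x ^ Suc n * x ^ k \<le> B * x ^ Suc n * (1 / 2) ^ k" using B0 x by (intro mult_left_mono) auto
   then show ?thesis using bz[of "k + Suc n"] by (simp add: power_add mult_ac)
  qed
  ultimately have "cmod (f z - (\<Sum>k<Suc n. b k * z ^ k)) \<le> B * x ^ Suc n * (1 / (1 - 1 / 2))"
   by (rule norm_sums_le)
  then show ?thesis by (simp add: x_def lessThan_Suc_atMost mult_ac)
 qed
 with bk show thesis using that by blast
qed

definition taylor_poly :: "(nat => real => complex) => nat => complex => complex" where
 "taylor_poly G N z = (\<Sum>k\<le>N. G k 0 / fact k * z ^ k)"

definition deriv_bounds :: "(nat => real) => real => real => (nat => real => complex) => bool" where
 "deriv_bounds l A r G \<longleftrightarrow> (\<forall>k s. \<bar>s\<bar> \<le> r -->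
   (G k has_vector_derivative G (Suc k) s) (at s within {-r..r}) \<and> cmod (G k s) \<le> A * fact k * l k)"

lemma deriv_boundsD:
 assumes "deriv_bounds l A r G" "\<bar>s\<bar> \<le> r"
 shows "(G k has_vector_derivative G (Suc k) s) (at s within {-r..r})" "cmod (G k s) \<le> A * fact k * l k"
 using assms by (auto simp: deriv_bounds_def)

lemma deriv_bounds_coeff:
 assumes "deriv_bounds l A r G" "r \<ge> 0"
 shows "cmod (G k 0 / fact k) \<le> A * l k"
proof -
 have "cmod (G k 0) / fact k \<le> A * fact k * l k / fact k"
  using deriv_boundsD(2)[OF assms(1), of 0 k] assms(2) by (intro divide_right_mono) auto
 then show ?thesis by (simp add: norm_divide)
qed

text \<open>The polynomial has degree \<open>N\<close>, yet the error is only of order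
  \<open>N\<close>: the bound must avoid \<open>l (N + 1)\<close>, over which the turning index
  gives no control. So the remainder of degree \<open>N - 1\<close> is used, and the term of degree
  \<open>N\<close> is added to the error.\<close>

lemma taylor_poly_remainder:
 assumes G: "deriv_bounds l A r G" and l: "\<And>k. 0 < l k" and A: "A \<ge> 0" and s: "\<bar>s\<bar> \<le> r" and N: "N > 0"
 shows "cmod (G 0 s - taylor_poly G N (of_real s)) \<le> A * (real N + 1) * l N * \<bar>s\<bar> ^ N"
proof -
 have r: "r \<ge> 0" using s by linarith
 have 1: "cmod (G 0 s - (\<Sum>i<N. (s ^ i / fact i) *\<^sub>R G i 0)) \<le> (A * fact N * l N) * \<bar>s\<bar> ^ N / fact (N - 1)"
  by (rule taylor_bound_sym[where r=r]) (use G N s in \<open>auto simp: deriv_bounds_def\<close>)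
 have "fact N = real N * fact (N - 1)" using N by (simp add: fact_reduce)
 then have 1: "cmod (G 0 s - (\<Sum>i<N. (s ^ i / fact i) *\<^sub>R G i 0)) \<le> A * N * l N * \<bar>s\<bar> ^ N"
  using 1 by (simp add: field_simps)
 have "cmod (G N 0 / fact N) \<le> A * l N" by (rule deriv_bounds_coeff[OF G r])
 then have 2: "cmod (G N 0 / fact N * of_real s ^ N) \<le> A * l N * \<bar>s\<bar> ^ N"
  unfolding norm_mult norm_power norm_of_real by (intro mult_right_mono) auto
 have "taylor_poly G N (of_real s) = (\<Sum>i<N. (s ^ i / fact i) *\<^sub>R G i 0) + G N 0 / fact N * of_real s ^ N"
  by (simp add: taylor_poly_def lessThan_Suc_atMost[symmetric] scaleR_conv_of_real mult.commute)
 then have eq: "G 0 s - taylor_poly G N (of_real s) = (G 0 s - (\<Sum>i<N. (s ^ i / fact i) *\<^sub>R G i 0)) - G N 0 / fact N * of_real s ^ N" by simp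
 have "cmod (G 0 s - taylor_poly G N (of_real s)) \<le> A * N * l N * \<bar>s\<bar> ^ N + A * l N * \<bar>s\<bar> ^ N"
  unfolding eq by (rule order_trans[OF norm_triangle_ineq4 add_mono[OF 1 2]])
 then show ?thesis by (simp add: algebra_simps)
qed

lemma taylor_poly_as_poly: "\<exists>p. \<forall>z. poly p z = taylor_poly G N z"
 by (intro exI[of _ "\<Sum>k\<le>N. monom (G k 0 / fact k) k"]) (simp add: taylor_poly_def poly_sum poly_monom)

lemma half_powers_sum: "finite I ==> (\<Sum>k\<in>I. (1 / 2 :: real) ^ k) \<le> 2"
proof -
 assume "finite I"
 have "(\<lambda>k. (1 / 2 :: real) ^ k) sums 2" using geometric_sums[of "1 / 2 :: real"] by simp
 then show ?thesis using sum_le_suminf[of "\<lambda>k. (1 / 2 :: real) ^ k" I] \<open>finite I\<close> by (auto simp: sums_iff)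
qed

text \<open>The Taylor polynomials satisfy the relation of powers up to order \<open>N\<close> at 0.
  As \<open>(l k t^k)^(1/k)\<close> increases with \<open>k\<close>, they stay bounded on the disc
  of radius \<open>t/(2y)\<close>, where \<open>y^N = l N t^N\<close>. On the disc of radius
  \<open>t/2\<close>, Schwarz' lemma then converts the order of vanishing into the factor
  \<open>y^(N+1)\<close>, and the approximate root applies with an error of size
  \<open>l N t^N\<close>.\<close>

lemma single_scale:
 fixes A :: real and j :: nat
 assumes j: "j \<ge> 1" and A: "A \<ge> 1"
 obtains C where "C \<ge> 1" "\<And>l t r G H. log_convex_weight l ==> 0 < t ==> t * l 1 < 1 ==> 0 < r ==>
   deriv_bounds l A r G ==> deriv_bounds l A r H ==> (\<And>s. \<bar>s\<bar> \<le> r ==> H 0 s ^ j = G 0 s ^ (j + 1)) ==>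
   \<exists>F. F holomorphic_on ball 0 (t / 128) \<and> (\<forall>z\<in>ball 0 (t / 128). cmod (F z) \<le> C \<and>
    cmod (F z ^ j - taylor_poly G (turning_index l t) z)
     \<le> C * root (joris_exponent j) (l (turning_index l t) * t ^ turning_index l t) ^ (j + 1) \<and>
    cmod (F z ^ (j + 1) - taylor_poly H (turning_index l t) z)
     \<le> C * root (joris_exponent j) (l (turning_index l t) * t ^ turning_index l t) ^ (j + 1))"
proof -
 define M where "M = 2 * (2 * A) ^ (j + 1)"
 have "(2 * A) ^ 1 \<le> (2 * A) ^ (j + 1)" using A by (intro power_increasing) auto
 then have MA: "2 * A \<le> M" using A unfolding M_def power_one_right by linarith
 then have M1: "M \<ge> 1" using A by linarith
 define L where "L = 2 * j * (2 * j + 1)"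
 have L: "L > 0" using j by (simp add: L_def)
 obtain C where C: "C \<ge> 1" and core: "\<And>P Q \<theta>. P holomorphic_on UNIV ==> Q holomorphic_on UNIV ==> 0 < \<theta> ==> \<theta> \<le> 1 ==>
   (\<And>z. cmod z \<le> 8 ==> cmod (P z) \<le> M \<and> cmod (Q z) \<le> M \<and> cmod (Q z ^ j - P z ^ (j + 1)) \<le> M * \<theta> ^ L) ==>
   (\<exists>F. F holomorphic_on ball 0 1 \<and>
    (\<forall>z. cmod z \<le> 1/8 --> cmod (F z) \<le> C \<and> cmod (F z ^ j - P z) \<le> C * \<theta> \<and> cmod (F z * P z - Q z) \<le> C * \<theta>))"
 proof (rule approximate_root[OF j M1, folded L_def])
  fix C assume c: "C \<ge> 1" "\<And>P Q \<theta>. P holomorphic_on UNIV ==> Q holomorphic_on UNIV ==> 0 < \<theta> ==> \<theta> \<le> 1 ==>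
   (\<And>z. cmod z \<le> 8 ==> cmod (P z) \<le> M \<and> cmod (Q z) \<le> M \<and> cmod (Q z ^ j - P z ^ (j + 1)) \<le> M * \<theta> ^ L) ==>
   (\<exists>F. F holomorphic_on ball 0 1 \<and>
    (\<forall>z. cmod z \<le> 1/8 --> cmod (F z) \<le> C \<and> cmod (F z ^ j - P z) \<le> C * \<theta> \<and> cmod (F z * P z - Q z) \<le> C * \<theta>))"
  show thesis by (rule that[OF c])
 qed
 show thesis
 proof (rule that[of "C * C + C"])
  show "C * C + C \<ge> 1" using C mult_nonneg_nonneg[of C C] by linarith
  fix l t r and G H :: "nat => real => complex"
  assume l: "log_convex_weight l" and t: "0 < t" "t * l 1 < 1" and r: "0 < r"
   and G: "deriv_bounds l A r G" and H: "deriv_bounds l A r H" and GH: "\<And>s. \<bar>s\<bar> \<le> r ==> H 0 s ^ j = G 0 s ^ (j + 1)"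
  have lpos: "l k > 0" for k using l by (auto simp: log_convex_weight_def)
  define N where "N = turning_index l t"
  have N: "N > 0" unfolding N_def by (rule turning_index_pos[OF l t])
  define \<eta> where "\<eta> = l N * t ^ N"
  have \<eta>0: "\<eta> > 0" using lpos t by (simp add: \<eta>_def)
  have \<eta>1: "\<eta> \<le> 1" using turning_index_decreasing[OF l t(1), of 0 N] l by (simp add: N_def \<eta>_def log_convex_weight_def)
  define y where "y = root N \<eta>"
  have y: "0 < y" "y \<le> 1" "y ^ N = \<eta>" using \<eta>0 \<eta>1 N by (auto simp: y_def)
  have lt: "l k * t ^ k \<le> y ^ k" if "k \<le> N" for k
  proof -
   have "(t ^ k * l k) ^ N \<le> (t ^ N * l N) ^ k"
    by (rule log_convex_power[OF log_convex_weight_scale[OF l t(1)] that N])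
   also have "... = (y ^ k) ^ N" by (simp add: \<eta>_def[symmetric] mult.commute y(3)[symmetric] flip: power_mult)
   finally show ?thesis using power_mono_iff[of "t ^ k * l k" "y ^ k" N] N y lpos[of k] t by (simp add: mult.commute)
  qed
  have tp: "cmod (taylor_poly G' N z) \<le> 2 * A" if G': "deriv_bounds l A r G'" and z: "cmod z \<le> t / (2 * y)" for G' z
  proof -
   have "cmod (taylor_poly G' N z) \<le> (\<Sum>k\<le>N. A * (1 / 2) ^ k)"
    unfolding taylor_poly_def
   proof (rule sum_norm_le)
    fix k assume k: "k \<in> {..N}"
    have "cmod (G' k 0 / fact k) \<le> A * l k" using r by (intro deriv_bounds_coeff[OF G']) simp
    then have "cmod (G' k 0 / fact k * z ^ k) \<le> (A * l k) * (t / (2 * y)) ^ k"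
     unfolding norm_mult norm_power using z A lpos[of k] by (intro mult_mono power_mono) auto
    also have "... = A * ((l k * t ^ k) * (1 / (2 * y)) ^ k)" by (simp add: power_divide)
    also have "... \<le> A * (y ^ k * (1 / (2 * y)) ^ k)" using A y lt k by (intro mult_left_mono mult_right_mono) auto
    also have "... = A * (1 / 2) ^ k" using y by (simp flip: power_mult_distrib)
    finally show "cmod (G' k 0 / fact k * z ^ k) \<le> A * (1 / 2) ^ k" .
   qed
   also have "... = A * (\<Sum>k\<le>N. (1 / 2) ^ k)" by (simp add: sum_distrib_left)
   also have "... \<le> A * 2" using A half_powers_sum[of "{..N}"] by (intro mult_left_mono) auto
   finally show ?thesis by simp
  qed
  obtain p where p: "\<And>z. poly p z = taylor_poly G N z" using taylor_poly_as_poly by metis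
  obtain q where q: "\<And>z. poly q z = taylor_poly H N z" using taylor_poly_as_poly by metis
  define S where "S = q ^ j - p ^ (j + 1)"
  have "\<exists>T. S = monom 1 (N + 1) * T"
  proof (rule poly_vanishing_order)
   show "min r 1 > 0" using r by simp
   fix s :: real assume s: "0 < s" "s < min r 1"
   define K where "K = A * l (N + 1) * (real N + 2) + A * l (N + 1)"
   have K: "K \<ge> 0" using A lpos[of "N + 1"] by (simp add: K_def)
   have sN: "s ^ (N + 1) \<le> 1" using s by (intro power_le_one) auto
   have rem: "cmod (G' 0 s - taylor_poly G' N (of_real s)) \<le> K * s ^ (N + 1)" if G': "deriv_bounds l A r G'" for G'
   proof -
    have "cmod (G' 0 s - taylor_poly G' (N + 1) (of_real s)) \<le> A * (real (N + 1) + 1) * l (N + 1) * \<bar>s\<bar> ^ (N + 1)"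
     using A s by (intro taylor_poly_remainder[OF G' lpos]) auto
    moreover have "cmod (G' (N + 1) 0 / fact (N + 1) * of_real s ^ (N + 1)) \<le> A * l (N + 1) * s ^ (N + 1)"
    proof -
     have "cmod (G' (N + 1) 0 / fact (N + 1)) \<le> A * l (N + 1)" using r by (intro deriv_bounds_coeff[OF G']) simp
     then have "cmod (G' (N + 1) 0 / fact (N + 1)) * \<bar>s\<bar> ^ (N + 1) \<le> A * l (N + 1) * \<bar>s\<bar> ^ (N + 1)"
      by (intro mult_right_mono) auto
     then show ?thesis unfolding norm_mult norm_power norm_of_real using s by simp
    qed
    moreover have "G' 0 s - taylor_poly G' N (of_real s) = (G' 0 s - taylor_poly G' (N + 1) (of_real s)) + G' (N + 1) 0 / fact (N + 1) * of_real s ^ (N + 1)"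
     by (simp add: taylor_poly_def)
    ultimately have "cmod (G' 0 s - taylor_poly G' N (of_real s)) \<le> A * (real (N + 1) + 1) * l (N + 1) * s ^ (N + 1) + A * l (N + 1) * s ^ (N + 1)"
     using s by (simp only: abs_of_pos) (rule norm_triangle_mono)
    then show ?thesis by (simp add: K_def algebra_simps)
   qed
   have G0: "cmod (G' 0 s) \<le> A + K" "cmod (taylor_poly G' N (of_real s)) \<le> A + K" if G': "deriv_bounds l A r G'" for G'
   proof -
    have "cmod (G' 0 s) \<le> A * fact 0 * l 0" using s by (intro deriv_boundsD(2)[OF G']) simp
    then have *: "cmod (G' 0 s) \<le> A" using l by (simp add: log_convex_weight_def)
    then show "cmod (G' 0 s) \<le> A + K" using K by simp
    have "K * s ^ (N + 1) \<le> K * 1" using sN K by (rule mult_left_mono)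
    then show "cmod (taylor_poly G' N (of_real s)) \<le> A + K"
     using rem[OF G'] * norm_triangle_sub[of "taylor_poly G' N (of_real s)" "G' 0 s"] by (simp add: norm_minus_commute)
   qed
   define x where "x = complex_of_real s"
   have "poly S x = (taylor_poly H N x ^ j - H 0 s ^ j) - (taylor_poly G N x ^ (j + 1) - G 0 s ^ (j + 1))"
    using GH[of s] s by (simp add: S_def p q)
   then have "cmod (poly S x) \<le> cmod (taylor_poly H N x ^ j - H 0 s ^ j) + cmod (taylor_poly G N x ^ (j + 1) - G 0 s ^ (j + 1))"
    by (simp only: norm_triangle_ineq4)
   also have "... \<le> j * (A + K) ^ (j - 1) * cmod (taylor_poly H N x - H 0 s) + (j + 1) * (A + K) ^ (j + 1 - 1) * cmod (taylor_poly G N x - G 0 s)"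
    unfolding x_def using G0[OF G] G0[OF H] norm_power_diff_le[where n="j + 1"]
    by (intro add_mono norm_power_diff_le[of _ _ _ j] norm_power_diff_le[of _ _ _ "j + 1"]) auto
   also have "... \<le> j * (A + K) ^ (j - 1) * (K * s ^ (N + 1)) + (j + 1) * (A + K) ^ (j + 1 - 1) * (K * s ^ (N + 1))"
    unfolding x_def using rem[OF G] rem[OF H] A K by (intro add_mono mult_left_mono) (auto simp: norm_minus_commute)
   also have "... = (j * (A + K) ^ (j - 1) + (j + 1) * (A + K) ^ j) * K * s ^ (N + 1)" by (simp add: algebra_simps)
   finally show "cmod (poly S (of_real s)) \<le> (j * (A + (A * l (N + 1) * (real N + 2) + A * l (N + 1))) ^ (j - 1) + (j + 1) * (A + (A * l (N + 1) * (real N + 2) + A * l (N + 1))) ^ j) * (A * l (N + 1) * (real N + 2) + A * l (N + 1)) * s ^ (N + 1)"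
    unfolding x_def K_def .
  qed
  then obtain T where T: "S = monom 1 (N + 1) * T" by blast
  have SM: "cmod (poly S z) \<le> M * \<eta>" if z: "cmod z \<le> t / 2" for z
  proof -
   have z': "cmod z \<le> t / (2 * y)"
   proof -
    have "t / 2 \<le> t / (2 * y)" using t y by (intro divide_left_mono) auto
    then show ?thesis using z by linarith
   qed
   have "cmod (poly S z) \<le> M * (cmod z / (t / (2 * y))) ^ (N + 1)"
   proof (rule poly_schwarz[OF T _ _ z'])
    show "t / (2 * y) > 0" using t y by simp
    fix w assume w: "cmod w \<le> t / (2 * y)"
    have "cmod (poly S w) \<le> cmod (taylor_poly H N w) ^ j + cmod (taylor_poly G N w) ^ (j + 1)"
     unfolding S_def poly_diff poly_power p q norm_power[symmetric] by (rule norm_triangle_ineq4)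
    also have "... \<le> (2 * A) ^ j + (2 * A) ^ (j + 1)" using tp[OF G w] tp[OF H w] by (intro add_mono power_mono) auto
    also have "(2 * A) ^ j \<le> (2 * A) ^ (j + 1)" using A by (intro power_increasing) auto
    finally show "cmod (poly S w) \<le> M" unfolding M_def by linarith
   qed
   also have "... \<le> M * y ^ (N + 1)"
   proof -
    have "cmod z / (t / (2 * y)) = cmod z / (t / 2) * y" using t y by (simp add: field_simps)
    also have "... \<le> 1 * y" using z t y by (intro mult_right_mono) auto
    finally show ?thesis using M1 t y by (intro mult_left_mono power_mono) auto
   qed
   also have "... \<le> M * y ^ N" using M1 y by (intro mult_left_mono power_decreasing) auto
   finally show ?thesis by (simp add: y)
  qed
  define \<theta> where "\<theta> = root L \<eta>"
  define \<epsilon> where "\<epsilon> = root (L * (j + 1)) \<eta>"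
  have \<theta>: "0 < \<theta>" "\<theta> \<le> 1" "\<theta> ^ L = \<eta>" using \<eta>0 \<eta>1 L by (auto simp: \<theta>_def)
  have "\<epsilon> = root (j + 1) \<theta>" unfolding \<epsilon>_def \<theta>_def by (simp only: real_root_mult_exp real_root_commute)
  then have \<epsilon>: "\<epsilon> ^ (j + 1) = \<theta>" using \<theta> by (simp add: real_root_pow_pos2 del: power_Suc)
  \<comment> \<open>Rescaling by \<open>u\<close> turns the radii 8 and 1/8 of
    \<open>approximate_root\<close> into \<open>t/2\<close> and \<open>t/128\<close>.\<close>
  define u where "u = t / 16"
  have u: "u > 0" using t by (simp add: u_def)
  have "\<exists>F. F holomorphic_on ball 0 1 \<and> (\<forall>z. cmod z \<le> 1/8 --> cmod (F z) \<le> C \<and> cmod (F z ^ j - taylor_poly G N (of_real u * z)) \<le> C * \<theta> \<and> cmod (F z * taylor_poly G N (of_real u * z) - taylor_poly H N (of_real u * z)) \<le> C * \<theta>)"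
  proof (rule core[OF _ _ \<theta>(1,2)])
   show "(\<lambda>z. taylor_poly G N (of_real u * z)) holomorphic_on UNIV" "(\<lambda>z. taylor_poly H N (of_real u * z)) holomorphic_on UNIV"
    unfolding taylor_poly_def by (intro holomorphic_intros)+
   fix z :: complex assume "cmod z \<le> 8"
   then have z2: "cmod (of_real u * z) \<le> t / 2" using mult_left_mono[of "cmod z" 8 u] u by (simp add: norm_mult u_def)
   have "t / 2 \<le> t / (2 * y)" using t y by (intro divide_left_mono) auto
   then have z': "cmod (of_real u * z) \<le> t / (2 * y)" using z2 by linarith
   show "cmod (taylor_poly G N (of_real u * z)) \<le> M \<and> cmod (taylor_poly H N (of_real u * z)) \<le> M \<and> cmod (taylor_poly H N (of_real u * z) ^ j - taylor_poly G N (of_real u * z) ^ (j + 1)) \<le> M * \<theta> ^ L"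
    using tp[OF G z'] tp[OF H z'] MA SM[OF z2] unfolding S_def poly_diff poly_power p q \<theta> by auto
  qed
  then obtain F where F: "F holomorphic_on ball 0 1" and F2: "\<And>z. cmod z \<le> 1/8 ==> cmod (F z) \<le> C \<and> cmod (F z ^ j - taylor_poly G N (of_real u * z)) \<le> C * \<theta> \<and> cmod (F z * taylor_poly G N (of_real u * z) - taylor_poly H N (of_real u * z)) \<le> C * \<theta>"
   by blast
  have zin: "cmod (z / of_real u) \<le> 1/8" if "z \<in> ball 0 (t / 128)" for z
   using that t by (simp add: norm_divide u_def field_simps)
  have CC: "C \<le> C * C + C" "0 \<le> C * C" using C by auto
  have "\<exists>F. F holomorphic_on ball 0 (t / 128) \<and> (\<forall>z\<in>ball 0 (t / 128). cmod (F z) \<le> C * C + C \<and>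
    cmod (F z ^ j - taylor_poly G N z) \<le> (C * C + C) * \<epsilon> ^ (j + 1) \<and>
    cmod (F z ^ (j + 1) - taylor_poly H N z) \<le> (C * C + C) * \<epsilon> ^ (j + 1))"
  proof (intro exI[of _ "\<lambda>z. F (z / of_real u)"] conjI ballI)
   show "(\<lambda>z. F (z / of_real u)) holomorphic_on ball 0 (t / 128)"
   proof (rule holomorphic_on_compose_gen[of "\<lambda>z. z / of_real u" _ F "ball 0 1", unfolded o_def])
    show "(\<lambda>z. z / complex_of_real u) holomorphic_on ball 0 (t / 128)" using u by (intro holomorphic_intros) auto
    show "(\<lambda>z. z / complex_of_real u) ` ball 0 (t / 128) \<subseteq> ball 0 1" using zin by fastforce
   qed (rule F)
   fix z :: complex assume z: "z \<in> ball 0 (t / 128)"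
   define w where "w = z / of_real u"
   have uw: "of_real u * w = z" using u by (simp add: w_def)
   note b = F2[OF zin[OF z], folded w_def, unfolded uw]
   show "cmod (F (z / of_real u)) \<le> C * C + C" using b CC(1) unfolding w_def by linarith
   have mono: "C * \<theta> \<le> (C * C + C) * \<theta>" using CC \<theta> by (intro mult_right_mono) auto
   then show "cmod (F (z / of_real u) ^ j - taylor_poly G N z) \<le> (C * C + C) * \<epsilon> ^ (j + 1)" using b unfolding \<epsilon> w_def by linarith
   have "F w ^ (j + 1) - taylor_poly H N z = F w * (F w ^ j - taylor_poly G N z) + (F w * taylor_poly G N z - taylor_poly H N z)"
    by (simp add: algebra_simps)
   then have "cmod (F w ^ (j + 1) - taylor_poly H N z) \<le> cmod (F w) * cmod (F w ^ j - taylor_poly G N z) + cmod (F w * taylor_poly G N z - taylor_poly H N z)"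
    by (simp only: norm_mult[symmetric] norm_triangle_ineq)
   also have "... \<le> C * (C * \<theta>) + C * \<theta>" using b C by (intro add_mono mult_mono) auto
   finally show "cmod (F (z / of_real u) ^ (j + 1) - taylor_poly H N z) \<le> (C * C + C) * \<epsilon> ^ (j + 1)"
    unfolding \<epsilon> w_def by (simp add: algebra_simps)
  qed
  then show "\<exists>F. F holomorphic_on ball 0 (t / 128) \<and> (\<forall>z\<in>ball 0 (t / 128). cmod (F z) \<le> C * C + C \<and>
    cmod (F z ^ j - taylor_poly G (turning_index l t) z)
     \<le> (C * C + C) * root (joris_exponent j) (l (turning_index l t) * t ^ turning_index l t) ^ (j + 1) \<and>
    cmod (F z ^ (j + 1) - taylor_poly H (turning_index l t) z)
     \<le> (C * C + C) * root (joris_exponent j) (l (turning_index l t) * t ^ turning_index l t) ^ (j + 1))"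
   unfolding \<epsilon>_def \<eta>_def N_def L_def .
 qed
qed

section \<open>Joris' theorem along a line\<close>

lemma sum_geometric_half_le:
 fixes u0 :: real
 assumes "u0 \<ge> 0" "finite I"
 shows "(\<Sum>m\<in>I. u0 / 2 ^ m) \<le> 2 * u0"
proof -
 have "(\<Sum>m\<in>I. u0 / 2 ^ m) = u0 * (\<Sum>m\<in>I. (1 / 2) ^ m)" by (simp add: sum_distrib_left power_divide)
 also have "... \<le> u0 * 2" using assms half_powers_sum by (intro mult_left_mono) auto
 finally show ?thesis by simp
qed

lemma geometric_tail_bound:
 fixes e :: "nat => complex"
 assumes "\<And>m. cmod (e m) \<le> c / 2 ^ m"
 shows "summable e" "cmod (suminf e) \<le> 2 * c"
proof -
 have s: "(\<lambda>m. c * (1 / 2) ^ m) sums (c * (1 / (1 - 1 / 2)))" by (intro sums_mult geometric_sums) simp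
 have b: "cmod (e m) \<le> c * (1 / 2) ^ m" for m using assms[of m] by (simp add: power_divide)
 show e: "summable e" by (rule summable_comparison_test'[OF sums_summable[OF s]]) (use b in auto)
 have "cmod (suminf e) \<le> c * (1 / (1 - 1 / 2))" by (rule norm_sums_le[OF summable_sums[OF e] s b])
 then show "cmod (suminf e) \<le> 2 * c" by simp
qed

lemma nat_le_two_power: "real n + 1 \<le> 2 ^ n" by (induction n) auto

text \<open>Multiscale assembly: \<open>F i\<close> approximates \<open>g\<close> at scale \<open>t0 / 2 ^ i\<close>, with an error \<open>\<epsilon> i\<close> that is
 smaller than every power of the scale.\<close>

lemma multiscale_expansion:
 fixes F :: "nat => complex => complex" and t0 C :: real and q \<epsilon> :: "nat => real" and g :: "real => complex"
 assumes t0: "0 < t0" "t0 \<le> 1" and C: "C \<ge> 1"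
  and hol: "\<And>i. F i holomorphic_on ball 0 (t0 / 2 ^ i / 128)"
  and bd: "\<And>i z. z \<in> ball 0 (t0 / 2 ^ i / 128) ==> cmod (F i z) \<le> C"
  and diff: "\<And>i z. z \<in> ball 0 (t0 / 2 ^ i / 256) ==> cmod (F i z - F (Suc i) z) \<le> C * \<epsilon> i"
  and app: "\<And>i s. \<bar>s\<bar> < t0 / 2 ^ i / 128 ==> cmod (F i (of_real s) - g s) \<le> C * \<epsilon> i"
  and \<epsilon>: "\<And>i n. \<epsilon> i \<le> q n * (t0 / 2 ^ i) ^ n" "\<And>i. 0 \<le> \<epsilon> i" and q: "\<And>n. 0 \<le> q n"
 shows "\<exists>a. (\<forall>k. cmod (a k) \<le> 2 * C * (512 ^ k * q (Suc k) + (512 / t0) ^ k)) \<and>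
  (\<forall>n s. \<bar>s\<bar> \<le> t0 / 1024 --> cmod (g s - (\<Sum>k\<le>n. a k * of_real s ^ k))
    \<le> (1 + 2048 ^ (n + 1)) * (C * q (n + 1) + (n + 1) * (2 * C * q (n + 1) * 512 ^ n) + 2 * C / (t0 / 512) ^ (n + 1) + 4 * C * q (n + 2) * 512 ^ (n + 1)) * \<bar>s\<bar> ^ (n + 1))"
proof -
 define t where "t i = t0 / 2 ^ i" for i :: nat
 have tpos: "t i > 0" for i using t0 by (simp add: t_def)
 have t1: "t i \<le> 1" for i
 proof -
  have "t0 / 2 ^ i \<le> t0 / 1" using t0 by (intro divide_left_mono) auto
  then show ?thesis using t0 unfolding t_def by linarith
 qed
 define E where "E m z = F m z - F (Suc m) z" for m z
 have sub: "ball 0 (t i / 256) \<subseteq> ball 0 (t0 / 2 ^ i / 128)" "ball 0 (t i / 256) \<subseteq> ball 0 (t0 / 2 ^ Suc i / 128)" for i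
  using tpos[of i] by (auto simp: t_def)
 have holE: "E m holomorphic_on ball 0 (t m / 256)" for m
  unfolding E_def using holomorphic_on_subset[OF hol sub(1)] holomorphic_on_subset[OF hol sub(2)] by (intro holomorphic_intros) auto
 have bdE: "cmod (E m z) \<le> C * \<epsilon> m" if "z \<in> ball 0 (t m / 256)" for m z
  using diff[of z m] that by (simp add: E_def t_def)
 obtain c0 where c0: "\<And>k. cmod (c0 k) \<le> C / (t 0 / 256 / 2) ^ k"
  "\<And>n z. cmod z \<le> t 0 / 256 / 4 ==> cmod (F 0 z - (\<Sum>k\<le>n. c0 k * z ^ k)) \<le> 2 * C * (cmod z / (t 0 / 256 / 2)) ^ (n + 1)"
 proof (rule holomorphic_taylor_bound)
  show "F 0 holomorphic_on ball 0 (t 0 / 256)" by (rule holomorphic_on_subset[OF hol sub(1)])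
  show "t 0 / 256 > 0" using tpos[of 0] by simp
  show "cmod (F 0 z) \<le> C" if "z \<in> ball 0 (t 0 / 256)" for z
   using bd[of z 0] sub(1)[of 0] that by blast
 qed (rule that)
 have "\<exists>b. (\<forall>k. cmod (b k) \<le> C * \<epsilon> m / (t m / 256 / 2) ^ k) \<and> (\<forall>n z. cmod z \<le> t m / 256 / 4 --> cmod (E m z - (\<Sum>k\<le>n. b k * z ^ k)) \<le> 2 * (C * \<epsilon> m) * (cmod z / (t m / 256 / 2)) ^ (n + 1))" for m
 proof -
  obtain b where "\<And>k. cmod (b k) \<le> C * \<epsilon> m / (t m / 256 / 2) ^ k"
   "\<And>n z. cmod z \<le> t m / 256 / 4 ==> cmod (E m z - (\<Sum>k\<le>n. b k * z ^ k)) \<le> 2 * (C * \<epsilon> m) * (cmod z / (t m / 256 / 2)) ^ (n + 1)"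
  proof (rule holomorphic_taylor_bound[OF holE])
   show "t m / 256 > 0" using tpos[of m] by simp
   show "cmod (E m z) \<le> C * \<epsilon> m" if "z \<in> ball 0 (t m / 256)" for z using bdE[OF that] .
  qed (rule that)
  then show ?thesis by blast
 qed
 then have "\<forall>m. \<exists>b. (\<forall>k. cmod (b k) \<le> C * \<epsilon> m / (t m / 256 / 2) ^ k) \<and> (\<forall>n z. cmod z \<le> t m / 256 / 4 --> cmod (E m z - (\<Sum>k\<le>n. b k * z ^ k)) \<le> 2 * (C * \<epsilon> m) * (cmod z / (t m / 256 / 2)) ^ (n + 1))" by (rule allI)
 from choice[OF this] obtain e where e0: "\<forall>m. (\<forall>k. cmod (e m k) \<le> C * \<epsilon> m / (t m / 256 / 2) ^ k) \<and> (\<forall>n z. cmod z \<le> t m / 256 / 4 --> cmod (E m z - (\<Sum>k\<le>n. e m k * z ^ k)) \<le> 2 * (C * \<epsilon> m) * (cmod z / (t m / 256 / 2)) ^ (n + 1))" ..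
 have e: "cmod (e m k) \<le> C * \<epsilon> m / (t m / 256 / 2) ^ k" for m k using e0 by blast
 have e2: "cmod (E m z - (\<Sum>k\<le>n. e m k * z ^ k)) \<le> 2 * (C * \<epsilon> m) * (cmod z / (t m / 256 / 2)) ^ (n + 1)" if "cmod z \<le> t m / 256 / 4" for m n z
  using e0 that by blast
 \<comment> \<open>Since \<open>\<epsilon> m\<close> is below every power of the scale, any power of
   \<open>t m\<close> is left after division by the k-th power of the radius.\<close>
 have \<epsilon>r: "\<epsilon> m / (t m / 256 / 2) ^ k \<le> q (n + k) * 512 ^ k * t m ^ n" for m k n
 proof -
  have "\<epsilon> m / (t m / 256 / 2) ^ k \<le> q (n + k) * t m ^ (n + k) / (t m / 256 / 2) ^ k"
   using \<epsilon>(1)[of m "n + k"] tpos[of m] by (intro divide_right_mono) (auto simp: t_def)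
  also have "... = q (n + k) * 512 ^ k * t m ^ n"
   using tpos[of m] by (simp add: power_add power_divide)
  finally show ?thesis .
 qed
 have tadd: "t (m + i) ^ Suc p \<le> t i ^ Suc p / 2 ^ m" for m i p
 proof -
  have "t (m + i) = t i / 2 ^ m" by (simp add: t_def power_add)
  then have "t (m + i) ^ Suc p = t i ^ Suc p / (2 ^ m) ^ Suc p" by (simp add: power_divide)
  also have "... \<le> t i ^ Suc p / 2 ^ m"
  proof (rule divide_left_mono)
   show "(2::real) ^ m \<le> (2 ^ m) ^ Suc p" using power_increasing[of 1 "Suc p" "(2::real) ^ m"] by simp
  qed (use tpos[of i] in auto)
  finally show ?thesis .
 qed
 have eb: "cmod (e (m + i) k) \<le> (C * q (Suc p + k) * 512 ^ k * t i ^ Suc p) / 2 ^ m" for m i k p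
 proof -
  have "cmod (e (m + i) k) \<le> C * (\<epsilon> (m + i) / (t (m + i) / 256 / 2) ^ k)" using e[of "m + i" k] by simp
  also have "... \<le> C * (q (Suc p + k) * 512 ^ k * t (m + i) ^ Suc p)" using C \<epsilon>r[of "m + i" k "Suc p"] by (intro mult_left_mono) auto
  also have "... \<le> C * (q (Suc p + k) * 512 ^ k * (t i ^ Suc p / 2 ^ m))" using C q tadd by (intro mult_left_mono) auto
  finally show ?thesis by simp
 qed
 have sume: "summable (\<lambda>m. e m k)" for k
  using geometric_tail_bound(1)[of "\<lambda>m. e (m + 0) k", OF eb[of _ 0 k 0]] by simp
 \<comment> \<open>\<open>F i\<close> is \<open>F 0\<close> minus the first \<open>i\<close>
   corrections \<open>E m\<close>. So \<open>ai i\<close> belongs to \<open>F i\<close>, and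
   \<open>a\<close> is the limit of these coefficients.\<close>
 define a where "a k = c0 k - (\<Sum>m. e m k)" for k
 define ai where "ai i k = c0 k - (\<Sum>m<i. e m k)" for i k
 have tail: "cmod (ai i k - a k) \<le> 2 * (C * q (Suc p + k) * 512 ^ k * t i ^ Suc p)" for i k p
 proof -
  have "ai i k - a k = (\<Sum>m. e (m + i) k)"
   using suminf_split_initial_segment[OF sume[of k], of i] by (simp add: a_def ai_def)
  then show ?thesis using geometric_tail_bound(2)[of "\<lambda>m. e (m + i) k", OF eb[of _ i k p]] by simp
 qed
 have ab: "cmod (a k) \<le> 2 * C * (512 ^ k * q (Suc k) + (512 / t0) ^ k)" for k
 proof -
  have "cmod (a k) \<le> cmod (ai 0 k) + cmod (ai 0 k - a k)" using norm_triangle_ineq4[of "ai 0 k" "ai 0 k - a k"] by simp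
  also have "... \<le> C / (t 0 / 256 / 2) ^ k + 2 * (C * q (Suc 0 + k) * 512 ^ k * t 0 ^ Suc 0)"
   using c0(1)[of k] tail[of 0 k 0] by (simp add: ai_def)
  also have "C / (t 0 / 256 / 2) ^ k = C * (512 / t0) ^ k" using t0 by (simp add: t_def power_divide)
  also have "2 * (C * q (Suc 0 + k) * 512 ^ k * t 0 ^ Suc 0) \<le> 2 * (C * q (Suc 0 + k) * 512 ^ k * 1)"
   using C q[of "Suc 0 + k"] t1[of 0] tpos[of 0] by (intro mult_left_mono) auto
  also have "C * (512 / t0) ^ k \<le> 2 * C * (512 / t0) ^ k" using C t0 by simp
  finally show ?thesis by (simp add: algebra_simps)
 qed
 define Kn where "Kn n = C * q (n + 1) + (n + 1) * (2 * C * q (n + 1) * 512 ^ n) + 2 * C / (t0 / 512) ^ (n + 1) + 4 * C * q (n + 2) * 512 ^ (n + 1)" for n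
 have Kn0: "Kn n \<ge> 0" for n
  unfolding Kn_def using C q t0 by (intro add_nonneg_nonneg mult_nonneg_nonneg divide_nonneg_nonneg) auto
 have telescope: "F i z = F 0 z - (\<Sum>m<i. E m z)" for i z by (induction i) (auto simp: E_def)
 have scale: "cmod (g s - (\<Sum>k\<le>n. a k * of_real s ^ k)) \<le> Kn n * (\<bar>s\<bar> ^ (n + 1) + t i ^ (n + 1))"
  if s: "\<bar>s\<bar> \<le> t i / 1024" for s i n
 proof -
  define x where "x = complex_of_real s"
  have x: "cmod x = \<bar>s\<bar>" by (simp add: x_def)
  have sm: "\<bar>s\<bar> \<le> t m / 256 / 4" if "m \<le> i" for m
  proof -
   have "t i \<le> t m" unfolding t_def using t0 that by (intro divide_left_mono power_increasing) auto
   then show ?thesis using s by simp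
  qed
  have 1: "cmod (g s - F i x) \<le> C * q (n + 1) * t i ^ (n + 1)"
  proof -
   have "\<bar>s\<bar> < t0 / 2 ^ i / 128" using s tpos[of i] by (simp add: t_def)
   then have "cmod (g s - F i x) \<le> C * \<epsilon> i" using app[of s i] by (simp add: norm_minus_commute x_def)
   also have "... \<le> C * (q (n + 1) * t i ^ (n + 1))" using C \<epsilon>(1)[of i "n + 1"] by (intro mult_left_mono) (auto simp: t_def)
   finally show ?thesis by simp
  qed
  have 2: "cmod (F i x - (\<Sum>k\<le>n. ai i k * x ^ k)) \<le> (2 * C / (t0 / 512) ^ (n + 1) + 4 * C * q (n + 2) * 512 ^ (n + 1)) * \<bar>s\<bar> ^ (n + 1)"
  proof -
   have "(\<Sum>k\<le>n. ai i k * x ^ k) = (\<Sum>k\<le>n. c0 k * x ^ k) - (\<Sum>m<i. \<Sum>k\<le>n. e m k * x ^ k)"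
    unfolding ai_def by (subst sum.swap) (simp add: left_diff_distrib sum_subtractf sum_distrib_right)
   then have "F i x - (\<Sum>k\<le>n. ai i k * x ^ k) = (F 0 x - (\<Sum>k\<le>n. c0 k * x ^ k)) - (\<Sum>m<i. E m x - (\<Sum>k\<le>n. e m k * x ^ k))"
    by (simp add: telescope[of i] sum_subtractf)
   then have "cmod (F i x - (\<Sum>k\<le>n. ai i k * x ^ k)) \<le> cmod (F 0 x - (\<Sum>k\<le>n. c0 k * x ^ k)) + cmod (\<Sum>m<i. E m x - (\<Sum>k\<le>n. e m k * x ^ k))"
    by (simp only: norm_triangle_ineq4)
   also have "cmod (\<Sum>m<i. E m x - (\<Sum>k\<le>n. e m k * x ^ k)) \<le> (\<Sum>m<i. (2 * C * q (n + 2) * 512 ^ (n + 1) * \<bar>s\<bar> ^ (n + 1)) * (t0 / 2 ^ m))"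
   proof (rule sum_norm_le)
    fix m assume "m \<in> {..<i}"
    then have "cmod (E m x - (\<Sum>k\<le>n. e m k * x ^ k)) \<le> 2 * (C * \<epsilon> m) * (cmod x / (t m / 256 / 2)) ^ (n + 1)"
     using sm[of m] by (intro e2) (simp add: x)
    also have "... = 2 * C * \<bar>s\<bar> ^ (n + 1) * (\<epsilon> m / (t m / 256 / 2) ^ (n + 1))" unfolding x power_divide by simp
    also have "... \<le> 2 * C * \<bar>s\<bar> ^ (n + 1) * (q (1 + (n + 1)) * 512 ^ (n + 1) * t m ^ 1)"
     using C \<epsilon>r[of m "n + 1" 1] by (intro mult_left_mono) auto
    finally show "cmod (E m x - (\<Sum>k\<le>n. e m k * x ^ k)) \<le> (2 * C * q (n + 2) * 512 ^ (n + 1) * \<bar>s\<bar> ^ (n + 1)) * (t0 / 2 ^ m)"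
     by (simp add: t_def mult_ac)
   qed
   also have "... = (2 * C * q (n + 2) * 512 ^ (n + 1) * \<bar>s\<bar> ^ (n + 1)) * (\<Sum>m<i. t0 / 2 ^ m)" by (simp only: sum_distrib_left)
   also have "... \<le> (2 * C * q (n + 2) * 512 ^ (n + 1) * \<bar>s\<bar> ^ (n + 1)) * 2"
    using sum_geometric_half_le[of t0 "{..<i}"] t0 C q by (intro mult_left_mono) auto
   also have "cmod (F 0 x - (\<Sum>k\<le>n. c0 k * x ^ k)) \<le> 2 * C * (cmod x / (t 0 / 256 / 2)) ^ (n + 1)"
    using sm[of 0] by (intro c0(2)) (simp add: x)
   also have "... = 2 * C / (t0 / 512) ^ (n + 1) * \<bar>s\<bar> ^ (n + 1)"
   proof -
    have "t 0 / 256 / 2 = t0 / 512" by (simp add: t_def)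
    then show ?thesis
     by (simp only: x power_divide[of "\<bar>s\<bar>"] times_divide_eq_right times_divide_eq_left)
   qed
   finally show ?thesis by (simp add: algebra_simps)
  qed
  have 3: "cmod ((\<Sum>k\<le>n. ai i k * x ^ k) - (\<Sum>k\<le>n. a k * x ^ k)) \<le> (n + 1) * (2 * C * q (n + 1) * 512 ^ n) * t i ^ (n + 1)"
  proof -
   have "(\<Sum>k\<le>n. ai i k * x ^ k) - (\<Sum>k\<le>n. a k * x ^ k) = (\<Sum>k\<le>n. (ai i k - a k) * x ^ k)"
    by (simp add: left_diff_distrib sum_subtractf)
   also have "cmod ... \<le> (\<Sum>k\<le>n. 2 * C * q (n + 1) * 512 ^ n * t i ^ (n + 1))"
   proof (rule sum_norm_le)
    fix k assume "k \<in> {..n}"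
    then have k: "k \<le> n" by simp
    \<comment> \<open>With this \<open>p\<close> the error of the k-th coefficient, multiplied by
      \<open>|s|^k \<le> (t i)^k\<close>, has total order \<open>n + 1\<close> in
      \<open>t i\<close>.\<close>
    define p where "p = n - k"
    have pk: "Suc p + k = n + 1" "p + 1 + k = n + 1" using k by (auto simp: p_def)
    have "cmod ((ai i k - a k) * x ^ k) \<le> 2 * (C * q (Suc p + k) * 512 ^ k * t i ^ Suc p) * t i ^ k"
     unfolding norm_mult norm_power x
    proof (intro mult_mono power_mono tail)
     show "0 \<le> 2 * (C * q (Suc p + k) * 512 ^ k * t i ^ Suc p)" by (rule order_trans[OF norm_ge_zero tail])
    qed (use s tpos[of i] in auto)
    also have "... = 2 * C * q (n + 1) * 512 ^ k * t i ^ (n + 1)"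
    proof -
     have tt: "t i ^ (n + 1) = t i ^ Suc p * t i ^ k" unfolding pk(1)[symmetric] by (rule power_add)
     show ?thesis unfolding pk(1) tt by (simp only: mult_ac)
    qed
    also have "... \<le> 2 * C * q (n + 1) * 512 ^ n * t i ^ (n + 1)"
     using C q[of "n + 1"] tpos[of i] k by (intro mult_right_mono mult_left_mono power_increasing) auto
    finally show "cmod ((ai i k - a k) * x ^ k) \<le> 2 * C * q (n + 1) * 512 ^ n * t i ^ (n + 1)" .
   qed
   finally show ?thesis by (simp add: algebra_simps)
  qed
  have "g s - (\<Sum>k\<le>n. a k * x ^ k) = (g s - F i x) + (F i x - (\<Sum>k\<le>n. ai i k * x ^ k)) + ((\<Sum>k\<le>n. ai i k * x ^ k) - (\<Sum>k\<le>n. a k * x ^ k))" by simp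
  then have "cmod (g s - (\<Sum>k\<le>n. a k * x ^ k)) \<le> C * q (n + 1) * t i ^ (n + 1) + (2 * C / (t0 / 512) ^ (n + 1) + 4 * C * q (n + 2) * 512 ^ (n + 1)) * \<bar>s\<bar> ^ (n + 1) + (n + 1) * (2 * C * q (n + 1) * 512 ^ n) * t i ^ (n + 1)"
   using 1 2 3 by (simp only:) (intro norm_triangle_mono)
  also have "... = (C * q (n + 1) + (n + 1) * (2 * C * q (n + 1) * 512 ^ n)) * t i ^ (n + 1) + (2 * C / (t0 / 512) ^ (n + 1) + 4 * C * q (n + 2) * 512 ^ (n + 1)) * \<bar>s\<bar> ^ (n + 1)"
   by (simp add: algebra_simps)
  also have "... \<le> Kn n * t i ^ (n + 1) + Kn n * \<bar>s\<bar> ^ (n + 1)"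
  proof (intro add_mono mult_right_mono)
   have nn: "0 \<le> C * q (n + 1)" "0 \<le> (n + 1) * (2 * C * q (n + 1) * 512 ^ n)" "0 \<le> 2 * C / (t0 / 512) ^ (n + 1)" "0 \<le> 4 * C * q (n + 2) * 512 ^ (n + 1)"
    using C q t0 by (intro mult_nonneg_nonneg divide_nonneg_nonneg; simp)+
   show "C * q (n + 1) + (n + 1) * (2 * C * q (n + 1) * 512 ^ n) \<le> Kn n" unfolding Kn_def of_nat_add of_nat_1 using nn[unfolded of_nat_add of_nat_1] by linarith
   show "2 * C / (t0 / 512) ^ (n + 1) + 4 * C * q (n + 2) * 512 ^ (n + 1) \<le> Kn n" unfolding Kn_def of_nat_add of_nat_1 using nn[unfolded of_nat_add of_nat_1] by linarith
  qed (use tpos[of i] in auto)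
  finally show ?thesis unfolding x_def by (simp add: algebra_simps)
 qed
 have tlim: "t \<longlonglongrightarrow> 0"
 proof -
  have "(\<lambda>i. t0 * (1 / 2) ^ i) \<longlonglongrightarrow> t0 * 0" by (intro tendsto_intros LIMSEQ_power_zero) simp
  then show ?thesis by (simp add: t_def[abs_def] power_divide)
 qed
 have fin: "cmod (g s - (\<Sum>k\<le>n. a k * of_real s ^ k)) \<le> (1 + 2048 ^ (n + 1)) * Kn n * \<bar>s\<bar> ^ (n + 1)"
  if s: "\<bar>s\<bar> \<le> t0 / 1024" for s n
 proof (cases "s = 0")
  case True
  have "cmod (g 0 - (\<Sum>k\<le>n. a k * of_real 0 ^ k)) \<le> 0"
  proof (rule LIMSEQ_le_const)
   have "(\<lambda>i. Kn n * (\<bar>0\<bar> ^ (n + 1) + t i ^ (n + 1))) \<longlonglongrightarrow> Kn n * (\<bar>0\<bar> ^ (n + 1) + 0 ^ (n + 1))"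
    by (intro tendsto_intros tlim)
   then show "(\<lambda>i. Kn n * (\<bar>0\<bar> ^ (n + 1) + t i ^ (n + 1))) \<longlonglongrightarrow> 0" by simp
   show "\<exists>N. \<forall>i\<ge>N. cmod (g 0 - (\<Sum>k\<le>n. a k * of_real 0 ^ k)) \<le> Kn n * (\<bar>0\<bar> ^ (n + 1) + t i ^ (n + 1))"
    using scale[of 0 _ n] less_imp_le[OF tpos] by (intro exI[of _ 0] allI impI) simp
  qed
  then show ?thesis using True by simp
 next
  case False
  have "\<exists>i. t (Suc i) / 1024 < \<bar>s\<bar>"
  proof -
   have "\<forall>\<^sub>F i in sequentially. t i < 1024 * \<bar>s\<bar>" using tlim False by (intro order_tendstoD) auto
   then obtain i where "\<forall>k\<ge>i. t k < 1024 * \<bar>s\<bar>" by (auto simp: eventually_sequentially)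
   then have "t (Suc i) < 1024 * \<bar>s\<bar>" by simp
   then show ?thesis by (intro exI[of _ i]) simp
  qed
  \<comment> \<open>The scale that fits \<open>s\<close>: then \<open>t i \<le> 2048 |s|\<close>, so
    powers of \<open>t i\<close> become powers of \<open>|s|\<close>. For \<open>s = 0\<close> every
    scale was allowed, and the limit over \<open>i\<close> was taken instead.\<close>
  define i where "i = (LEAST i. t (Suc i) / 1024 < \<bar>s\<bar>)"
  have i1: "t (Suc i) / 1024 < \<bar>s\<bar>" unfolding i_def by (rule LeastI_ex) fact
  have i2: "\<bar>s\<bar> \<le> t i / 1024"
  proof (cases i)
   case 0 then show ?thesis using s by (simp add: t_def)
  next
   case (Suc i')
   have "\<not> t (Suc i') / 1024 < \<bar>s\<bar>"
   proof (rule not_less_Least[where P="\<lambda>i. t (Suc i) / 1024 < \<bar>s\<bar>"])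
    show "i' < (LEAST i. t (Suc i) / 1024 < \<bar>s\<bar>)" unfolding i_def[symmetric] Suc by simp
   qed
   then show ?thesis using Suc by simp
  qed
  have "t i \<le> 2048 * \<bar>s\<bar>" using i1 by (simp add: t_def)
  then have "t i ^ (n + 1) \<le> (2048 * \<bar>s\<bar>) ^ (n + 1)" using tpos[of i] by (intro power_mono) auto
  then have "\<bar>s\<bar> ^ (n + 1) + t i ^ (n + 1) \<le> (1 + 2048 ^ (n + 1)) * \<bar>s\<bar> ^ (n + 1)" by (simp only: power_mult_distrib distrib_right mult_1_left add_left_mono)
  then have "Kn n * (\<bar>s\<bar> ^ (n + 1) + t i ^ (n + 1)) \<le> Kn n * ((1 + 2048 ^ (n + 1)) * \<bar>s\<bar> ^ (n + 1))" using Kn0 by (rule mult_left_mono)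
  then show ?thesis using scale[OF i2, of n] by (simp only: mult_ac)
 qed
 show ?thesis using ab fin unfolding Kn_def by blast
qed

text \<open>The function \<open>g\<close> is arbitrary; differentiability enters through its two
  powers. \<open>B\<close>, \<rho> and \<open>K\<close> are chosen before \<open>g\<close>,
  \<open>G\<close> and \<open>H\<close>, which is the uniformity over base points and directions
  required later.\<close>

theorem joris_line:
 fixes l :: "nat => real" and A r :: real and j :: nat
 assumes j: "j \<ge> 1" and l: "log_convex_weight l" and A: "A \<ge> 1" and r: "r > 0"
 obtains B \<rho> :: real and K :: "nat => real" where "B \<ge> 0" "\<rho> > 0"
  "\<And>g G H. deriv_bounds l A r G ==> deriv_bounds l A r H ==>
    (\<And>s. \<bar>s\<bar> \<le> r ==> G 0 s = g s ^ j \<and> H 0 s = g s ^ (j + 1)) ==>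
    \<exists>a. (\<forall>k. cmod (a k) \<le> B * joris_rate j l \<rho> k) \<and>
     (\<forall>n s. \<bar>s\<bar> \<le> \<rho> --> cmod (g s - (\<Sum>k\<le>n. a k * of_real s ^ k)) \<le> K n * \<bar>s\<bar> ^ (n + 1))"
proof -
 define L where "L = joris_exponent j"
 have L: "L > 0" using j by (simp add: L_def)
 have Lj: "L \<ge> j + 1"
 proof -
  have "1 \<le> 2 * j * (2 * j + 1)" using j by simp
  then have "1 * (j + 1) \<le> joris_exponent j" by (rule mult_right_mono) simp
  then show ?thesis by (simp add: L_def)
 qed
 have lpos: "l k > 0" for k using l by (auto simp: log_convex_weight_def)
 \<comment> \<open>The three bounds serve the multiscale lemma, the interval on which
   \<open>G\<close> and \<open>H\<close> live, and positivity of the turning indices.\<close>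
 define t0 where "t0 = min 1 (min r (1 / (2 * l 1)))"
 have t0: "0 < t0" "t0 \<le> 1" "t0 \<le> r" using r lpos[of 1] by (auto simp: t0_def)
 have "t0 \<le> 1 / (2 * l 1)" by (simp add: t0_def)
 then have "t0 * l 1 \<le> 1 / (2 * l 1) * l 1" using lpos[of 1] by (intro mult_right_mono) auto
 then have t0l: "t0 * l 1 < 1" using lpos[of 1] by simp
 define t where "t i = t0 / 2 ^ i" for i :: nat
 have tpos: "t i > 0" for i using t0 by (simp add: t_def)
 have tle: "t i \<le> t0" for i
 proof -
  have "t0 / 2 ^ i \<le> t0 / 1" using t0 by (intro divide_left_mono) auto
  then show ?thesis by (simp add: t_def)
 qed
 have tl: "t i * l 1 < 1" for i using mult_right_mono[OF tle[of i], of "l 1"] lpos[of 1] t0l by linarith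
 have tSuc: "t (Suc i) = t i / 2" for i by (simp add: t_def)
 have tSle: "t (Suc i) \<le> t i" for i using tSuc[of i] tpos[of i] by linarith
 define N where "N i = turning_index l (t i)" for i
 have Npos: "N i > 0" for i unfolding N_def by (rule turning_index_pos[OF l tpos tl])
 have Nmono: "N i \<le> N (Suc i)" for i
  unfolding N_def by (rule turning_index_antimono[OF l tpos tpos]) (rule tSle)
 \<comment> \<open>\<open>\<eta> i\<close> is the minimum of \<open>l k (t i)^k\<close> over all
   \<open>k\<close>. Comparison with the index \<open>L n\<close> and an L-th root make its root
   \<open>\<epsilon> i\<close> smaller than every power of \<open>t i\<close>.\<close>
 define \<eta> where "\<eta> i = l (N i) * t i ^ N i" for i
 have \<eta>min: "\<eta> i \<le> l k * t i ^ k" for i k unfolding \<eta>_def N_def by (rule turning_index_min[OF l tpos])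
 have \<eta>0: "\<eta> i > 0" for i using lpos tpos by (simp add: \<eta>_def)
 have \<eta>1: "\<eta> i \<le> 1" for i using \<eta>min[of i 0] l by (simp add: log_convex_weight_def)
 have \<eta>Suc: "\<eta> (Suc i) \<le> \<eta> i" for i
 proof -
  have "l (N i) * t (Suc i) ^ N i \<le> l (N i) * t i ^ N i"
   using tpos[of "Suc i"] lpos[of "N i"] by (intro mult_left_mono power_mono tSle) auto
  then show ?thesis using \<eta>min[of "Suc i" "N i"] by (simp add: \<eta>_def)
 qed
 define \<epsilon> where "\<epsilon> i = root L (\<eta> i)" for i
 have \<epsilon>0: "\<epsilon> i > 0" and \<epsilon>1: "\<epsilon> i \<le> 1" and \<epsilon>L: "\<epsilon> i ^ L = \<eta> i" for i
  using \<eta>0[of i] \<eta>1[of i] L by (auto simp: \<epsilon>_def)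
 have \<epsilon>Suc: "\<epsilon> (Suc i) \<le> \<epsilon> i" for i using \<eta>Suc L by (simp add: \<epsilon>_def)
 have \<eta>\<epsilon>: "\<eta> i \<le> \<epsilon> i ^ (j + 1)" for i
  unfolding \<epsilon>L[symmetric] using \<epsilon>0[of i] \<epsilon>1[of i] Lj by (intro power_decreasing) auto
 define q where "q n = root L (l (L * n))" for n
 have q0: "q n \<ge> 0" for n using L lpos by (simp add: q_def less_imp_le)
 have \<epsilon>q: "\<epsilon> i \<le> q n * t i ^ n" for i n
 proof -
  have "\<epsilon> i \<le> root L (l (L * n) * t i ^ (L * n))" unfolding \<epsilon>_def using \<eta>min L by simp
  also have "... = q n * root L ((t i ^ n) ^ L)" by (simp add: q_def real_root_mult power_mult[symmetric] mult.commute)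
  also have "root L ((t i ^ n) ^ L) = t i ^ n" using L tpos[of i] by (intro real_root_power_cancel) auto
  finally show ?thesis .
 qed
 obtain C where C: "C \<ge> 1" and scale: "\<And>l t r G H. log_convex_weight l ==> 0 < t ==> t * l 1 < 1 ==> 0 < r ==>
   deriv_bounds l A r G ==> deriv_bounds l A r H ==> (\<And>s. \<bar>s\<bar> \<le> r ==> H 0 s ^ j = G 0 s ^ (j + 1)) ==>
   \<exists>F. F holomorphic_on ball 0 (t / 128) \<and> (\<forall>z\<in>ball 0 (t / 128). cmod (F z) \<le> C \<and>
    cmod (F z ^ j - taylor_poly G (turning_index l t) z)
     \<le> C * root (joris_exponent j) (l (turning_index l t) * t ^ turning_index l t) ^ (j + 1) \<and>
    cmod (F z ^ (j + 1) - taylor_poly H (turning_index l t) z)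
     \<le> C * root (joris_exponent j) (l (turning_index l t) * t ^ turning_index l t) ^ (j + 1))"
  by (rule single_scale[OF j A]) blast
 \<comment> \<open>Bound for the differences of the powers of \<open>F i\<close> and
   \<open>F (Suc i)\<close>: twice the error \<open>C\<close> of the approximate root, and
   \<open>2 A\<close> for the change of the Taylor polynomial.\<close>
 define D where "D = 2 * C + 2 * A"
 define C3 where "C3 = D * (1 + (C + A)) + 2 + C"
 have D0: "D \<ge> 0" and DC: "0 \<le> D * (1 + (C + A))" using C A by (auto simp: D_def)
 have C3: "C3 \<ge> 1" "C \<le> C3" "D * (1 + (C + A)) + 2 \<le> C3" using C DC unfolding C3_def by linarith+
 define K where "K n = (1 + 2048 ^ (n + 1)) * (C3 * q (n + 1) + (n + 1) * (2 * C3 * q (n + 1) * 512 ^ n) + 2 * C3 / (t0 / 512) ^ (n + 1) + 4 * C3 * q (n + 2) * 512 ^ (n + 1))" for n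
 show thesis
 proof (rule that[of "2 * C3" "t0 / 1024" K])
  show "2 * C3 \<ge> 0" "t0 / 1024 > 0" using C3 t0 by auto
  fix g :: "real => complex" and G H :: "nat => real => complex"
  assume G: "deriv_bounds l A r G" and H: "deriv_bounds l A r H"
   and g: "\<And>s. \<bar>s\<bar> \<le> r ==> G 0 s = g s ^ j \<and> H 0 s = g s ^ (j + 1)"
  have GH: "H 0 s ^ j = G 0 s ^ (j + 1)" if "\<bar>s\<bar> \<le> r" for s
   using g[OF that] by (simp only: power_mult[symmetric] mult.commute)
  have "\<exists>F. F holomorphic_on ball 0 (t i / 128) \<and> (\<forall>z\<in>ball 0 (t i / 128). cmod (F z) \<le> C \<and>
    cmod (F z ^ j - taylor_poly G (N i) z) \<le> C * \<epsilon> i ^ (j + 1) \<and> cmod (F z ^ (j + 1) - taylor_poly H (N i) z) \<le> C * \<epsilon> i ^ (j + 1))" for i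
   unfolding N_def \<epsilon>_def \<eta>_def L_def by (rule scale[OF l tpos tl r G H GH])
  then have "\<forall>i. \<exists>F. F holomorphic_on ball 0 (t i / 128) \<and> (\<forall>z\<in>ball 0 (t i / 128). cmod (F z) \<le> C \<and>
    cmod (F z ^ j - taylor_poly G (N i) z) \<le> C * \<epsilon> i ^ (j + 1) \<and> cmod (F z ^ (j + 1) - taylor_poly H (N i) z) \<le> C * \<epsilon> i ^ (j + 1))" by (rule allI)
  from choice[OF this] obtain F where F0: "\<forall>i. F i holomorphic_on ball 0 (t i / 128) \<and> (\<forall>z\<in>ball 0 (t i / 128). cmod (F i z) \<le> C \<and>
    cmod (F i z ^ j - taylor_poly G (N i) z) \<le> C * \<epsilon> i ^ (j + 1) \<and> cmod (F i z ^ (j + 1) - taylor_poly H (N i) z) \<le> C * \<epsilon> i ^ (j + 1))" ..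
  have hol: "F i holomorphic_on ball 0 (t i / 128)" for i using F0 by blast
  have F: "cmod (F i z) \<le> C \<and> cmod (F i z ^ j - taylor_poly G (N i) z) \<le> C * \<epsilon> i ^ (j + 1) \<and> cmod (F i z ^ (j + 1) - taylor_poly H (N i) z) \<le> C * \<epsilon> i ^ (j + 1)"
   if "z \<in> ball 0 (t i / 128)" for i z using F0 that by blast
  \<comment> \<open>The polynomials of consecutive scales differ in degrees between the two turning
    indices. There \<open>l k (t (Suc i))^k\<close> is still decreasing, so each such product is at
    most \<open>\<eta> i\<close>; the smaller disc contributes the factors
    \<open>2^-k\<close>.\<close>
  have tpd: "cmod (taylor_poly G' (N i) z - taylor_poly G' (N (Suc i)) z) \<le> 2 * A * \<epsilon> i ^ (j + 1)"
   if G': "deriv_bounds l A r G'" and z: "z \<in> ball 0 (t i / 256)" for G' i z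
  proof -
   have "{..N (Suc i)} = {..N i} \<union> {N i<..N (Suc i)}" using Nmono[of i] by auto
   then have "taylor_poly G' (N (Suc i)) z = taylor_poly G' (N i) z + (\<Sum>k\<in>{N i<..N (Suc i)}. G' k 0 / fact k * z ^ k)"
    unfolding taylor_poly_def by (simp only:) (rule sum.union_disjoint; auto)
   then have "cmod (taylor_poly G' (N i) z - taylor_poly G' (N (Suc i)) z) = cmod (\<Sum>k\<in>{N i<..N (Suc i)}. G' k 0 / fact k * z ^ k)"
    by (simp add: norm_minus_commute)
   also have "... \<le> (\<Sum>k\<in>{N i<..N (Suc i)}. A * \<eta> i * (1 / 2) ^ k)"
   proof (rule sum_norm_le)
    fix k assume k: "k \<in> {N i<..N (Suc i)}"
    have z2: "cmod z \<le> t (Suc i) * (1 / 2)" using z tpos[of i] by (simp add: tSuc)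
    have "cmod (G' k 0 / fact k) \<le> A * l k" using r by (intro deriv_bounds_coeff[OF G']) simp
    then have "cmod (G' k 0 / fact k * z ^ k) \<le> A * l k * (t (Suc i) * (1 / 2)) ^ k"
     unfolding norm_mult norm_power using z2 A lpos[of k] by (intro mult_mono power_mono) auto
    also have "... = A * (l k * t (Suc i) ^ k) * (1 / 2) ^ k" by (simp only: power_mult_distrib mult_ac)
    also have "l k * t (Suc i) ^ k \<le> l (N i) * t (Suc i) ^ N i"
     using k by (intro turning_index_decreasing[OF l tpos]) (auto simp: N_def)
    also have "l (N i) * t (Suc i) ^ N i \<le> \<eta> i" unfolding \<eta>_def
     using tpos[of "Suc i"] lpos[of "N i"] by (intro mult_left_mono power_mono tSle) auto
    finally show "cmod (G' k 0 / fact k * z ^ k) \<le> A * \<eta> i * (1 / 2) ^ k" using A by (simp add: mult_left_mono mult_right_mono)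
   qed
   also have "... = A * \<eta> i * (\<Sum>k\<in>{N i<..N (Suc i)}. (1 / 2) ^ k)" by (simp only: sum_distrib_left)
   also have "... \<le> A * \<eta> i * 2" using A \<eta>0[of i] by (intro mult_left_mono half_powers_sum) auto
   also have "... \<le> A * \<epsilon> i ^ (j + 1) * 2" using A \<eta>\<epsilon>[of i] by (intro mult_right_mono mult_left_mono) auto
   finally show ?thesis by (simp add: mult_ac)
  qed
  have sub: "z \<in> ball 0 (t i / 128)" "z \<in> ball 0 (t (Suc i) / 128)" if "z \<in> ball 0 (t i / 256)" for i and z :: complex
   using that tpos[of i] by (auto simp: tSuc)
  have pw: "cmod (x - y) \<le> D * \<epsilon> i ^ (j + 1)"
   if "cmod (x - u) \<le> C * \<epsilon> i ^ (j + 1)" "cmod (u - v) \<le> 2 * A * \<epsilon> i ^ (j + 1)" "cmod (y - v) \<le> C * \<epsilon> (Suc i) ^ (j + 1)" for x y u v :: complex and i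
  proof -
   have "\<epsilon> (Suc i) ^ (j + 1) \<le> \<epsilon> i ^ (j + 1)" using \<epsilon>Suc[of i] \<epsilon>0[of "Suc i"] by (intro power_mono) auto
   then have "C * \<epsilon> (Suc i) ^ (j + 1) \<le> C * \<epsilon> i ^ (j + 1)" using C by (intro mult_left_mono) auto
   then have 3: "cmod (v - y) \<le> C * \<epsilon> i ^ (j + 1)" using that(3) norm_minus_commute[of v y] by linarith
   have "cmod ((x - u) + (u - v) + (v - y)) \<le> C * \<epsilon> i ^ (j + 1) + 2 * A * \<epsilon> i ^ (j + 1) + C * \<epsilon> i ^ (j + 1)"
    by (intro norm_triangle_mono that 3)
   then show ?thesis by (simp add: D_def algebra_simps)
  qed
  have diff: "cmod (F i z - F (Suc i) z) \<le> C3 * \<epsilon> i" if z: "z \<in> ball 0 (t i / 256)" for i z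
  proof -
   have "cmod (F i z - F (Suc i) z) \<le> (D * (1 + (C + A)) + 2) * \<epsilon> i"
   proof (rule close_powers_imp_close[where j=j])
    show "cmod (F i z) \<le> C + A" "cmod (F (Suc i) z) \<le> C + A"
     using F[OF sub(1)[OF z]] F[OF sub(2)[OF z]] A by linarith+
    show "cmod (F i z ^ j - F (Suc i) z ^ j) \<le> D * \<epsilon> i ^ (j + 1)"
     using F[OF sub(1)[OF z]] F[OF sub(2)[OF z]] tpd[OF G z] by (intro pw) auto
    show "cmod (F i z ^ (j + 1) - F (Suc i) z ^ (j + 1)) \<le> D * \<epsilon> i ^ (j + 1)"
     by (rule pw[OF conjunct2[OF conjunct2[OF F[OF sub(1)[OF z]]]] tpd[OF H z] conjunct2[OF conjunct2[OF F[OF sub(2)[OF z]]]]])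
   qed (use D0 \<epsilon>0 in auto)
   also have "... \<le> C3 * \<epsilon> i" using C3 \<epsilon>0[of i] by (intro mult_right_mono) auto
   finally show ?thesis .
  qed
  have rem: "cmod (G' 0 s - taylor_poly G' (N i) (of_real s)) \<le> A * \<epsilon> i ^ (j + 1)"
   if G': "deriv_bounds l A r G'" and s: "\<bar>s\<bar> < t i / 128" for G' i s
  proof -
   have s': "\<bar>s\<bar> \<le> r" "\<bar>s\<bar> \<le> t i * (1 / 2)" using s tle[of i] t0 tpos[of i] by auto
   have "cmod (G' 0 s - taylor_poly G' (N i) (of_real s)) \<le> A * (real (N i) + 1) * l (N i) * \<bar>s\<bar> ^ N i"
    using A by (intro taylor_poly_remainder[OF G' lpos _ s'(1) Npos]) simp
   also have "... \<le> A * (real (N i) + 1) * l (N i) * (t i * (1 / 2)) ^ N i"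
    using A lpos[of "N i"] s' by (intro mult_left_mono power_mono) auto
   also have "... = A * \<eta> i * ((real (N i) + 1) * (1 / 2) ^ N i)" by (simp only: \<eta>_def power_mult_distrib mult_ac)
   also have "... \<le> A * \<eta> i * 1"
   proof (intro mult_left_mono)
    have "real (N i) + 1 \<le> 2 ^ N i" by (rule nat_le_two_power)
    then show "(real (N i) + 1) * (1 / 2) ^ N i \<le> 1" by (simp add: power_divide)
   qed (use A \<eta>0[of i] in auto)
   also have "... \<le> A * \<epsilon> i ^ (j + 1)" using A \<eta>\<epsilon>[of i] by simp
   finally show ?thesis .
  qed
  have app: "cmod (F i (of_real s) - g s) \<le> C3 * \<epsilon> i" if s: "\<bar>s\<bar> < t i / 128" for i s
  proof -
   have z: "complex_of_real s \<in> ball 0 (t i / 128)" using s by simp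
   have s': "\<bar>s\<bar> \<le> r" using s tle[of i] t0 tpos[of i] by auto
   have gA: "cmod (g s) \<le> A"
   proof (rule ccontr)
    assume n: "\<not> cmod (g s) \<le> A"
    then have "cmod (g s) ^ 1 \<le> cmod (g s) ^ j" using A j by (intro power_increasing) auto
    moreover have "cmod (G 0 s) \<le> A * fact 0 * l 0" by (rule deriv_boundsD(2)[OF G s'])
    then have "cmod (g s) ^ j \<le> A" using l g[OF s'] by (simp add: log_convex_weight_def norm_power)
    ultimately show False using n by simp
   qed
   have pw': "cmod (x - y) \<le> D * \<epsilon> i ^ (j + 1)"
    if "cmod (x - u) \<le> C * \<epsilon> i ^ (j + 1)" "cmod (y - u) \<le> A * \<epsilon> i ^ (j + 1)" for x y u :: complex
   proof -
    have "cmod ((x - u) - (y - u)) \<le> C * \<epsilon> i ^ (j + 1) + A * \<epsilon> i ^ (j + 1)"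
     by (rule order_trans[OF norm_triangle_ineq4 add_mono[OF that]])
    moreover have "C * \<epsilon> i ^ (j + 1) + A * \<epsilon> i ^ (j + 1) \<le> D * \<epsilon> i ^ (j + 1)"
     unfolding distrib_right[symmetric] using \<epsilon>0[of i] C A by (intro mult_right_mono) (auto simp: D_def)
    ultimately show ?thesis by simp
   qed
   have "cmod (F i (of_real s) - g s) \<le> (D * (1 + (C + A)) + 2) * \<epsilon> i"
   proof (rule close_powers_imp_close[where j=j])
    show "cmod (F i (of_real s)) \<le> C + A" "cmod (g s) \<le> C + A" using F[OF z] gA C A by linarith+
    show "cmod (F i (of_real s) ^ j - g s ^ j) \<le> D * \<epsilon> i ^ (j + 1)"
     by (rule pw'[OF conjunct1[OF conjunct2[OF F[OF z]]]]) (use rem[OF G s] g[OF s'] in simp)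
    show "cmod (F i (of_real s) ^ (j + 1) - g s ^ (j + 1)) \<le> D * \<epsilon> i ^ (j + 1)"
     by (rule pw'[OF conjunct2[OF conjunct2[OF F[OF z]]]]) (use rem[OF H s] g[OF s'] in simp)
   qed (use D0 \<epsilon>0 in auto)
   also have "... \<le> C3 * \<epsilon> i" using C3 \<epsilon>0[of i] by (intro mult_right_mono) auto
   finally show ?thesis .
  qed
  have "\<exists>a. (\<forall>k. cmod (a k) \<le> 2 * C3 * (512 ^ k * q (Suc k) + (512 / t0) ^ k)) \<and>
   (\<forall>n s. \<bar>s\<bar> \<le> t0 / 1024 --> cmod (g s - (\<Sum>k\<le>n. a k * of_real s ^ k)) \<le> K n * \<bar>s\<bar> ^ (n + 1))"
   unfolding K_def
  proof (rule multiscale_expansion[OF t0(1,2) C3(1)])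
   show "cmod (F i z) \<le> C3" if "z \<in> ball 0 (t0 / 2 ^ i / 128)" for i z
    using F[of z i] that C3 by (force simp: t_def)
  qed (use hol diff app \<epsilon>q \<epsilon>0 q0 in \<open>auto simp: t_def less_imp_le\<close>)
  then obtain a where a: "\<And>k. cmod (a k) \<le> 2 * C3 * (512 ^ k * q (Suc k) + (512 / t0) ^ k)"
   "\<And>n s. \<bar>s\<bar> \<le> t0 / 1024 ==> cmod (g s - (\<Sum>k\<le>n. a k * of_real s ^ k)) \<le> K n * \<bar>s\<bar> ^ (n + 1)" by blast
  have a': "cmod (a k) \<le> 2 * C3 * (512 ^ k * q (Suc k) + (1 / (t0 / 1024)) ^ k)" for k
  proof -
   have "(512 / t0) ^ k \<le> (1 / (t0 / 1024)) ^ k" using t0 by (intro power_mono) (auto simp: divide_right_mono)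
   then have "2 * C3 * (512 ^ k * q (Suc k) + (512 / t0) ^ k) \<le> 2 * C3 * (512 ^ k * q (Suc k) + (1 / (t0 / 1024)) ^ k)"
    using C3 by (intro mult_left_mono add_left_mono) auto
   then show ?thesis using a(1)[of k] by linarith
  qed
  show "\<exists>a. (\<forall>k. cmod (a k) \<le> 2 * C3 * (512 ^ k * root (joris_exponent j) (l (joris_exponent j * Suc k)) + (1 / (t0 / 1024)) ^ k)) \<and>
     (\<forall>n s. \<bar>s\<bar> \<le> t0 / 1024 --> cmod (g s - (\<Sum>k\<le>n. a k * of_real s ^ k)) \<le> K n * \<bar>s\<bar> ^ (n + 1))"
   using a' a(2) unfolding q_def L_def by blast
 qed
qed

section \<open>Frechet derivatives from uniform Taylor expansions\<close>

text \<open>Numerical differentiation at 0 with the nodes 0, ..., m. The weights are the linear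
  coefficients of the Lagrange basis polynomials; interpolation is exact on monomials of degree at
  most \<open>m\<close>.\<close>

lemma lagrange_derivative_weights:
 obtains wt :: "nat => real" where "\<And>i. i \<le> m ==> (\<Sum>j\<le>m. wt j * real j ^ i) = (if i = 1 then 1 else 0)"
proof -
 define L :: "nat => real poly" where "L j = (\<Prod>i\<in>{..m} - {j}. smult (1 / (real j - real i)) [:- real i, 1:])" for j
 have Lv: "poly (L j) (real k) = (if k = j then 1 else 0)" if "j \<le> m" "k \<le> m" for j k
 proof (cases "k = j")
  case True
  have "poly (L j) (real k) = (\<Prod>i\<in>{..m} - {j}. 1)"
   unfolding L_def poly_prod True
  proof (intro prod.cong refl)
   fix i assume "i \<in> {..m} - {j}"
   then have "real j - real i \<noteq> 0" by simp
   then show "poly (smult (1 / (real j - real i)) [:- real i, 1:]) (real j) = 1"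
    by (simp add: diff_divide_distrib[symmetric])
  qed
  then show ?thesis using True by simp
 next
  case False
  then show ?thesis using that unfolding L_def poly_prod by (auto intro!: prod_zero bexI[of _ k])
 qed
 have degL: "degree (L j) \<le> m" if "j \<le> m" for j
 proof -
  have "degree (L j) \<le> (\<Sum>i\<in>{..m} - {j}. degree (smult (1 / (real j - real i)) [:- real i, 1:]))"
   unfolding L_def by (rule degree_prod_sum_le[unfolded o_def]) auto
  also have "... \<le> (\<Sum>i\<in>{..m} - {j}. 1)" by (intro sum_mono) (auto intro: order_trans[OF degree_smult_le])
  also have "... \<le> m" using that by simp
  finally show ?thesis .
 qed
 have eq: "(\<Sum>j\<le>m. smult (real j ^ i) (L j)) = monom 1 i" if i: "i \<le> m" for i
 proof (rule poly_eqI_degree[of "real ` {..m}"])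
  fix x assume "x \<in> real ` {..m}"
  then obtain k where k: "x = real k" "k \<le> m" by auto
  have "poly (\<Sum>j\<le>m. smult (real j ^ i) (L j)) x = (\<Sum>j\<le>m. real j ^ i * (if k = j then 1 else 0))"
   unfolding k poly_sum poly_smult by (intro sum.cong refl) (use Lv k in auto)
  then show "poly (\<Sum>j\<le>m. smult (real j ^ i) (L j)) x = poly (monom 1 i) x"
  proof -
   have "(\<Sum>j\<le>m. real j ^ i * (if k = j then 1 else 0)) = (\<Sum>j\<le>m. if k = j then real j ^ i else 0)"
    by (intro sum.cong refl) simp
   also have "... = real k ^ i" using k(2) by simp
   finally show ?thesis using \<open>poly (\<Sum>j\<le>m. smult (real j ^ i) (L j)) x = _\<close> k(1) by (simp add: poly_monom)
  qed
 next
  have c: "card (real ` {..m}) = m + 1" by (simp add: card_image inj_on_def)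
  have "degree (\<Sum>j\<le>m. smult (real j ^ i) (L j)) \<le> m"
   by (intro degree_sum_le order_trans[OF degree_smult_le degL]) auto
  then show "card (real ` {..m}) > degree (\<Sum>j\<le>m. smult (real j ^ i) (L j))" using c by simp
  show "card (real ` {..m}) > degree (monom 1 i :: real poly)" using c i by (simp add: degree_monom_eq)
 qed
 show thesis
 proof
  fix i assume "i \<le> m"
  from arg_cong[OF eq[OF this], of "\<lambda>p. coeff p 1"]
  show "(\<Sum>j\<le>m. coeff (L j) 1 * real j ^ i) = (if i = 1 then 1 else 0)" by (simp add: coeff_sum mult.commute)
 qed
qed

definition dir_deriv :: "('v::real_vector => complex) => 'v => 'v => complex" where
 "dir_deriv \<phi> u x = Lim (at 0) (\<lambda>s::real. (\<phi> (x + s *\<^sub>R u) - \<phi> x) / of_real s)"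

lemma dir_derivI:
 "((\<lambda>s::real. (\<phi> (x + s *\<^sub>R u) - \<phi> x) / of_real s) \<longlongrightarrow> \<alpha>) (at 0) ==> dir_deriv \<phi> u x = \<alpha>"
 unfolding dir_deriv_def by (rule tendsto_Lim) auto

lemma taylor_first_coeffs:
 fixes a :: "nat => complex" and \<phi> :: "'v::real_vector => complex"
 assumes \<delta>: "\<delta> > 0" and n: "n \<ge> 1"
  and b: "\<And>s. \<bar>s\<bar> < \<delta> ==> cmod (\<phi> (x + s *\<^sub>R u) - (\<Sum>k\<le>n. a k * of_real s ^ k)) \<le> C * \<bar>s\<bar> ^ (n + 1)"
 shows "a 0 = \<phi> x" "((\<lambda>s. (\<phi> (x + s *\<^sub>R u) - \<phi> x) / of_real s) \<longlongrightarrow> a 1) (at 0)" "dir_deriv \<phi> u x = a 1"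
proof -
 have "(\<Sum>k\<le>n. a k * 0 ^ k) = a 0" by (subst sum.atMost_shift) simp
 then show a0: "a 0 = \<phi> x" using b[of 0] \<delta> by simp
 have t1: "((\<lambda>s. (\<phi> (x + s *\<^sub>R u) - (\<Sum>k\<le>n. a k * of_real s ^ k)) / of_real s) \<longlongrightarrow> 0) (at 0)"
 proof (rule Lim_null_comparison)
  have "((\<lambda>s. C * \<bar>s\<bar> ^ n) \<longlongrightarrow> C * \<bar>0\<bar> ^ n) (at (0::real))" by (intro tendsto_intros)
  then show "((\<lambda>s. C * \<bar>s\<bar> ^ n) \<longlongrightarrow> 0) (at (0::real))" using n by (simp add: power_0_left)
  show "\<forall>\<^sub>F s in at 0. cmod ((\<phi> (x + s *\<^sub>R u) - (\<Sum>k\<le>n. a k * of_real s ^ k)) / of_real s) \<le> C * \<bar>s\<bar> ^ n"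
   unfolding eventually_at
  proof (intro exI[of _ \<delta>] conjI \<delta> ballI impI)
   fix s :: real assume s: "s \<noteq> 0 \<and> dist s 0 < \<delta>"
   then have "cmod (\<phi> (x + s *\<^sub>R u) - (\<Sum>k\<le>n. a k * of_real s ^ k)) / \<bar>s\<bar> \<le> C * \<bar>s\<bar> ^ (n + 1) / \<bar>s\<bar>"
    by (intro divide_right_mono b) auto
   then show "cmod ((\<phi> (x + s *\<^sub>R u) - (\<Sum>k\<le>n. a k * of_real s ^ k)) / of_real s) \<le> C * \<bar>s\<bar> ^ n"
    using s by (simp add: norm_divide)
  qed
 qed
 have t2: "((\<lambda>s::real. \<Sum>k<n. a (Suc k) * of_real s ^ k) \<longlongrightarrow> (\<Sum>k<n. a (Suc k) * of_real 0 ^ k)) (at 0)"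
  by (intro tendsto_intros)
 have e: "(\<Sum>k<n. a (Suc k) * of_real 0 ^ k) = a 1"
  using n by (cases n) (simp_all add: sum.lessThan_Suc_shift)
 have "((\<lambda>s. (\<phi> (x + s *\<^sub>R u) - (\<Sum>k\<le>n. a k * of_real s ^ k)) / of_real s + (\<Sum>k<n. a (Suc k) * of_real s ^ k)) \<longlongrightarrow> 0 + a 1) (at 0)"
  by (rule tendsto_add[OF t1 t2[unfolded e]])
 then have "((\<lambda>s. (\<phi> (x + s *\<^sub>R u) - \<phi> x) / of_real s) \<longlongrightarrow> 0 + a 1) (at 0)"
 proof (rule Lim_transform_eventually[OF _ eventually_mono[OF eventually_neq_at_within[of 0]]])
  fix s :: real assume s: "s \<noteq> 0"
  have "(\<Sum>k\<le>n. a k * of_real s ^ k) = \<phi> x + of_real s * (\<Sum>k<n. a (Suc k) * of_real s ^ k)"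
   by (subst sum.atMost_shift) (simp add: a0 sum_distrib_left mult_ac)
  then show "(\<phi> (x + s *\<^sub>R u) - (\<Sum>k\<le>n. a k * of_real s ^ k)) / of_real s + (\<Sum>k<n. a (Suc k) * of_real s ^ k) = (\<phi> (x + s *\<^sub>R u) - \<phi> x) / of_real s"
   using s by (simp add: field_simps)
 qed
 then show "((\<lambda>s. (\<phi> (x + s *\<^sub>R u) - \<phi> x) / of_real s) \<longlongrightarrow> a 1) (at 0)" by simp
 then show "dir_deriv \<phi> u x = a 1" by (rule dir_derivI)
qed

lemma dir_deriv_scale_tendsto:
 fixes \<phi> :: "'v::real_vector => complex"
 assumes "((\<lambda>s::real. (\<phi> (x + s *\<^sub>R u) - \<phi> x) / of_real s) \<longlongrightarrow> \<alpha>) (at 0)"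
 shows "((\<lambda>s::real. (\<phi> (x + s *\<^sub>R (c *\<^sub>R u)) - \<phi> x) / of_real s) \<longlongrightarrow> of_real c * \<alpha>) (at 0)"
proof (cases "c = 0")
 case True then show ?thesis by simp
next
 case False
 have "((\<lambda>s. c * s) \<longlongrightarrow> c * 0) (at (0::real))" by (intro tendsto_intros)
 then have f: "filterlim (\<lambda>s. c * s) (at 0) (at (0::real))"
  using False by (auto simp: filterlim_at eventually_at_filter)
 have "((\<lambda>s. of_real c * ((\<phi> (x + (c * s) *\<^sub>R u) - \<phi> x) / of_real (c * s))) \<longlongrightarrow> of_real c * \<alpha>) (at 0)"
  by (intro tendsto_mult_left filterlim_compose[OF assms f])
 then show ?thesis using False by (simp add: mult.commute)
qed

text \<open>Instantiated twice: by the real line, for smooth curves, and by \<open>span B\<close>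
  with the Minkowski functional.\<close>

locale normed_open =
 fixes V :: "'v::real_vector set" and p :: "'v => real" and W :: "'v set"
 assumes sub: "subspace V"
  and p_ge: "\<And>x. x \<in> V ==> 0 \<le> p x"
  and p_0: "\<And>x. x \<in> V ==> p x = 0 ==> x = 0"
  and p_tri: "\<And>x y. x \<in> V ==> y \<in> V ==> p (x + y) \<le> p x + p y"
  and p_scale: "\<And>x a. x \<in> V ==> p (a *\<^sub>R x) = \<bar>a\<bar> * p x"
  and W_sub: "W \<subseteq> V"
  and W_open: "\<And>x. x \<in> W ==> \<exists>\<delta>>0. \<forall>h\<in>V. p h < \<delta> --> x + h \<in> W"
begin

lemma V_ops [simp]:
 "x \<in> V ==> y \<in> V ==> x + y \<in> V" "x \<in> V ==> a *\<^sub>R x \<in> V" "x \<in> V ==> y \<in> V ==> x - y \<in> V" "0 \<in> V"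
 using sub by (auto simp: subspace_add subspace_scale subspace_diff subspace_0)

lemma p_zero [simp]: "p 0 = 0"
 using p_scale[of 0 0] by simp

lemma W_V: "x \<in> W ==> x \<in> V" using W_sub by blast

lemma p_dist: "x \<in> V ==> y \<in> V ==> z \<in> V ==> p (x - z) \<le> p (x - y) + p (y - z)"
 using p_tri[of "x - y" "y - z"] by simp

definition expansion :: "('v => complex) => nat => real => real => 'v => 'v => (nat => complex) => bool" where
 "expansion \<phi> n \<delta> C x u a \<longleftrightarrow> (\<forall>s. \<bar>s\<bar> < \<delta> --> x + s *\<^sub>R u \<in> W \<and>
   cmod (\<phi> (x + s *\<^sub>R u) - (\<Sum>k\<le>n. a k * of_real s ^ k)) \<le> C * \<bar>s\<bar> ^ (n + 1))"

text \<open>\<delta> and \<open>C\<close> are uniform in the function, in the base point near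
  \<open>x0\<close> and in the direction. The coefficients \<open>a\<close> may depend on all of
  these in an arbitrary way; overlapping expansions will force regularity.\<close>

definition uniform_taylor :: "('v => complex) set => bool" where
 "uniform_taylor \<F> \<longleftrightarrow> (\<forall>x0\<in>W. \<forall>n. \<exists>\<delta>>0. \<exists>C\<ge>0. \<forall>\<phi>\<in>\<F>. \<forall>x\<in>V. \<forall>u\<in>V.
   p (x - x0) < \<delta> --> p u \<le> 1 --> (\<exists>a. expansion \<phi> n \<delta> C x u a))"

lemma uniform_taylor_subset: "uniform_taylor \<F> ==> \<G> \<subseteq> \<F> ==> uniform_taylor \<G>"
 unfolding uniform_taylor_def by (meson subsetD)

lemma uniform_taylorE:
 assumes "uniform_taylor \<F>" "x0 \<in> W"
 obtains \<delta> C where "\<delta> > 0" "C \<ge> 0" "\<And>\<phi> x u. \<phi> \<in> \<F> ==> x \<in> V ==> u \<in> V ==> p (x - x0) < \<delta> ==> p u \<le> 1 ==> \<exists>a. expansion \<phi> n \<delta> C x u a"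
 using assms unfolding uniform_taylor_def by (meson that)

lemma uniform_first_order:
 assumes "uniform_taylor \<F>" "x0 \<in> W"
 obtains \<delta> C where "\<delta> > 0" "C \<ge> 0"
  "\<And>\<phi> x u s. \<phi> \<in> \<F> ==> x \<in> V ==> u \<in> V ==> p (x - x0) < \<delta> ==> p u \<le> 1 ==> \<bar>s\<bar> < \<delta> ==>
   x + s *\<^sub>R u \<in> W \<and> cmod (\<phi> (x + s *\<^sub>R u) - \<phi> x - of_real s * dir_deriv \<phi> u x) \<le> C * s\<^sup>2"
proof -
 obtain \<delta> C where d: "\<delta> > 0" "C \<ge> 0" "\<And>\<phi> x u. \<phi> \<in> \<F> ==> x \<in> V ==> u \<in> V ==> p (x - x0) < \<delta> ==> p u \<le> 1 ==> \<exists>a. expansion \<phi> 1 \<delta> C x u a"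
  by (rule uniform_taylorE[OF assms, of 1]) blast
 show thesis
 proof (rule that[OF d(1,2)])
  fix \<phi> x u s assume \<phi>: "\<phi> \<in> \<F>" "x \<in> V" "u \<in> V" "p (x - x0) < \<delta>" "p u \<le> 1" and s: "\<bar>s\<bar> < \<delta>"
  obtain a where a: "expansion \<phi> 1 \<delta> C x u a" using d(3)[OF \<phi>] by blast
  have b: "cmod (\<phi> (x + s *\<^sub>R u) - (\<Sum>k\<le>1. a k * of_real s ^ k)) \<le> C * \<bar>s\<bar> ^ (1 + 1)" if "\<bar>s\<bar> < \<delta>" for s
   using a that unfolding expansion_def by blast
  note c = taylor_first_coeffs[OF d(1) _ b]
  have c0: "a 0 = \<phi> x" and c1: "dir_deriv \<phi> u x = a 1" by (rule c(1); simp) (rule c(3); simp)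
  have "x + s *\<^sub>R u \<in> W" using a s unfolding expansion_def by blast
  moreover have "(\<Sum>k\<le>1. a k * of_real s ^ k) = \<phi> x + of_real s * dir_deriv \<phi> u x" by (simp add: c0 c1 mult.commute)
  ultimately show "x + s *\<^sub>R u \<in> W \<and> cmod (\<phi> (x + s *\<^sub>R u) - \<phi> x - of_real s * dir_deriv \<phi> u x) \<le> C * s\<^sup>2"
   using b[OF s] by (simp add: diff_diff_eq power2_eq_square)
 qed
qed

lemma uniform_lipschitz:
 assumes "uniform_taylor \<F>" "x0 \<in> W"
 obtains \<delta> C where "\<delta> > 0" "C \<ge> 0"
  "\<And>\<phi> x u s. \<phi> \<in> \<F> ==> x \<in> V ==> u \<in> V ==> p (x - x0) < \<delta> ==> p u \<le> 1 ==> \<bar>s\<bar> < \<delta> ==> cmod (\<phi> (x + s *\<^sub>R u) - \<phi> x) \<le> C * \<bar>s\<bar>"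
proof -
 obtain \<delta> C where d: "\<delta> > 0" "C \<ge> 0" "\<And>\<phi> x u. \<phi> \<in> \<F> ==> x \<in> V ==> u \<in> V ==> p (x - x0) < \<delta> ==> p u \<le> 1 ==> \<exists>a. expansion \<phi> 0 \<delta> C x u a"
  by (rule uniform_taylorE[OF assms, of 0]) blast
 show thesis
 proof (rule that[OF d(1,2)])
  fix \<phi> x u s assume \<phi>: "\<phi> \<in> \<F>" "x \<in> V" "u \<in> V" "p (x - x0) < \<delta>" "p u \<le> 1" and s: "\<bar>s\<bar> < \<delta>"
  obtain a where a: "expansion \<phi> 0 \<delta> C x u a" using d(3)[OF \<phi>] by blast
  have b: "cmod (\<phi> (x + s *\<^sub>R u) - a 0) \<le> C * \<bar>s\<bar>" if "\<bar>s\<bar> < \<delta>" for s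
   using a that unfolding expansion_def by simp
  have "a 0 = \<phi> x" using b[of 0] d(1) by simp
  then show "cmod (\<phi> (x + s *\<^sub>R u) - \<phi> x) \<le> C * \<bar>s\<bar>" using b[OF s] by simp
 qed
qed

lemma uniform_dir_deriv_bound:
 assumes "uniform_taylor \<F>" "x0 \<in> W"
 obtains C where "C \<ge> 0" "\<And>\<phi> u. \<phi> \<in> \<F> ==> u \<in> V ==> p u \<le> 1 ==> cmod (dir_deriv \<phi> u x0) \<le> C"
proof -
 obtain \<delta> C where d: "\<delta> > 0" "C \<ge> 0" "\<And>\<phi> x u s. \<phi> \<in> \<F> ==> x \<in> V ==> u \<in> V ==> p (x - x0) < \<delta> ==> p u \<le> 1 ==> \<bar>s\<bar> < \<delta> ==>
   x + s *\<^sub>R u \<in> W \<and> cmod (\<phi> (x + s *\<^sub>R u) - \<phi> x - of_real s * dir_deriv \<phi> u x) \<le> C * s\<^sup>2"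
  by (rule uniform_first_order[OF assms]) blast
 obtain \<delta>' C' where d': "\<delta>' > 0" "C' \<ge> 0" "\<And>\<phi> x u s. \<phi> \<in> \<F> ==> x \<in> V ==> u \<in> V ==> p (x - x0) < \<delta>' ==> p u \<le> 1 ==> \<bar>s\<bar> < \<delta>' ==> cmod (\<phi> (x + s *\<^sub>R u) - \<phi> x) \<le> C' * \<bar>s\<bar>"
  by (rule uniform_lipschitz[OF assms]) blast
 define s where "s = min \<delta> \<delta>' / 2"
 have s: "s > 0" "\<bar>s\<bar> < \<delta>" "\<bar>s\<bar> < \<delta>'" using d d' by (auto simp: s_def)
 show thesis
 proof (rule that[of "C * s + C'"])
  show "C * s + C' \<ge> 0" using s d d' by simp
  fix \<phi> u assume \<phi>: "\<phi> \<in> \<F>" "u \<in> V" "p u \<le> 1"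
  have x: "x0 \<in> V" "p (x0 - x0) < \<delta>" "p (x0 - x0) < \<delta>'" using assms W_V d d' by auto
  have "cmod (of_real s * dir_deriv \<phi> u x0) \<le> cmod (\<phi> (x0 + s *\<^sub>R u) - \<phi> x0) + cmod (\<phi> (x0 + s *\<^sub>R u) - \<phi> x0 - of_real s * dir_deriv \<phi> u x0)"
   using norm_triangle_ineq4[of "\<phi> (x0 + s *\<^sub>R u) - \<phi> x0" "\<phi> (x0 + s *\<^sub>R u) - \<phi> x0 - of_real s * dir_deriv \<phi> u x0"] by simp
  also have "... \<le> C' * \<bar>s\<bar> + C * s\<^sup>2"
   using d(3)[OF \<phi>(1) x(1) \<phi>(2) x(2) \<phi>(3) s(2)] d'(3)[OF \<phi>(1) x(1) \<phi>(2) x(3) \<phi>(3) s(3)] by (intro add_mono) auto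
  finally have "s * cmod (dir_deriv \<phi> u x0) \<le> s * (C * s + C')" using s by (simp add: norm_mult power2_eq_square algebra_simps)
  then show "cmod (dir_deriv \<phi> u x0) \<le> C * s + C'" using s by simp
 qed
qed

lemma normalize:
 assumes "v \<in> V"
 obtains c u where "c \<ge> 1" "u \<in> V" "p u \<le> 1" "v = c *\<^sub>R u"
proof (rule that[of "max 1 (p v)" "(1 / max 1 (p v)) *\<^sub>R v"])
 show "p ((1 / max 1 (p v)) *\<^sub>R v) \<le> 1" using assms by (subst p_scale) (auto simp: field_simps)
qed (use assms in auto)

lemma dir_deriv_tendsto:
 assumes U: "uniform_taylor \<F>" and x: "x \<in> W" and \<phi>: "\<phi> \<in> \<F>" and v: "v \<in> V"
 shows "((\<lambda>s::real. (\<phi> (x + s *\<^sub>R v) - \<phi> x) / of_real s) \<longlongrightarrow> dir_deriv \<phi> v x) (at 0)"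
proof -
 obtain c u where u: "c \<ge> 1" "u \<in> V" "p u \<le> 1" "v = c *\<^sub>R u" by (rule normalize[OF v])
 obtain \<delta> C where d: "\<delta> > 0" "C \<ge> 0" "\<And>\<phi> x' u. \<phi> \<in> \<F> ==> x' \<in> V ==> u \<in> V ==> p (x' - x) < \<delta> ==> p u \<le> 1 ==> \<exists>a. expansion \<phi> 1 \<delta> C x' u a"
  by (rule uniform_taylorE[OF U x, of 1]) blast
 obtain a where a: "expansion \<phi> 1 \<delta> C x u a" using d(3)[OF \<phi> W_V[OF x] u(2) _ u(3)] d(1) by auto
 have b: "cmod (\<phi> (x + s *\<^sub>R u) - (\<Sum>k\<le>1. a k * of_real s ^ k)) \<le> C * \<bar>s\<bar> ^ (1 + 1)" if "\<bar>s\<bar> < \<delta>" for s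
  using a that unfolding expansion_def by blast
 have "((\<lambda>s::real. (\<phi> (x + s *\<^sub>R u) - \<phi> x) / of_real s) \<longlongrightarrow> a 1) (at 0)"
  by (rule taylor_first_coeffs(2)[OF d(1) _ b]) auto
 from dir_deriv_scale_tendsto[OF this, of c]
 have "((\<lambda>s::real. (\<phi> (x + s *\<^sub>R v) - \<phi> x) / of_real s) \<longlongrightarrow> of_real c * a 1) (at 0)" unfolding u(4) .
 then show ?thesis using dir_derivI by metis
qed

lemma dir_deriv_scale:
 assumes "uniform_taylor \<F>" "x \<in> W" "\<phi> \<in> \<F>" "v \<in> V"
 shows "dir_deriv \<phi> (c *\<^sub>R v) x = of_real c * dir_deriv \<phi> v x"
 by (rule dir_derivI[OF dir_deriv_scale_tendsto[OF dir_deriv_tendsto[OF assms]]])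

text \<open>Difference quotients with step \<open>t = sqrt |s|\<close> at \<open>x\<close> and at
  \<open>x + s u\<close> are compared. The first-order errors contribute \<open>t^2 / t\<close> and
  the Lipschitz bound in direction \<open>u\<close> contributes \<open>|s| / t\<close>; both are of
  size \<open>sqrt |s|\<close>.\<close>

lemma dir_deriv_line_continuous:
 assumes U: "uniform_taylor \<F>" and x: "x \<in> W" and \<phi>: "\<phi> \<in> \<F>" and u: "u \<in> V" "p u \<le> 1" and v: "v \<in> V" "p v \<le> 1"
 shows "((\<lambda>s::real. dir_deriv \<phi> v (x + s *\<^sub>R u)) \<longlongrightarrow> dir_deriv \<phi> v x) (at 0)"
proof -
 obtain \<delta> C where d: "\<delta> > 0" "C \<ge> 0" "\<And>\<phi> y u s. \<phi> \<in> \<F> ==> y \<in> V ==> u \<in> V ==> p (y - x) < \<delta> ==> p u \<le> 1 ==> \<bar>s\<bar> < \<delta> ==>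
   y + s *\<^sub>R u \<in> W \<and> cmod (\<phi> (y + s *\<^sub>R u) - \<phi> y - of_real s * dir_deriv \<phi> u y) \<le> C * s\<^sup>2"
  by (rule uniform_first_order[OF U x]) blast
 obtain \<delta>' C' where d': "\<delta>' > 0" "C' \<ge> 0" "\<And>\<phi> y u s. \<phi> \<in> \<F> ==> y \<in> V ==> u \<in> V ==> p (y - x) < \<delta>' ==> p u \<le> 1 ==> \<bar>s\<bar> < \<delta>' ==> cmod (\<phi> (y + s *\<^sub>R u) - \<phi> y) \<le> C' * \<bar>s\<bar>"
  by (rule uniform_lipschitz[OF U x]) blast
 define \<eta> where "\<eta> = min 1 ((min \<delta> \<delta>')\<^sup>2)"
 have \<eta>: "\<eta> > 0" using d d' by (simp add: \<eta>_def)
 have xV: "x \<in> V" using x W_V by blast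
 have main: "cmod (dir_deriv \<phi> v (x + s *\<^sub>R u) - dir_deriv \<phi> v x) \<le> (2 * C + 2 * C') * sqrt \<bar>s\<bar>" if s: "s \<noteq> 0" "\<bar>s\<bar> < \<eta>" for s
 proof -
  define t where "t = sqrt \<bar>s\<bar>"
  have t: "t > 0" "\<bar>s\<bar> = t * t" using s by (auto simp: t_def)
  have "\<bar>s\<bar> < 1" using s by (simp add: \<eta>_def)
  then have t1: "t \<le> 1" by (simp add: t_def)
  have "t < min \<delta> \<delta>'"
  proof -
   have "t < sqrt ((min \<delta> \<delta>')\<^sup>2)" unfolding t_def using s by (intro real_sqrt_less_mono) (simp add: \<eta>_def)
   then show ?thesis using d d' by simp
  qed
  then have t2: "\<bar>t\<bar> < \<delta>" "\<bar>t\<bar> < \<delta>'" using t by auto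
  have "\<bar>s\<bar> \<le> t" using t t1 by (simp add: mult_left_le)
  then have s2: "\<bar>s\<bar> < \<delta>" "\<bar>s\<bar> < \<delta>'" using t2 t by linarith+
  have pu: "p (x + r *\<^sub>R w - x) \<le> \<bar>r\<bar>" if "w \<in> V" "p w \<le> 1" for r w
   using that by (simp add: p_scale mult_left_le)
  let ?y = "x + s *\<^sub>R u"
  have y: "?y \<in> V" "p (?y - x) < \<delta>" using pu[OF u, of s] s2 u xV by auto
  have z: "x + t *\<^sub>R v \<in> V" "p (x + t *\<^sub>R v - x) < \<delta>'" using pu[OF v, of t] t2 v xV by auto
  have 1: "cmod (\<phi> (?y + t *\<^sub>R v) - \<phi> ?y - of_real t * dir_deriv \<phi> v ?y) \<le> C * t\<^sup>2"
   using d(3)[OF \<phi> y(1) v(1) y(2) v(2) t2(1)] by blast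
  have 2: "cmod (\<phi> (x + t *\<^sub>R v) - \<phi> x - of_real t * dir_deriv \<phi> v x) \<le> C * t\<^sup>2"
   using d(3)[OF \<phi> xV v(1) _ v(2) t2(1)] d(1) by auto
  have 3: "cmod (\<phi> (x + t *\<^sub>R v + s *\<^sub>R u) - \<phi> (x + t *\<^sub>R v)) \<le> C' * \<bar>s\<bar>"
   by (rule d'(3)[OF \<phi> z(1) u(1) z(2) u(2) s2(2)])
  have 4: "cmod (\<phi> ?y - \<phi> x) \<le> C' * \<bar>s\<bar>"
   using d'(3)[OF \<phi> xV u(1) _ u(2) s2(2)] d'(1) by auto
  have "of_real t * (dir_deriv \<phi> v ?y - dir_deriv \<phi> v x)
   = (\<phi> (x + t *\<^sub>R v) - \<phi> x - of_real t * dir_deriv \<phi> v x) - (\<phi> (?y + t *\<^sub>R v) - \<phi> ?y - of_real t * dir_deriv \<phi> v ?y)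
    + ((\<phi> (x + t *\<^sub>R v + s *\<^sub>R u) - \<phi> (x + t *\<^sub>R v)) - (\<phi> ?y - \<phi> x))"
   by (simp add: algebra_simps)
  then have "cmod (of_real t * (dir_deriv \<phi> v ?y - dir_deriv \<phi> v x)) \<le> (C * t\<^sup>2 + C * t\<^sup>2) + (C' * \<bar>s\<bar> + C' * \<bar>s\<bar>)"
   by (simp only:) (intro norm_triangle_mono order_trans[OF norm_triangle_ineq4 add_mono] 1 2 3 4)
  also have "... = t * ((2 * C + 2 * C') * t)" using t by (simp add: power2_eq_square algebra_simps)
  finally show ?thesis using t(1) by (simp add: norm_mult t_def)
 qed
 have "((\<lambda>s. dir_deriv \<phi> v (x + s *\<^sub>R u) - dir_deriv \<phi> v x) \<longlongrightarrow> 0) (at 0)"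
 proof (rule Lim_null_comparison)
  show "\<forall>\<^sub>F s in at 0. cmod (dir_deriv \<phi> v (x + s *\<^sub>R u) - dir_deriv \<phi> v x) \<le> (2 * C + 2 * C') * sqrt \<bar>s\<bar>"
   unfolding eventually_at using \<eta> main by (intro exI[of _ \<eta>]) auto
  have "((\<lambda>s. (2 * C + 2 * C') * sqrt \<bar>s\<bar>) \<longlongrightarrow> (2 * C + 2 * C') * sqrt \<bar>0\<bar>) (at 0)" by (intro tendsto_intros)
  then show "((\<lambda>s. (2 * C + 2 * C') * sqrt \<bar>s\<bar>) \<longlongrightarrow> 0) (at 0)" by simp
 qed
 then show ?thesis by (simp add: LIM_zero_iff)
qed

text \<open>The path from \<open>x\<close> to \<open>x + s (u + v)\<close> runs through
  \<open>x + s u\<close>. The second leg has its derivative at a moving point, which is brought back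
  to \<open>x\<close> by continuity along the line.\<close>

lemma dir_deriv_add:
 assumes U: "uniform_taylor \<F>" and x: "x \<in> W" and \<phi>: "\<phi> \<in> \<F>" and u: "u \<in> V" and v: "v \<in> V"
 shows "dir_deriv \<phi> (u + v) x = dir_deriv \<phi> u x + dir_deriv \<phi> v x"
proof -
 have unit: "dir_deriv \<phi> (u + v) x = dir_deriv \<phi> u x + dir_deriv \<phi> v x"
  if u: "u \<in> V" "p u \<le> 1" and v: "v \<in> V" "p v \<le> 1" for u v
 proof -
  obtain \<delta> C where d: "\<delta> > 0" "C \<ge> 0" "\<And>\<phi> y u s. \<phi> \<in> \<F> ==> y \<in> V ==> u \<in> V ==> p (y - x) < \<delta> ==> p u \<le> 1 ==> \<bar>s\<bar> < \<delta> ==>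
    y + s *\<^sub>R u \<in> W \<and> cmod (\<phi> (y + s *\<^sub>R u) - \<phi> y - of_real s * dir_deriv \<phi> u y) \<le> C * s\<^sup>2"
   by (rule uniform_first_order[OF U x]) blast
  have xV: "x \<in> V" using x W_V by blast
  have "((\<lambda>s. (\<phi> (x + s *\<^sub>R u + s *\<^sub>R v) - \<phi> (x + s *\<^sub>R u) - of_real s * dir_deriv \<phi> v (x + s *\<^sub>R u)) / of_real s) \<longlongrightarrow> 0) (at 0)"
  proof (rule Lim_null_comparison)
   show "\<forall>\<^sub>F s in at 0. cmod ((\<phi> (x + s *\<^sub>R u + s *\<^sub>R v) - \<phi> (x + s *\<^sub>R u) - of_real s * dir_deriv \<phi> v (x + s *\<^sub>R u)) / of_real s) \<le> C * \<bar>s\<bar>"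
    unfolding eventually_at
   proof (intro exI[of _ \<delta>] conjI d(1) ballI impI)
    fix s :: real assume s: "s \<noteq> 0 \<and> dist s 0 < \<delta>"
    have "\<bar>s\<bar> * p u \<le> \<bar>s\<bar> * 1" using u by (intro mult_left_mono) auto
    moreover have "p (x + s *\<^sub>R u - x) = \<bar>s\<bar> * p u" using u by (simp add: p_scale)
    moreover have "\<bar>s\<bar> < \<delta>" using s by simp
    ultimately have pxs: "p (x + s *\<^sub>R u - x) < \<delta>" by linarith
    have "cmod (\<phi> (x + s *\<^sub>R u + s *\<^sub>R v) - \<phi> (x + s *\<^sub>R u) - of_real s * dir_deriv \<phi> v (x + s *\<^sub>R u)) \<le> C * s\<^sup>2"
     using d(3)[OF \<phi> _ v(1) pxs v(2) \<open>\<bar>s\<bar> < \<delta>\<close>] u xV by simp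
    then have "cmod (\<phi> (x + s *\<^sub>R u + s *\<^sub>R v) - \<phi> (x + s *\<^sub>R u) - of_real s * dir_deriv \<phi> v (x + s *\<^sub>R u)) / \<bar>s\<bar> \<le> C * s\<^sup>2 / \<bar>s\<bar>"
     by (intro divide_right_mono) auto
    also have "C * s\<^sup>2 / \<bar>s\<bar> = C * \<bar>s\<bar>" using s by (simp add: power2_eq_square abs_if)
    finally show "cmod ((\<phi> (x + s *\<^sub>R u + s *\<^sub>R v) - \<phi> (x + s *\<^sub>R u) - of_real s * dir_deriv \<phi> v (x + s *\<^sub>R u)) / of_real s) \<le> C * \<bar>s\<bar>"
     by (simp add: norm_divide)
   qed
   have "((\<lambda>s. C * \<bar>s\<bar>) \<longlongrightarrow> C * \<bar>0\<bar>) (at (0::real))" by (intro tendsto_intros)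
   then show "((\<lambda>s. C * \<bar>s\<bar>) \<longlongrightarrow> 0) (at (0::real))" by simp
  qed
  from tendsto_add[OF tendsto_add[OF this dir_deriv_line_continuous[OF U x \<phi> u v]] dir_deriv_tendsto[OF U x \<phi> u(1)]]
  have "((\<lambda>s. (\<phi> (x + s *\<^sub>R u + s *\<^sub>R v) - \<phi> (x + s *\<^sub>R u) - of_real s * dir_deriv \<phi> v (x + s *\<^sub>R u)) / of_real s + dir_deriv \<phi> v (x + s *\<^sub>R u) + (\<phi> (x + s *\<^sub>R u) - \<phi> x) / of_real s) \<longlongrightarrow> 0 + dir_deriv \<phi> v x + dir_deriv \<phi> u x) (at 0)" .
  then have "((\<lambda>s. (\<phi> (x + s *\<^sub>R (u + v)) - \<phi> x) / of_real s) \<longlongrightarrow> 0 + dir_deriv \<phi> v x + dir_deriv \<phi> u x) (at 0)"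
  proof (rule Lim_transform_eventually[OF _ eventually_mono[OF eventually_neq_at_within[of 0]]])
   fix s :: real assume "s \<noteq> 0"
   then show "(\<phi> (x + s *\<^sub>R u + s *\<^sub>R v) - \<phi> (x + s *\<^sub>R u) - of_real s * dir_deriv \<phi> v (x + s *\<^sub>R u)) / of_real s + dir_deriv \<phi> v (x + s *\<^sub>R u) + (\<phi> (x + s *\<^sub>R u) - \<phi> x) / of_real s = (\<phi> (x + s *\<^sub>R (u + v)) - \<phi> x) / of_real s"
    by (simp add: field_simps scaleR_add_right)
  qed
  from dir_derivI[OF this] show ?thesis by simp
 qed
 obtain c1 u1 where 1: "c1 \<ge> 1" "u1 \<in> V" "p u1 \<le> 1" "u = c1 *\<^sub>R u1" by (rule normalize[OF u])
 obtain c2 v1 where 2: "c2 \<ge> 1" "v1 \<in> V" "p v1 \<le> 1" "v = c2 *\<^sub>R v1" by (rule normalize[OF v])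
 define c where "c = c1 * c2"
 have c: "c > 0" using 1 2 by (simp add: c_def)
 have e: "u = c *\<^sub>R ((1 / c2) *\<^sub>R u1)" "v = c *\<^sub>R ((1 / c1) *\<^sub>R v1)" using 1 2 by (auto simp: c_def)
 have pu: "p ((1 / c2) *\<^sub>R u1) \<le> 1" "p ((1 / c1) *\<^sub>R v1) \<le> 1"
  using 1 2 by (auto simp: p_scale)
 have "dir_deriv \<phi> (u + v) x = dir_deriv \<phi> (c *\<^sub>R ((1 / c2) *\<^sub>R u1 + (1 / c1) *\<^sub>R v1)) x"
  by (subst e(1), subst e(2)) (simp only: scaleR_add_right)
 also have "... = of_real c * (dir_deriv \<phi> ((1 / c2) *\<^sub>R u1) x + dir_deriv \<phi> ((1 / c1) *\<^sub>R v1) x)"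
  using 1 2 pu by (subst dir_deriv_scale[OF U x \<phi>]) (auto simp: unit)
 also have "... = dir_deriv \<phi> u x + dir_deriv \<phi> v x"
 proof -
  have "dir_deriv \<phi> u x = of_real c * dir_deriv \<phi> ((1 / c2) *\<^sub>R u1) x"
   by (subst e(1), rule dir_deriv_scale[OF U x \<phi>]) (use 1 in simp)
  moreover have "dir_deriv \<phi> v x = of_real c * dir_deriv \<phi> ((1 / c1) *\<^sub>R v1) x"
   by (subst e(2), rule dir_deriv_scale[OF U x \<phi>]) (use 2 in simp)
  ultimately show ?thesis by (simp only: distrib_left)
 qed
 finally show ?thesis .
qed

text \<open>Up to normalisation of directions, the points \<open>x + s (u + j v)\<close> with
  \<open>j = 0, ..., m\<close> are reached in two ways: from \<open>x\<close> in direction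
  \<open>u + j v\<close>, and from \<open>y = x + s u\<close> in direction \<open>v\<close> with
  step \<open>j s\<close>. The differentiation weights extract \<open>s\<close> times the derivative
  at \<open>y\<close> from the second expansions; from the first they produce a polynomial in
  \<open>s\<close> with coefficients at \<open>x\<close>. Division by \<open>s\<close> costs one
  order, hence \<open>m = n + 1\<close>.\<close>

lemma uniform_taylor_dir_deriv:
 assumes U: "uniform_taylor \<F>" and R: "R \<ge> 1"
 shows "uniform_taylor {dir_deriv \<phi> v |\<phi> v. \<phi> \<in> \<F> \<and> v \<in> V \<and> p v \<le> R}"
 unfolding uniform_taylor_def
proof (intro ballI allI)
 fix x0 and n :: nat assume x0: "x0 \<in> W"
 define m where "m = n + 1"
 obtain \<delta> C where d: "\<delta> > 0" "C \<ge> 0" "\<And>\<phi> x u. \<phi> \<in> \<F> ==> x \<in> V ==> u \<in> V ==> p (x - x0) < \<delta> ==> p u \<le> 1 ==> \<exists>a. expansion \<phi> m \<delta> C x u a"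
  by (rule uniform_taylorE[OF U x0, of m]) blast
 obtain wt :: "nat => real" where wt: "\<And>i. i \<le> m ==> (\<Sum>j\<le>m. wt j * real j ^ i) = (if i = 1 then 1 else 0)"
  by (rule lagrange_derivative_weights) blast
 \<comment> \<open>Large enough to put all directions \<open>(u + j v) / c\<close> into the unit
   ball.\<close>
 define c where "c = 1 + m * R"
 have c: "c \<ge> 1" using R by (simp add: c_def)
 define \<delta>' where "\<delta>' = \<delta> / (2 * c)"
 have \<delta>': "\<delta>' > 0" "\<delta>' \<le> \<delta> / 2" "c * \<delta>' < \<delta>" using d c by (auto simp: \<delta>'_def field_simps)
 define \<Lambda> where "\<Lambda> = (\<Sum>j\<le>m. \<bar>wt j\<bar>)"
 define C' where "C' = \<Lambda> * (2 * C * c ^ (m + 1))"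
 have C': "C' \<ge> 0" using d c by (auto simp: C'_def \<Lambda>_def intro!: mult_nonneg_nonneg sum_nonneg)
 show "\<exists>\<delta>>0. \<exists>C\<ge>0. \<forall>\<psi>\<in>{dir_deriv \<phi> v |\<phi> v. \<phi> \<in> \<F> \<and> v \<in> V \<and> p v \<le> R}. \<forall>x\<in>V. \<forall>u\<in>V. p (x - x0) < \<delta> --> p u \<le> 1 --> (\<exists>a. expansion \<psi> n \<delta> C x u a)"
 proof (rule exI[of _ \<delta>'], intro conjI \<delta>'(1) exI[of _ C'] C' ballI impI)
  fix \<psi> x u assume "\<psi> \<in> {dir_deriv \<phi> v |\<phi> v. \<phi> \<in> \<F> \<and> v \<in> V \<and> p v \<le> R}" and x: "x \<in> V" "p (x - x0) < \<delta>'" and u: "u \<in> V" "p u \<le> 1"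
  then obtain \<phi> v where \<psi>: "\<psi> = dir_deriv \<phi> v" and \<phi>: "\<phi> \<in> \<F>" and v: "v \<in> V" "p v \<le> R" by blast
  have xd: "p (x - x0) < \<delta>" using x \<delta>' d by simp
  define w where "w j = (1 / c) *\<^sub>R (u + real j *\<^sub>R v)" for j :: nat
  have w: "w j \<in> V" "p (w j) \<le> 1" if "j \<le> m" for j
  proof -
   have "real j * p v \<le> m * R" using that v p_ge[OF v(1)] R by (intro mult_mono) auto
   then have "p (u + real j *\<^sub>R v) \<le> c" using p_tri[of u "real j *\<^sub>R v"] u v by (simp add: p_scale c_def)
   then have "(1 / c) * p (u + real j *\<^sub>R v) \<le> (1 / c) * c" using c by (intro mult_left_mono) auto
   then show "p (w j) \<le> 1" using u v c by (simp add: w_def p_scale)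
   show "w j \<in> V" using u v by (simp add: w_def)
  qed
  have "\<forall>j. \<exists>a. j \<le> m --> expansion \<phi> m \<delta> C x (w j) a" using d(3)[OF \<phi> x(1) w(1) xd w(2)] by blast
  from choice[OF this] obtain a where a: "\<And>j. j \<le> m ==> expansion \<phi> m \<delta> C x (w j) (a j)" by blast
  have ab: "cmod (\<phi> (x + s *\<^sub>R w j) - (\<Sum>k\<le>m. a j k * of_real s ^ k)) \<le> C * \<bar>s\<bar> ^ (m + 1)" if "j \<le> m" "\<bar>s\<bar> < \<delta>" for j s
   using a[OF that(1)] that(2) unfolding expansion_def by blast
  have xW: "x + s *\<^sub>R u \<in> W" if "\<bar>s\<bar> < \<delta>" for s
   using d(3)[OF \<phi> x(1) u(1) xd u(2)] that unfolding expansion_def by blast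
  have xW0: "x \<in> W" using xW[of 0] d by simp
  have a0: "a j 0 = \<phi> x" and a1: "a j 1 = dir_deriv \<phi> (w j) x" if "j \<le> m" for j
   using taylor_first_coeffs(1,3)[OF d(1) _ ab[OF that]] by (auto simp: m_def)
  \<comment> \<open>Coefficients of the combined expansion at \<open>x\<close>. That
    \<open>D 0\<close> vanishes permits the division by \<open>s\<close>, and \<open>D 1\<close> is
    the value of the new expansion at \<open>s = 0\<close>.\<close>
  define D where "D k = (\<Sum>j\<le>m. of_real (wt j) * (a j k * of_real c ^ k))" for k
  have sum1: "(\<Sum>j\<le>m. complex_of_real (wt j) * of_real (real j) ^ i) = (if i = 1 then 1 else 0)" if "i \<le> m" for i
   using arg_cong[OF wt[OF that], of complex_of_real] by simp
  have D0: "D 0 = 0"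
  proof -
   have "D 0 = (\<Sum>j\<le>m. complex_of_real (wt j) * of_real (real j) ^ 0) * \<phi> x"
    unfolding D_def sum_distrib_right by (intro sum.cong refl) (simp add: a0)
   then show ?thesis using sum1[of 0] by simp
  qed
  have D1: "D 1 = dir_deriv \<phi> v x"
  proof -
   have "D 1 = (\<Sum>j\<le>m. of_real (wt j) * (dir_deriv \<phi> u x + of_real (real j) * dir_deriv \<phi> v x))"
    unfolding D_def
   proof (intro sum.cong refl)
    fix j assume "j \<in> {..m}"
    then have j: "j \<le> m" by simp
    have "c *\<^sub>R w j = u + real j *\<^sub>R v" using c by (simp add: w_def)
    then have "of_real c * dir_deriv \<phi> (w j) x = dir_deriv \<phi> (u + real j *\<^sub>R v) x"
     using dir_deriv_scale[OF U xW0 \<phi> w(1)[OF j], of c] by simp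
    also have "... = dir_deriv \<phi> u x + of_real (real j) * dir_deriv \<phi> v x"
     using dir_deriv_add[OF U xW0 \<phi> u(1) V_ops(2)[OF v(1)]] dir_deriv_scale[OF U xW0 \<phi> v(1)] by simp
    finally show "of_real (wt j) * (a j 1 * of_real c ^ 1) = of_real (wt j) * (dir_deriv \<phi> u x + of_real (real j) * dir_deriv \<phi> v x)"
     by (simp only: a1[OF j] power_one_right mult.commute[of _ "of_real c"])
   qed
   also have "... = (\<Sum>j\<le>m. complex_of_real (wt j) * of_real (real j) ^ 0) * dir_deriv \<phi> u x + (\<Sum>j\<le>m. complex_of_real (wt j) * of_real (real j) ^ 1) * dir_deriv \<phi> v x"
    unfolding sum_distrib_right sum.distrib[symmetric] by (intro sum.cong refl) (simp add: algebra_simps)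
   also have "... = dir_deriv \<phi> v x" using sum1[of 0] sum1[of 1] by (simp add: m_def)
   finally show ?thesis .
  qed
  have "expansion \<psi> n \<delta>' C' x u (\<lambda>k. D (Suc k))"
   unfolding expansion_def
  proof (intro allI impI conjI)
   fix s :: real assume s: "\<bar>s\<bar> < \<delta>'"
   then have sd: "\<bar>s\<bar> < \<delta>" using \<delta>' d by linarith
   show yW: "x + s *\<^sub>R u \<in> W" by (rule xW[OF sd])
   show "cmod (\<psi> (x + s *\<^sub>R u) - (\<Sum>k\<le>n. D (Suc k) * of_real s ^ k)) \<le> C' * \<bar>s\<bar> ^ (n + 1)"
   proof (cases "s = 0")
    case True
    have "(\<Sum>k\<le>n. D (Suc k) * 0 ^ k) = D 1" by (subst sum.atMost_shift) simp
    then show ?thesis using True D1 by (simp add: \<psi>)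
   next
    case False
    let ?y = "x + s *\<^sub>R u"
    have cs: "\<bar>c * s\<bar> < \<delta>"
    proof -
     have "\<bar>c * s\<bar> \<le> c * \<delta>'" using s c by (simp add: abs_mult mult_left_mono)
     then show ?thesis using \<delta>' by simp
    qed
    have y: "?y \<in> V" using x u by simp
    have "p (?y - x0) \<le> p (x - x0) + \<bar>s\<bar> * p u" using p_dist[OF y x(1) W_V[OF x0]] u by (simp add: p_scale)
    also have "\<bar>s\<bar> * p u \<le> \<bar>s\<bar> * 1" using u by (intro mult_left_mono) auto
    finally have yd: "p (?y - x0) < \<delta>" using x s \<delta>' by simp
    define v1 where "v1 = (1 / R) *\<^sub>R v"
    have v1: "v1 \<in> V" "p v1 \<le> 1" "R *\<^sub>R v1 = v" using v R by (auto simp: v1_def p_scale field_simps)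
    obtain b where b: "expansion \<phi> m \<delta> C ?y v1 b" using d(3)[OF \<phi> y v1(1) yd v1(2)] by blast
    have bb: "cmod (\<phi> (?y + t *\<^sub>R v1) - (\<Sum>k\<le>m. b k * of_real t ^ k)) \<le> C * \<bar>t\<bar> ^ (m + 1)" if "\<bar>t\<bar> < \<delta>" for t
     using b that unfolding expansion_def by blast
    have b1: "b 1 = dir_deriv \<phi> v1 ?y" using taylor_first_coeffs(3)[OF d(1) _ bb] by (simp add: m_def)
    have Rb: "of_real R * b 1 = dir_deriv \<phi> v ?y" using dir_deriv_scale[OF U yW \<phi> v1(1), of R] v1(3) b1 by simp
    have each: "cmod ((\<Sum>k\<le>m. b k * of_real (R * real j * s) ^ k) - (\<Sum>k\<le>m. a j k * of_real (c * s) ^ k)) \<le> 2 * C * c ^ (m + 1) * \<bar>s\<bar> ^ (m + 1)"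
     if j: "j \<le> m" for j
    proof -
     have "real j * R \<le> m * R" using j R by (intro mult_right_mono) auto
     then have Rj: "R * real j \<le> c" unfolding c_def mult.commute[of R] by linarith
     have Rj0: "R * real j \<ge> 0" using R by simp
     have Rjs: "\<bar>R * real j * s\<bar> \<le> c * \<bar>s\<bar>"
      using Rj0 mult_right_mono[OF Rj abs_ge_zero[of s]] by (simp only: abs_mult[of "R * real j" s] abs_of_nonneg)
     also have "... = \<bar>c * s\<bar>" using c by (simp add: abs_mult)
     finally have Rjs': "\<bar>R * real j * s\<bar> < \<delta>" using cs by linarith
     have pt: "x + (c * s) *\<^sub>R w j = ?y + (R * real j * s) *\<^sub>R v1"
     proof -
      have "(c * s) *\<^sub>R w j = s *\<^sub>R u + (s * real j) *\<^sub>R v" using c by (simp add: w_def scaleR_add_right)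
      moreover have "(R * real j * s) *\<^sub>R v1 = (s * real j) *\<^sub>R v" using R by (simp add: v1_def)
      ultimately show ?thesis by simp
     qed
     have 1: "cmod (\<phi> (?y + (R * real j * s) *\<^sub>R v1) - (\<Sum>k\<le>m. b k * of_real (R * real j * s) ^ k)) \<le> C * (c * \<bar>s\<bar>) ^ (m + 1)"
      by (rule order_trans[OF bb[OF Rjs'] mult_left_mono[OF power_mono[OF Rjs abs_ge_zero] d(2)]])
     have 2: "cmod (\<phi> (?y + (R * real j * s) *\<^sub>R v1) - (\<Sum>k\<le>m. a j k * of_real (c * s) ^ k)) \<le> C * (c * \<bar>s\<bar>) ^ (m + 1)"
      using ab[OF j cs] c unfolding pt by (simp add: abs_mult)
     have "cmod ((\<phi> (?y + (R * real j * s) *\<^sub>R v1) - (\<Sum>k\<le>m. a j k * of_real (c * s) ^ k)) - (\<phi> (?y + (R * real j * s) *\<^sub>R v1) - (\<Sum>k\<le>m. b k * of_real (R * real j * s) ^ k))) \<le> C * (c * \<bar>s\<bar>) ^ (m + 1) + C * (c * \<bar>s\<bar>) ^ (m + 1)"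
      by (rule order_trans[OF norm_triangle_ineq4 add_mono[OF 2 1]])
     then show ?thesis by (simp add: power_mult_distrib mult_ac)
    qed
    have "(\<Sum>j\<le>m. of_real (wt j) * (\<Sum>k\<le>m. b k * of_real (R * real j * s) ^ k)) = of_real s * dir_deriv \<phi> v ?y"
    proof -
     have "(\<Sum>j\<le>m. of_real (wt j) * (\<Sum>k\<le>m. b k * of_real (R * real j * s) ^ k))
      = (\<Sum>k\<le>m. b k * of_real (R * s) ^ k * (\<Sum>j\<le>m. of_real (wt j) * of_real (real j) ^ k))"
      unfolding sum_distrib_left by (subst sum.swap) (intro sum.cong refl, simp add: power_mult_distrib mult_ac)
     also have "... = (\<Sum>k\<le>m. if k = 1 then b 1 * of_real (R * s) else 0)"
      by (intro sum.cong refl) (use sum1 in auto)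
     also have "... = of_real R * b 1 * of_real s" by (simp add: m_def)
     finally show ?thesis unfolding Rb by (simp add: mult.commute)
    qed
    moreover have "(\<Sum>j\<le>m. of_real (wt j) * (\<Sum>k\<le>m. a j k * of_real (c * s) ^ k)) = of_real s * (\<Sum>k\<le>n. D (Suc k) * of_real s ^ k)"
    proof -
     have "(\<Sum>j\<le>m. of_real (wt j) * (\<Sum>k\<le>m. a j k * of_real (c * s) ^ k)) = (\<Sum>k\<le>m. D k * of_real s ^ k)"
      unfolding sum_distrib_left D_def sum_distrib_right by (subst sum.swap) (intro sum.cong refl, simp add: power_mult_distrib mult_ac)
     also have "... = D 0 + (\<Sum>k<m. D (Suc k) * of_real s ^ Suc k)" by (subst sum.atMost_shift) simp
     also have "... = of_real s * (\<Sum>k\<le>n. D (Suc k) * of_real s ^ k)"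
      by (simp add: D0 m_def lessThan_Suc_atMost sum_distrib_left mult_ac)
     finally show ?thesis .
    qed
    ultimately have "of_real s * (\<psi> ?y - (\<Sum>k\<le>n. D (Suc k) * of_real s ^ k))
     = (\<Sum>j\<le>m. of_real (wt j) * ((\<Sum>k\<le>m. b k * of_real (R * real j * s) ^ k) - (\<Sum>k\<le>m. a j k * of_real (c * s) ^ k)))"
     unfolding \<psi> right_diff_distrib sum_subtractf by simp
    then have "cmod (of_real s * (\<psi> ?y - (\<Sum>k\<le>n. D (Suc k) * of_real s ^ k))) \<le> (\<Sum>j\<le>m. \<bar>wt j\<bar> * (2 * C * c ^ (m + 1) * \<bar>s\<bar> ^ (m + 1)))"
     by (simp only:) (intro sum_norm_le, simp only: norm_mult norm_of_real, intro mult_left_mono each, auto)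
    also have "... = \<Lambda> * (2 * C * c ^ (m + 1) * \<bar>s\<bar> ^ (m + 1))" unfolding \<Lambda>_def by (rule sum_distrib_right[symmetric])
    also have "... = \<bar>s\<bar> * (C' * \<bar>s\<bar> ^ (n + 1))" by (simp add: C'_def m_def mult_ac)
    finally have "\<bar>s\<bar> * cmod (\<psi> ?y - (\<Sum>k\<le>n. D (Suc k) * of_real s ^ k)) \<le> \<bar>s\<bar> * (C' * \<bar>s\<bar> ^ (n + 1))" by (simp only: norm_mult norm_of_real)
    moreover have "0 < \<bar>s\<bar>" using False by simp
    ultimately show ?thesis by (simp only: mult_le_cancel_left_pos)
   qed
  qed
  then show "\<exists>a. expansion \<psi> n \<delta>' C' x u a" by blast
 qed
qed

end

text \<open>The head of the list is the direction of the last differentiation, as in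
  \<open>frechet_derivs\<close>, where the increment is put in front.\<close>

primrec iter_deriv :: "('v::real_vector => complex) => 'v list => 'v => complex" where
 "iter_deriv f [] = f"
| "iter_deriv f (v # vs) = dir_deriv (iter_deriv f vs) v"

lemma op_norm_leI:
 assumes "\<And>vs. length vs = k ==> (\<forall>v\<in>set vs. v \<in> V \<and> p v \<le> 1) ==> cmod (T vs) \<le> c"
 shows "op_norm V p k T \<le> ennreal c"
 unfolding op_norm_def by (intro SUP_least ennreal_leI) (use assms in blast)

lemma op_normD:
 assumes "op_norm V p k T \<le> ennreal c" "c \<ge> 0" "length vs = k" "\<forall>v\<in>set vs. v \<in> V \<and> p v \<le> 1"
 shows "cmod (T vs) \<le> c"
proof -
 have "ennreal (cmod (T vs)) \<le> op_norm V p k T"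
  unfolding op_norm_def by (rule SUP_upper) (use assms in blast)
 then have "ennreal (cmod (T vs)) \<le> ennreal c" using assms(1) by (rule order_trans)
 then show ?thesis using assms(2) by (simp add: ennreal_le_iff)
qed

section \<open>Multilinearity and Frechet differentiability of iterated directional
  derivatives\<close>

context normed_open
begin

definition unit_lists :: "nat => real => 'v list set" where
 "unit_lists k R = {vs. length vs = k \<and> (\<forall>v\<in>set vs. v \<in> V \<and> p v \<le> R)}"

text \<open>Uniformity over all lists from a ball is what turns pointwise limits into limits in
  operator norm.\<close>

lemma uniform_taylor_iter:
 assumes "uniform_taylor {f}" "R \<ge> 1"
 shows "uniform_taylor (iter_deriv f ` unit_lists k R)"
proof (induction k)
 case 0
 have "iter_deriv f ` unit_lists 0 R \<subseteq> {f}" by (auto simp: unit_lists_def)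
 then show ?case by (rule uniform_taylor_subset[OF assms(1)])
next
 case (Suc k)
 show ?case
 proof (rule uniform_taylor_subset[OF uniform_taylor_dir_deriv[OF Suc assms(2)]])
  show "iter_deriv f ` unit_lists (Suc k) R \<subseteq> {dir_deriv \<phi> v |\<phi> v. \<phi> \<in> iter_deriv f ` unit_lists k R \<and> v \<in> V \<and> p v \<le> R}"
  proof
   fix \<psi> assume "\<psi> \<in> iter_deriv f ` unit_lists (Suc k) R"
   then obtain ws where ws: "\<psi> = iter_deriv f ws" "ws \<in> unit_lists (Suc k) R" by blast
   then obtain v vs where v: "ws = v # vs" unfolding unit_lists_def by (cases ws) auto
   then have "v \<in> V" "p v \<le> R" "vs \<in> unit_lists k R" using ws by (auto simp: unit_lists_def)
   then show "\<psi> \<in> {dir_deriv \<phi> v |\<phi> v. \<phi> \<in> iter_deriv f ` unit_lists k R \<and> v \<in> V \<and> p v \<le> R}"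
    using ws(1) v by auto
  qed
 qed
qed

lemma uniform_taylor_iter_single:
 assumes "uniform_taylor {f}" "set vs \<subseteq> V"
 shows "uniform_taylor {iter_deriv f vs}"
 using assms(2)
proof (induction vs)
 case Nil then show ?case using assms(1) by simp
next
 case (Cons v vs)
 then have U: "uniform_taylor {iter_deriv f vs}" and v: "v \<in> V" by auto
 have "uniform_taylor {dir_deriv \<phi> w |\<phi> w. \<phi> \<in> {iter_deriv f vs} \<and> w \<in> V \<and> p w \<le> max 1 (p v)}"
  by (rule uniform_taylor_dir_deriv[OF U]) simp
 then show ?case by (rule uniform_taylor_subset) (use v in auto)
qed

lemma W_line: "x \<in> W ==> v \<in> V ==> \<forall>\<^sub>F s in at (0::real). x + s *\<^sub>R v \<in> W"
proof -
 assume x: "x \<in> W" and v: "v \<in> V"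
 obtain \<delta> where d: "\<delta> > 0" "\<And>h. h \<in> V ==> p h < \<delta> ==> x + h \<in> W" using W_open[OF x] by blast
 have pos: "\<delta> / (p v + 1) > 0" using d p_ge[OF v] by (intro divide_pos_pos) auto
 show ?thesis unfolding eventually_at
 proof (intro exI[of _ "\<delta> / (p v + 1)"] conjI pos ballI impI)
  fix s :: real assume "s \<noteq> 0 \<and> dist s 0 < \<delta> / (p v + 1)"
  then have s: "\<bar>s\<bar> < \<delta> / (p v + 1)" by simp
  have "\<bar>s\<bar> * p v \<le> \<bar>s\<bar> * (p v + 1)" by (intro mult_left_mono) auto
  also have "... < \<delta>" using s p_ge[OF v] by (simp add: pos_less_divide_eq)
  finally show "x + s *\<^sub>R v \<in> W" using d(2)[of "s *\<^sub>R v"] v by (simp add: p_scale)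
 qed
qed

lemma dir_deriv_linear_combination:
 assumes U: "uniform_taylor {\<phi>}" "uniform_taylor {\<psi>}" and x: "x \<in> W" and v: "v \<in> V"
  and eq: "\<And>y. y \<in> W ==> \<kappa> y = a *\<^sub>R \<phi> y + b *\<^sub>R \<psi> y"
 shows "dir_deriv \<kappa> v x = a *\<^sub>R dir_deriv \<phi> v x + b *\<^sub>R dir_deriv \<psi> v x"
proof (rule dir_derivI)
 have "((\<lambda>s. a *\<^sub>R ((\<phi> (x + s *\<^sub>R v) - \<phi> x) / of_real s) + b *\<^sub>R ((\<psi> (x + s *\<^sub>R v) - \<psi> x) / of_real s)) \<longlongrightarrow> a *\<^sub>R dir_deriv \<phi> v x + b *\<^sub>R dir_deriv \<psi> v x) (at 0)"
  by (intro tendsto_add tendsto_scaleR tendsto_const dir_deriv_tendsto[OF U(1) x _ v] dir_deriv_tendsto[OF U(2) x _ v]) auto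
 then show "((\<lambda>s. (\<kappa> (x + s *\<^sub>R v) - \<kappa> x) / of_real s) \<longlongrightarrow> a *\<^sub>R dir_deriv \<phi> v x + b *\<^sub>R dir_deriv \<psi> v x) (at 0)"
 proof (rule Lim_transform_eventually[OF _ eventually_mono[OF W_line[OF x v]]])
  fix s :: real assume "x + s *\<^sub>R v \<in> W"
  then show "a *\<^sub>R ((\<phi> (x + s *\<^sub>R v) - \<phi> x) / of_real s) + b *\<^sub>R ((\<psi> (x + s *\<^sub>R v) - \<psi> x) / of_real s) = (\<kappa> (x + s *\<^sub>R v) - \<kappa> x) / of_real s"
   using eq x by (simp add: scaleR_conv_of_real diff_divide_distrib add_divide_distrib right_diff_distrib)
 qed
qed

text \<open>In the head this is additivity and homogeneity of directional derivatives. In a later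
  slot the linear relation holds on the whole open set \<open>W\<close> and can be
  differentiated.\<close>

lemma iter_deriv_multilinear:
 assumes U: "uniform_taylor {f}" and vs: "set vs \<subseteq> V" and i: "i < length vs" and u: "u \<in> V" "w \<in> V" and x: "x \<in> W"
 shows "iter_deriv f (vs[i := a *\<^sub>R u + b *\<^sub>R w]) x = a *\<^sub>R iter_deriv f (vs[i := u]) x + b *\<^sub>R iter_deriv f (vs[i := w]) x"
 using vs i x
proof (induction vs arbitrary: i x)
 case (Cons v vs)
 have U': "uniform_taylor {iter_deriv f vs}" using uniform_taylor_iter_single[OF U] Cons.prems by simp
 show ?case
 proof (cases i)
  case 0
  have s: "dir_deriv (iter_deriv f vs) (c *\<^sub>R z) x = of_real c * dir_deriv (iter_deriv f vs) z x" if "z \<in> V" for c z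
   by (rule dir_deriv_scale[OF U' Cons.prems(3) _ that]) simp
  have "dir_deriv (iter_deriv f vs) (a *\<^sub>R u + b *\<^sub>R w) x = dir_deriv (iter_deriv f vs) (a *\<^sub>R u) x + dir_deriv (iter_deriv f vs) (b *\<^sub>R w) x"
   by (rule dir_deriv_add[OF U' Cons.prems(3)]) (use u in auto)
  then show ?thesis using 0 u by (simp add: s scaleR_conv_of_real)
 next
  case (Suc k)
  have V1: "set (vs[k := u]) \<subseteq> V" "set (vs[k := w]) \<subseteq> V"
   using Cons.prems u set_update_subset_insert[of vs k] by fastforce+
  have "dir_deriv (iter_deriv f (vs[k := a *\<^sub>R u + b *\<^sub>R w])) v x = a *\<^sub>R dir_deriv (iter_deriv f (vs[k := u])) v x + b *\<^sub>R dir_deriv (iter_deriv f (vs[k := w])) v x"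
  proof (rule dir_deriv_linear_combination[OF uniform_taylor_iter_single[OF U V1(1)] uniform_taylor_iter_single[OF U V1(2)] Cons.prems(3)])
   show "v \<in> V" using Cons.prems by simp
   fix y assume "y \<in> W"
   then show "iter_deriv f (vs[k := a *\<^sub>R u + b *\<^sub>R w]) y = a *\<^sub>R iter_deriv f (vs[k := u]) y + b *\<^sub>R iter_deriv f (vs[k := w]) y"
    using Cons.prems Suc by (intro Cons.IH) auto
  qed
  then show ?thesis using Suc by simp
 qed
qed simp

lemma iter_deriv_bounded:
 assumes U: "uniform_taylor {f}" and x: "x \<in> W"
 shows "\<exists>C\<ge>0. \<forall>vs\<in>unit_lists k 1. cmod (iter_deriv f vs x) \<le> C"
proof (cases k)
 case 0
 then show ?thesis by (intro exI[of _ "cmod (f x)"]) (auto simp: unit_lists_def)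
next
 case (Suc k)
 obtain C where C: "C \<ge> 0" "\<And>\<phi> u. \<phi> \<in> iter_deriv f ` unit_lists k 1 ==> u \<in> V ==> p u \<le> 1 ==> cmod (dir_deriv \<phi> u x) \<le> C"
  by (rule uniform_dir_deriv_bound[OF uniform_taylor_iter[OF U, of 1 k] x]) auto
 have "cmod (iter_deriv f ws x) \<le> C" if ws: "ws \<in> unit_lists (Suc k) 1" for ws
 proof -
  obtain v vs where v: "ws = v # vs" using ws unfolding unit_lists_def by (cases ws) auto
  then have "v \<in> V" "p v \<le> 1" "vs \<in> unit_lists k 1" using ws by (auto simp: unit_lists_def)
  then show ?thesis using C(2)[of "iter_deriv f vs" v] v by auto
 qed
 then show ?thesis using C(1) Suc by blast
qed

text \<open>The first-order error \<open>K s^2\<close> is the same for all unit argument lists and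
  all unit directions, so it bounds the operator norm of the remainder by
  \<open>K (p h)^2\<close>.\<close>

theorem uniform_taylor_imp_frechet_derivs:
 assumes U: "uniform_taylor {f}"
 shows "frechet_derivs V p W f (\<lambda>k x vs. iter_deriv f vs x)"
 unfolding frechet_derivs_def
proof (intro conjI allI ballI impI)
 show "iter_deriv f [] x = f x" for x by simp
 fix k and x assume x: "x \<in> W"
 show "multilinear_on V k (\<lambda>vs. iter_deriv f vs x)"
  unfolding multilinear_on_def using iter_deriv_multilinear[OF U _ _ _ _ x] by blast
 obtain C where C: "C \<ge> 0" "\<forall>vs\<in>unit_lists k 1. cmod (iter_deriv f vs x) \<le> C" using iter_deriv_bounded[OF U x] by blast
 have "op_norm V p k (\<lambda>vs. iter_deriv f vs x) \<le> ennreal C"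
  by (rule op_norm_leI) (use C in \<open>auto simp: unit_lists_def\<close>)
 then show "op_norm V p k (\<lambda>vs. iter_deriv f vs x) < \<infinity>" using le_less_trans by fastforce
 fix \<epsilon> :: real assume \<epsilon>: "\<epsilon> > 0"
 have xV: "x \<in> V" using x W_V by blast
 have Uk: "uniform_taylor (iter_deriv f ` unit_lists k 1)" by (rule uniform_taylor_iter[OF U]) simp
 obtain \<delta> K where d: "\<delta> > 0" "K \<ge> 0" "\<And>\<phi> y u s. \<phi> \<in> iter_deriv f ` unit_lists k 1 ==> y \<in> V ==> u \<in> V ==> p (y - x) < \<delta> ==> p u \<le> 1 ==> \<bar>s\<bar> < \<delta> ==>
   y + s *\<^sub>R u \<in> W \<and> cmod (\<phi> (y + s *\<^sub>R u) - \<phi> y - of_real s * dir_deriv \<phi> u y) \<le> K * s\<^sup>2"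
  by (rule uniform_first_order[OF Uk x]) blast
 define \<delta>' where "\<delta>' = min \<delta> (\<epsilon> / (K + 1))"
 have \<delta>': "\<delta>' > 0" using d \<epsilon> by (simp add: \<delta>'_def)
 show "\<exists>\<delta>>0. \<forall>h\<in>V. p h < \<delta> --> x + h \<in> W -->
    op_norm V p k (\<lambda>vs. iter_deriv f vs (x + h) - iter_deriv f vs x - iter_deriv f (h # vs) x) \<le> ennreal (\<epsilon> * p h)"
 proof (intro exI[of _ \<delta>'] conjI \<delta>' ballI impI op_norm_leI)
  fix h vs assume h: "h \<in> V" "p h < \<delta>'" and vs: "length vs = k" "\<forall>v\<in>set vs. v \<in> V \<and> p v \<le> 1"
  have vs': "iter_deriv f vs \<in> iter_deriv f ` unit_lists k 1" using vs by (auto simp: unit_lists_def)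
  define t where "t = p h"
  have t0: "t \<ge> 0" using p_ge[OF h(1)] by (simp add: t_def)
  define u where "u = (1 / t) *\<^sub>R h"
  have hu: "h = t *\<^sub>R u"
  proof (cases "t = 0")
   case True then show ?thesis using p_0[OF h(1)] by (simp add: t_def)
  qed (simp add: u_def)
  have u: "u \<in> V" "p u \<le> 1" using h t0 by (auto simp: u_def p_scale t_def)
  have t: "\<bar>t\<bar> < \<delta>" "t \<le> \<epsilon> / (K + 1)" using h t0 by (auto simp: \<delta>'_def t_def)
  have dh: "iter_deriv f (h # vs) x = of_real t * dir_deriv (iter_deriv f vs) u x"
   unfolding iter_deriv.simps by (subst hu) (rule dir_deriv_scale[OF Uk x vs' u(1)])
  have "cmod (iter_deriv f vs (x + h) - iter_deriv f vs x - iter_deriv f (h # vs) x) \<le> K * t\<^sup>2"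
   using d(3)[OF vs' xV u(1) _ u(2) t(1)] d(1) unfolding dh by (subst hu) simp
  also have "... \<le> (K + 1) * t * t" using t0 by (simp add: power2_eq_square algebra_simps)
  also have "... \<le> \<epsilon> * t"
  proof (rule mult_right_mono[OF _ t0])
   show "(K + 1) * t \<le> \<epsilon>" using t(2) d(2) by (simp add: pos_le_divide_eq mult.commute)
  qed
  finally show "cmod (iter_deriv f vs (x + h) - iter_deriv f vs x - iter_deriv f (h # vs) x) \<le> \<epsilon> * p h" by (simp add: t_def)
 qed
qed

lemma frechet_line_derivative:
 assumes D: "frechet_derivs V p W g D" and y: "y \<in> W" and v: "v \<in> V" and ws: "length ws = k" "\<forall>v\<in>set ws. v \<in> V \<and> p v \<le> 1"
 shows "((\<lambda>h. D k (y + h *\<^sub>R v) ws) has_vector_derivative D (Suc k) y (v # ws)) (at 0)"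
proof -
 have ml: "multilinear_on V (Suc k) (D (Suc k) y)" using D y unfolding frechet_derivs_def by blast
 have lin: "D (Suc k) y ((h *\<^sub>R v) # ws) = h *\<^sub>R D (Suc k) y (v # ws)" for h
 proof -
  have "D (Suc k) y ((v # ws)[0 := h *\<^sub>R v + 0 *\<^sub>R v]) = h *\<^sub>R D (Suc k) y ((v # ws)[0 := v]) + 0 *\<^sub>R D (Suc k) y ((v # ws)[0 := v])"
   using ml[unfolded multilinear_on_def, rule_format, of "v # ws" 0 v v h 0] ws v by (auto simp: subset_iff)
  then show ?thesis by simp
 qed
 have pv: "p v \<ge> 0" by (rule p_ge[OF v])
 show ?thesis unfolding has_vector_derivative_def has_derivative_at_within
 proof (intro conjI)
  show "bounded_linear (\<lambda>x. x *\<^sub>R D (Suc k) y (v # ws))" by (rule bounded_linear_scaleR_left)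
  have "\<forall>\<^sub>F h in at 0. cmod ((D k (y + h *\<^sub>R v) ws - D k y ws - h *\<^sub>R D (Suc k) y (v # ws)) /\<^sub>R \<bar>h\<bar>) < e" if e: "e > 0" for e
  proof -
   define \<epsilon> where "\<epsilon> = e / (2 * (p v + 1))"
   have \<epsilon>: "\<epsilon> > 0" using e pv by (simp add: \<epsilon>_def)
   obtain \<delta> where d: "\<delta> > 0" "\<And>h. h \<in> V ==> p h < \<delta> ==> y + h \<in> W ==> op_norm V p k (\<lambda>vs. D k (y + h) vs - D k y vs - D (Suc k) y (h # vs)) \<le> ennreal (\<epsilon> * p h)"
    using D y \<epsilon> unfolding frechet_derivs_def by meson
   have "\<forall>\<^sub>F h in at (0::real). \<bar>h\<bar> < \<delta> / (p v + 1)"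
    unfolding eventually_at using d pv by (intro exI[of _ "\<delta> / (p v + 1)"]) auto
   with W_line[OF y v] show ?thesis
   proof eventually_elim
    case (elim h)
    have "\<bar>h\<bar> * p v \<le> \<bar>h\<bar> * (p v + 1)" by (intro mult_left_mono) auto
    also have "... < \<delta>" using elim pv by (simp add: pos_less_divide_eq)
    finally have ph: "p (h *\<^sub>R v) < \<delta>" using v by (simp add: p_scale)
    have "cmod (D k (y + h *\<^sub>R v) ws - D k y ws - D (Suc k) y ((h *\<^sub>R v) # ws)) \<le> \<epsilon> * p (h *\<^sub>R v)"
     using op_normD[OF d(2)[OF V_ops(2)[OF v] ph elim(1)] _ ws] \<epsilon> v pv by (simp add: p_scale)
    then have b: "cmod (D k (y + h *\<^sub>R v) ws - D k y ws - h *\<^sub>R D (Suc k) y (v # ws)) \<le> \<epsilon> * (\<bar>h\<bar> * p v)"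
     unfolding lin using v by (simp add: p_scale)
    show ?case
    proof (cases "h = 0")
     case True then show ?thesis using e by simp
    next
     case False
     have "cmod ((D k (y + h *\<^sub>R v) ws - D k y ws - h *\<^sub>R D (Suc k) y (v # ws)) /\<^sub>R \<bar>h\<bar>) \<le> (\<epsilon> * (\<bar>h\<bar> * p v)) / \<bar>h\<bar>"
      using b False by (simp add: divide_right_mono divide_inverse mult.commute)
     also have "... = \<epsilon> * p v" using False by simp
     also have "... \<le> \<epsilon> * (p v + 1)" using \<epsilon> by simp
     also have "... = e / 2"
     proof -
      have "e / (2 * P) * P = e / 2" if "P \<noteq> 0" for P :: real using that by simp
      from this[of "p v + 1"] show ?thesis using pv unfolding \<epsilon>_def by linarith
     qed
     finally show ?thesis using e by simp
    qed
   qed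
  qed
  then have "((\<lambda>h. (D k (y + h *\<^sub>R v) ws - D k y ws - h *\<^sub>R D (Suc k) y (v # ws)) /\<^sub>R \<bar>h\<bar>) \<longlongrightarrow> 0) (at 0)"
   unfolding tendsto_iff dist_norm by simp
  then show "((\<lambda>ya. (D k (y + ya *\<^sub>R v) ws - D k (y + 0 *\<^sub>R v) ws - (ya - 0) *\<^sub>R D (Suc k) y (v # ws)) /\<^sub>R norm (ya - 0)) \<longlongrightarrow> 0) (at 0)"
   by simp
 qed
qed

lemma frechet_line_derivative_at:
 assumes D: "frechet_derivs V p W g D" and y: "x + t *\<^sub>R v \<in> W" and v: "v \<in> V" and ws: "length ws = k" "\<forall>v\<in>set ws. v \<in> V \<and> p v \<le> 1"
 shows "((\<lambda>t. D k (x + t *\<^sub>R v) ws) has_vector_derivative D (Suc k) (x + t *\<^sub>R v) (v # ws)) (at t)"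
proof -
 have f: "((\<lambda>h. D k ((x + t *\<^sub>R v) + h *\<^sub>R v) ws) has_vector_derivative D (Suc k) (x + t *\<^sub>R v) (v # ws)) (at 0)"
  by (rule frechet_line_derivative[OF D y v ws])
 have s: "((\<lambda>r. r - t) has_vector_derivative 1) (at t)" by (auto intro!: derivative_eq_intros)
 have "((\<lambda>h. D k ((x + t *\<^sub>R v) + h *\<^sub>R v) ws) \<circ> (\<lambda>r. r - t) has_vector_derivative 1 *\<^sub>R D (Suc k) (x + t *\<^sub>R v) (v # ws)) (at t)"
  by (rule vector_diff_chain_at[OF s]) (use f in simp)
 then show ?thesis by (simp add: o_def scaleR_left_diff_distrib)
qed

section \<open>Finite differences, and operator norms from bounds on lines\<close>

primrec fdiff :: "real => 'v list => ('v => complex) => 'v => complex" where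
 "fdiff s [] \<phi> x = \<phi> x"
| "fdiff s (v # vs) \<phi> x = fdiff s vs \<phi> (x + s *\<^sub>R v) - fdiff s vs \<phi> x"

lemma fdiff_snoc: "fdiff s (us @ [v]) \<phi> x = fdiff s us \<phi> (x + s *\<^sub>R v) - fdiff s us \<phi> x"
proof (induction us arbitrary: x)
 case (Cons u us)
 have e: "x + s *\<^sub>R u + s *\<^sub>R v = x + s *\<^sub>R v + s *\<^sub>R u" by simp
 show ?case unfolding append_Cons fdiff.simps Cons.IH e by simp
qed simp

lemma fdiff_derivative:
 fixes s :: real
 assumes "\<And>y. y \<in> V ==> p (y - x) \<le> s * length us ==> ((\<lambda>h. \<phi> (y + h *\<^sub>R v)) has_vector_derivative \<phi>' y) (at 0)"
  "x \<in> V" "\<forall>u\<in>set us. u \<in> V \<and> p u \<le> 1" "s \<ge> 0"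
 shows "((\<lambda>h. fdiff s us \<phi> (x + h *\<^sub>R v)) has_vector_derivative fdiff s us \<phi>' x) (at 0)"
 using assms
proof (induction us arbitrary: x)
 case Nil
 then show ?case using Nil(1)[of x] by simp
next
 case (Cons u us)
 have u: "u \<in> V" "p u \<le> 1" using Cons.prems by auto
 have su: "s * p u \<le> s" using u Cons.prems by (simp add: mult_left_le)
 have "((\<lambda>h. fdiff s us \<phi> ((x + s *\<^sub>R u) + h *\<^sub>R v)) has_vector_derivative fdiff s us \<phi>' (x + s *\<^sub>R u)) (at 0)"
 proof (rule Cons.IH)
  fix y assume y: "y \<in> V" "p (y - (x + s *\<^sub>R u)) \<le> s * length us"
  have "p (y - x) \<le> p (y - (x + s *\<^sub>R u)) + s * p u"
   using p_dist[of "y" "x + s *\<^sub>R u" "x"] y u Cons.prems by (simp add: p_scale)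
  then have "p (y - x) \<le> s * length (u # us)" using y su by (simp add: algebra_simps)
  then show "((\<lambda>h. \<phi> (y + h *\<^sub>R v)) has_vector_derivative \<phi>' y) (at 0)" using Cons.prems y by blast
 qed (use Cons.prems u in auto)
 moreover have "((\<lambda>h. fdiff s us \<phi> (x + h *\<^sub>R v)) has_vector_derivative fdiff s us \<phi>' x) (at 0)"
 proof (rule Cons.IH)
  fix y assume y: "y \<in> V" "p (y - x) \<le> s * length us"
  have "s * length us \<le> s * length (u # us)" using Cons.prems by (intro mult_left_mono) auto
  then show "((\<lambda>h. \<phi> (y + h *\<^sub>R v)) has_vector_derivative \<phi>' y) (at 0)" using Cons.prems y by (meson order_trans)
 qed (use Cons.prems in auto)
 ultimately have "((\<lambda>h. fdiff s us \<phi> ((x + s *\<^sub>R u) + h *\<^sub>R v) - fdiff s us \<phi> (x + h *\<^sub>R v)) has_vector_derivative fdiff s us \<phi>' (x + s *\<^sub>R u) - fdiff s us \<phi>' x) (at 0)"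
  by (rule has_vector_derivative_diff)
 moreover have "x + s *\<^sub>R u + h *\<^sub>R v = x + h *\<^sub>R v + s *\<^sub>R u" for h by simp
 ultimately show ?case by simp
qed

text \<open>The mean value theorem, once for each direction. It requires real functions, hence the
  real part after multiplication by \<open>e\<close>, later chosen as a phase. The last entry of
  \<open>us\<close> is removed first and moves in front of \<open>ws\<close>, so the argument list
  of \<open>D\<close> keeps its order.\<close>

lemma fdiff_mean_value:
 fixes s :: real
 assumes D: "frechet_derivs V p W g D" and s: "s > 0"
  and x: "x \<in> V" "\<And>y. y \<in> V ==> p (y - x) \<le> s * length us ==> y \<in> W"
  and us: "\<forall>u\<in>set us. u \<in> V \<and> p u \<le> 1" and ws: "\<forall>v\<in>set ws. v \<in> V \<and> p v \<le> 1"
 shows "\<exists>\<xi>\<in>V. p (\<xi> - x) \<le> s * length us \<and>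
  Re (e * fdiff s us (\<lambda>y. D (length ws) y ws) x) = s ^ length us * Re (e * D (length us + length ws) \<xi> (us @ ws))"
 using us ws x
proof (induction us arbitrary: ws x rule: rev_induct)
 case Nil
 then show ?case by (intro bexI[of _ x]) auto
next
 case (snoc v us)
 have v: "v \<in> V" "p v \<le> 1" using snoc.prems by auto
 have us: "\<forall>u\<in>set us. u \<in> V \<and> p u \<le> 1" using snoc.prems by auto
 let ?n = "length ws"
 have near: "y \<in> W" if "y \<in> V" "t \<in> {0..s}" "p (y - (x + t *\<^sub>R v)) \<le> s * length us" for y and t :: real
 proof (rule snoc.prems(4)[OF that(1)])
  have "p (y - x) \<le> p (y - (x + t *\<^sub>R v)) + t * p v"
   using p_dist[of "y" "x + t *\<^sub>R v" "x"] that v snoc.prems by (simp add: p_scale)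
  moreover have "t * p v \<le> s * 1" using that v p_ge[OF v(1)] by (intro mult_mono) auto
  ultimately show "p (y - x) \<le> s * length (us @ [v])" using that by (simp add: algebra_simps)
 qed
 define \<kappa> where "\<kappa> t = Re (e * fdiff s us (\<lambda>y. D ?n y ws) (x + t *\<^sub>R v))" for t
 have "(\<kappa> has_real_derivative Re (e * fdiff s us (\<lambda>y. D (Suc ?n) y (v # ws)) (x + t *\<^sub>R v))) (at t)" if t: "t \<in> {0..s}" for t
 proof -
  have f: "((\<lambda>h. fdiff s us (\<lambda>y. D ?n y ws) ((x + t *\<^sub>R v) + h *\<^sub>R v)) has_vector_derivative fdiff s us (\<lambda>y. D (Suc ?n) y (v # ws)) (x + t *\<^sub>R v)) (at 0)"
  proof (rule fdiff_derivative[OF _ _ us])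
   fix y assume "y \<in> V" "p (y - (x + t *\<^sub>R v)) \<le> s * length us"
   then have "y \<in> W" using near t by blast
   then show "((\<lambda>h. D ?n (y + h *\<^sub>R v) ws) has_vector_derivative D (Suc ?n) y (v # ws)) (at 0)"
    by (rule frechet_line_derivative[OF D _ v(1) refl snoc.prems(2)])
  qed (use snoc.prems v s in auto)
  have sh: "((\<lambda>r. r - t) has_vector_derivative 1) (at t)" by (auto intro!: derivative_eq_intros)
  have "((\<lambda>h. fdiff s us (\<lambda>y. D ?n y ws) ((x + t *\<^sub>R v) + h *\<^sub>R v)) \<circ> (\<lambda>r. r - t) has_vector_derivative 1 *\<^sub>R fdiff s us (\<lambda>y. D (Suc ?n) y (v # ws)) (x + t *\<^sub>R v)) (at t)"
   by (rule vector_diff_chain_at[OF sh]) (use f in simp)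
  then have "((\<lambda>r. fdiff s us (\<lambda>y. D ?n y ws) (x + r *\<^sub>R v)) has_vector_derivative fdiff s us (\<lambda>y. D (Suc ?n) y (v # ws)) (x + t *\<^sub>R v)) (at t)"
   by (simp add: o_def scaleR_left_diff_distrib)
  from bounded_linear.has_vector_derivative[OF bounded_linear_compose[OF bounded_linear_Re bounded_linear_mult_right[of e]] this]
  show ?thesis unfolding \<kappa>_def has_real_derivative_iff_has_vector_derivative .
 qed
 then obtain z where z: "0 < z" "z < s" "\<kappa> s - \<kappa> 0 = (s - 0) * Re (e * fdiff s us (\<lambda>y. D (Suc ?n) y (v # ws)) (x + z *\<^sub>R v))"
  using MVT2[of 0 s \<kappa> "\<lambda>t. Re (e * fdiff s us (\<lambda>y. D (Suc ?n) y (v # ws)) (x + t *\<^sub>R v))"] s by auto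
 have zx: "x + z *\<^sub>R v \<in> V" using snoc.prems v by simp
 have zi: "z \<in> {0..s}" using z by simp
 have vws: "\<forall>w\<in>set (v # ws). w \<in> V \<and> p w \<le> 1" using v snoc.prems by auto
 obtain \<xi> where \<xi>: "\<xi> \<in> V" "p (\<xi> - (x + z *\<^sub>R v)) \<le> s * length us"
  "Re (e * fdiff s us (\<lambda>y. D (length (v # ws)) y (v # ws)) (x + z *\<^sub>R v)) = s ^ length us * Re (e * D (length us + length (v # ws)) \<xi> (us @ (v # ws)))"
  using snoc.IH[OF us vws zx near[OF _ zi]] by blast
 have "p (\<xi> - x) \<le> p (\<xi> - (x + z *\<^sub>R v)) + z * p v"
  using p_dist[of "\<xi>" "x + z *\<^sub>R v" "x"] \<xi> v snoc.prems z by (simp add: p_scale)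
 moreover have "z * p v \<le> s * 1" using z v p_ge[OF v(1)] by (intro mult_mono) auto
 ultimately have p\<xi>: "p (\<xi> - x) \<le> s * length (us @ [v])" using \<xi> by (simp add: algebra_simps)
 have "Re (e * fdiff s (us @ [v]) (\<lambda>y. D ?n y ws) x) = \<kappa> s - \<kappa> 0"
  unfolding fdiff_snoc \<kappa>_def by (simp add: right_diff_distrib)
 also have "... = s ^ length (us @ [v]) * Re (e * D (length (us @ [v]) + ?n) \<xi> ((us @ [v]) @ ws))"
  using z(3) \<xi>(3) by simp
 finally show ?case using \<xi>(1) p\<xi> by blast
qed

end

text \<open>Multiplication by a power of \<open>s\<close> shows that the constant coefficient
  vanishes, and division by \<open>s\<close> lowers the degree.\<close>

lemma leading_coefficient_limit:
 fixes r :: "nat => real"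
 assumes "((\<lambda>s. (\<Sum>i\<le>k. r i * s ^ i) / s ^ k) \<longlongrightarrow> L) (at_right 0)"
 shows "r k = L"
 using assms
proof (induction k arbitrary: r)
 case 0
 then have "((\<lambda>s::real. r 0) \<longlongrightarrow> L) (at_right 0)" by simp
 then show ?case by (simp add: tendsto_const_iff)
next
 case (Suc k)
 have ev: "\<forall>\<^sub>F s in at_right (0::real). s > 0" by (rule eventually_at_right_less)
 have "((\<lambda>s. s ^ Suc k * ((\<Sum>i\<le>Suc k. r i * s ^ i) / s ^ Suc k)) \<longlongrightarrow> 0 ^ Suc k * L) (at_right 0)"
  by (intro tendsto_intros Suc.prems)
 then have "((\<lambda>s. \<Sum>i\<le>Suc k. r i * s ^ i) \<longlongrightarrow> 0 ^ Suc k * L) (at_right 0)"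
  by (rule Lim_transform_eventually) (use ev in \<open>eventually_elim, simp\<close>)
 moreover have "((\<lambda>s. \<Sum>i\<le>Suc k. r i * s ^ i) \<longlongrightarrow> (\<Sum>i\<le>Suc k. r i * 0 ^ i)) (at_right (0::real))"
  by (intro tendsto_intros)
 ultimately have "0 ^ Suc k * L = (\<Sum>i\<le>Suc k. r i * 0 ^ i)" by (rule tendsto_unique[OF trivial_limit_at_right_real])
 moreover have "(\<Sum>i\<le>Suc k. r i * 0 ^ i) = r 0" by (subst sum.atMost_shift) simp
 ultimately have r0: "r 0 = 0" by simp
 have "((\<lambda>s. (\<Sum>i\<le>k. r (Suc i) * s ^ i) / s ^ k) \<longlongrightarrow> L) (at_right 0)"
 proof (rule Lim_transform_eventually[OF Suc.prems])
  show "\<forall>\<^sub>F s in at_right 0. (\<Sum>i\<le>Suc k. r i * s ^ i) / s ^ Suc k = (\<Sum>i\<le>k. r (Suc i) * s ^ i) / s ^ k"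
   using ev
  proof eventually_elim
   case (elim s)
   have "(\<Sum>i\<le>Suc k. r i * s ^ i) = s * (\<Sum>i\<le>k. r (Suc i) * s ^ i)"
    by (subst sum.atMost_shift) (simp add: r0 sum_distrib_left mult_ac lessThan_Suc_atMost)
   then show ?case using elim by simp
  qed
 qed
 then show ?case by (rule Suc.IH)
qed

text \<open>A single term of the exponential series:
  \<open>(k + 1)^k / k! \<le> e^(k+1)\<close>.\<close>

lemma power_le_three_power_fact: "(real k + 1) ^ k \<le> 3 * 3 ^ k * fact k"
proof -
 have "(\<lambda>n. (real k + 1) ^ n /\<^sub>R fact n) sums exp (real k + 1)" by (rule exp_converges)
 note s = this
 have "(\<Sum>n\<in>{k}. (real k + 1) ^ n /\<^sub>R fact n) \<le> (\<Sum>n. (real k + 1) ^ n /\<^sub>R fact n)"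
  by (rule sum_le_suminf[OF sums_summable[OF s]]) auto
 then have "(\<Sum>n\<in>{k}. (real k + 1) ^ n /\<^sub>R fact n) \<le> exp (real k + 1)"
  unfolding sums_unique[OF s, symmetric] .
 then have "(real k + 1) ^ k / fact k \<le> exp (real k + 1)" by (simp add: divide_inverse mult.commute)
 also have "exp (real k + 1) = exp 1 ^ (k + 1)" using exp_of_nat_mult[of "k + 1" "1::real"] by (simp add: add.commute)
 also have "... \<le> 3 ^ (k + 1)" using exp_le by (intro power_mono) auto
 finally show ?thesis by (simp add: field_simps)
qed

context normed_open
begin

text \<open>The k-fold difference is an alternating sum of \<open>2^k\<close> values
  \<open>f (x + s y)\<close>, where \<open>y\<close> is a sum of at most \<open>k\<close> unit
  vectors. By homogeneity the coefficient of \<open>s^k\<close> along such a line is at most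
  \<open>B (k + 1)^k\<close>. The difference divided by \<open>s^k\<close> tends to the derivative,
  so \<open>2^k (k + 1)^k B\<close> is a bound.\<close>

theorem frechet_derivs_bound:
 assumes D: "frechet_derivs V p W f D" and x: "x \<in> W" and B: "B \<ge> 0" and \<rho>: "\<rho> > 0"
  and exp: "\<And>u. u \<in> V ==> p u \<le> 1 ==> \<exists>a. cmod (a k) \<le> B \<and>
   (\<forall>s. \<bar>s\<bar> \<le> \<rho> --> cmod (f (x + s *\<^sub>R u) - (\<Sum>i\<le>k. a i * of_real s ^ i)) \<le> K * \<bar>s\<bar> ^ (k + 1))"
  and vs: "length vs = k" "\<forall>v\<in>set vs. v \<in> V \<and> p v \<le> 1"
 shows "cmod (D k x vs) \<le> 3 * 6 ^ k * fact k * B"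
proof -
 have xV: "x \<in> V" using x W_V by blast
 \<comment> \<open>The summand 1 covers rescaling by \<open>max 1 (p y)\<close>, which puts the
   direction into the unit ball; \<open>length us\<close> covers the vectors still to be added to
   \<open>y\<close>.\<close>
 have fd: "\<exists>c K \<delta>. \<delta> > 0 \<and> cmod (c k) \<le> 2 ^ length us * (B * (p y + 1 + length us) ^ k) \<and>
   (\<forall>s. 0 < s --> s < \<delta> --> cmod (fdiff s us f (x + s *\<^sub>R y) - (\<Sum>i\<le>k. c i * of_real s ^ i)) \<le> K * s ^ (k + 1))"
  if "\<forall>u\<in>set us. u \<in> V \<and> p u \<le> 1" "y \<in> V" for us y
  using that
 proof (induction us arbitrary: y)
  case Nil
  have y: "y \<in> V" by (rule Nil)
  define c where "c = max 1 (p y)"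
  define u where "u = (1 / c) *\<^sub>R y"
  have c: "c \<ge> 1" "c \<le> p y + 1" "p y \<le> c" using p_ge[OF y] by (auto simp: c_def)
  have u: "u \<in> V" "y = c *\<^sub>R u" using y c by (auto simp: u_def)
  have pu: "p u \<le> 1"
  proof -
   have "p u = p y / c" using y c by (simp add: u_def p_scale)
   then show ?thesis using c by simp
  qed
  obtain a where a: "cmod (a k) \<le> B" "\<And>s. \<bar>s\<bar> \<le> \<rho> ==> cmod (f (x + s *\<^sub>R u) - (\<Sum>i\<le>k. a i * of_real s ^ i)) \<le> K * \<bar>s\<bar> ^ (k + 1)"
   using exp[OF u(1) pu] by blast
  show ?case
  proof (rule exI[of _ "\<lambda>i. a i * of_real c ^ i"], rule exI[of _ "K * c ^ (k + 1)"], rule exI[of _ "\<rho> / c"], intro conjI allI impI)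
   show "\<rho> / c > 0" using \<rho> c by simp
   have "cmod (a k) * c ^ k \<le> B * (p y + 1) ^ k" using a c B by (intro mult_mono power_mono) auto
   then show "cmod (a k * of_real c ^ k) \<le> 2 ^ length [] * (B * (p y + 1 + length []) ^ k)" using c by (simp add: norm_mult norm_power)
   fix s :: real assume s: "0 < s" "s < \<rho> / c"
   have cs: "\<bar>s * c\<bar> \<le> \<rho>" using s c by (simp add: pos_less_divide_eq)
   have "cmod (f (x + (s * c) *\<^sub>R u) - (\<Sum>i\<le>k. a i * of_real (s * c) ^ i)) \<le> K * \<bar>s * c\<bar> ^ (k + 1)" by (rule a(2)[OF cs])
   moreover have "(s * c) *\<^sub>R u = s *\<^sub>R y" using u(2) by simp
   moreover have "(\<Sum>i\<le>k. a i * of_real (s * c) ^ i) = (\<Sum>i\<le>k. a i * of_real c ^ i * of_real s ^ i)"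
    by (intro sum.cong refl) (simp add: power_mult_distrib mult_ac)
   moreover have "K * \<bar>s * c\<bar> ^ (k + 1) = K * c ^ (k + 1) * s ^ (k + 1)"
   proof -
    have "\<bar>s * c\<bar> = c * s" using s c by simp
    then show ?thesis by (simp only: power_mult_distrib mult.assoc)
   qed
   ultimately show "cmod (fdiff s [] f (x + s *\<^sub>R y) - (\<Sum>i\<le>k. a i * of_real c ^ i * of_real s ^ i)) \<le> K * c ^ (k + 1) * s ^ (k + 1)"
    by (simp only: fdiff.simps)
  qed
 next
  case (Cons v us)
  have v: "v \<in> V" "p v \<le> 1" and us: "\<forall>u\<in>set us. u \<in> V \<and> p u \<le> 1" and y: "y \<in> V" using Cons.prems by auto
  obtain c1 K1 \<delta>1 where 1: "\<delta>1 > 0" "cmod (c1 k) \<le> 2 ^ length us * (B * (p (y + v) + 1 + length us) ^ k)"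
   "\<And>s. 0 < s ==> s < \<delta>1 ==> cmod (fdiff s us f (x + s *\<^sub>R (y + v)) - (\<Sum>i\<le>k. c1 i * of_real s ^ i)) \<le> K1 * s ^ (k + 1)"
   using Cons.IH[OF us V_ops(1)[OF y v(1)]] by blast
  obtain c2 K2 \<delta>2 where 2: "\<delta>2 > 0" "cmod (c2 k) \<le> 2 ^ length us * (B * (p y + 1 + length us) ^ k)"
   "\<And>s. 0 < s ==> s < \<delta>2 ==> cmod (fdiff s us f (x + s *\<^sub>R y) - (\<Sum>i\<le>k. c2 i * of_real s ^ i)) \<le> K2 * s ^ (k + 1)"
   using Cons.IH[OF us y] by blast
  define M where "M = 2 ^ length us * (B * (p y + 1 + length (v # us)) ^ k)"
  have M1: "2 ^ length us * (B * (p (y + v) + 1 + length us) ^ k) \<le> M"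
   unfolding M_def using p_tri[OF y v(1)] v p_ge[of "y + v"] y B by (intro mult_left_mono power_mono) auto
  have M2: "2 ^ length us * (B * (p y + 1 + length us) ^ k) \<le> M"
   unfolding M_def using p_ge[OF y] B by (intro mult_left_mono power_mono) auto
  show ?case
  proof (rule exI[of _ "\<lambda>i. c1 i - c2 i"], rule exI[of _ "K1 + K2"], rule exI[of _ "min \<delta>1 \<delta>2"], intro conjI allI impI)
   show "min \<delta>1 \<delta>2 > 0" using 1 2 by simp
   have "cmod (c1 k - c2 k) \<le> M + M" using norm_triangle_ineq4[of "c1 k" "c2 k"] 1(2) 2(2) M1 M2 by linarith
   then show "cmod (c1 k - c2 k) \<le> 2 ^ length (v # us) * (B * (p y + 1 + length (v # us)) ^ k)" by (simp add: M_def mult.assoc mult.left_commute)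
   fix s :: real assume s: "0 < s" "s < min \<delta>1 \<delta>2"
   have e1: "cmod (fdiff s us f (x + s *\<^sub>R y + s *\<^sub>R v) - (\<Sum>i\<le>k. c1 i * of_real s ^ i)) \<le> K1 * s ^ (k + 1)"
    using 1(3)[of s] s by (simp add: scaleR_add_right add.assoc)
   have e2: "cmod (fdiff s us f (x + s *\<^sub>R y) - (\<Sum>i\<le>k. c2 i * of_real s ^ i)) \<le> K2 * s ^ (k + 1)"
    using 2(3)[of s] s by simp
   have "(\<Sum>i\<le>k. (c1 i - c2 i) * of_real s ^ i) = (\<Sum>i\<le>k. c1 i * of_real s ^ i) - (\<Sum>i\<le>k. c2 i * of_real s ^ i)"
    by (simp add: left_diff_distrib sum_subtractf)
   then have "fdiff s (v # us) f (x + s *\<^sub>R y) - (\<Sum>i\<le>k. (c1 i - c2 i) * of_real s ^ i)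
    = (fdiff s us f (x + s *\<^sub>R y + s *\<^sub>R v) - (\<Sum>i\<le>k. c1 i * of_real s ^ i)) - (fdiff s us f (x + s *\<^sub>R y) - (\<Sum>i\<le>k. c2 i * of_real s ^ i))"
    by simp
   then have "cmod (fdiff s (v # us) f (x + s *\<^sub>R y) - (\<Sum>i\<le>k. (c1 i - c2 i) * of_real s ^ i)) \<le> K1 * s ^ (k + 1) + K2 * s ^ (k + 1)"
    by (simp only:) (rule order_trans[OF norm_triangle_ineq4 add_mono[OF e1 e2]])
   then show "cmod (fdiff s (v # us) f (x + s *\<^sub>R y) - (\<Sum>i\<le>k. (c1 i - c2 i) * of_real s ^ i)) \<le> (K1 + K2) * s ^ (k + 1)"
    by (simp only: distrib_right)
  qed
 qed
 obtain c K' \<delta> where c: "\<delta> > 0" "cmod (c k) \<le> 2 ^ length vs * (B * (p 0 + 1 + length vs) ^ k)"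
   "\<And>s. 0 < s ==> s < \<delta> ==> cmod (fdiff s vs f (x + s *\<^sub>R 0) - (\<Sum>i\<le>k. c i * of_real s ^ i)) \<le> K' * s ^ (k + 1)"
  using fd[OF vs(2) V_ops(4)] by blast
 define d where "d = D k x vs"
 \<comment> \<open>The phase that turns the derivative \<open>d\<close> into its modulus, so that
   taking real parts loses nothing.\<close>
 define e where "e = (if d = 0 then 1 else cnj d / of_real (cmod d))"
 have e1: "cmod e = 1" by (simp add: e_def norm_divide)
 have ed: "e * d = of_real (cmod d)"
 proof (cases "d = 0")
  case False
  then have "e * d = of_real ((cmod d)\<^sup>2) / of_real (cmod d)" unfolding complex_norm_square by (simp add: e_def mult.commute)
  then show ?thesis using False by (simp add: power2_eq_square)
 qed simp
 obtain \<eta> where \<eta>: "\<eta> > 0" "\<And>h. h \<in> V ==> p h < \<eta> ==> x + h \<in> W" using W_open[OF x] by blast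
 have f0: "D 0 y [] = f y" if "y \<in> W" for y using D that unfolding frechet_derivs_def by blast
 have fdeq: "fdiff s us (\<lambda>y. D (length ([]::'v list)) y []) y = fdiff s us f y"
  if "\<And>z. z \<in> V ==> p (z - y) \<le> s * length us ==> z \<in> W" "y \<in> V" "\<forall>u\<in>set us. u \<in> V \<and> p u \<le> 1" "s \<ge> 0" for us y and s :: real
  using that
 proof (induction us arbitrary: y)
  case Nil then show ?case using f0[of y] by simp
 next
  case (Cons u us)
  have u: "u \<in> V" "p u \<le> 1" using Cons.prems by auto
  have su: "s * p u \<le> s" using u Cons.prems by (simp add: mult_left_le)
  have a: "fdiff s us (\<lambda>y. D (length ([]::'v list)) y []) y = fdiff s us f y"
  proof (rule Cons.IH)
   fix z assume z: "z \<in> V" "p (z - y) \<le> s * length us"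
   have "s * length us \<le> s * length (u # us)" using Cons.prems by (intro mult_left_mono) auto
   then show "z \<in> W" using Cons.prems(1)[OF z(1)] z(2) by linarith
  qed (use Cons.prems in auto)
  have b: "fdiff s us (\<lambda>y. D (length ([]::'v list)) y []) (y + s *\<^sub>R u) = fdiff s us f (y + s *\<^sub>R u)"
  proof (rule Cons.IH)
   fix z assume z: "z \<in> V" "p (z - (y + s *\<^sub>R u)) \<le> s * length us"
   have "p (z - y) \<le> p (z - (y + s *\<^sub>R u)) + s * p u"
    using p_dist[of "z" "y + s *\<^sub>R u" "y"] z u Cons.prems by (simp add: p_scale)
   then have "p (z - y) \<le> s * length (u # us)" using z su by (simp add: algebra_simps)
   then show "z \<in> W" using Cons.prems(1)[OF z(1)] by blast
  qed (use Cons.prems u in auto)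
  show ?case using a b by simp
 qed
 \<comment> \<open>The mean value theorem gives the derivative at some point near \<open>x\<close>;
   continuity moves it to \<open>x\<close> as \<open>s\<close> tends to 0.\<close>
 have cont: "\<exists>\<delta>>0. \<forall>h\<in>V. p h < \<delta> --> cmod (D k (x + h) vs - D k x vs) \<le> \<epsilon>" if \<epsilon>: "\<epsilon> > 0" for \<epsilon>
 proof -
  obtain \<delta>1 where d1: "\<delta>1 > 0" "\<And>h. h \<in> V ==> p h < \<delta>1 ==> x + h \<in> W ==> op_norm V p k (\<lambda>vs. D k (x + h) vs - D k x vs - D (Suc k) x (h # vs)) \<le> ennreal (1 * p h)"
   using D x zero_less_one unfolding frechet_derivs_def by meson
  have fin: "op_norm V p (Suc k) (D (Suc k) x) < \<infinity>" using D x unfolding frechet_derivs_def by blast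
  then obtain C where C: "C \<ge> 0" "op_norm V p (Suc k) (D (Suc k) x) \<le> ennreal C"
   by (cases "op_norm V p (Suc k) (D (Suc k) x)") auto
  have ml: "multilinear_on V (Suc k) (D (Suc k) x)" using D x unfolding frechet_derivs_def by blast
  define \<delta>2 where "\<delta>2 = min \<eta> (min \<delta>1 (\<epsilon> / (C + 1)))"
  have \<delta>2: "\<delta>2 > 0" using d1 \<eta> \<epsilon> C by (simp add: \<delta>2_def)
  show ?thesis
  proof (intro exI[of _ \<delta>2] conjI \<delta>2 ballI impI)
   fix h assume h: "h \<in> V" "p h < \<delta>2"
   have hW: "x + h \<in> W" using \<eta>(2)[OF h(1)] h by (simp add: \<delta>2_def)
   have b1: "cmod (D k (x + h) vs - D k x vs - D (Suc k) x (h # vs)) \<le> p h"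
    using op_normD[OF d1(2)[OF h(1) _ hW] _ vs] h p_ge[OF h(1)] by (simp add: \<delta>2_def)
   have b2: "cmod (D (Suc k) x (h # vs)) \<le> C * p h"
   proof (cases "p h = 0")
    case True
    then have h0: "h = 0" using p_0 h by blast
    have "D (Suc k) x ((h # vs)[0 := 0 *\<^sub>R h + 0 *\<^sub>R h]) = 0 *\<^sub>R D (Suc k) x ((h # vs)[0 := h]) + 0 *\<^sub>R D (Suc k) x ((h # vs)[0 := h])"
     using ml[unfolded multilinear_on_def, rule_format, of "h # vs" 0 h h 0 0] vs h by (auto simp: subset_iff)
    then show ?thesis using h0 by simp
   next
    case False
    define u where "u = (1 / p h) *\<^sub>R h"
    have u: "u \<in> V" "p u \<le> 1" "h = p h *\<^sub>R u" using h False p_ge[OF h(1)] by (auto simp: u_def p_scale)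
    have "D (Suc k) x ((h # vs)[0 := p h *\<^sub>R u + 0 *\<^sub>R u]) = p h *\<^sub>R D (Suc k) x ((h # vs)[0 := u]) + 0 *\<^sub>R D (Suc k) x ((h # vs)[0 := u])"
     using ml[unfolded multilinear_on_def, rule_format, of "h # vs" 0 u u "p h" 0] vs h u(1) by (auto simp: subset_iff)
    then have "D (Suc k) x (h # vs) = p h *\<^sub>R D (Suc k) x (u # vs)" using u(3) by simp
    moreover have "cmod (D (Suc k) x (u # vs)) \<le> C" by (rule op_normD[OF C(2,1)]) (use vs u in auto)
    ultimately show ?thesis using mult_left_mono[of "cmod (D (Suc k) x (u # vs))" C "p h"] p_ge[OF h(1)] by (simp add: mult.commute)
   qed
   have "cmod (D k (x + h) vs - D k x vs) \<le> p h + C * p h"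
    using norm_triangle_ineq[of "D k (x + h) vs - D k x vs - D (Suc k) x (h # vs)" "D (Suc k) x (h # vs)"] b1 b2 by simp
   also have "... = p h * (C + 1)" by (simp add: algebra_simps)
   also have "... \<le> \<epsilon>"
   proof -
    have "p h < \<epsilon> / (C + 1)" using h by (simp add: \<delta>2_def)
    then show ?thesis using C by (simp add: pos_less_divide_eq)
   qed
   finally show "cmod (D k (x + h) vs - D k x vs) \<le> \<epsilon>" .
  qed
 qed
 define q where "q s = Re (e * fdiff s vs f x) / s ^ k" for s
 have lim: "(q \<longlongrightarrow> cmod d) (at_right 0)"
  unfolding tendsto_iff
 proof (intro allI impI)
  fix \<epsilon> :: real assume \<epsilon>: "\<epsilon> > 0"
  then obtain \<delta>3 where d3: "\<delta>3 > 0" "\<And>h. h \<in> V ==> p h < \<delta>3 ==> cmod (D k (x + h) vs - D k x vs) \<le> \<epsilon> / 2"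
   using cont[of "\<epsilon> / 2"] by auto
  define b where "b = min \<eta> \<delta>3 / (k + 1)"
  have b: "b > 0" using \<eta> d3 by (simp add: b_def)
  show "\<forall>\<^sub>F s in at_right 0. dist (q s) (cmod d) < \<epsilon>"
   unfolding eventually_at_right_field
  proof (intro exI[of _ b] conjI b allI impI)
   fix s :: real assume s: "0 < s" "s < b"
   have "s * (k + 1) < min \<eta> \<delta>3" using s(2) by (simp add: b_def pos_less_divide_eq)
   moreover have "s * k \<le> s * (k + 1)" using s by simp
   ultimately have sk: "s * k < \<eta>" "s * k < \<delta>3" by linarith+
   have W': "y \<in> W" if "y \<in> V" "p (y - x) \<le> s * length vs" for y
    using \<eta>(2)[of "y - x"] that xV sk vs by simp
   obtain \<xi> where \<xi>: "\<xi> \<in> V" "p (\<xi> - x) \<le> s * length vs"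
    "Re (e * fdiff s vs (\<lambda>y. D (length ([]::'v list)) y []) x) = s ^ length vs * Re (e * D (length vs + length ([]::'v list)) \<xi> (vs @ []))"
    using fdiff_mean_value[OF D s(1) xV W' vs(2), of "[]" e] by auto
   have "fdiff s vs (\<lambda>y. D (length ([]::'v list)) y []) x = fdiff s vs f x"
    by (rule fdeq[OF W' xV vs(2)]) (use s in auto)
   then have "Re (e * fdiff s vs f x) = s ^ k * Re (e * D k \<xi> vs)" using \<xi>(3) vs(1) by simp
   then have qs: "q s = Re (e * D k \<xi> vs)" using s by (simp add: q_def)
   have "cmod (D k (x + (\<xi> - x)) vs - D k x vs) \<le> \<epsilon> / 2"
    using \<xi> sk vs xV by (intro d3(2)) auto
   then have "cmod (D k \<xi> vs - d) \<le> \<epsilon> / 2" by (simp add: d_def)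
   then have "cmod (e * D k \<xi> vs - e * d) \<le> \<epsilon> / 2" by (simp add: right_diff_distrib[symmetric] norm_mult e1)
   then have "\<bar>Re (e * D k \<xi> vs - e * d)\<bar> \<le> \<epsilon> / 2" using abs_Re_le_cmod order_trans by blast
   then show "dist (q s) (cmod d) < \<epsilon>" using \<epsilon> by (simp add: qs ed dist_real_def)
  qed
 qed
 have "((\<lambda>s. q s - (\<Sum>i\<le>k. Re (e * c i) * s ^ i) / s ^ k) \<longlongrightarrow> 0) (at_right 0)"
 proof (rule Lim_null_comparison)
  have "((\<lambda>s. K' * s) \<longlongrightarrow> K' * 0) (at_right (0::real))" by (intro tendsto_intros)
  then show "((\<lambda>s. K' * s) \<longlongrightarrow> 0) (at_right (0::real))" by simp
  show "\<forall>\<^sub>F s in at_right 0. norm (q s - (\<Sum>i\<le>k. Re (e * c i) * s ^ i) / s ^ k) \<le> K' * s"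
   unfolding eventually_at_right_field
  proof (intro exI[of _ \<delta>] conjI c(1) allI impI)
   fix s :: real assume s: "0 < s" "s < \<delta>"
   have "(\<Sum>i\<le>k. Re (e * c i) * s ^ i) = Re (e * (\<Sum>i\<le>k. c i * of_real s ^ i))"
    unfolding sum_distrib_left Re_sum by (intro sum.cong refl) (simp add: mult.assoc[symmetric] of_real_power[symmetric] del: of_real_power)
   then have "q s - (\<Sum>i\<le>k. Re (e * c i) * s ^ i) / s ^ k = Re (e * (fdiff s vs f x - (\<Sum>i\<le>k. c i * of_real s ^ i))) / s ^ k"
    by (simp add: q_def right_diff_distrib diff_divide_distrib)
   also have "\<bar>...\<bar> \<le> cmod (e * (fdiff s vs f x - (\<Sum>i\<le>k. c i * of_real s ^ i))) / s ^ k"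
   proof -
    have sk: "0 \<le> s ^ k" using s by simp
    show ?thesis unfolding abs_divide abs_of_nonneg[OF sk] by (rule divide_right_mono[OF abs_Re_le_cmod sk])
   qed
   also have "... \<le> K' * s ^ (k + 1) / s ^ k"
    using c(3)[OF s] s by (intro divide_right_mono) (auto simp: norm_mult e1)
   also have "... = K' * s" using s by simp
   finally show "norm (q s - (\<Sum>i\<le>k. Re (e * c i) * s ^ i) / s ^ k) \<le> K' * s" by simp
  qed
 qed
 from tendsto_diff[OF lim this]
 have "((\<lambda>s. (\<Sum>i\<le>k. Re (e * c i) * s ^ i) / s ^ k) \<longlongrightarrow> cmod d) (at_right 0)" by simp
 then have "Re (e * c k) = cmod d" by (rule leading_coefficient_limit)
 then have "cmod d \<le> cmod (e * c k)" using abs_Re_le_cmod[of "e * c k"] by simp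
 also have "... \<le> 2 ^ k * (B * (real k + 1) ^ k)" using c(2) vs(1) by (simp add: norm_mult e1 add.commute)
 also have "... \<le> 2 ^ k * (B * (3 * 3 ^ k * fact k))"
  using B power_le_three_power_fact by (intro mult_left_mono) auto
 also have "... = 3 * 6 ^ k * fact k * B"
 proof -
  have "(6::real) ^ k = 2 ^ k * 3 ^ k" by (simp flip: power_mult_distrib)
  then show ?thesis by simp
 qed
 finally show ?thesis by (simp add: d_def)
qed

end

section \<open>Transfer of derivative bounds on normed spaces\<close>

text \<open>What the argument consumes and produces: \<open>a\<close> bounds the derivatives of the
  powers, \<open>joris_line\<close> answers with coefficients of size \<open>joris_rate\<close>, and
  the passage from lines to operator norms costs \<open>k! 6^k\<close>. The radius \<rho> is found
  only after \<open>l\<close>, hence the quantifier over all \<rho>.\<close>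

definition transfer_weights :: "nat => (nat => real) => (nat => real) => bool" where
 "transfer_weights j a b \<longleftrightarrow> (\<exists>l A. log_convex_weight l \<and> (\<forall>k. a k \<le> A * fact k * l k) \<and>
   (\<forall>\<rho>>0. \<exists>A'. \<forall>k. fact k * 6 ^ k * joris_rate j l \<rho> k \<le> A' * b k))"

lemma frechet_smooth_frechet_deriv:
 "frechet_smooth V p W f ==> frechet_derivs V p W f (frechet_deriv V p W f)"
 unfolding frechet_smooth_def frechet_deriv_def by (erule someI_ex)

context normed_open
begin

lemma joris_lines:
 assumes j: "j \<ge> 1" and DG: "frechet_derivs V p W (\<lambda>x. f x ^ j) DG" and DH: "frechet_derivs V p W (\<lambda>x. f x ^ (j + 1)) DH"
  and r: "r > 0" and l: "log_convex_weight l" and A: "A \<ge> 1" and NV: "N \<subseteq> V"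
  and nb: "\<And>x u s. x \<in> N ==> u \<in> V ==> p u \<le> 1 ==> \<bar>s\<bar> \<le> r ==> x + s *\<^sub>R u \<in> W \<and>
   (\<forall>k. op_norm V p k (DG k (x + s *\<^sub>R u)) \<le> ennreal (A * fact k * l k) \<and> op_norm V p k (DH k (x + s *\<^sub>R u)) \<le> ennreal (A * fact k * l k))"
 obtains B \<rho> :: real and K :: "nat => real" where "B \<ge> 0" "\<rho> > 0"
  "\<And>x u. x \<in> N ==> u \<in> V ==> p u \<le> 1 ==>
    \<exists>a. (\<forall>k. cmod (a k) \<le> B * joris_rate j l \<rho> k) \<and>
     (\<forall>n s. \<bar>s\<bar> \<le> \<rho> --> cmod (f (x + s *\<^sub>R u) - (\<Sum>k\<le>n. a k * of_real s ^ k)) \<le> K n * \<bar>s\<bar> ^ (n + 1))"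
proof (rule joris_line[OF j l A r])
 fix B \<rho> :: real and K :: "nat => real"
 assume B: "B \<ge> 0" "\<rho> > 0" and main: "\<And>g G H. deriv_bounds l A r G ==> deriv_bounds l A r H ==>
    (\<And>s. \<bar>s\<bar> \<le> r ==> G 0 s = g s ^ j \<and> H 0 s = g s ^ (j + 1)) ==>
    \<exists>a. (\<forall>k. cmod (a k) \<le> B * joris_rate j l \<rho> k) \<and>
     (\<forall>n s. \<bar>s\<bar> \<le> \<rho> --> cmod (g s - (\<Sum>k\<le>n. a k * of_real s ^ k)) \<le> K n * \<bar>s\<bar> ^ (n + 1))"
 have lpos: "l k > 0" for k using l by (auto simp: log_convex_weight_def)
 show thesis
 proof (rule that[OF B])
  fix x u assume x: "x \<in> N" and u: "u \<in> V" "p u \<le> 1"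
  \<comment> \<open>The k-th derivative along the line is the Frechet derivative evaluated at
    \<open>k\<close> copies of \<open>u\<close>.\<close>
  have db: "deriv_bounds l A r (\<lambda>k s. D k (x + s *\<^sub>R u) (replicate k u))"
   if D: "frechet_derivs V p W g D" and b: "\<And>k s. \<bar>s\<bar> \<le> r ==> op_norm V p k (D k (x + s *\<^sub>R u)) \<le> ennreal (A * fact k * l k)" for g D
   unfolding deriv_bounds_def
  proof (intro allI impI conjI)
   fix k s assume s: "\<bar>s\<bar> \<le> r"
   have W: "x + s *\<^sub>R u \<in> W" using nb[OF x u s] by blast
   have un: "\<forall>v\<in>set (replicate k u). v \<in> V \<and> p v \<le> 1" using u by auto
   have "((\<lambda>t. D k (x + t *\<^sub>R u) (replicate k u)) has_vector_derivative D (Suc k) (x + s *\<^sub>R u) (u # replicate k u)) (at s)"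
    by (rule frechet_line_derivative_at[OF D W u(1) _ un]) simp
   then show "((\<lambda>t. D k (x + t *\<^sub>R u) (replicate k u)) has_vector_derivative D (Suc k) (x + s *\<^sub>R u) (replicate (Suc k) u)) (at s within {-r..r})"
    by (simp add: has_vector_derivative_at_within)
   show "cmod (D k (x + s *\<^sub>R u) (replicate k u)) \<le> A * fact k * l k"
    by (rule op_normD[OF b[OF s] _ _ un]) (use A lpos[of k] in auto)
  qed
  have G0: "DG 0 y [] = f y ^ j" "DH 0 y [] = f y ^ (j + 1)" if "y \<in> W" for y
   using DG DH that unfolding frechet_derivs_def by blast+
  show "\<exists>a. (\<forall>k. cmod (a k) \<le> B * joris_rate j l \<rho> k) \<and>
     (\<forall>n s. \<bar>s\<bar> \<le> \<rho> --> cmod (f (x + s *\<^sub>R u) - (\<Sum>k\<le>n. a k * of_real s ^ k)) \<le> K n * \<bar>s\<bar> ^ (n + 1))"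
  proof (rule main[OF db[OF DG] db[OF DH]])
   fix s assume s: "\<bar>s\<bar> \<le> r"
   have "x + s *\<^sub>R u \<in> W" using nb[OF x u s] by blast
   then show "DG 0 (x + s *\<^sub>R u) (replicate 0 u) = f (x + s *\<^sub>R u) ^ j \<and> DH 0 (x + s *\<^sub>R u) (replicate 0 u) = f (x + s *\<^sub>R u) ^ (j + 1)"
    using G0 by simp
  qed (use nb[OF x u] in blast)+
 qed
qed

lemma metric_space: "Metric_space V (\<lambda>x y. if x \<in> V \<and> y \<in> V then p (x - y) else 0)"
proof
 fix x y z :: 'v
 show "0 \<le> (if x \<in> V \<and> y \<in> V then p (x - y) else 0)" using p_ge by simp
 have "p (x - y) = p (y - x)" if "x \<in> V" "y \<in> V"
  using p_scale[of "x - y" "-1"] that by simp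
 then show "(if x \<in> V \<and> y \<in> V then p (x - y) else 0) = (if y \<in> V \<and> x \<in> V then p (y - x) else 0)" by auto
 show "(if x \<in> V \<and> y \<in> V then p (x - y) else 0) = 0 \<longleftrightarrow> x = y" if "x \<in> V" "y \<in> V"
  using that p_0[of "x - y"] by auto
 show "(if x \<in> V \<and> z \<in> V then p (x - z) else 0) \<le> (if x \<in> V \<and> y \<in> V then p (x - y) else 0) + (if y \<in> V \<and> z \<in> V then p (y - z) else 0)"
  if "x \<in> V" "y \<in> V" "z \<in> V" using that p_dist by simp
qed

lemma topspace_norm_topology: "topspace (norm_topology V p) = V"
 unfolding norm_topology_def by (simp add: Metric_space.topspace_mtopology[OF metric_space])

lemma limitin_norm_topology:
 "limitin (norm_topology V p) \<sigma> y sequentially \<longleftrightarrow> y \<in> V \<and> (\<forall>\<epsilon>>0. \<forall>\<^sub>F n in sequentially. \<sigma> n \<in> V \<and> p (\<sigma> n - y) < \<epsilon>)"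
proof -
 have "(\<forall>\<^sub>F n in sequentially. \<sigma> n \<in> V \<and> (if \<sigma> n \<in> V \<and> y \<in> V then p (\<sigma> n - y) else 0) < \<epsilon>) \<longleftrightarrow>
   (\<forall>\<^sub>F n in sequentially. \<sigma> n \<in> V \<and> p (\<sigma> n - y) < \<epsilon>)" if "y \<in> V" for \<epsilon>
  using that by (intro eventually_subst always_eventually) auto
 then show ?thesis
  unfolding norm_topology_def Metric_space.limitin_metric[OF metric_space] by blast
qed

text \<open>A bound that holds on every compact set holds on a neighbourhood of every compact set: otherwise
 it fails along a convergent sequence, which together with its limit is compact.\<close>

lemma compact_neighbourhood_bound:
 fixes a :: "nat => nat => real" and X :: "nat => 'v => ennreal"
 assumes K: "compactin (norm_topology V p) K" "K \<subseteq> W"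
  and a: "\<And>m m' k. m \<le> m' ==> a m k \<le> a m' k" "\<And>m k. 0 < a m k"
  and bd: "\<And>S. compactin (norm_topology V p) S ==> S \<subseteq> W ==> \<exists>m A. \<forall>x\<in>S. \<forall>k. X k x \<le> ennreal (A * a m k)"
 shows "\<exists>m A. \<exists>\<delta>>0. \<forall>y\<in>K. \<forall>h\<in>V. p h < \<delta> --> y + h \<in> W \<and> (\<forall>k. X k (y + h) \<le> ennreal (A * a m k))"
proof (rule ccontr)
 assume n: "\<not> ?thesis"
 \<comment> \<open>Radius \<open>1/(n+1)\<close>, factor \<open>n + 1\<close> and weight
   \<open>a n\<close> are used at once. As the weights do not decrease in their first index, failure
   for all \<open>n\<close> contradicts a bound with any one pair \<open>m\<close>,
   \<open>A\<close>.\<close>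
 have "\<exists>y h. y \<in> K \<and> h \<in> V \<and> p h < 1 / (real n + 1) \<and> \<not> (y + h \<in> W \<and> (\<forall>k. X k (y + h) \<le> ennreal ((real n + 1) * a n k)))" for n :: nat
 proof (rule ccontr)
  assume c: "\<not> ?thesis"
  have "1 / (real n + 1) > 0" by simp
  then show False using n c by blast
 qed
 then have "\<forall>n. \<exists>yh. fst yh \<in> K \<and> snd yh \<in> V \<and> p (snd yh) < 1 / (real n + 1) \<and> \<not> (fst yh + snd yh \<in> W \<and> (\<forall>k. X k (fst yh + snd yh) \<le> ennreal ((real n + 1) * a n k)))"
  by fastforce
 from choice[OF this] obtain yh where yh: "\<And>n. fst (yh n) \<in> K \<and> snd (yh n) \<in> V \<and> p (snd (yh n)) < 1 / (real n + 1) \<and> \<not> (fst (yh n) + snd (yh n) \<in> W \<and> (\<forall>k. X k (fst (yh n) + snd (yh n)) \<le> ennreal ((real n + 1) * a n k)))" by blast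
 define y where "y n = fst (yh n)" for n
 define h where "h n = snd (yh n)" for n
 have y: "y n \<in> K" and h: "h n \<in> V" "p (h n) < 1 / (real n + 1)"
  and bad: "\<not> (y n + h n \<in> W \<and> (\<forall>k. X k (y n + h n) \<le> ennreal ((real n + 1) * a n k)))" for n
  using yh[of n] by (auto simp: y_def h_def)
 have "range y \<subseteq> K" using y by blast
 with K(1) obtain z r where z: "z \<in> K" and r: "strict_mono r" and lim: "limitin (norm_topology V p) (y \<circ> r) z sequentially"
  unfolding norm_topology_def Metric_space.compactin_sequentially[OF metric_space] by blast
 have zW: "z \<in> W" using z K by blast
 define x where "x n = y (r n) + h (r n)" for n
 have yV: "y n \<in> V" for n using y K W_V by blast
 have xV: "x n \<in> V" for n using yV h by (simp add: x_def)
 have limx: "limitin (norm_topology V p) x z sequentially"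
  unfolding limitin_norm_topology
 proof (intro conjI W_V[OF zW] allI impI)
  fix \<epsilon> :: real assume \<epsilon>: "\<epsilon> > 0"
  have "\<forall>\<^sub>F n in sequentially. (y \<circ> r) n \<in> V \<and> p ((y \<circ> r) n - z) < \<epsilon> / 2"
   using lim half_gt_zero[OF \<epsilon>] unfolding limitin_norm_topology by blast
  moreover have "\<forall>\<^sub>F n in sequentially. 1 / (real n + 1) < \<epsilon> / 2"
  proof -
   have "(\<lambda>n. 1 / (real n + 1)) \<longlonglongrightarrow> 0" using LIMSEQ_inverse_real_of_nat by (simp add: inverse_eq_divide add.commute)
   then show ?thesis using \<epsilon> by (intro order_tendstoD) auto
  qed
  ultimately show "\<forall>\<^sub>F n in sequentially. x n \<in> V \<and> p (x n - z) < \<epsilon>"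
  proof eventually_elim
   case (elim n)
   have "n \<le> r n" using r by (rule seq_suble)
   then have "1 / (real (r n) + 1) \<le> 1 / (real n + 1)" by (intro divide_left_mono) auto
   then have "p (h (r n)) < \<epsilon> / 2" using h(2)[of "r n"] elim by linarith
   moreover have "p (x n - z) \<le> p (x n - y (r n)) + p (y (r n) - z)" by (rule p_dist[OF xV yV W_V[OF zW]])
   moreover have "x n - y (r n) = h (r n)" by (simp add: x_def)
   ultimately show ?case using elim xV[of n] by simp
  qed
 qed
 obtain \<delta> where d: "\<delta> > 0" "\<And>h. h \<in> V ==> p h < \<delta> ==> z + h \<in> W" using W_open[OF zW] by blast
 have "\<forall>\<^sub>F n in sequentially. x n \<in> V \<and> p (x n - z) < \<delta>" using limx d(1) unfolding limitin_norm_topology by blast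
 then obtain n0 where n0: "\<And>n. n \<ge> n0 ==> p (x n - z) < \<delta>" by (auto simp: eventually_sequentially)
 have xW: "x n \<in> W" if "n \<ge> n0" for n
  using d(2)[of "x n - z"] n0[OF that] xV[of n] W_V[OF zW] by simp
 define S where "S = insert z (x ` {n0..})"
 have "compactin (norm_topology V p) S"
  unfolding S_def by (rule compactin_sequence_with_limit[OF limx]) (use xV topspace_norm_topology in auto)
 moreover have "S \<subseteq> W" using xW zW by (auto simp: S_def)
 ultimately obtain m A where mA: "\<And>x k. x \<in> S ==> X k x \<le> ennreal (A * a m k)" using bd by blast
 obtain n1 :: nat where n1: "A \<le> n1" using real_arch_simple by blast
 define n where "n = max n0 (max m n1)"
 have nr: "n \<le> r n" using r by (rule seq_suble)
 have "X k (x n) \<le> ennreal ((real (r n) + 1) * a (r n) k)" for k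
 proof -
  have "X k (x n) \<le> ennreal (A * a m k)" by (rule mA) (simp add: S_def n_def)
  also have "A * a m k \<le> (real (r n) + 1) * a (r n) k"
  proof (intro mult_mono a(1))
   show "A \<le> real (r n) + 1" using n1 nr by (simp add: n_def)
   show "m \<le> r n" using nr by (simp add: n_def)
  qed (use a(2)[of m k] in auto)
  finally show ?thesis by (simp add: ennreal_leI)
 qed
 moreover have "x n \<in> W" by (rule xW) (simp add: n_def)
 ultimately show False using bad[of "r n"] by (simp add: x_def)
qed

text \<open>Smoothness of \<open>f\<close> uses neighbourhoods of single points; the bound on
  \<open>K\<close> uses one neighbourhood of all of \<open>K\<close>. The sequence
  \<open>a m\<close> fits both readings of the bracket: a growing chain of weights in the Roumieu
  case, a constant one in the Beurling case.\<close>

theorem joris_transfer: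
 fixes a b :: "nat => nat => real"
 assumes j: "j \<ge> 1" and sm: "frechet_smooth V p W (\<lambda>x. f x ^ j)" "frechet_smooth V p W (\<lambda>x. f x ^ (j + 1))"
  and a: "\<And>m m' k. m \<le> m' ==> a m k \<le> a m' k" "\<And>m k. 0 < a m k"
  and bd: "\<And>S. compactin (norm_topology V p) S ==> S \<subseteq> W ==> \<exists>m A. \<forall>x\<in>S. \<forall>k. op_norm V p k (frechet_deriv V p W (\<lambda>x. f x ^ j) k x) \<le> ennreal (A * a m k)"
   "\<And>S. compactin (norm_topology V p) S ==> S \<subseteq> W ==> \<exists>m A. \<forall>x\<in>S. \<forall>k. op_norm V p k (frechet_deriv V p W (\<lambda>x. f x ^ (j + 1)) k x) \<le> ennreal (A * a m k)"
  and tr: "\<And>m. transfer_weights j (a m) (b m)"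
 shows "frechet_smooth V p W f"
  "\<And>K. compactin (norm_topology V p) K ==> K \<subseteq> W ==> \<exists>m A. \<forall>x\<in>K. \<forall>k. op_norm V p k (frechet_deriv V p W f k x) \<le> ennreal (A * b m k)"
proof -
 define DG where "DG = frechet_deriv V p W (\<lambda>x. f x ^ j)"
 define DH where "DH = frechet_deriv V p W (\<lambda>x. f x ^ (j + 1))"
 have DG: "frechet_derivs V p W (\<lambda>x. f x ^ j) DG" and DH: "frechet_derivs V p W (\<lambda>x. f x ^ (j + 1)) DH"
  unfolding DG_def DH_def using sm by (auto intro: frechet_smooth_frechet_deriv)
 have bd': "\<exists>m A. \<forall>x\<in>S. \<forall>k. max (op_norm V p k (DG k x)) (op_norm V p k (DH k x)) \<le> ennreal (A * a m k)"
  if S: "compactin (norm_topology V p) S" "S \<subseteq> W" for S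
 proof -
  obtain m1 A1 where 1: "\<And>x k. x \<in> S ==> op_norm V p k (DG k x) \<le> ennreal (A1 * a m1 k)" using bd(1)[OF S] unfolding DG_def by blast
  obtain m2 A2 where 2: "\<And>x k. x \<in> S ==> op_norm V p k (DH k x) \<le> ennreal (A2 * a m2 k)" using bd(2)[OF S] unfolding DH_def by blast
  define A where "A = max 0 (max A1 A2)"
  have le: "A1 * a m1 k \<le> A * a (max m1 m2) k" "A2 * a m2 k \<le> A * a (max m1 m2) k" for k
   by (intro mult_mono a(1); use a(2)[of _ k] in \<open>auto simp: A_def less_imp_le\<close>)+
  show ?thesis
  proof (rule exI[of _ "max m1 m2"], rule exI[of _ A], intro ballI allI)
   fix x k assume "x \<in> S"
   then show "max (op_norm V p k (DG k x)) (op_norm V p k (DH k x)) \<le> ennreal (A * a (max m1 m2) k)"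
    using order_trans[OF 1 ennreal_leI[OF le(1)]] order_trans[OF 2 ennreal_leI[OF le(2)]] by simp
  qed
 qed
 define good where "good K m l B \<rho> r K' \<longleftrightarrow> B \<ge> 0 \<and> \<rho> > 0 \<and> r > 0 \<and>
   (\<forall>\<rho>>0. \<exists>A'. \<forall>k. fact k * 6 ^ k * joris_rate j l \<rho> k \<le> A' * b m k) \<and>
   log_convex_weight l \<and>
   (\<forall>y\<in>K. \<forall>x\<in>V. \<forall>u\<in>V. p (x - y) < r --> p u \<le> 1 --> (\<forall>s. \<bar>s\<bar> \<le> r --> x + s *\<^sub>R u \<in> W) \<and>
    (\<exists>a. (\<forall>k. cmod (a k) \<le> B * joris_rate j l \<rho> k) \<and>
     (\<forall>n s. \<bar>s\<bar> \<le> \<rho> --> cmod (f (x + s *\<^sub>R u) - (\<Sum>k\<le>n. a k * of_real s ^ k)) \<le> K' n * \<bar>s\<bar> ^ (n + 1))))" for K m l and B \<rho> r :: real and K' :: "nat => real"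
 have main: "\<exists>m l B \<rho> r K'. good K m l B \<rho> r K'"
  if K: "compactin (norm_topology V p) K" "K \<subseteq> W" for K
 proof -
  obtain m A \<delta> where d: "\<delta> > 0" and nb: "\<And>y h. y \<in> K ==> h \<in> V ==> p h < \<delta> ==> y + h \<in> W \<and> (\<forall>k. max (op_norm V p k (DG k (y + h))) (op_norm V p k (DH k (y + h))) \<le> ennreal (A * a m k))"
   using compact_neighbourhood_bound[where a=a, OF K a bd'] by blast
  obtain l A0 where l: "log_convex_weight l" and al: "\<And>k. a m k \<le> A0 * fact k * l k" and
   t: "\<forall>\<rho>>0. \<exists>A'. \<forall>k. fact k * 6 ^ k * joris_rate j l \<rho> k \<le> A' * b m k"
   using tr[of m] unfolding transfer_weights_def by blast
  have lpos: "l k > 0" for k using l by (auto simp: log_convex_weight_def)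
  define A1 where "A1 = max 1 (max 0 A * A0)"
  have Aa: "A * a m k \<le> A1 * fact k * l k" for k
  proof -
   have "A * a m k \<le> max 0 A * a m k" using a(2)[of m k] by (intro mult_right_mono) auto
   also have "... \<le> max 0 A * (A0 * fact k * l k)" using al[of k] by (intro mult_left_mono) auto
   also have "... = (max 0 A * A0) * (fact k * l k)" by simp
   also have "... \<le> A1 * (fact k * l k)" using lpos[of k] by (intro mult_right_mono) (auto simp: A1_def)
   finally show ?thesis by simp
  qed
  \<comment> \<open>Base points within \<open>r\<close> of \<open>K\<close> and line parameters up
    to \<open>r\<close> stay within \<open>2 r\<close>, hence inside the neighbourhood of radius
    \<delta>.\<close>
  define r where "r = \<delta> / 3"
  have r: "r > 0" using d by (simp add: r_def)
  define N where "N = {x \<in> V. \<exists>y\<in>K. p (x - y) < r}"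
  have NW: "x + s *\<^sub>R u \<in> W \<and> (\<forall>k. op_norm V p k (DG k (x + s *\<^sub>R u)) \<le> ennreal (A1 * fact k * l k) \<and> op_norm V p k (DH k (x + s *\<^sub>R u)) \<le> ennreal (A1 * fact k * l k))"
   if x: "x \<in> N" and u: "u \<in> V" "p u \<le> 1" and s: "\<bar>s\<bar> \<le> r" for x u s
  proof -
   obtain y where y: "y \<in> K" "x \<in> V" "p (x - y) < r" using x unfolding N_def by blast
   have yV: "y \<in> V" using y K W_V by blast
   define h where "h = (x - y) + s *\<^sub>R u"
   have hV: "h \<in> V" using y yV u by (simp add: h_def)
   have "p h \<le> p (x - y) + \<bar>s\<bar> * p u" using p_tri[of "x - y" "s *\<^sub>R u"] y yV u by (simp add: h_def p_scale)
   moreover have "\<bar>s\<bar> * p u \<le> r * 1" using s u p_ge[OF u(1)] r by (intro mult_mono) auto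
   ultimately have "p h < \<delta>" using y r by (simp add: r_def)
   then have b: "y + h \<in> W" "\<And>k. max (op_norm V p k (DG k (y + h))) (op_norm V p k (DH k (y + h))) \<le> ennreal (A * a m k)"
    using nb[OF y(1) hV] by blast+
   have yh: "y + h = x + s *\<^sub>R u" by (simp add: h_def)
   have c: "max (op_norm V p k (DG k (y + h))) (op_norm V p k (DH k (y + h))) \<le> ennreal (A1 * fact k * l k)" for k
    by (rule order_trans[OF b(2) ennreal_leI[OF Aa]])
   show ?thesis using b(1) c unfolding yh by simp
  qed
  have A1: "A1 \<ge> 1" and NV: "N \<subseteq> V" by (auto simp: A1_def N_def)
  obtain B \<rho> K' where B: "B \<ge> 0" "\<rho> > 0" and ex: "\<And>x u. x \<in> N ==> u \<in> V ==> p u \<le> 1 ==>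
    \<exists>a. (\<forall>k. cmod (a k) \<le> B * joris_rate j l \<rho> k) \<and>
     (\<forall>n s. \<bar>s\<bar> \<le> \<rho> --> cmod (f (x + s *\<^sub>R u) - (\<Sum>k\<le>n. a k * of_real s ^ k)) \<le> K' n * \<bar>s\<bar> ^ (n + 1))"
   by (rule joris_lines[OF j DG DH r l A1 NV NW]) blast+
  show ?thesis
  proof (rule exI[of _ m], rule exI[of _ l], rule exI[of _ B], rule exI[of _ \<rho>], rule exI[of _ r], rule exI[of _ K'], unfold good_def, intro conjI B r t l ballI impI)
   fix y x u assume y: "y \<in> K" "x \<in> V" "u \<in> V" "p (x - y) < r" "p u \<le> 1"
   then have xN: "x \<in> N" unfolding N_def by blast
   show "\<forall>s. \<bar>s\<bar> \<le> r --> x + s *\<^sub>R u \<in> W" using NW[OF xN y(3,5)] by blast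
   show "\<exists>a. (\<forall>k. cmod (a k) \<le> B * joris_rate j l \<rho> k) \<and>
     (\<forall>n s. \<bar>s\<bar> \<le> \<rho> --> cmod (f (x + s *\<^sub>R u) - (\<Sum>k\<le>n. a k * of_real s ^ k)) \<le> K' n * \<bar>s\<bar> ^ (n + 1))"
    by (rule ex[OF xN y(3,5)])
  qed
 qed
 have "uniform_taylor {f}"
  unfolding uniform_taylor_def
 proof (intro ballI allI)
  fix x0 and n :: nat assume x0: "x0 \<in> W"
  have "compactin (norm_topology V p) {x0}" using x0 W_V by (simp add: topspace_norm_topology)
  from main[OF this] x0 obtain m l B \<rho> r K' where g: "good {x0} m l B \<rho> r K'" by auto
  have B: "\<rho> > 0" "r > 0" using g unfolding good_def by blast+
  have e: "(\<forall>s. \<bar>s\<bar> \<le> r --> x + s *\<^sub>R u \<in> W) \<and>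
     (\<exists>a. \<forall>n s. \<bar>s\<bar> \<le> \<rho> --> cmod (f (x + s *\<^sub>R u) - (\<Sum>k\<le>n. a k * of_real s ^ k)) \<le> K' n * \<bar>s\<bar> ^ (n + 1))"
   if "x \<in> V" "u \<in> V" "p (x - x0) < r" "p u \<le> 1" for x u
   using g that unfolding good_def by blast
  show "\<exists>\<delta>>0. \<exists>C\<ge>0. \<forall>\<phi>\<in>{f}. \<forall>x\<in>V. \<forall>u\<in>V. p (x - x0) < \<delta> --> p u \<le> 1 --> (\<exists>a. expansion \<phi> n \<delta> C x u a)"
  proof (rule exI[of _ "min r \<rho>"], intro conjI exI[of _ "max 0 (K' n)"] ballI impI)
   fix \<phi> x u assume \<phi>: "\<phi> \<in> {f}" and x: "x \<in> V" "u \<in> V" "p (x - x0) < min r \<rho>" "p u \<le> 1"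
   obtain a where a: "\<And>s. \<bar>s\<bar> \<le> r ==> x + s *\<^sub>R u \<in> W" "\<And>n s. \<bar>s\<bar> \<le> \<rho> ==> cmod (f (x + s *\<^sub>R u) - (\<Sum>k\<le>n. a k * of_real s ^ k)) \<le> K' n * \<bar>s\<bar> ^ (n + 1)"
    using e[OF x(1,2) _ x(4)] x(3) by auto
   have "expansion f n (min r \<rho>) (max 0 (K' n)) x u a"
    unfolding expansion_def
   proof (intro allI impI conjI)
    fix s assume s: "\<bar>s\<bar> < min r \<rho>"
    show "x + s *\<^sub>R u \<in> W" using a(1)[of s] s by simp
    have "cmod (f (x + s *\<^sub>R u) - (\<Sum>k\<le>n. a k * of_real s ^ k)) \<le> K' n * \<bar>s\<bar> ^ (n + 1)" by (rule a(2)) (use s in simp)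
    also have "... \<le> max 0 (K' n) * \<bar>s\<bar> ^ (n + 1)" by (intro mult_right_mono) auto
    finally show "cmod (f (x + s *\<^sub>R u) - (\<Sum>k\<le>n. a k * of_real s ^ k)) \<le> max 0 (K' n) * \<bar>s\<bar> ^ (n + 1)" .
   qed
   then show "\<exists>a. expansion \<phi> n (min r \<rho>) (max 0 (K' n)) x u a" using \<phi> by blast
  qed (use B in auto)
 qed
 then show fs: "frechet_smooth V p W f"
  unfolding frechet_smooth_def using uniform_taylor_imp_frechet_derivs by blast
 define D where "D = frechet_deriv V p W f"
 have D: "frechet_derivs V p W f D" unfolding D_def by (rule frechet_smooth_frechet_deriv[OF fs])
 fix K assume K: "compactin (norm_topology V p) K" "K \<subseteq> W"
 from main[OF K] obtain m l B \<rho> r K' where g: "good K m l B \<rho> r K'" by blast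
 have B: "B \<ge> 0" "\<rho> > 0" "r > 0"
  and t: "\<forall>\<rho>>0. \<exists>A'. \<forall>k. fact k * 6 ^ k * joris_rate j l \<rho> k \<le> A' * b m k"
  and l: "log_convex_weight l"
  using g unfolding good_def by blast+
 have e: "\<exists>a. (\<forall>k. cmod (a k) \<le> B * joris_rate j l \<rho> k) \<and>
     (\<forall>n s. \<bar>s\<bar> \<le> \<rho> --> cmod (f (x + s *\<^sub>R u) - (\<Sum>k\<le>n. a k * of_real s ^ k)) \<le> K' n * \<bar>s\<bar> ^ (n + 1))"
  if "y \<in> K" "x \<in> V" "u \<in> V" "p (x - y) < r" "p u \<le> 1" for x y u
  using g that unfolding good_def by blast
 have lpos: "l k > 0" for k using l by (auto simp: log_convex_weight_def)
 define Q where "Q k = joris_rate j l \<rho> k" for k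
 have Q0: "Q k \<ge> 0" for k unfolding Q_def using j B lpos
  by (intro add_nonneg_nonneg mult_nonneg_nonneg) (auto simp: less_imp_le)
 obtain A' where A': "\<And>k. fact k * 6 ^ k * Q k \<le> A' * b m k" using t B(2) unfolding Q_def by blast
 have "op_norm V p k (D k x) \<le> ennreal (3 * B * A' * b m k)" if x: "x \<in> K" for x k
 proof (rule op_norm_leI)
  fix vs assume vs: "length vs = k" "\<forall>v\<in>set vs. v \<in> V \<and> p v \<le> 1"
  have xW: "x \<in> W" using x K by blast
  have "cmod (D k x vs) \<le> 3 * 6 ^ k * fact k * (B * Q k)"
  proof (rule frechet_derivs_bound[OF D xW _ B(2) _ vs])
   show "0 \<le> B * Q k" using B Q0 by simp
   fix u assume u: "u \<in> V" "p u \<le> 1"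
   show "\<exists>a. cmod (a k) \<le> B * Q k \<and> (\<forall>s. \<bar>s\<bar> \<le> \<rho> --> cmod (f (x + s *\<^sub>R u) - (\<Sum>i\<le>k. a i * of_real s ^ i)) \<le> K' k * \<bar>s\<bar> ^ (k + 1))"
    using e[OF x W_V[OF xW] u(1) _ u(2)] B(3) unfolding Q_def by auto
  qed
  also have "... = 3 * B * (fact k * 6 ^ k * Q k)" by simp
  also have "... \<le> 3 * B * (A' * b m k)" using B A'[of k] by (intro mult_left_mono) auto
  finally show "cmod (D k x vs) \<le> 3 * B * A' * b m k" by simp
 qed
 then show "\<exists>m A. \<forall>x\<in>K. \<forall>k. op_norm V p k (frechet_deriv V p W f k x) \<le> ennreal (A * b m k)" unfolding D_def by blast
qed

end

section \<open>Admissible weight matrices\<close>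

lemma power_le_of_root_at_top:
 fixes m :: "nat => real"
 assumes pos: "\<And>k. 0 < m k" and lim: "filterlim (\<lambda>k. root k (m k)) at_top sequentially"
 obtains A where "A > 0" "\<And>k. c ^ k \<le> A * m k"
proof -
 have "\<forall>\<^sub>F k in sequentially. \<bar>c\<bar> \<le> root k (m k)" using lim by (simp add: filterlim_at_top)
 then obtain k0 where k0: "\<And>k. k \<ge> k0 ==> \<bar>c\<bar> \<le> root k (m k)" by (auto simp: eventually_sequentially)
 have large: "c ^ k \<le> m k" if "k \<ge> Suc k0" for k
 proof -
  have "c ^ k \<le> \<bar>c\<bar> ^ k" by (metis abs_ge_self power_abs)
  also have "... \<le> root k (m k) ^ k" using k0[of k] that by (intro power_mono) auto
  also have "... = m k" using that pos[of k] by (intro real_root_pow_pos) auto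
  finally show ?thesis .
 qed
 define A where "A = 1 + (\<Sum>i\<le>k0. \<bar>c\<bar> ^ i / m i)"
 have sum0: "(\<Sum>i\<le>k0. \<bar>c\<bar> ^ i / m i) \<ge> 0" by (intro sum_nonneg divide_nonneg_pos pos) auto
 show thesis
 proof (rule that)
  show "A > 0" using sum0 by (simp add: A_def)
  fix k
  show "c ^ k \<le> A * m k"
  proof (cases "k \<le> k0")
   case True
   have "c ^ k / m k \<le> \<bar>c\<bar> ^ k / m k" using pos[of k] by (intro divide_right_mono) (auto simp: power_abs[symmetric])
   also have "... \<le> (\<Sum>i\<le>k0. \<bar>c\<bar> ^ i / m i)" using True by (intro member_le_sum) (auto intro: divide_nonneg_pos pos)
   also have "... \<le> A" by (simp add: A_def)
   finally show ?thesis using pos[of k] by (simp add: pos_divide_le_eq)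
  next
   case False
   then have "c ^ k \<le> 1 * m k" using large[of k] by simp
   also have "... \<le> A * m k" using sum0 pos[of k] by (intro mult_right_mono) (auto simp: A_def)
   finally show ?thesis .
  qed
 qed
qed

text \<open>\<open>LEAST\<close> needs a witness: \<open>m k t^k\<close> exceeds its value at 0 for
  large \<open>k\<close>, so the infimum is a minimum over finitely many indices.\<close>

lemma Gamma_upper_minimizes:
 fixes m :: "nat => real"
 assumes pos: "\<And>k. 0 < m k" and lim: "filterlim (\<lambda>k. root k (m k)) at_top sequentially" and t: "t > 0"
 shows "m (Gamma_upper m t) * t ^ Gamma_upper m t \<le> m k * t ^ k"
proof -
 obtain A where A: "A > 0" "\<And>k. (2 / t) ^ k \<le> A * m k" using power_le_of_root_at_top[OF pos lim] by blast
 obtain k0 where k0: "A * m 0 < 2 ^ k0" using real_arch_pow[of 2 "A * m 0"] by auto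
 have large: "m 0 * t ^ 0 \<le> m k * t ^ k" if "k \<ge> k0" for k
 proof -
  have "A * m 0 \<le> 2 ^ k0" using k0 by simp
  also have "... \<le> 2 ^ k" using that by (intro power_increasing) auto
  also have "... = (2 / t) ^ k * t ^ k" using t by (simp add: power_divide)
  also have "... \<le> A * m k * t ^ k" using A(2)[of k] t by (intro mult_right_mono) auto
  finally have "A * m 0 \<le> A * (m k * t ^ k)" by (simp add: mult.assoc)
  then show ?thesis using A(1) by simp
 qed
 define i where "i = arg_min_on (\<lambda>k. m k * t ^ k) {..k0}"
 have fin: "finite {..k0}" "{..k0} \<noteq> {}" by auto
 have le0: "m i * t ^ i \<le> m k * t ^ k" if "k \<le> k0" for k
  unfolding i_def by (rule arg_min_least[OF fin]) (use that in simp)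
 have le: "m i * t ^ i \<le> m k * t ^ k" for k
  using le0[of k] order_trans[OF le0[of 0] large[of k]] by (cases "k \<le> k0") auto
 have h: "h_fun m t = m i * t ^ i" unfolding h_fun_def
 proof (rule antisym)
  show "(INF k. m k * t ^ k) \<le> m i * t ^ i"
   by (rule cINF_lower) (use le in \<open>auto intro!: bdd_belowI[where m="m i * t ^ i"]\<close>)
  show "m i * t ^ i \<le> (INF k. m k * t ^ k)" by (rule cINF_greatest) (use le in auto)
 qed
 have "h_fun m t = m (Gamma_upper m t) * t ^ Gamma_upper m t"
  unfolding Gamma_upper_def by (rule LeastI[of _ i]) (rule h)
 then show ?thesis using h le by simp
qed

text \<open>Bounded ratios would allow at most geometric growth.\<close>

lemma ratio_unbounded:
 fixes m :: "nat => real"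
 assumes pos: "\<And>k. 0 < m k" and unb: "\<And>c. c > 0 ==> \<exists>A>0. \<forall>k. c ^ k \<le> A * m k"
 shows "\<exists>k. c * m k < m (Suc k)"
proof (rule ccontr)
 define d where "d = max 1 c"
 assume "\<not> ?thesis"
 then have c: "m (Suc k) \<le> c * m k" for k by (auto simp: not_less)
 have d: "m (Suc k) \<le> d * m k" for k
  by (rule order_trans[OF c]) (use pos[of k] in \<open>auto intro!: mult_right_mono simp: d_def\<close>)
 have ub: "m k \<le> d ^ k * m 0" for k
 proof (induction k)
  case (Suc k)
  have "m (Suc k) \<le> d * (d ^ k * m 0)" by (rule order_trans[OF d mult_left_mono[OF Suc]]) (simp add: d_def)
  then show ?case by (simp add: mult.assoc)
 qed simp
 have "2 * d > 0" by (simp add: d_def)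
 then obtain A where A: "A > 0" "\<And>k. (2 * d) ^ k \<le> A * m k" using unb by blast
 obtain k where k: "A * m 0 < 2 ^ k" using real_arch_pow[of 2 "A * m 0"] by auto
 have "(2 * d) ^ k \<le> A * (d ^ k * m 0)" by (rule order_trans[OF A(2) mult_left_mono[OF ub]]) (use A in simp)
 then have "d ^ k * 2 ^ k \<le> d ^ k * (A * m 0)" by (simp add: power_mult_distrib mult_ac)
 then have "2 ^ k \<le> A * m 0" by (rule mult_left_le_imp_le) (simp add: d_def)
 then show False using k by simp
qed

text \<open>The maximal ratios \<open>max\<^sub>i\<^sub>\<le>\<^sub>k m\<^sub>i\<^sub>+\<^sub>1/m\<^sub>i\<close> generate a log-convex majorant of \<open>m\<close>; the condition on the
 counting functions bounds it by \<open>n\<close>.\<close>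

lemma log_convex_sandwich:
 fixes m n :: "nat => real"
 assumes m: "\<And>k. 0 < m k" "m 0 = 1" "filterlim (\<lambda>k. root k (m k)) at_top sequentially"
  and n: "\<And>k. 0 < n k" "n 0 = 1" "filterlim (\<lambda>k. root k (n k)) at_top sequentially"
  and C: "C \<ge> 1" and \<Gamma>: "\<And>t. t > 0 ==> Gamma_upper n (C * t) \<le> Gamma_lower m t"
 obtains l where "log_convex_weight l" "\<And>k. m k \<le> l k" "\<And>k. l k \<le> C ^ k * n k"
proof -
 define \<mu> where "\<mu> i = Max ((\<lambda>i. m (Suc i) / m i) ` {..i})" for i
 define l where "l k = (\<Prod>i<k. \<mu> i)" for k
 have rat: "m (Suc i) / m i \<le> \<mu> k" if "i \<le> k" for i k unfolding \<mu>_def using that by (intro Max_ge) auto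
 have att: "\<exists>i\<le>k. \<mu> k = m (Suc i) / m i" for k
 proof -
  have "\<mu> k \<in> (\<lambda>i. m (Suc i) / m i) ` {..k}" unfolding \<mu>_def by (intro Max_in) auto
  then show ?thesis by auto
 qed
 have \<mu>pos: "\<mu> k > 0" for k using att[of k] m(1) by auto
 have \<mu>mono: "\<mu> i \<le> \<mu> k" if "i \<le> k" for i k
  using att[of i] rat that by (metis le_trans)
 have lpos: "l k > 0" for k unfolding l_def by (intro prod_pos) (use \<mu>pos in auto)
 have lS: "l (Suc k) = l k * \<mu> k" for k by (simp add: l_def)
 have ml: "m k \<le> l k" for k
 proof (induction k)
  case (Suc k)
  have "m (Suc k) = m k * (m (Suc k) / m k)" using m(1)[of k] by simp
  also have "... \<le> l k * \<mu> k" using Suc rat[of k k] lpos[of k] m(1)[of k] m(1)[of "Suc k"] by (intro mult_mono) (auto simp: less_imp_le)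
  finally show ?case by (simp add: lS)
 qed (simp add: l_def m)
 have "log_convex_weight l" unfolding log_convex_weight_def
 proof (intro conjI allI)
  show "l 0 = 1" by (simp add: l_def)
  fix k show "0 < l k" by (rule lpos)
  have "(l k * l k * \<mu> k) * \<mu> k \<le> (l k * l k * \<mu> k) * \<mu> (Suc k)"
   using \<mu>mono[of k "Suc k"] lpos[of k] \<mu>pos[of k] by (intro mult_left_mono) auto
  then show "(l (Suc k))\<^sup>2 \<le> l k * l (Suc (Suc k))" by (simp add: lS power2_eq_square mult_ac)
 next
  fix c
  have "\<exists>A>0. \<forall>k. c ^ k \<le> A * m k" for c using power_le_of_root_at_top[OF m(1,3)] by metis
  then obtain k where k: "c * m k < m (Suc k)" using ratio_unbounded[of m c] m(1) by blast
  then have "c < m (Suc k) / m k" using m(1)[of k] by (simp add: pos_less_divide_eq)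
  also have "... \<le> \<mu> k" by (rule rat) simp
  finally have "c * l k < \<mu> k * l k" using lpos[of k] by (intro mult_strict_right_mono)
  then show "\<exists>k. c * l k < l (Suc k)" by (auto simp: lS mult.commute)
 qed
 moreover have "l k \<le> C ^ k * n k" for k
 proof (induction k rule: less_induct)
  case (less k)
  show ?case
  proof (cases k)
   case 0
   then show ?thesis by (simp add: l_def n)
  next
   case (Suc k')
   \<comment> \<open>For this \<open>t\<close> the products \<open>l i t^i\<close> decrease up to
     \<open>k\<close>, and \<open>Gamma_lower m t\<close> is at most the place where the largest
     ratio occurs. So the minimiser \<open>g\<close> belonging to \<open>n\<close> lies before
     \<open>k\<close>; the induction hypothesis at \<open>g\<close> and minimality give the bound at
     \<open>k\<close>.\<close>
   define t where "t = 1 / \<mu> k'"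
   have t: "t > 0" using \<mu>pos by (simp add: t_def)
   obtain i where i: "i \<le> k'" "\<mu> k' = m (Suc i) / m i" using att by blast
   have "Gamma_lower m t \<le> i" unfolding Gamma_lower_def by (rule Least_le) (simp add: t_def i)
   define g where "g = Gamma_upper n (C * t)"
   have g: "g < k" using \<Gamma>[OF t] \<open>Gamma_lower m t \<le> i\<close> i Suc by (simp add: g_def)
   have anti: "l i * t ^ i \<le> l g * t ^ g" if "g \<le> i" "i \<le> k" for i
    using that
   proof (induction i rule: dec_induct)
    case (step i)
    have "\<mu> i * t \<le> 1" using \<mu>mono[of i k'] \<mu>pos[of k'] step Suc by (simp add: t_def)
    then have "(l i * t ^ i) * (\<mu> i * t) \<le> (l i * t ^ i) * 1" using lpos[of i] t by (intro mult_left_mono) auto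
    then show ?case using step by (simp add: lS mult_ac)
   qed simp
   have "l k * t ^ k \<le> l g * t ^ g" by (rule anti) (use g in auto)
   also have "... \<le> C ^ g * n g * t ^ g" using less[OF g] t by (intro mult_right_mono) auto
   also have "... = n g * (C * t) ^ g" by (simp add: power_mult_distrib)
   also have "... \<le> n k * (C * t) ^ k" unfolding g_def by (rule Gamma_upper_minimizes) (use n C t in auto)
   also have "... = C ^ k * n k * t ^ k" by (simp add: power_mult_distrib)
   finally show ?thesis using t by simp
  qed
 qed
 ultimately show thesis using ml that by blast
qed

section \<open>Moderate growth, and the weights produced by a matrix\<close>

lemma mg_bound:
 fixes M N :: "nat => real"
 assumes "\<And>k. 0 < M k" "\<And>k. 0 < N k" "M 0 = 1" "N 0 = 1" and mg: "mg M N < \<infinity>"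
 obtains D where "D \<ge> 1" "\<And>j k. M (j + k) \<le> D ^ (j + k) * (N j * N k)"
proof (rule that)
 let ?D = "max 1 (enn2real (mg M N))"
 show "?D \<ge> 1" by simp
 fix j k
 show "M (j + k) \<le> ?D ^ (j + k) * (N j * N k)"
 proof (cases "j + k = 0")
  case True
  then show ?thesis using assms by simp
 next
  case False
  have NN: "N j * N k > 0" using assms by simp
  have "ennreal (root (j + k) (M (j + k) / (N j * N k))) \<le> mg M N"
   unfolding mg_def by (rule SUP_upper2[of "(j, k)"]) (use False in auto)
  also have "mg M N = ennreal (enn2real (mg M N))" using mg by (simp add: less_top)
  also have "... \<le> ennreal ?D" by (rule ennreal_leI) simp
  finally have r: "root (j + k) (M (j + k) / (N j * N k)) \<le> ?D" by (simp add: ennreal_le_iff)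
  have q: "0 < M (j + k) / (N j * N k)" using NN assms(1) by simp
  have "M (j + k) / (N j * N k) = root (j + k) (M (j + k) / (N j * N k)) ^ (j + k)"
   using False q by (intro real_root_pow_pos[symmetric]) auto
  also have "... \<le> ?D ^ (j + k)" using r q False by (intro power_mono) (auto simp: real_root_ge_zero)
  finally show ?thesis using NN by (simp add: pos_divide_le_eq)
 qed
qed

text \<open>Moderate growth applied \<open>L - 1\<close> times, with \<open>L k\<close> cut into
  \<open>L\<close> blocks of length \<open>k\<close>. The second conjunct takes care of the block
  that is split off in the induction on \<open>L\<close>.\<close>

definition mg_iterated :: "nat => (nat => real) => (nat => real) => bool" where
 "mg_iterated L X Y \<longleftrightarrow> (\<exists>D\<ge>1. \<forall>k. X (L * k) \<le> D ^ k * Y k ^ L \<and> X k \<le> D ^ k * Y k)"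

lemma mg_iterated_1: "mg_iterated 1 X X"
 unfolding mg_iterated_def by (rule exI[of _ 1]) simp

lemma mg_iterated_Suc:
 assumes X: "weight_sequence X" and Y: "weight_sequence Y" and Z: "weight_sequence Z"
  and mg: "mg X Y < \<infinity>" and it: "mg_iterated L Y Z"
 shows "mg_iterated (Suc L) X Z"
proof -
 have pos: "0 < X k" "0 < Y k" "0 < Z k" "X 0 = 1" "Y 0 = 1" for k using X Y Z by (auto simp: weight_sequence_def)
 obtain D1 where D1: "D1 \<ge> 1" "\<And>j k. X (j + k) \<le> D1 ^ (j + k) * (Y j * Y k)" using mg_bound[OF pos(1,2,4,5) mg] by blast
 obtain D2 where D2: "D2 \<ge> 1" "\<And>k. Y (L * k) \<le> D2 ^ k * Z k ^ L" "\<And>k. Y k \<le> D2 ^ k * Z k"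
  using it unfolding mg_iterated_def by blast
 define D where "D = D1 ^ Suc L * (D2 * D2)"
 have D2D: "D2 * D2 \<ge> 1" "D2 \<le> D2 * D2" using D2(1) mult_mono[of 1 D2 1 D2] by auto
 have D1L: "D1 \<le> D1 ^ Suc L" using D1(1) by (intro self_le_power) auto
 have D1L': "1 \<le> D1 ^ Suc L" using D1(1) by (intro one_le_power)
 have D: "D \<ge> 1" unfolding D_def using mult_mono[OF D1L' D2D(1)] D1 by auto
 have DD: "D1 * D2 \<le> D" unfolding D_def using D1 D2 D2D D1L by (intro mult_mono) auto
 have 1: "X (Suc L * k) \<le> D ^ k * Z k ^ Suc L" for k
 proof -
  have "X (Suc L * k) = X (L * k + k)" by (simp add: add.commute)
  also have "... \<le> D1 ^ (L * k + k) * (Y (L * k) * Y k)" by (rule D1)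
  also have "... \<le> D1 ^ (L * k + k) * ((D2 ^ k * Z k ^ L) * (D2 ^ k * Z k))"
   by (intro mult_left_mono mult_mono D2) (use D1 D2 pos in \<open>auto intro!: mult_nonneg_nonneg simp: less_imp_le\<close>)
  also have "... = D ^ k * Z k ^ Suc L"
  proof -
   have "D1 ^ (L * k + k) = (D1 ^ Suc L) ^ k" by (simp add: power_mult[symmetric] add.commute del: power_Suc)
   then show ?thesis unfolding D_def by (simp add: power_mult_distrib mult_ac)
  qed
  finally show ?thesis .
 qed
 have 2: "X k \<le> D ^ k * Z k" for k
 proof -
  have "X k \<le> D1 ^ k * Y k" using D1(2)[of k 0] pos by simp
  also have "... \<le> D1 ^ k * (D2 ^ k * Z k)" using D1 D2 by (intro mult_left_mono) auto
  also have "... = (D1 * D2) ^ k * Z k" by (simp add: power_mult_distrib)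
  also have "... \<le> D ^ k * Z k" using DD D1 D2 pos(3)[of k] by (intro mult_right_mono power_mono) auto
  finally show ?thesis .
 qed
 show ?thesis unfolding mg_iterated_def using 1 2 D by blast
qed

lemma fact_power_le_fact_mult: "(fact k :: real) ^ L \<le> fact (L * k)"
proof (induction L)
 case (Suc L)
 have "(fact k :: nat) * fact (L * k) \<le> fact (k + L * k)"
  by (rule dvd_imp_le[OF fact_fact_dvd_fact]) simp
 then have "real (fact k * fact (L * k)) \<le> real (fact (k + L * k))" by (simp only: of_nat_le_iff)
 then have "(fact k :: real) * fact (L * k) \<le> fact (k + L * k)" by (simp only: of_nat_mult of_nat_fact)
 then show ?case using order_trans[OF mult_left_mono[OF Suc, of "fact k"]] by (simp add: mult.commute[of _ L])
qed simp

text \<open>A chain of four sequences. The counting functions give a log-convex \<open>l\<close>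
  between \<open>M\<close> and \<open>N\<close>; iterated moderate growth replaces the L-th root of
  \<open>N (L (k + 1))\<close> by \<open>N' (k + 1)\<close>; one more application lowers
  \<open>k + 1\<close> to \<open>k\<close> in \<open>N''\<close>. A factor \<open>\<rho>^k\<close>
  is carried along by scaling \<open>l\<close>, and \<open>c\<close> is the same for all \<rho>, as
  the Beurling case demands.\<close>

lemma transfer_weights_sequence:
 assumes j: "j \<ge> 1" and M: "weight_sequence M" "filterlim (\<lambda>k. root k (fact_quot M k)) at_top sequentially"
  and N: "weight_sequence N" "filterlim (\<lambda>k. root k (fact_quot N k)) at_top sequentially"
  and N': "weight_sequence N'"
  and N'': "weight_sequence N''" "filterlim (\<lambda>k. root k (fact_quot N'' k)) at_top sequentially"
  and \<Gamma>: "\<exists>C\<ge>1. \<forall>t>0. Gamma_upper (fact_quot N) (C * t) \<le> Gamma_lower (fact_quot M) t"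
  and it: "mg_iterated (joris_exponent j) N N'" and mg: "mg N' N'' < \<infinity>"
 obtains c where "c > 0" "\<And>\<rho>. \<rho> > 0 ==> transfer_weights j (\<lambda>k. \<rho> ^ k * M k) (\<lambda>k. (c * \<rho>) ^ k * N'' k)"
proof -
 define L where "L = joris_exponent j"
 have L: "L > 0" using j by (simp add: L_def)
 have pos: "0 < M k" "0 < N k" "0 < N' k" "0 < N'' k" "M 0 = 1" "N 0 = 1" "N' 0 = 1" "N'' 0 = 1" for k
  using M(1) N(1) N' N''(1) by (auto simp: weight_sequence_def)
 have posq: "0 < fact_quot M k" "0 < fact_quot N k" "0 < fact_quot N'' k" "fact_quot M 0 = 1" "fact_quot N 0 = 1" for k
  using pos by (auto simp: fact_quot_def)
 obtain C where C: "C \<ge> 1" "\<And>t. t > 0 ==> Gamma_upper (fact_quot N) (C * t) \<le> Gamma_lower (fact_quot M) t"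
  using \<Gamma> by blast
 obtain l where l: "log_convex_weight l" "\<And>k. fact_quot M k \<le> l k" "\<And>k. l k \<le> C ^ k * fact_quot N k"
  using log_convex_sandwich[OF posq(1,4) M(2) posq(2,5) N(2) C] by blast
 obtain D where D: "D \<ge> 1" "\<And>k. N (L * k) \<le> D ^ k * N' k ^ L" using it unfolding mg_iterated_def L_def[symmetric] by blast
 obtain D' where D': "D' \<ge> 1" "\<And>j k. N' (j + k) \<le> D' ^ (j + k) * (N'' j * N'' k)"
  using mg_bound[OF pos(3,4,7,8) mg] by blast
 define E where "E = C * D * D'"
 have E: "E > 0" using C D D' by (simp add: E_def)
 have lpos: "l k > 0" for k using l(1) by (auto simp: log_convex_weight_def)
 have rt: "fact k * root L (\<rho> ^ (L * Suc k) * l (L * Suc k)) \<le> (\<rho> * E) ^ Suc k * (N'' 1 * N'' k)" if \<rho>: "\<rho> > 0" for \<rho> k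
 proof -
  define y where "y = (\<rho> * C * D) ^ Suc k * (N' (Suc k) / fact (Suc k))"
  have y0: "y \<ge> 0" using \<rho> C D pos(3)[of "Suc k"] by (simp add: y_def)
  have "1 * Suc k \<le> L * Suc k" using L by (intro mult_le_mono1) simp
  then have DL: "D ^ Suc k \<le> D ^ (L * Suc k)" using D by (intro power_increasing) auto
  have "\<rho> ^ (L * Suc k) * l (L * Suc k) \<le> \<rho> ^ (L * Suc k) * (C ^ (L * Suc k) * (N (L * Suc k) / fact (L * Suc k)))"
   using l(3)[of "L * Suc k"] \<rho> by (intro mult_left_mono) (auto simp: fact_quot_def)
  also have "... \<le> \<rho> ^ (L * Suc k) * (C ^ (L * Suc k) * ((D ^ (L * Suc k) * N' (Suc k) ^ L) / fact (Suc k) ^ L))"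
  proof (intro mult_left_mono frac_le)
   show "N (L * Suc k) \<le> D ^ (L * Suc k) * N' (Suc k) ^ L"
    by (rule order_trans[OF D(2) mult_right_mono[OF DL]]) (use pos(3)[of "Suc k"] in simp)
   show "fact (Suc k) ^ L \<le> (fact (L * Suc k) :: real)" by (rule fact_power_le_fact_mult)
  qed (use \<rho> C D pos(3)[of "Suc k"] in auto)
  also have "... = y ^ L"
   by (simp only: y_def power_mult_distrib power_divide power_mult[symmetric] mult.commute[of _ L]) (simp add: mult_ac)
  finally have "root L (\<rho> ^ (L * Suc k) * l (L * Suc k)) \<le> root L (y ^ L)" using L by (intro real_root_le_mono) auto
  also have "... = y" using y0 L by (simp add: real_root_power_cancel)
  finally have "fact k * root L (\<rho> ^ (L * Suc k) * l (L * Suc k)) \<le> fact k * y" by (intro mult_left_mono) auto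
  also have "... \<le> fact (Suc k) * y" using y0 by (intro mult_right_mono fact_mono) auto
  also have "... = (\<rho> * C * D) ^ Suc k * N' (Suc k)" unfolding y_def by (simp del: power_Suc fact_Suc)
  also have "... \<le> (\<rho> * C * D) ^ Suc k * (D' ^ Suc k * (N'' 1 * N'' k))"
   using D'(2)[of 1 k] \<rho> C D by (intro mult_left_mono) auto
  also have "... = (\<rho> * E) ^ Suc k * (N'' 1 * N'' k)" by (simp only: E_def power_mult_distrib mult_ac)
  finally show ?thesis .
 qed
 \<comment> \<open>3072 is the product of the 6 of the operator norm and the 512 of
   \<open>joris_rate\<close>.\<close>
 define c where "c = 3072 * E"
 have c: "c > 0" using E by (simp add: c_def)
 show thesis
 proof (rule that[OF c])
  fix \<rho> :: real assume \<rho>: "\<rho> > 0"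
  show "transfer_weights j (\<lambda>k. \<rho> ^ k * M k) (\<lambda>k. (c * \<rho>) ^ k * N'' k)"
   unfolding transfer_weights_def L_def[symmetric]
  proof (rule exI[of _ "\<lambda>k. \<rho> ^ k * l k"], rule exI[of _ 1], intro conjI allI impI)
   show "log_convex_weight (\<lambda>k. \<rho> ^ k * l k)" by (rule log_convex_weight_scale[OF l(1) \<rho>])
   fix k
   have "M k \<le> fact k * l k" using l(2)[of k] by (simp add: fact_quot_def pos_divide_le_eq mult.commute)
   then have "\<rho> ^ k * M k \<le> \<rho> ^ k * (fact k * l k)" using \<rho> by (intro mult_left_mono) auto
   then show "\<rho> ^ k * M k \<le> 1 * fact k * (\<rho> ^ k * l k)" by (simp add: mult_ac)
  next
   fix \<sigma> :: real assume \<sigma>: "\<sigma> > 0"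
   \<comment> \<open>The purely geometric term is absorbed because \<open>N'' k / k!\<close>
     outgrows every geometric sequence.\<close>
   obtain A where A: "A > 0" "\<And>k. (6 / (\<sigma> * c * \<rho>)) ^ k \<le> A * fact_quot N'' k"
    using power_le_of_root_at_top[OF posq(3) N''(2)] by blast
   show "\<exists>A'. \<forall>k. fact k * 6 ^ k * (512 ^ k * root L (\<rho> ^ (L * Suc k) * l (L * Suc k)) + (1 / \<sigma>) ^ k) \<le> A' * ((c * \<rho>) ^ k * N'' k)"
   proof (rule exI[of _ "\<rho> * E * N'' 1 + A"], intro allI)
    fix k
    have "fact k * 6 ^ k * (512 ^ k * root L (\<rho> ^ (L * Suc k) * l (L * Suc k))) = 3072 ^ k * (fact k * root L (\<rho> ^ (L * Suc k) * l (L * Suc k)))"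
     by (simp add: power_mult_distrib[symmetric])
    also have "... \<le> 3072 ^ k * ((\<rho> * E) ^ Suc k * (N'' 1 * N'' k))" by (intro mult_left_mono rt \<rho>) simp
    also have "... = (\<rho> * E * N'' 1) * ((c * \<rho>) ^ k * N'' k)" by (simp add: c_def power_mult_distrib mult_ac)
    finally have 1: "fact k * 6 ^ k * (512 ^ k * root L (\<rho> ^ (L * Suc k) * l (L * Suc k))) \<le> (\<rho> * E * N'' 1) * ((c * \<rho>) ^ k * N'' k)" .
    have e: "6 * (1 / \<sigma>) = 6 / (\<sigma> * c * \<rho>) * (c * \<rho>)" using \<sigma> \<rho> c by simp
    have "fact k * 6 ^ k * (1 / \<sigma>) ^ k = fact k * (6 * (1 / \<sigma>)) ^ k" by (simp only: power_mult_distrib mult.assoc)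
    also have "... = fact k * (c * \<rho>) ^ k * (6 / (\<sigma> * c * \<rho>)) ^ k" unfolding e by (simp only: power_mult_distrib mult_ac)
    also have "... \<le> fact k * (c * \<rho>) ^ k * (A * fact_quot N'' k)" using c \<rho> by (intro mult_left_mono A(2)) auto
    also have "... = A * ((c * \<rho>) ^ k * N'' k)" by (simp add: fact_quot_def)
    finally have 2: "fact k * 6 ^ k * (1 / \<sigma>) ^ k \<le> A * ((c * \<rho>) ^ k * N'' k)" .
    show "fact k * 6 ^ k * (512 ^ k * root L (\<rho> ^ (L * Suc k) * l (L * Suc k)) + (1 / \<sigma>) ^ k) \<le> (\<rho> * E * N'' 1 + A) * ((c * \<rho>) ^ k * N'' k)"
     using add_mono[OF 1 2] by (simp only: distrib_left distrib_right)
   qed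
  qed
 qed
qed

lemma R_admissible_transfer:
 assumes R: "R_admissible \<MM>" and j: "j \<ge> 1" and M: "M \<in> \<MM>"
 shows "\<exists>N\<in>\<MM>. \<exists>c>0. \<forall>\<rho>>0. transfer_weights j (\<lambda>k. \<rho> ^ k * M k) (\<lambda>k. (c * \<rho>) ^ k * N k)"
proof -
 have ws: "weight_sequence X" "filterlim (\<lambda>k. root k (fact_quot X k)) at_top sequentially" if "X \<in> \<MM>" for X
  using R that by (auto simp: R_admissible_def weight_matrix_def)
 have ex: "\<exists>N\<in>\<MM>. mg X N < \<infinity>" if "X \<in> \<MM>" for X using R that by (auto simp: R_admissible_def)
 have it: "\<exists>Y\<in>\<MM>. mg_iterated (Suc n) X Y" if "X \<in> \<MM>" for X n
  using that
 proof (induction n arbitrary: X)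
  case 0
  then show ?case using mg_iterated_1 by auto
 next
  case (Suc n)
  obtain X1 where X1: "X1 \<in> \<MM>" "mg X X1 < \<infinity>" using ex Suc.prems by blast
  obtain Y where "Y \<in> \<MM>" "mg_iterated (Suc n) X1 Y" using Suc.IH X1 by blast
  then show ?case using mg_iterated_Suc[OF _ _ _ X1(2)] ws X1 Suc.prems by blast
 qed
 define L where "L = joris_exponent j"
 have "L \<noteq> 0" using j by (simp add: L_def)
 then obtain n where n: "L = Suc n" using not0_implies_Suc by blast
 obtain N where N: "N \<in> \<MM>" and \<Gamma>: "\<exists>C\<ge>1. \<forall>t>0. Gamma_upper (fact_quot N) (C * t) \<le> Gamma_lower (fact_quot M) t"
  using R M unfolding R_admissible_def by blast
 obtain N' where N': "N' \<in> \<MM>" "mg_iterated L N N'" using it N unfolding n by blast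
 obtain N'' where N'': "N'' \<in> \<MM>" "mg N' N'' < \<infinity>" using ex N' by blast
 show ?thesis
  using transfer_weights_sequence[OF j ws[OF M] ws[OF N] ws(1)[OF N'(1)] ws[OF N''(1)] \<Gamma> N'(2)[unfolded L_def] N''(2)] N''(1)
  by metis
qed

text \<open>The chain of the Roumieu case is traversed from its other end: the target is given and a
  source is found.\<close>

lemma B_admissible_transfer:
 assumes B: "B_admissible \<MM>" and j: "j \<ge> 1" and N'': "N'' \<in> \<MM>"
 shows "\<exists>M\<in>\<MM>. \<exists>c>0. \<forall>\<rho>>0. transfer_weights j (\<lambda>k. \<rho> ^ k * M k) (\<lambda>k. (c * \<rho>) ^ k * N'' k)"
proof -
 have ws: "weight_sequence X" "filterlim (\<lambda>k. root k (fact_quot X k)) at_top sequentially" if "X \<in> \<MM>" for X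
  using B that by (auto simp: B_admissible_def weight_matrix_def)
 have ex: "\<exists>N\<in>\<MM>. mg N X < \<infinity>" if "X \<in> \<MM>" for X using B that by (auto simp: B_admissible_def)
 have it: "\<exists>X\<in>\<MM>. mg_iterated (Suc n) X Y" if "Y \<in> \<MM>" for Y n
 proof (induction n)
  case 0
  then show ?case using mg_iterated_1 that by auto
 next
  case (Suc n)
  then obtain X1 where X1: "X1 \<in> \<MM>" "mg_iterated (Suc n) X1 Y" by blast
  obtain X where X: "X \<in> \<MM>" "mg X X1 < \<infinity>" using ex X1 by blast
  then show ?case using mg_iterated_Suc[OF _ _ _ X(2) X1(2)] ws X1 that by blast
 qed
 define L where "L = joris_exponent j"
 have "L \<noteq> 0" using j by (simp add: L_def)
 then obtain n where n: "L = Suc n" using not0_implies_Suc by blast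
 obtain N' where N': "N' \<in> \<MM>" "mg N' N'' < \<infinity>" using ex N'' by blast
 obtain N where N: "N \<in> \<MM>" "mg_iterated L N N'" using it N' unfolding n by blast
 obtain M where M: "M \<in> \<MM>" and \<Gamma>: "\<exists>C\<ge>1. \<forall>t>0. Gamma_upper (fact_quot N) (C * t) \<le> Gamma_lower (fact_quot M) t"
  using B N unfolding B_admissible_def by blast
 show ?thesis
  using transfer_weights_sequence[OF j ws[OF M] ws[OF N(1)] ws(1)[OF N'(1)] ws[OF N''] \<Gamma> N(2)[unfolded L_def] N'(2)] M
  by metis
qed

text \<open>A weight matrix without a largest element is dominated by countably many elements: a sequence that
 exceeds a rational \<open>q\<close> at an index \<open>k\<close> is chosen for each pair \<open>(k, q)\<close>.\<close>

lemma weight_matrix_cofinal_chain: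
 assumes "weight_matrix \<MM>"
 obtains S :: "nat => nat => real" where "\<forall>m. S m \<in> \<MM>" "mono S" "\<forall>M\<in>\<MM>. \<exists>m. M \<le> S m"
proof -
 have ne: "\<MM> \<noteq> {}" and tot: "\<And>M N. M \<in> \<MM> ==> N \<in> \<MM> ==> M \<le> N \<or> N \<le> M"
  using assms by (auto simp: weight_matrix_def)
 show thesis
 proof (cases "\<exists>M\<in>\<MM>. \<forall>N\<in>\<MM>. N \<le> M")
  case True
  then obtain M where "M \<in> \<MM>" "\<And>N. N \<in> \<MM> ==> N \<le> M" by blast
  then show thesis by (intro that[of "\<lambda>_. M"]) (auto simp: mono_def)
 next
  case False
  have "\<forall>kq. \<exists>N. N \<in> \<MM> \<and> ((\<exists>N\<in>\<MM>. real_of_rat (snd kq) < N (fst kq)) --> real_of_rat (snd kq) < N (fst kq))"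
   using ne by blast
  from choice[OF this] obtain e where e: "\<And>kq. e kq \<in> \<MM>"
   "\<And>kq N. N \<in> \<MM> ==> real_of_rat (snd kq) < N (fst kq) ==> real_of_rat (snd kq) < e kq (fst kq)" by blast
  \<comment> \<open>In a totally ordered family the supremum of two members is one of them, so the
    running suprema stay in the matrix.\<close>
  define S where "S = rec_nat (e (from_nat 0)) (\<lambda>n X. sup X (e (from_nat (Suc n))))"
  have S: "S 0 = e (from_nat 0)" "\<And>n. S (Suc n) = sup (S n) (e (from_nat (Suc n)))" by (simp_all add: S_def)
  have SM: "S n \<in> \<MM>" for n
  proof (induction n)
   case (Suc n)
   then show ?case using tot[OF Suc e(1), of "from_nat (Suc n)"] e(1)[of "from_nat (Suc n)"]
    unfolding S(2) by (metis sup_absorb1 sup_absorb2 Suc.IH)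
  qed (simp add: S e)
  show thesis
  proof (rule that)
   show "\<forall>m. S m \<in> \<MM>" using SM by simp
   show "mono S" by (rule incseq_SucI) (simp only: S(2) sup_ge1)
   show "\<forall>M\<in>\<MM>. \<exists>m. M \<le> S m"
   proof
   fix M assume M: "M \<in> \<MM>"
   then obtain N where N: "N \<in> \<MM>" "\<not> N \<le> M" using False by blast
   then obtain k where k: "M k < N k" by (auto simp: le_fun_def not_le)
   then obtain q where q: "M k < real_of_rat q" "real_of_rat q < N k" using of_rat_dense by blast
   have "real_of_rat q < e (k, q) k" using e(2)[of N "(k, q)"] N q by simp
   then have "\<not> e (k, q) \<le> M" using q by (auto simp: le_fun_def not_le intro!: exI[of _ k])
   then have "M \<le> e (k, q)" using tot[OF M e(1)] by blast
   moreover have "e (from_nat n) \<le> S n" for n by (cases n) (simp_all only: S order_refl sup_ge2)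
   then have "e (k, q) \<le> S (to_nat (k, q))" by (metis from_nat_to_nat)
   ultimately show "\<exists>m. M \<le> S m" by (intro exI[of _ "to_nat (k, q)"]) (rule order_trans)
   qed
  qed
 qed
qed

lemma SUP_divide_finite_iff:
 fixes X :: "nat => 'v => ennreal" and w :: "nat => real"
 assumes w: "\<And>k. w k > 0"
 shows "(SUP x\<in>K. SUP k. X k x / ennreal (w k)) < \<infinity> \<longleftrightarrow> (\<exists>A. \<forall>x\<in>K. \<forall>k. X k x \<le> ennreal (A * w k))"
proof
 assume fin: "(SUP x\<in>K. SUP k. X k x / ennreal (w k)) < \<infinity>"
 define A where "A = enn2real (SUP x\<in>K. SUP k. X k x / ennreal (w k))"
 have A: "(SUP x\<in>K. SUP k. X k x / ennreal (w k)) = ennreal A" using fin by (simp add: A_def less_top)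
 have "X k x \<le> ennreal (A * w k)" if "x \<in> K" for x k
 proof -
  have "X k x / ennreal (w k) \<le> ennreal A"
   unfolding A[symmetric] by (rule SUP_upper2[OF that]) (rule SUP_upper, simp)
  then have "X k x / ennreal (w k) * ennreal (w k) \<le> ennreal A * ennreal (w k)" by (rule mult_right_mono) simp
  moreover have "X k x / ennreal (w k) * ennreal (w k) = X k x"
   using w[of k] by (simp add: ennreal_divide_times ennreal_divide_self)
  ultimately show ?thesis using w[of k] by (simp add: ennreal_mult'' less_imp_le)
 qed
 then show "\<exists>A. \<forall>x\<in>K. \<forall>k. X k x \<le> ennreal (A * w k)" by blast
next
 assume "\<exists>A. \<forall>x\<in>K. \<forall>k. X k x \<le> ennreal (A * w k)"
 then obtain A where A: "\<And>x k. x \<in> K ==> X k x \<le> ennreal (A * w k)" by blast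
 have "X k x / ennreal (w k) \<le> ennreal (max 0 A)" if "x \<in> K" for x k
 proof -
  have "A * w k \<le> max 0 A * w k" using w[of k] by (intro mult_right_mono) auto
  then have "X k x \<le> ennreal (max 0 A * w k)" using order_trans[OF A[OF that] ennreal_leI] by blast
  then have "X k x / ennreal (w k) \<le> ennreal (max 0 A * w k) / ennreal (w k)" by (rule divide_right_mono_ennreal)
  also have "... = ennreal (max 0 A)" using w[of k] by (simp add: divide_ennreal)
  finally show ?thesis .
 qed
 then have "(SUP x\<in>K. SUP k. X k x / ennreal (w k)) \<le> ennreal (max 0 A)" by (intro SUP_least)
 then show "(SUP x\<in>K. SUP k. X k x / ennreal (w k)) < \<infinity>" by (rule le_less_trans) simp
qed

lemma M_norm_finite_iff:
 assumes "\<And>k. M k > 0" "\<rho> > 0"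
 shows "M_norm V p W M K \<rho> f < \<infinity> \<longleftrightarrow> (\<exists>A. \<forall>x\<in>K. \<forall>k. op_norm V p k (frechet_deriv V p W f k x) \<le> ennreal (A * (\<rho> ^ k * M k)))"
 unfolding M_norm_def by (rule SUP_divide_finite_iff) (use assms in simp)

section \<open>Concave weight functions\<close>

text \<open>For \<rho> > 0 these sequences form the weight matrix associated with \<omega>.\<close>

definition omega_weight :: "(real => real) => real => nat => real" where
 "omega_weight \<omega> \<rho> k = exp ((1 / \<rho>) * phi_conj \<omega> (\<rho> * real k))"

lemma omega_weight_pos [simp]: "0 < omega_weight \<omega> \<rho> k"
 by (simp add: omega_weight_def)

lemma weight_function_nonneg: "weight_function \<omega> ==> 0 \<le> t ==> 0 \<le> \<omega> t"
 by (simp add: weight_function_def)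

lemma weight_function_mono: "weight_function \<omega> ==> 0 \<le> s ==> s \<le> t ==> \<omega> s \<le> \<omega> t"
 by (auto simp: weight_function_def mono_on_def)

lemma weight_function_above_ln:
 assumes "weight_function \<omega>" "c > 0"
 obtains T where "T \<ge> 1" "\<And>t. t \<ge> T ==> c * ln t \<le> \<omega> t"
proof -
 have "ln \<in> o[at_top](\<omega>)" using assms by (simp add: weight_function_def)
 then have "\<forall>\<^sub>F t in at_top. norm (ln t) \<le> (1 / c) * norm (\<omega> t)" by (rule landau_o.smallD) (use assms in simp)
 then obtain T where T: "\<And>t. t \<ge> T ==> norm (ln t) \<le> (1 / c) * norm (\<omega> t)" by (auto simp: eventually_at_top_linorder)
 show thesis
 proof (rule that[of "max 1 T"])
  fix t assume t: "max 1 T \<le> t"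
  have "ln t \<le> (1 / c) * \<omega> t" using T[of t] t weight_function_nonneg[OF assms(1), of t] by auto
  then show "c * ln t \<le> \<omega> t" using assms(2) by (simp add: pos_le_divide_eq mult.commute)
 qed simp
qed

lemma weight_function_unbounded:
 assumes "weight_function \<omega>"
 obtains t where "t \<ge> s" "c < \<omega> t"
proof -
 obtain T where T: "T \<ge> 1" "\<And>t. t \<ge> T ==> 1 * ln t \<le> \<omega> t" using weight_function_above_ln[OF assms, of 1] by auto
 define t where "t = max (max T s) (exp (\<bar>c\<bar> + 1))"
 have t: "t \<ge> T" "t \<ge> s" "t \<ge> exp (\<bar>c\<bar> + 1)" by (auto simp: t_def)
 have "\<bar>c\<bar> + 1 \<le> ln t" using t by (subst ln_ge_iff) (auto intro: less_le_trans[OF exp_gt_zero])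
 then show thesis using T(2)[OF t(1)] t by (intro that[of t]) auto
qed

lemma weight_function_sublinear:
 assumes \<omega>: "weight_function \<omega>" and e: "\<epsilon> > 0"
 obtains E where "E \<ge> 0" "\<And>s. s \<ge> 0 ==> \<omega> s \<le> \<epsilon> * s + E"
proof -
 have "\<omega> \<in> o[at_top](\<lambda>t. t)" using \<omega> by (simp add: weight_function_def)
 then have "\<forall>\<^sub>F t in at_top. norm (\<omega> t) \<le> \<epsilon> * norm t" by (rule landau_o.smallD) (rule e)
 then obtain T where T: "\<And>t. t \<ge> T ==> norm (\<omega> t) \<le> \<epsilon> * norm t" by (auto simp: eventually_at_top_linorder)
 define T' where "T' = max 0 T"
 show thesis
 proof (rule that)
  show E: "\<omega> T' \<ge> 0" by (rule weight_function_nonneg[OF \<omega>]) (simp add: T'_def)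
  fix s :: real assume s: "s \<ge> 0"
  show "\<omega> s \<le> \<epsilon> * s + \<omega> T'"
  proof (cases "s \<ge> T'")
   case True
   then show ?thesis using T[of s] s E by (auto simp: T'_def)
  next
   case False
   then have "\<omega> s \<le> \<omega> T'" using s by (intro weight_function_mono[OF \<omega>]) auto
   then show ?thesis using s e mult_nonneg_nonneg[of \<epsilon> s] by linarith
  qed
 qed
qed

lemma weight_function_dilation:
 assumes \<omega>: "weight_function \<omega>"
 obtains D E where "D > 0" "\<And>s. s \<ge> 0 ==> \<omega> (2 ^ n * s) \<le> D * \<omega> s + E"
proof -
 have "(\<lambda>t. \<omega> (2 * t)) \<in> O[at_top](\<omega>)" using \<omega> by (simp add: weight_function_def)
 then obtain c where c: "c > 0" "\<forall>\<^sub>F t in at_top. norm (\<omega> (2 * t)) \<le> c * norm (\<omega> t)" by (rule landau_o.bigE)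
 then obtain T where T: "\<And>t. t \<ge> T ==> norm (\<omega> (2 * t)) \<le> c * norm (\<omega> t)" by (auto simp: eventually_at_top_linorder)
 define T' where "T' = max 0 T"
 have E0: "\<omega> (2 * T') \<ge> 0" by (rule weight_function_nonneg[OF \<omega>]) (simp add: T'_def)
 have two: "\<omega> (2 * s) \<le> c * \<omega> s + \<omega> (2 * T')" if s: "s \<ge> 0" for s
 proof (cases "s \<ge> T'")
  case True
  then show ?thesis using T[of s] s E0 weight_function_nonneg[OF \<omega>, of s] by (auto simp: T'_def)
 next
  case False
  then have "\<omega> (2 * s) \<le> \<omega> (2 * T')" using s by (intro weight_function_mono[OF \<omega>]) auto
  then show ?thesis using mult_nonneg_nonneg[of c "\<omega> s"] c weight_function_nonneg[OF \<omega> s] by linarith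
 qed
 have "\<exists>D>0. \<exists>E. \<forall>s\<ge>0. \<omega> (2 ^ n * s) \<le> D * \<omega> s + E"
 proof (induction n)
  case 0
  show ?case by (rule exI[of _ 1]) (auto intro: exI[of _ 0])
 next
  case (Suc n)
  then obtain D E where DE: "D > 0" "\<And>s. s \<ge> 0 ==> \<omega> (2 ^ n * s) \<le> D * \<omega> s + E" by blast
  have "\<omega> (2 ^ Suc n * s) \<le> (c * D) * \<omega> s + (c * E + \<omega> (2 * T'))" if s: "s \<ge> 0" for s
  proof -
   have "\<omega> (2 ^ Suc n * s) \<le> c * \<omega> (2 ^ n * s) + \<omega> (2 * T')" using two[of "2 ^ n * s"] s by (simp add: mult.assoc)
   moreover have "c * \<omega> (2 ^ n * s) \<le> c * (D * \<omega> s + E)" using DE(2)[OF s] c by (intro mult_left_mono) auto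
   ultimately show ?thesis by (simp add: algebra_simps)
  qed
  moreover have "c * D > 0" using c DE by simp
  ultimately show ?case by blast
 qed
 then show thesis using that by blast
qed

text \<open>With \<open>omega_weight_le\<close> this describes the weight as the least
  \<open>W\<close> such that \<open>s^k \<le> W exp (\<omega> s / \<rho>)\<close> for all
  \<open>s \<ge> 1\<close>; put \<open>s = exp x\<close> in the conjugate. Comparisons of weights
  are made through this description.\<close>

lemma omega_weight_ge:
 assumes \<omega>: "weight_function \<omega>" and \<rho>: "\<rho> > 0" and s: "s \<ge> 1"
 shows "s ^ k \<le> exp (\<omega> s / \<rho>) * omega_weight \<omega> \<rho> k"
proof -
 define y where "y = \<rho> * real k"
 have y: "y \<ge> 0" using \<rho> by (simp add: y_def)
 obtain T where T: "T \<ge> 1" "\<And>t. t \<ge> T ==> (y + 1) * ln t \<le> \<omega> t" using weight_function_above_ln[OF \<omega>, of "y + 1"] y by auto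
 have bdd: "bdd_above ((\<lambda>x. x * y - \<omega> (exp x)) ` {0..})"
 proof (rule bdd_aboveI2)
  fix x :: real assume x: "x \<in> {0..}"
  show "x * y - \<omega> (exp x) \<le> ln T * y"
  proof (cases "exp x \<ge> T")
   case True
   have "(y + 1) * x \<le> \<omega> (exp x)" using T(2)[OF True] by simp
   moreover have "(y + 1) * x = x * y + x" by (simp add: algebra_simps)
   moreover have "ln T * y \<ge> 0" using T y by simp
   ultimately show ?thesis using x by simp
  next
   case False
   then have "x \<le> ln T" using T by (subst ln_ge_iff) auto
   then have "x * y \<le> ln T * y" using y by (rule mult_right_mono)
   then show ?thesis using weight_function_nonneg[OF \<omega>, of "exp x"] by simp
  qed
 qed
 have "ln s * y - \<omega> (exp (ln s)) \<le> phi_conj \<omega> y"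
  unfolding phi_conj_def by (rule cSUP_upper[OF _ bdd]) (use s in auto)
 then have "ln s * y - \<omega> s \<le> phi_conj \<omega> y" using s by simp
 then have "(ln s * y - \<omega> s) / \<rho> \<le> phi_conj \<omega> y / \<rho>" using \<rho> by (intro divide_right_mono) auto
 moreover have "(ln s * y - \<omega> s) / \<rho> = real k * ln s - \<omega> s / \<rho>" using \<rho> by (simp add: y_def diff_divide_distrib)
 ultimately have "real k * ln s \<le> \<omega> s / \<rho> + phi_conj \<omega> y / \<rho>" by simp
 then have "exp (real k * ln s) \<le> exp (\<omega> s / \<rho> + phi_conj \<omega> y / \<rho>)" by simp
 then show ?thesis using s by (simp add: exp_add omega_weight_def y_def exp_of_nat_mult)
qed

lemma omega_weight_le:
 assumes \<rho>: "\<rho> > 0" and A: "A > 0" and b: "\<And>s. s \<ge> 1 ==> s ^ k \<le> A * exp (\<omega> s / \<rho>)"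
 shows "omega_weight \<omega> \<rho> k \<le> A"
proof -
 have "phi_conj \<omega> (\<rho> * real k) \<le> \<rho> * ln A" unfolding phi_conj_def
 proof (rule cSUP_least)
  fix x :: real assume x: "x \<in> {0..}"
  have "exp x ^ k \<le> A * exp (\<omega> (exp x) / \<rho>)" by (rule b) (use x in simp)
  then have "exp (real k * x) \<le> exp (ln A + \<omega> (exp x) / \<rho>)" using A by (simp add: exp_of_nat_mult exp_add)
  then have "real k * x \<le> ln A + \<omega> (exp x) / \<rho>" by simp
  then have "\<rho> * (real k * x) \<le> \<rho> * (ln A + \<omega> (exp x) / \<rho>)" using \<rho> by (intro mult_left_mono) auto
  then show "x * (\<rho> * real k) - \<omega> (exp x) \<le> \<rho> * ln A" using \<rho> by (simp add: algebra_simps)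
 qed simp
 then have "phi_conj \<omega> (\<rho> * real k) / \<rho> \<le> ln A" using \<rho> by (simp add: pos_divide_le_eq mult.commute)
 then have "exp (phi_conj \<omega> (\<rho> * real k) / \<rho>) \<le> exp (ln A)" by simp
 then show ?thesis using A by (simp add: omega_weight_def)
qed

lemma omega_weight_mono:
 assumes \<omega>: "weight_function \<omega>" and "0 < \<rho>" "\<rho> \<le> \<sigma>"
 shows "omega_weight \<omega> \<rho> k \<le> omega_weight \<omega> \<sigma> k"
proof (rule omega_weight_le[OF assms(2) omega_weight_pos])
 fix s :: real assume s: "s \<ge> 1"
 have "s ^ k \<le> exp (\<omega> s / \<sigma>) * omega_weight \<omega> \<sigma> k" by (rule omega_weight_ge[OF \<omega> _ s]) (use assms in simp)
 also have "... \<le> exp (\<omega> s / \<rho>) * omega_weight \<omega> \<sigma> k"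
  using assms weight_function_nonneg[OF \<omega>, of s] s by (intro mult_right_mono) (auto intro!: divide_left_mono simp: less_imp_le[OF omega_weight_pos])
 finally show "s ^ k \<le> omega_weight \<omega> \<sigma> k * exp (\<omega> s / \<rho>)" by (simp add: mult.commute)
qed

text \<open>The inequality for the parameter \<open>L \<rho>\<close>, raised to the power
  \<open>L\<close>, has \<open>\<omega> s / \<rho>\<close> in the exponent again. So the loss of an
  L-th root costs only a change of parameter.\<close>

lemma omega_weight_mult:
 assumes \<omega>: "weight_function \<omega>" and \<rho>: "\<rho> > 0" and L: "L > 0"
 shows "omega_weight \<omega> \<rho> (L * k) \<le> omega_weight \<omega> (real L * \<rho>) k ^ L"
proof (rule omega_weight_le[OF \<rho>])
 fix s :: real assume s: "s \<ge> 1"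
 have "s ^ (L * k) = (s ^ k) ^ L" by (simp add: power_mult[symmetric] mult.commute)
 also have "... \<le> (exp (\<omega> s / (real L * \<rho>)) * omega_weight \<omega> (real L * \<rho>) k) ^ L"
  by (intro power_mono omega_weight_ge \<omega> s) (use \<rho> L s in auto)
 also have "... = exp (\<omega> s / (real L * \<rho>)) ^ L * omega_weight \<omega> (real L * \<rho>) k ^ L" by (rule power_mult_distrib)
 also have "exp (\<omega> s / (real L * \<rho>)) ^ L = exp (\<omega> s / \<rho>)" using L by (simp add: exp_of_nat_mult[symmetric])
 finally show "s ^ (L * k) \<le> omega_weight \<omega> (real L * \<rho>) k ^ L * exp (\<omega> s / \<rho>)" by (simp add: mult.commute)
qed simp

lemma omega_weight_Suc:
 assumes \<omega>: "weight_function \<omega>" and \<rho>: "\<rho> > 0"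
 shows "omega_weight \<omega> \<rho> (Suc k) \<le> omega_weight \<omega> (2 * \<rho>) 1 * omega_weight \<omega> (2 * \<rho>) k"
proof (rule omega_weight_le[OF \<rho>])
 fix s :: real assume s: "s \<ge> 1"
 have "s ^ Suc k = s ^ 1 * s ^ k" by simp
 also have "... \<le> (exp (\<omega> s / (2 * \<rho>)) * omega_weight \<omega> (2 * \<rho>) 1) * (exp (\<omega> s / (2 * \<rho>)) * omega_weight \<omega> (2 * \<rho>) k)"
  by (intro mult_mono omega_weight_ge \<omega> s) (use \<rho> s in \<open>auto intro!: mult_nonneg_nonneg simp: less_imp_le[OF omega_weight_pos]\<close>)
 also have "... = omega_weight \<omega> (2 * \<rho>) 1 * omega_weight \<omega> (2 * \<rho>) k * (exp (\<omega> s / (2 * \<rho>)) * exp (\<omega> s / (2 * \<rho>)))" by simp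
 also have "exp (\<omega> s / (2 * \<rho>)) * exp (\<omega> s / (2 * \<rho>)) = exp (\<omega> s / \<rho>)" unfolding exp_add[symmetric] using \<rho> by (simp add: field_simps)
 finally show "s ^ Suc k \<le> omega_weight \<omega> (2 * \<rho>) 1 * omega_weight \<omega> (2 * \<rho>) k * exp (\<omega> s / \<rho>)" .
qed simp

text \<open>Dilating \<open>s\<close> by \<open>2^n\<close> produces the factor
  \<open>(2^n)^k\<close>; by the doubling condition it costs a multiple of \<omega> and a constant,
  that is, a change of \<rho>.\<close>

lemma omega_weight_geometric:
 assumes \<omega>: "weight_function \<omega>"
 obtains D where "D > 0" "\<And>\<rho>. \<rho> > 0 ==> \<exists>A. \<forall>k. (2 ^ n) ^ k * omega_weight \<omega> \<rho> k \<le> A * omega_weight \<omega> (D * \<rho>) k"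
proof -
 obtain D E where DE: "D > 0" "\<And>s. s \<ge> 0 ==> \<omega> (2 ^ n * s) \<le> D * \<omega> s + E" using weight_function_dilation[OF \<omega>] by blast
 show thesis
 proof (rule that[OF DE(1)], rule exI, rule allI)
  fix \<rho> :: real and k assume \<rho>: "\<rho> > 0"
  let ?A = "exp (E / (D * \<rho>)) * omega_weight \<omega> (D * \<rho>) k"
  have "omega_weight \<omega> \<rho> k \<le> ?A / (2 ^ n) ^ k"
  proof (rule omega_weight_le[OF \<rho>])
   fix s :: real assume s: "s \<ge> 1"
   have s2: "2 ^ n * s \<ge> 1" using mult_mono[of 1 "2 ^ n" 1 s] s by simp
   have "(2 ^ n) ^ k * s ^ k = (2 ^ n * s) ^ k" by (simp add: power_mult_distrib)
   also have "... \<le> exp (\<omega> (2 ^ n * s) / (D * \<rho>)) * omega_weight \<omega> (D * \<rho>) k"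
    by (rule omega_weight_ge[OF \<omega> _ s2]) (use DE \<rho> in simp)
   also have "... \<le> exp ((D * \<omega> s + E) / (D * \<rho>)) * omega_weight \<omega> (D * \<rho>) k"
    using DE \<rho> s by (intro mult_right_mono) (auto intro!: divide_right_mono simp: less_imp_le[OF omega_weight_pos])
   also have "(D * \<omega> s + E) / (D * \<rho>) = E / (D * \<rho>) + \<omega> s / \<rho>" using DE \<rho> by (simp add: add_divide_distrib)
   finally have "(2 ^ n) ^ k * s ^ k \<le> ?A * exp (\<omega> s / \<rho>)" by (simp add: exp_add mult_ac)
   then show "s ^ k \<le> ?A / (2 ^ n) ^ k * exp (\<omega> s / \<rho>)" by (simp add: pos_le_divide_eq mult.commute)
  qed simp
  then show "(2 ^ n) ^ k * omega_weight \<omega> \<rho> k \<le> exp (E / (D * \<rho>)) * omega_weight \<omega> (D * \<rho>) k"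
   by (simp add: pos_le_divide_eq mult.commute)
 qed
qed

lemma fact_le_power_self: "(fact k :: real) \<le> real k ^ k"
proof -
 have "(fact k :: real) \<le> of_nat (k ^ k)" by (rule fact_le_power)
 then show ?thesis by simp
qed

text \<open>The test point is a multiple \<open>s = d k\<close>. Because \<omega> is sublinear,
  \<open>exp (\<omega> s / \<rho>)\<close> is at most a constant times \<open>e^k\<close> there. The
  index 0 is treated apart, since \<open>s\<close> has to be at least 1.\<close>

lemma fact_geometric_le_omega_weight:
 assumes \<omega>: "weight_function \<omega>" and \<rho>: "\<rho> > 0"
 obtains A where "\<And>k. fact k * c ^ k \<le> A * omega_weight \<omega> \<rho> k"
proof -
 define d where "d = max 1 (\<bar>c\<bar> * exp 1)"
 have d: "d \<ge> 1" "\<bar>c\<bar> * exp 1 \<le> d" by (auto simp: d_def)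
 obtain E where E: "E \<ge> 0" "\<And>s. s \<ge> 0 ==> \<omega> s \<le> (\<rho> / d) * s + E"
  using weight_function_sublinear[OF \<omega>, of "\<rho> / d"] \<rho> d by auto
 define A where "A = max (exp (E / \<rho>)) (1 / omega_weight \<omega> \<rho> 0)"
 show thesis
 proof (rule that[of A])
  fix k
  show "fact k * c ^ k \<le> A * omega_weight \<omega> \<rho> k"
  proof (cases "k = 0")
   case True
   have "1 / omega_weight \<omega> \<rho> 0 * omega_weight \<omega> \<rho> 0 \<le> A * omega_weight \<omega> \<rho> 0"
    by (intro mult_right_mono) (auto simp: A_def less_imp_le[OF omega_weight_pos])
   moreover have "1 / omega_weight \<omega> \<rho> 0 * omega_weight \<omega> \<rho> 0 = 1" using omega_weight_pos[of \<omega> \<rho> 0] by (simp add: less_imp_neq[symmetric])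
   ultimately show ?thesis using True by simp
  next
   case False
   define s where "s = d * real k"
   have s: "s \<ge> 1" using mult_mono[of 1 d 1 "real k"] d False by (simp add: s_def)
   have "\<omega> s / \<rho> \<le> ((\<rho> / d) * s + E) / \<rho>" using E(2)[of s] s \<rho> by (intro divide_right_mono) auto
   also have "... = real k + E / \<rho>" using \<rho> d by (simp add: s_def add_divide_distrib)
   finally have e: "exp (\<omega> s / \<rho>) \<le> exp (real k) * exp (E / \<rho>)" by (simp add: exp_add[symmetric])
   have "fact k * c ^ k \<le> fact k * \<bar>c\<bar> ^ k"
    using abs_ge_self[of "c ^ k"] by (intro mult_left_mono) (auto simp: power_abs)
   also have "... \<le> real k ^ k * \<bar>c\<bar> ^ k" by (intro mult_right_mono fact_le_power_self) simp
   also have "... = (\<bar>c\<bar> * exp 1 * real k) ^ k / exp (real k)"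
    by (simp add: power_mult_distrib exp_of_nat_mult[of k 1, simplified])
   also have "... \<le> s ^ k / exp (real k)" unfolding s_def using d by (intro divide_right_mono power_mono mult_right_mono) auto
   also have "... \<le> (exp (\<omega> s / \<rho>) * omega_weight \<omega> \<rho> k) / exp (real k)" by (intro divide_right_mono omega_weight_ge \<omega> \<rho> s) simp
   also have "... \<le> (exp (real k) * exp (E / \<rho>) * omega_weight \<omega> \<rho> k) / exp (real k)"
    using e by (intro divide_right_mono mult_right_mono) (auto simp: less_imp_le[OF omega_weight_pos])
   also have "... = exp (E / \<rho>) * omega_weight \<omega> \<rho> k" by simp
   also have "... \<le> A * omega_weight \<omega> \<rho> k" by (intro mult_right_mono) (auto simp: A_def less_imp_le[OF omega_weight_pos])
   finally show ?thesis .
  qed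
 qed
qed

lemma power_le_fact_exp: "(x::real) \<ge> 0 ==> x ^ k \<le> fact k * exp x"
proof -
 assume x: "x \<ge> 0"
 have "(\<Sum>i\<in>{k}. x ^ i /\<^sub>R fact i) \<le> (\<Sum>i. x ^ i /\<^sub>R fact i)"
  by (rule sum_le_suminf) (use x summable_exp_generic[of x] in auto)
 then have "x ^ k / fact k \<le> exp x" by (simp add: exp_def divide_inverse_commute)
 then show ?thesis by (simp add: pos_divide_le_eq mult.commute)
qed

text \<open>\<open>t\<close> is the slope of a supporting line at \<open>s\<close>, divided by
  \<rho>; it is positive since \<omega> is unbounded.\<close>

lemma concave_supergradient:
 assumes \<omega>: "weight_function \<omega>" "concave_on {0..} \<omega>" and \<rho>: "\<rho> > 0" and s: "s > 0"
 obtains t where "t > 0" "\<And>u. u \<ge> 0 ==> \<omega> u / \<rho> - u * t \<le> \<omega> s / \<rho> - s * t"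
proof -
 have "convex_on {0..} (\<lambda>t. - \<omega> t)" using \<omega>(2) by (simp add: concave_on_def)
 then obtain d where d: "\<And>u. u \<ge> 0 ==> - \<omega> u \<ge> - \<omega> s + d * (u - s)"
  using convex_le_Inf_differential[of "{0..}" "\<lambda>t. - \<omega> t" s] s by (auto simp: interior_real_atLeast)
 have "d < 0"
 proof (rule ccontr)
  assume "\<not> d < 0"
  obtain u where u: "u \<ge> s" "\<omega> s < \<omega> u" using weight_function_unbounded[OF \<omega>(1)] by blast
  have "d * (u - s) \<ge> 0" using \<open>\<not> d < 0\<close> u by simp
  then show False using d[of u] u s by simp
 qed
 show thesis
 proof (rule that[of "- d / \<rho>"])
  show "0 < - d / \<rho>" using divide_neg_pos[OF \<open>d < 0\<close> \<rho>] by simp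
  fix u :: real assume u: "u \<ge> 0"
  have "\<omega> u + u * d \<le> \<omega> s + s * d" using d[OF u] by (simp add: algebra_simps)
  then have "(\<omega> u + u * d) / \<rho> \<le> (\<omega> s + s * d) / \<rho>" using \<rho> by (intro divide_right_mono) auto
  then show "\<omega> u / \<rho> - u * (- d / \<rho>) \<le> \<omega> s / \<rho> - s * (- d / \<rho>)" by (simp add: add_divide_distrib)
 qed
qed

text \<open>For concave \<open>\<omega>\<close> the weights are comparable to \<open>k! \<lambda>\<^sub>k\<close> with
 \<open>\<lambda>\<^sub>k = sup\<^sub>t t\<^sup>-\<^sup>k exp(-\<kappa>(t))\<close>, where \<open>\<kappa>(t) = sup\<^sub>s (\<omega>(s)/\<rho> - st)\<close>; as a supremum of
 log-linear functions of \<open>k\<close>, \<open>\<lambda>\<close> is log-convex.\<close>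

lemma omega_weight_log_convex:
 assumes \<omega>: "weight_function \<omega>" "concave_on {0..} \<omega>" and \<rho>: "\<rho> > 0"
 obtains l A where "A > 0" "log_convex_weight l" "\<And>k. omega_weight \<omega> \<rho> k \<le> A * fact k * l k"
  "\<And>k. k > 0 ==> l k \<le> A * (exp 1 / real k) ^ k * omega_weight \<omega> \<rho> k"
proof -
 define \<kappa> where "\<kappa> t = (SUP s\<in>{0..}. \<omega> s / \<rho> - s * t)" for t
 have bdd: "bdd_above ((\<lambda>s. \<omega> s / \<rho> - s * t) ` {0..})" if t: "t > 0" for t
 proof -
  obtain E where E: "\<And>s. s \<ge> 0 ==> \<omega> s \<le> (\<rho> * t) * s + E"
   using weight_function_sublinear[OF \<omega>(1), of "\<rho> * t"] \<rho> t by auto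
  show ?thesis
  proof (rule bdd_aboveI2)
   fix s :: real assume "s \<in> {0..}"
   then have "\<omega> s / \<rho> \<le> ((\<rho> * t) * s + E) / \<rho>" using E[of s] \<rho> by (intro divide_right_mono) auto
   then show "\<omega> s / \<rho> - s * t \<le> E / \<rho>" using \<rho> by (simp add: add_divide_distrib mult.commute)
  qed
 qed
 have \<kappa>ge: "\<omega> s / \<rho> - s * t \<le> \<kappa> t" if "t > 0" "s \<ge> 0" for s t
  unfolding \<kappa>_def by (rule cSUP_upper[OF _ bdd]) (use that in auto)
 define u where "u k t = exp (- \<kappa> t) / t ^ k" for k and t :: real
 define lam where "lam k = (SUP t\<in>{0<..}. u k t)" for k
 have upos: "u k t > 0" if "t > 0" for k t using that by (simp add: u_def)
 define A1 where "A1 = exp (\<omega> 1 / \<rho>)"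
 have A1: "A1 \<ge> 1" using weight_function_nonneg[OF \<omega>(1), of 1] \<rho> by (simp add: A1_def)
 have W1: "1 \<le> A1 * omega_weight \<omega> \<rho> k" for k using omega_weight_ge[OF \<omega>(1) \<rho>, of 1 k] by (simp add: A1_def)
 \<comment> \<open>At \<open>s = k/t\<close> the product \<open>s t\<close> equals \<open>k\<close>.
   The weights only see \<open>s \<ge> 1\<close>, so for \<open>t > k\<close> the bound
   \<open>\<kappa> t \<ge> 0\<close> is used in its place.\<close>
 have ub: "u k t \<le> A1 * (exp 1 / real k) ^ k * omega_weight \<omega> \<rho> k" if t: "t > 0" for k t
 proof (cases "real k / t \<ge> 1")
  case True
  define s where "s = real k / t"
  have s: "s \<ge> 1" "s * t = real k" using True t by (simp_all add: s_def)
  have k: "k > 0" using True by (cases k) auto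
  have "exp (- \<kappa> t) \<le> exp (real k - \<omega> s / \<rho>)" using \<kappa>ge[of t s] t s by simp
  then have "u k t \<le> exp (real k - \<omega> s / \<rho>) / t ^ k" unfolding u_def using t by (intro divide_right_mono) auto
  also have "... = exp (real k) / real k ^ k * (s ^ k / exp (\<omega> s / \<rho>))"
   using t k by (simp add: s_def power_divide exp_diff field_simps)
  also have "... \<le> exp (real k) / real k ^ k * omega_weight \<omega> \<rho> k"
   using omega_weight_ge[OF \<omega>(1) \<rho> s(1), of k] by (intro mult_left_mono) (auto simp: pos_divide_le_eq mult.commute)
  also have "... = 1 * ((exp 1 / real k) ^ k * omega_weight \<omega> \<rho> k)" by (simp add: power_divide exp_of_nat_mult[of k 1, simplified])
  also have "... \<le> A1 * ((exp 1 / real k) ^ k * omega_weight \<omega> \<rho> k)" using A1 by (intro mult_right_mono) (auto simp: less_imp_le[OF omega_weight_pos])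
  finally show ?thesis by (simp add: mult.assoc)
 next
  case False
  have "\<kappa> t \<ge> 0" using \<kappa>ge[of t 0] t weight_function_nonneg[OF \<omega>(1), of 0] \<rho> by (simp add: order_trans[OF divide_nonneg_pos])
  then have e1: "exp (- \<kappa> t) \<le> 1" by simp
  have "real k ^ k \<le> t ^ k" using False t by (intro power_mono) (auto simp: pos_le_divide_eq)
  moreover have "real k ^ k > 0" by (cases k) auto
  ultimately have "u k t \<le> 1 / real k ^ k" unfolding u_def using e1 t by (intro frac_le) auto
  also have "... \<le> (exp 1 / real k) ^ k" by (simp add: power_divide divide_right_mono)
  also have "... = (exp 1 / real k) ^ k * 1" by simp
  also have "... \<le> (exp 1 / real k) ^ k * (A1 * omega_weight \<omega> \<rho> k)" by (intro mult_left_mono W1) simp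
  finally show ?thesis by (simp add: mult_ac)
 qed
 have bddu: "bdd_above (u k ` {0<..})" for k by (rule bdd_aboveI2[OF ub]) simp
 have lam_ge: "u k t \<le> lam k" if "t > 0" for k t unfolding lam_def by (rule cSUP_upper[OF _ bddu]) (use that in simp)
 have lam_pos: "lam k > 0" for k using less_le_trans[OF upos[of 1 k] lam_ge[of 1 k]] by simp
 have lam_le: "lam k \<le> A1 * (exp 1 / real k) ^ k * omega_weight \<omega> \<rho> k" for k
  unfolding lam_def by (rule cSUP_least) (use ub in auto)
 \<comment> \<open>Concavity enters here: for the slope \<open>t\<close> of a supporting line at
   \<open>s\<close>, the supremum \<open>\<kappa> t\<close> is attained at \<open>s\<close>. What
   remains is \<open>(s t)^k \<le> k! exp (s t)\<close>.\<close>
 have W_lam: "omega_weight \<omega> \<rho> k \<le> fact k * lam k" for k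
 proof (rule omega_weight_le[OF \<rho>])
  show "0 < fact k * lam k" using lam_pos by simp
  fix s :: real assume s: "s \<ge> 1"
  obtain t where t: "t > 0" "\<And>u. u \<ge> 0 ==> \<omega> u / \<rho> - u * t \<le> \<omega> s / \<rho> - s * t"
   using concave_supergradient[OF \<omega> \<rho>, of s] s by auto
  have "\<kappa> t \<le> \<omega> s / \<rho> - s * t" unfolding \<kappa>_def by (rule cSUP_least) (use t in auto)
  then have "exp (s * t - \<omega> s / \<rho>) \<le> exp (- \<kappa> t)" by simp
  then have "exp (s * t - \<omega> s / \<rho>) / t ^ k \<le> u k t" unfolding u_def using t by (intro divide_right_mono) auto
  also have "... \<le> lam k" by (rule lam_ge[OF t(1)])
  finally have 1: "exp (s * t - \<omega> s / \<rho>) \<le> lam k * t ^ k" using t by (simp add: pos_divide_le_eq)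
  have "(s * t) ^ k * exp (s * t - \<omega> s / \<rho>) \<le> (fact k * exp (s * t)) * (lam k * t ^ k)"
   by (intro mult_mono power_le_fact_exp 1) (use s t in auto)
  also have "(s * t) ^ k * exp (s * t - \<omega> s / \<rho>) = s ^ k * (t ^ k * exp (s * t)) / exp (\<omega> s / \<rho>)"
   by (simp add: power_mult_distrib exp_diff)
  finally have "s ^ k * (t ^ k * exp (s * t)) \<le> (fact k * lam k * exp (\<omega> s / \<rho>)) * (t ^ k * exp (s * t))"
   by (simp add: pos_divide_le_eq mult_ac)
  then show "s ^ k \<le> fact k * lam k * exp (\<omega> s / \<rho>)" by (rule mult_right_le_imp_le) (use t in simp)
 qed
 define l where "l k = lam k / lam 0" for k
 have lc: "(lam (Suc k))\<^sup>2 \<le> lam k * lam (Suc (Suc k))" for k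
 proof -
  have "lam (Suc k) \<le> sqrt (lam k * lam (Suc (Suc k)))"
   unfolding lam_def[of "Suc k"]
  proof (rule cSUP_least)
   fix t :: real assume t: "t \<in> {0<..}"
   have "(u (Suc k) t)\<^sup>2 = u k t * u (Suc (Suc k)) t" by (simp add: u_def power2_eq_square)
   also have "... \<le> lam k * lam (Suc (Suc k))" using t lam_ge upos lam_pos by (intro mult_mono) (auto simp: less_imp_le)
   finally show "u (Suc k) t \<le> sqrt (lam k * lam (Suc (Suc k)))" by (rule real_le_rsqrt)
  qed simp
  then have "(lam (Suc k))\<^sup>2 \<le> (sqrt (lam k * lam (Suc (Suc k))))\<^sup>2" using lam_pos by (intro power_mono) (auto simp: less_imp_le)
  also have "... = lam k * lam (Suc (Suc k))" using lam_pos[of k] lam_pos[of "Suc (Suc k)"] by (intro real_sqrt_pow2) simp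
  finally show ?thesis .
 qed
 have unb: "\<exists>k. c * lam k < lam (Suc k)" for c
 proof (rule ccontr)
  define d where "d = max 1 c"
  have d: "d \<ge> 1" "c \<le> d" by (auto simp: d_def)
  assume "\<not> ?thesis"
  then have n: "lam (Suc k) \<le> c * lam k" for k by (auto simp: not_less)
  have g: "lam k \<le> d ^ k * lam 0" for k
  proof (induction k)
   case (Suc k)
   have "lam (Suc k) \<le> c * lam k" by (rule n)
   also have "... \<le> d * lam k" using d lam_pos[of k] by (intro mult_right_mono) auto
   also have "... \<le> d * (d ^ k * lam 0)" using Suc d by (intro mult_left_mono) auto
   finally show ?case by (simp add: mult.assoc)
  qed simp
  define t where "t = 1 / (2 * d)"
  have t: "t > 0" using d by (simp add: t_def)
  obtain k where k: "lam 0 / exp (- \<kappa> t) < 2 ^ k" using real_arch_pow[of 2] by auto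
  have "exp (- \<kappa> t) / t ^ k \<le> d ^ k * lam 0" using order_trans[OF lam_ge[OF t] g] unfolding u_def .
  moreover have "exp (- \<kappa> t) / t ^ k = d ^ k * (exp (- \<kappa> t) * 2 ^ k)" by (simp add: t_def power_divide power_mult_distrib)
  ultimately have "exp (- \<kappa> t) * 2 ^ k \<le> lam 0" using d by simp
  then show False using k by (simp add: pos_divide_less_eq mult.commute)
 qed
 have lw: "log_convex_weight l" unfolding log_convex_weight_def
 proof (intro conjI allI)
  show "l 0 = 1" "0 < l k" for k using lam_pos[of 0] lam_pos[of k] by (simp_all add: l_def)
  show "(l (Suc k))\<^sup>2 \<le> l k * l (Suc (Suc k))" for k
   using divide_right_mono[OF lc[of k], of "lam 0 * lam 0"] lam_pos[of 0] by (simp add: l_def power2_eq_square)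
  fix c
  obtain k where "c * lam k < lam (Suc k)" using unb by blast
  then have "c * lam k / lam 0 < lam (Suc k) / lam 0" using lam_pos[of 0] by (intro divide_strict_right_mono)
  then show "\<exists>k. c * l k < l (Suc k)" by (auto simp: l_def)
 qed
 define A where "A = max (lam 0) (A1 / lam 0)"
 show thesis
 proof (rule that[OF _ lw, of A])
  show "A > 0" using lam_pos[of 0] by (simp add: A_def less_max_iff_disj)
  fix k
  have lp: "l k > 0" using lam_pos by (simp add: l_def)
  have "omega_weight \<omega> \<rho> k \<le> lam 0 * (fact k * l k)" using W_lam[of k] lam_pos[of 0] by (simp add: l_def)
  also have "... \<le> A * (fact k * l k)" using lp by (intro mult_right_mono) (auto simp: A_def)
  finally show "omega_weight \<omega> \<rho> k \<le> A * fact k * l k" by (simp add: mult.assoc)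
  have "l k \<le> (A1 * (exp 1 / real k) ^ k * omega_weight \<omega> \<rho> k) / lam 0"
   unfolding l_def using lam_le[of k] lam_pos[of 0] by (intro divide_right_mono) auto
  also have "... = (A1 / lam 0) * ((exp 1 / real k) ^ k * omega_weight \<omega> \<rho> k)" by simp
  also have "... \<le> A * ((exp 1 / real k) ^ k * omega_weight \<omega> \<rho> k)" by (intro mult_right_mono) (auto simp: A_def less_imp_le[OF omega_weight_pos])
  finally show "l k \<le> A * (exp 1 / real k) ^ k * omega_weight \<omega> \<rho> k" by (simp add: mult.assoc)
 qed
qed

text \<open>Up to a constant, the L-th root of \<open>l (L (k + 1))\<close> is at most
  \<open>(e/(k + 1))^(k+1)\<close> times the weight with parameter \<open>L \<rho>\<close> at
  \<open>k + 1\<close>. The first factor cancels \<open>k!\<close> up to a geometric factor, and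
  geometric factors are swallowed by the doubling condition.\<close>

lemma transfer_weights_omega:
 assumes \<omega>: "weight_function \<omega>" "concave_on {0..} \<omega>" and j: "j \<ge> 1"
 obtains c where "c > 0" "\<And>\<rho>. \<rho> > 0 ==> transfer_weights j (omega_weight \<omega> \<rho>) (omega_weight \<omega> (c * \<rho>))"
proof -
 define L where "L = joris_exponent j"
 have L: "L > 0" using j by (simp add: L_def)
 \<comment> \<open>\<open>2^14\<close> exceeds 9216 = 6 * 512 * 3, where 3 is an upper bound for
   \<open>e\<close>.\<close>
 obtain D where D: "D > 0" "\<And>\<rho>. \<rho> > 0 ==> \<exists>A. \<forall>k. (2 ^ 14) ^ k * omega_weight \<omega> \<rho> k \<le> A * omega_weight \<omega> (D * \<rho>) k"
  using omega_weight_geometric[OF \<omega>(1)] by blast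
 define c where "c = D * (2 * real L)"
 have c: "c > 0" using D L by (simp add: c_def)
 show thesis
 proof (rule that[OF c])
  fix \<rho> :: real assume \<rho>: "\<rho> > 0"
  obtain l A where A: "A > 0" and l: "log_convex_weight l" "\<And>k. omega_weight \<omega> \<rho> k \<le> A * fact k * l k"
   "\<And>k. k > 0 ==> l k \<le> A * (exp 1 / real k) ^ k * omega_weight \<omega> \<rho> k"
   by (rule omega_weight_log_convex[OF \<omega> \<rho>]) blast
  have L\<rho>: "real L * \<rho> > 0" "c * \<rho> > 0" using L \<rho> c by auto
  define w where "w = omega_weight \<omega> (2 * (real L * \<rho>))"
  have wpos: "w k > 0" for k by (simp add: w_def)
  obtain A2 where A2: "\<And>k. (2 ^ 14) ^ k * w k \<le> A2 * omega_weight \<omega> (c * \<rho>) k"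
   using D(2)[of "2 * (real L * \<rho>)"] L\<rho> unfolding w_def c_def by (auto simp: mult.assoc)
  have rt: "fact k * root L (l (L * Suc k)) \<le> root L A * exp 1 * w 1 * (3 ^ k * w k)" for k
  proof -
   define y where "y = (exp 1 / real (Suc k)) ^ Suc k * omega_weight \<omega> (real L * \<rho>) (Suc k)"
   have y0: "y \<ge> 0" by (simp add: y_def less_imp_le[OF omega_weight_pos])
   have LS: "L * Suc k > 0" using L by simp
   have "real (Suc k) \<le> real (L * Suc k)" using mult_le_mono1[of 1 L "Suc k"] L by (simp only: of_nat_le_iff) simp
   then have 1: "exp 1 / real (L * Suc k) \<le> exp 1 / real (Suc k)" by (intro divide_left_mono) auto
   have "l (L * Suc k) \<le> A * (exp 1 / real (L * Suc k)) ^ (L * Suc k) * omega_weight \<omega> \<rho> (L * Suc k)" by (rule l(3)[OF LS])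
   also have "... \<le> A * (exp 1 / real (Suc k)) ^ (L * Suc k) * omega_weight \<omega> (real L * \<rho>) (Suc k) ^ L"
    using A L \<rho> by (intro mult_mono mult_left_mono power_mono 1 omega_weight_mult \<omega>(1)) (auto simp: less_imp_le[OF omega_weight_pos])
   also have "... = A * y ^ L" by (simp only: y_def power_mult_distrib power_mult[symmetric] mult.commute[of L] mult.assoc)
   finally have "root L (l (L * Suc k)) \<le> root L (A * y ^ L)" using L by (intro real_root_le_mono) auto
   also have "... = root L A * y" using L y0 by (simp add: real_root_mult real_root_power_cancel)
   finally have "fact k * root L (l (L * Suc k)) \<le> fact k * (root L A * y)" by (intro mult_left_mono) auto
   also have "... \<le> real (Suc k) ^ Suc k * (root L A * y)"
   proof (intro mult_right_mono)
    have "(fact k :: real) \<le> fact (Suc k)" by (rule fact_mono) simp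
    then show "(fact k :: real) \<le> real (Suc k) ^ Suc k" using fact_le_power_self[of "Suc k"] by linarith
    show "0 \<le> root L A * y" using A y0 L by (intro mult_nonneg_nonneg) (auto simp: real_root_ge_zero)
   qed
   also have "... = root L A * (exp 1 ^ Suc k * omega_weight \<omega> (real L * \<rho>) (Suc k))"
    unfolding y_def by (simp only: power_divide) simp
   also have "... \<le> root L A * (exp 1 * 3 ^ k * (w 1 * w k))"
    unfolding w_def power_Suc
    using A L \<rho> exp_le by (intro mult_left_mono mult_mono power_mono omega_weight_Suc \<omega>(1)) (auto simp: real_root_ge_zero less_imp_le[OF omega_weight_pos])
   finally show ?thesis by (simp add: mult_ac)
  qed
  show "transfer_weights j (omega_weight \<omega> \<rho>) (omega_weight \<omega> (c * \<rho>))"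
   unfolding transfer_weights_def L_def[symmetric]
  proof (rule exI[of _ l], rule exI[of _ A], intro conjI allI impI l(1,2))
   fix \<sigma> :: real assume \<sigma>: "\<sigma> > 0"
   obtain A3 where A3: "\<And>k. fact k * (6 / \<sigma>) ^ k \<le> A3 * omega_weight \<omega> (c * \<rho>) k"
    using fact_geometric_le_omega_weight[OF \<omega>(1) L\<rho>(2)] by blast
   define B where "B = root L A * exp 1 * w 1"
   have B: "B \<ge> 0" unfolding B_def using A L wpos[of 1] by (intro mult_nonneg_nonneg) (auto simp: real_root_ge_zero)
   show "\<exists>A'. \<forall>k. fact k * 6 ^ k * (512 ^ k * root L (l (L * Suc k)) + (1 / \<sigma>) ^ k) \<le> A' * omega_weight \<omega> (c * \<rho>) k"
   proof (rule exI[of _ "B * A2 + A3"], rule allI)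
    fix k
    have "fact k * 6 ^ k * (512 ^ k * root L (l (L * Suc k))) = 3072 ^ k * (fact k * root L (l (L * Suc k)))"
     by (simp add: power_mult_distrib[symmetric])
    also have "... \<le> 3072 ^ k * (B * (3 ^ k * w k))" unfolding B_def by (intro mult_left_mono rt) simp
    also have "... = B * (9216 ^ k * w k)" by (simp add: power_mult_distrib[symmetric] mult_ac)
    also have "... \<le> B * ((2 ^ 14) ^ k * w k)" using B wpos[of k] by (intro mult_left_mono mult_right_mono power_mono) auto
    also have "... \<le> B * (A2 * omega_weight \<omega> (c * \<rho>) k)" using B A2 by (intro mult_left_mono) auto
    finally have 1: "fact k * 6 ^ k * (512 ^ k * root L (l (L * Suc k))) \<le> B * A2 * omega_weight \<omega> (c * \<rho>) k" by (simp add: mult.assoc)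
    have 2: "fact k * 6 ^ k * (1 / \<sigma>) ^ k \<le> A3 * omega_weight \<omega> (c * \<rho>) k" using A3[of k] by (simp add: power_divide)
    show "fact k * 6 ^ k * (512 ^ k * root L (l (L * Suc k)) + (1 / \<sigma>) ^ k) \<le> (B * A2 + A3) * omega_weight \<omega> (c * \<rho>) k"
     using add_mono[OF 1 2] by (simp only: distrib_left distrib_right)
   qed
  qed
 qed
qed

section \<open>Convenient vector spaces\<close>

text \<open>Makes \<open>joris_line\<close> applicable to arbitrary smooth curves, whose derivatives
  have no prescribed growth. The index 0 is left out because \<open>l 0 = 1\<close>.\<close>

lemma log_convex_weight_exists:
 fixes b :: "nat => real"
 obtains l where "log_convex_weight l" "\<And>k. b (Suc k) \<le> l (Suc k)"
proof -
 define \<mu> where "\<mu> i = (\<Sum>n\<le>i. \<bar>b (Suc n)\<bar> + 1)" for i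
 define l where "l k = (\<Prod>i<k. \<mu> i)" for k
 have \<mu>ge: "\<mu> k \<ge> real k + 1" for k
 proof -
  have "(\<Sum>n\<le>k. 1) \<le> \<mu> k" unfolding \<mu>_def by (intro sum_mono) auto
  then show ?thesis by simp
 qed
 have \<mu>1: "\<mu> k \<ge> 1" for k using \<mu>ge[of k] by linarith
 have \<mu>b: "\<bar>b (Suc k)\<bar> \<le> \<mu> k" for k
 proof -
  have "\<bar>b (Suc k)\<bar> + 1 \<le> \<mu> k" unfolding \<mu>_def by (rule member_le_sum) auto
  then show ?thesis by simp
 qed
 have lS: "l (Suc k) = l k * \<mu> k" for k by (simp add: l_def)
 have l1: "l k \<ge> 1" for k unfolding l_def by (rule prod_ge_1) (use \<mu>1 in auto)
 have "log_convex_weight l" unfolding log_convex_weight_def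
 proof (intro conjI allI)
  show "l 0 = 1" by (simp add: l_def)
  show "0 < l k" for k using l1[of k] by linarith
  fix k
  have "\<mu> k \<le> \<mu> (Suc k)" by (simp add: \<mu>_def)
  then have "(l k * l k * \<mu> k) * \<mu> k \<le> (l k * l k * \<mu> k) * \<mu> (Suc k)"
   using l1[of k] \<mu>1[of k] by (intro mult_left_mono) auto
  then show "(l (Suc k))\<^sup>2 \<le> l k * l (Suc (Suc k))" by (simp add: lS power2_eq_square mult_ac)
 next
  fix c :: real
  obtain k :: nat where "c \<le> k" using real_arch_simple by blast
  then have "c < \<mu> k" using \<mu>ge[of k] by linarith
  then have "c * l k < \<mu> k * l k" using l1[of k] by (intro mult_strict_right_mono) auto
  then show "\<exists>k. c * l k < l (Suc k)" by (auto simp: lS mult.commute)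
 qed
 moreover have "b (Suc k) \<le> l (Suc k)" for k
 proof -
  have "b (Suc k) \<le> 1 * \<mu> k" using \<mu>b[of k] by linarith
  also have "... \<le> l k * \<mu> k" using l1[of k] \<mu>1[of k] by (intro mult_right_mono) auto
  finally show ?thesis by (simp add: lS)
 qed
 ultimately show thesis using that by blast
qed

section \<open>Joris' theorem for smooth curves\<close>

lemma difference_quotient_iff:
 fixes f :: "real => complex"
 shows "((\<lambda>s. (1 / s) *\<^sub>R (f (t + s) - f t)) \<longlongrightarrow> D) (at 0) \<longleftrightarrow> (f has_vector_derivative D) (at t)"
proof -
 define q where "q s = (1 / s) *\<^sub>R (f (t + s) - f t)" for s
 have n: "norm (q s - D) = norm (f (t + s) - f t - s *\<^sub>R D) / norm s" if "s \<noteq> 0" for s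
 proof -
  have "q s - D = (1 / s) *\<^sub>R (f (t + s) - f t - s *\<^sub>R D)" using that by (simp add: q_def scaleR_diff_right)
  then show ?thesis by simp
 qed
 have "(q \<longlongrightarrow> D) (at 0) \<longleftrightarrow> ((\<lambda>s. q s - D) \<longlongrightarrow> 0) (at 0)" by (rule LIM_zero_iff[symmetric])
 also have "... \<longleftrightarrow> ((\<lambda>s. norm (q s - D)) \<longlongrightarrow> 0) (at 0)" by (rule tendsto_norm_zero_iff[symmetric])
 also have "... \<longleftrightarrow> ((\<lambda>s. norm (f (t + s) - f t - s *\<^sub>R D) / norm s) \<longlongrightarrow> 0) (at 0)"
  by (intro filterlim_cong refl) (use n in \<open>auto simp: eventually_at_filter\<close>)
 finally show ?thesis
  unfolding has_vector_derivative_def has_derivative_at q_def by (simp add: bounded_linear_scaleR_left)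
qed

lemma smooth_curve_complex_iff:
 fixes f :: "real => complex"
 shows "smooth_curve f \<longleftrightarrow> (\<exists>d. d 0 = f \<and> (\<forall>k t. (d k has_vector_derivative d (Suc k) t) (at t)))"
 unfolding smooth_curve_def difference_quotient_iff ..

interpretation real_line: normed_open "UNIV :: real set" abs UNIV
 by unfold_locales (auto simp: abs_mult intro: exI[of _ 1])

lemma smooth_power_bounds:
 fixes d :: "nat => real => complex"
 assumes "\<And>k t. (d k has_vector_derivative d (Suc k) t) (at t)"
 obtains b where "\<And>k y. \<bar>y - x0\<bar> \<le> 2 ==> cmod (d k y) \<le> b k"
proof -
 have "\<exists>B. \<forall>y\<in>{x0 - 2..x0 + 2}. cmod (d k y) \<le> B" for k
 proof -
  have "continuous_on {x0 - 2..x0 + 2} (d k)"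
   by (intro continuous_at_imp_continuous_on ballI has_vector_derivative_continuous[OF assms])
  then have "bounded (d k ` {x0 - 2..x0 + 2})" by (intro compact_imp_bounded compact_continuous_image) auto
  then show ?thesis by (auto simp: bounded_iff)
 qed
 then have "\<forall>k. \<exists>B. \<forall>y\<in>{x0 - 2..x0 + 2}. cmod (d k y) \<le> B" by blast
 from choice[OF this] obtain b where b: "\<forall>k. \<forall>y\<in>{x0 - 2..x0 + 2}. cmod (d k y) \<le> b k" by blast
 show thesis by (rule that[of b]) (use b in \<open>auto simp: abs_le_iff\<close>)
qed

text \<open>Locally the derivatives of both powers are bounded by some log-convex weight. The
  resulting uniform expansions give Frechet derivatives on the real line, whose values at lists of
  ones are the derivatives of \<open>g\<close>.\<close>

lemma smooth_curve_powers:
 fixes g :: "real => complex"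
 assumes j: "j \<ge> 1" and sm: "smooth_curve (\<lambda>t. g t ^ j)" "smooth_curve (\<lambda>t. g t ^ (j + 1))"
 shows "smooth_curve g"
proof -
 obtain dG where dG: "dG 0 = (\<lambda>t. g t ^ j)" "\<And>k t. (dG k has_vector_derivative dG (Suc k) t) (at t)"
  using sm(1) unfolding smooth_curve_complex_iff by blast
 obtain dH where dH: "dH 0 = (\<lambda>t. g t ^ (j + 1))" "\<And>k t. (dH k has_vector_derivative dH (Suc k) t) (at t)"
  using sm(2) unfolding smooth_curve_complex_iff by blast
 have "real_line.uniform_taylor {g}"
  unfolding real_line.uniform_taylor_def
 proof (intro ballI allI)
  fix x0 :: real and n :: nat
  \<comment> \<open>Radius 2 leaves room for base points within 1 of \<open>x0\<close> and line
    parameters up to 1.\<close>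
  obtain b1 where b1: "\<And>k y. \<bar>y - x0\<bar> \<le> 2 ==> cmod (dG k y) \<le> b1 k" using smooth_power_bounds[of dG x0] dG(2) by blast
  obtain b2 where b2: "\<And>k y. \<bar>y - x0\<bar> \<le> 2 ==> cmod (dH k y) \<le> b2 k" using smooth_power_bounds[of dH x0] dH(2) by blast
  define b where "b k = max 0 (max (b1 k) (b2 k))" for k
  obtain l where l: "log_convex_weight l" "\<And>k. b (Suc k) \<le> l (Suc k)" using log_convex_weight_exists[of b] by blast
  define A where "A = max 1 (b 0)"
  have A: "A \<ge> 1" by (simp add: A_def)
  have lpos: "l k > 0" "l 0 = 1" for k using l(1) by (auto simp: log_convex_weight_def)
  have bl: "b k \<le> A * fact k * l k" for k
  proof (cases k)
   case 0
   then show ?thesis using lpos by (simp add: A_def)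
  next
   case (Suc i)
   have "1 * 1 * l k \<le> A * fact k * l k" using A lpos(1)[of k] by (intro mult_mono) auto
   then show ?thesis using l(2)[of i] Suc by simp
  qed
  have db: "deriv_bounds l A 1 (\<lambda>k s. u ^ k *\<^sub>R d k (x + s * u))"
   if d: "\<And>k t. (d k has_vector_derivative d (Suc k) t) (at t)" and bd: "\<And>k y. \<bar>y - x0\<bar> \<le> 2 ==> cmod (d k y) \<le> b k"
    and x: "\<bar>x - x0\<bar> < 1" "\<bar>u\<bar> \<le> 1" for d :: "nat => real => complex" and x u :: real
   unfolding deriv_bounds_def
  proof (intro allI impI conjI)
   fix k s assume s: "\<bar>s\<bar> \<le> (1::real)"
   have "((\<lambda>s. x + s * u) has_vector_derivative u) (at s)" by (auto intro!: derivative_eq_intros)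
   from vector_diff_chain_at[OF this d] have "((\<lambda>s. d k (x + s * u)) has_vector_derivative u *\<^sub>R d (Suc k) (x + s * u)) (at s)"
    by (simp add: o_def)
   then have "((\<lambda>s. u ^ k *\<^sub>R d k (x + s * u)) has_vector_derivative u ^ k *\<^sub>R (u *\<^sub>R d (Suc k) (x + s * u))) (at s)"
    by (rule bounded_linear.has_vector_derivative[OF bounded_linear_scaleR_right])
   then show "((\<lambda>s. u ^ k *\<^sub>R d k (x + s * u)) has_vector_derivative u ^ Suc k *\<^sub>R d (Suc k) (x + s * u)) (at s within {-1..1})"
    by (simp add: has_vector_derivative_at_within mult.commute)
   have "\<bar>s * u\<bar> \<le> 1 * 1" unfolding abs_mult using s x by (intro mult_mono) auto
   then have "cmod (d k (x + s * u)) \<le> b k" using x by (intro bd) linarith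
   moreover have "\<bar>u\<bar> ^ k \<le> 1" using x by (intro power_le_one) auto
   ultimately have "\<bar>u\<bar> ^ k * cmod (d k (x + s * u)) \<le> 1 * b k" by (intro mult_mono) auto
   then show "cmod (u ^ k *\<^sub>R d k (x + s * u)) \<le> A * fact k * l k" using bl[of k] by (simp add: power_abs)
  qed
  show "\<exists>\<delta>>0. \<exists>C\<ge>0. \<forall>\<phi>\<in>{g}. \<forall>x\<in>UNIV. \<forall>u\<in>UNIV. \<bar>x - x0\<bar> < \<delta> --> \<bar>u\<bar> \<le> 1 --> (\<exists>a. real_line.expansion \<phi> n \<delta> C x u a)"
  proof (rule joris_line[OF j l(1) A zero_less_one])
   fix B \<rho> :: real and K :: "nat => real"
   assume B: "B \<ge> 0" "\<rho> > 0" and main: "\<And>g G H. deriv_bounds l A 1 G ==> deriv_bounds l A 1 H ==>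
    (\<And>s. \<bar>s\<bar> \<le> 1 ==> G 0 s = g s ^ j \<and> H 0 s = g s ^ (j + 1)) ==>
    \<exists>a. (\<forall>k. cmod (a k) \<le> B * joris_rate j l \<rho> k) \<and>
     (\<forall>n s. \<bar>s\<bar> \<le> \<rho> --> cmod (g s - (\<Sum>k\<le>n. a k * of_real s ^ k)) \<le> K n * \<bar>s\<bar> ^ (n + 1))"
   show ?thesis
   proof (rule exI[of _ "min 1 \<rho>"], intro conjI exI[of _ "max 0 (K n)"] ballI impI)
    fix \<phi> and x u :: real assume \<phi>: "\<phi> \<in> {g}" and x: "\<bar>x - x0\<bar> < min 1 \<rho>" "\<bar>u\<bar> \<le> 1"
    have b': "\<And>k y. \<bar>y - x0\<bar> \<le> 2 ==> cmod (dG k y) \<le> b k" "\<And>k y. \<bar>y - x0\<bar> \<le> 2 ==> cmod (dH k y) \<le> b k"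
     using order_trans[OF b1] order_trans[OF b2] by (auto simp: b_def)
    have x1: "\<bar>x - x0\<bar> < 1" using x by simp
    obtain a where a: "\<And>n s. \<bar>s\<bar> \<le> \<rho> ==> cmod (g (x + s * u) - (\<Sum>k\<le>n. a k * of_real s ^ k)) \<le> K n * \<bar>s\<bar> ^ (n + 1)"
     using main[OF db[OF dG(2) b'(1) x1 x(2)] db[OF dH(2) b'(2) x1 x(2)], of "\<lambda>s. g (x + s * u)"] dG(1) dH(1) by auto
    have "real_line.expansion g n (min 1 \<rho>) (max 0 (K n)) x u a"
     unfolding real_line.expansion_def
    proof (intro allI impI conjI)
     fix s :: real assume s: "\<bar>s\<bar> < min 1 \<rho>"
     have "cmod (g (x + s *\<^sub>R u) - (\<Sum>k\<le>n. a k * of_real s ^ k)) \<le> K n * \<bar>s\<bar> ^ (n + 1)" using a[of s n] s by simp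
     also have "... \<le> max 0 (K n) * \<bar>s\<bar> ^ (n + 1)" by (intro mult_right_mono) auto
     finally show "cmod (g (x + s *\<^sub>R u) - (\<Sum>k\<le>n. a k * of_real s ^ k)) \<le> max 0 (K n) * \<bar>s\<bar> ^ (n + 1)" .
    qed simp
    then show "\<exists>a. real_line.expansion \<phi> n (min 1 \<rho>) (max 0 (K n)) x u a" using \<phi> by blast
   qed (use B in auto)
  qed
 qed
 then obtain D where D: "frechet_derivs UNIV abs UNIV g D" using real_line.uniform_taylor_imp_frechet_derivs by blast
 show ?thesis unfolding smooth_curve_complex_iff
 proof (rule exI[of _ "\<lambda>k t. D k t (replicate k 1)"], intro conjI allI)
  show "(\<lambda>t. D 0 t (replicate 0 1)) = g" using D by (auto simp: frechet_derivs_def)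
  fix k t
  have "((\<lambda>s. D k (0 + s *\<^sub>R 1) (replicate k 1)) has_vector_derivative D (Suc k) (0 + t *\<^sub>R 1) (1 # replicate k 1)) (at t)"
   by (rule real_line.frechet_line_derivative_at[OF D]) auto
  then show "((\<lambda>t. D k t (replicate k 1)) has_vector_derivative D (Suc k) t (replicate (Suc k) 1)) (at t)" by simp
 qed
qed

lemma convenient_smooth_powers:
 assumes "j \<ge> 1" "convenient_smooth U (\<lambda>x. f x ^ j)" "convenient_smooth U (\<lambda>x. f x ^ (j + 1))"
 shows "convenient_smooth U f"
 unfolding convenient_smooth_def
proof (intro allI impI)
 fix c :: "real => 'a" assume "smooth_curve c \<and> range c \<subseteq> U"
 then have "smooth_curve (\<lambda>t. (f \<circ> c) t ^ j)" "smooth_curve (\<lambda>t. (f \<circ> c) t ^ (j + 1))"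
  using assms(2,3) unfolding convenient_smooth_def by (auto simp: o_def)
 then show "smooth_curve (f \<circ> c)" by (rule smooth_curve_powers[OF assms(1)])
qed

section \<open>Smooth bump functions\<close>

definition flat_exp :: "nat => real => real" where
 "flat_exp i t = (if t > 0 then (1 / t) ^ i * exp (- (1 / t)) else 0)"

text \<open>The quadratic bound forces the derivative at 0 to be 0 for every \<open>i\<close>, so no
  extra smoothness argument is required at the junction.\<close>

lemma flat_exp_bound: "\<bar>flat_exp i t\<bar> \<le> fact (i + 2) * t\<^sup>2"
proof (cases "t > 0")
 case True
 have "(1 / t) ^ (i + 2) \<le> fact (i + 2) * exp (1 / t)" by (rule power_le_fact_exp) (use True in simp)
 then have "(1 / t) ^ (i + 2) * exp (- (1 / t)) \<le> fact (i + 2) * exp (1 / t) * exp (- (1 / t))" by (intro mult_right_mono) auto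
 then have "(1 / t) ^ (i + 2) * exp (- (1 / t)) \<le> fact (i + 2)" by (simp add: mult.assoc exp_add[symmetric])
 then have "t\<^sup>2 * ((1 / t) ^ (i + 2) * exp (- (1 / t))) \<le> t\<^sup>2 * fact (i + 2)" by (intro mult_left_mono) auto
 moreover have "t\<^sup>2 * ((1 / t) ^ (i + 2) * exp (- (1 / t))) = flat_exp i t"
  using True by (simp add: flat_exp_def power_add power2_eq_square)
 moreover have "flat_exp i t \<ge> 0" using True by (simp add: flat_exp_def)
 ultimately show ?thesis by (simp add: mult.commute)
qed (simp add: flat_exp_def)

lemma flat_exp_derivative:
 "(flat_exp i has_real_derivative flat_exp (i + 2) t - real i * flat_exp (i + 1) t) (at t)"
proof -
 consider "t > 0" | "t < 0" | "t = 0" by linarith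
 then show ?thesis
 proof cases
  case 1
  have "((\<lambda>t. (1 / t) ^ i * exp (- (1 / t))) has_real_derivative flat_exp (i + 2) t - real i * flat_exp (i + 1) t) (at t)"
  proof -
   define y where "y = 1 / t"
   have inv: "((\<lambda>t. 1 / t) has_real_derivative - y\<^sup>2) (at t)"
    using 1 by (auto intro!: derivative_eq_intros simp: y_def power2_eq_square)
   have e: "((\<lambda>t. exp (- (1 / t))) has_real_derivative exp (- y) * y\<^sup>2) (at t)"
    using DERIV_chain2[OF DERIV_exp DERIV_minus[OF inv]] by (simp add: y_def)
   have F: "flat_exp k t = y ^ k * exp (- y)" for k using 1 by (simp add: flat_exp_def y_def)
   show ?thesis
    using DERIV_mult'[OF DERIV_power[OF inv, of i] e] unfolding F y_def[symmetric]
    by (rule DERIV_cong) (cases i; simp add: power2_eq_square algebra_simps)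
  qed
  then show ?thesis
   by (rule has_field_derivative_transform_within_open[of _ _ _ "{0<..}"]) (use 1 in \<open>auto simp: flat_exp_def\<close>)
 next
  case 2
  have "((\<lambda>t. 0) has_real_derivative flat_exp (i + 2) t - real i * flat_exp (i + 1) t) (at t)" using 2 by (simp add: flat_exp_def)
  then show ?thesis
   by (rule has_field_derivative_transform_within_open[of _ _ _ "{..<0}"]) (use 2 in \<open>auto simp: flat_exp_def\<close>)
 next
  case 3
  have "((\<lambda>h. (flat_exp i (0 + h) - flat_exp i 0) / h) \<longlongrightarrow> 0) (at 0)"
  proof (rule Lim_null_comparison)
   show "\<forall>\<^sub>F h in at 0. norm ((flat_exp i (0 + h) - flat_exp i 0) / h) \<le> fact (i + 2) * \<bar>h\<bar>"
    unfolding eventually_at_filter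
   proof (intro always_eventually allI impI)
    fix h :: real assume "h \<noteq> 0"
    have "\<bar>flat_exp i h\<bar> \<le> fact (i + 2) * \<bar>h\<bar> * \<bar>h\<bar>" using flat_exp_bound[of i h] by (simp add: power2_eq_square mult.assoc)
    then show "norm ((flat_exp i (0 + h) - flat_exp i 0) / h) \<le> fact (i + 2) * \<bar>h\<bar>"
     using \<open>h \<noteq> 0\<close> by (simp add: flat_exp_def[of i 0] pos_divide_le_eq)
   qed
   have "((\<lambda>h. fact (i + 2) * \<bar>h\<bar>) \<longlongrightarrow> fact (i + 2) * \<bar>0::real\<bar>) (at 0)" by (intro tendsto_intros)
   then show "((\<lambda>h. fact (i + 2) * \<bar>h\<bar>) \<longlongrightarrow> (0::real)) (at 0)" by simp
  qed
  then show ?thesis using 3 by (simp add: DERIV_def flat_exp_def)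
 qed
qed

text \<open>A class of functions with support in \<open>[-1, 1]\<close> that is closed under differentiation.\<close>

inductive bump :: "(real => real) => bool" where
 base: "bump (\<lambda>t. flat_exp i (1 + t) * flat_exp k (1 - t))"
| lin: "bump f ==> bump g ==> bump (\<lambda>t. a * f t + b * g t)"

lemma bump_support: "bump f ==> \<bar>t\<bar> \<ge> 1 ==> f t = 0"
 by (induction rule: bump.induct) (auto simp: flat_exp_def abs_if split: if_splits)

lemma bump_derivative: "bump f ==> \<exists>f'. bump f' \<and> (\<forall>t. (f has_real_derivative f' t) (at t))"
proof (induction rule: bump.induct)
 case (base i k)
 let ?e = "\<lambda>i k t. flat_exp i (1 + t) * flat_exp k (1 - t)"
 let ?f = "\<lambda>t. 1 * (1 * ?e (i + 2) k t + (- real i) * ?e (i + 1) k t) + 1 * ((-1) * ?e i (k + 2) t + real k * ?e i (k + 1) t)"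
 have "bump ?f" by (intro bump.lin bump.base)
 moreover have "((\<lambda>t. ?e i k t) has_real_derivative ?f t) (at t)" for t
 proof -
  have 1: "((\<lambda>t. flat_exp i (1 + t)) has_real_derivative flat_exp (i + 2) (1 + t) - real i * flat_exp (i + 1) (1 + t)) (at t)"
  proof -
   have "((\<lambda>t. 1 + t) has_real_derivative 1) (at t)" by (auto intro!: derivative_eq_intros)
   from DERIV_chain2[where f="flat_exp i" and g="\<lambda>t. 1 + t", OF flat_exp_derivative this] show ?thesis by simp
  qed
  have 2: "((\<lambda>t. flat_exp k (1 - t)) has_real_derivative (flat_exp (k + 2) (1 - t) - real k * flat_exp (k + 1) (1 - t)) * (-1)) (at t)"
  proof -
   have "((\<lambda>t. 1 - t) has_real_derivative -1) (at t)" by (auto intro!: derivative_eq_intros)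
   from DERIV_chain2[where f="flat_exp k" and g="\<lambda>t. 1 - t", OF flat_exp_derivative this] show ?thesis .
  qed
  show ?thesis using DERIV_mult'[OF 1 2] by (rule DERIV_cong) (simp add: algebra_simps)
 qed
 ultimately show ?case by blast
next
 case (lin f g a b)
 then obtain f' g' where d: "bump f'" "bump g'" "\<And>t. (f has_real_derivative f' t) (at t)" "\<And>t. (g has_real_derivative g' t) (at t)" by blast
 have "((\<lambda>t. a * f t + b * g t) has_real_derivative a * f' t + b * g' t) (at t)" for t
  using d(3,4)[of t] by (auto intro!: derivative_eq_intros)
 then show ?case using bump.lin[OF d(1,2)] by blast
qed

lemma bump_function:
 obtains b :: "nat => real => real" and M where "b 0 0 = 1" "\<And>k t. \<bar>t\<bar> \<ge> 1 ==> b k t = 0"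
  "\<And>k t. (b k has_real_derivative b (Suc k) t) (at t)" "\<And>k t. \<bar>b k t\<bar> \<le> M k"
proof -
 \<comment> \<open>\<open>exp 2\<close> normalises the value at 0; the vanishing second summand
   provides the shape required by the rule \<open>lin\<close>.\<close>
 define \<beta> where "\<beta> t = exp 2 * (flat_exp 0 (1 + t) * flat_exp 0 (1 - t)) + 0 * (flat_exp 0 (1 + t) * flat_exp 0 (1 - t))" for t
 have "bump \<beta>" unfolding \<beta>_def by (intro bump.lin bump.base)
 define b where "b = rec_nat \<beta> (\<lambda>_ f. SOME f'. bump f' \<and> (\<forall>t. (f has_real_derivative f' t) (at t)))"
 have b0: "b 0 = \<beta>" and bS: "\<And>k. b (Suc k) = (SOME f'. bump f' \<and> (\<forall>t. (b k has_real_derivative f' t) (at t)))" by (simp_all add: b_def)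
 have step: "bump (b (Suc k)) \<and> (\<forall>t. (b k has_real_derivative b (Suc k) t) (at t))" if "bump (b k)" for k
  unfolding bS[of k] by (rule someI_ex[OF bump_derivative[OF that]])
 have bump: "bump (b k)" for k by (induction k) (use step \<open>bump \<beta>\<close> b0 in auto)
 have "\<exists>B. \<forall>t. \<bar>b k t\<bar> \<le> B" for k
 proof -
  have "continuous_on {-1..1} (b k)" using step[OF bump] by (meson DERIV_isCont continuous_at_imp_continuous_on)
  then have "bounded (b k ` {-1..1})" by (intro compact_imp_bounded compact_continuous_image) auto
  then obtain B where B: "\<forall>t\<in>{-1..1}. \<bar>b k t\<bar> \<le> B" by (auto simp: bounded_iff)
  have "\<bar>b k t\<bar> \<le> max 0 B" for t
  proof (cases "\<bar>t\<bar> \<ge> 1")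
   case False
   then have "t \<in> {-1..1}" by auto
   then show ?thesis using B by fastforce
  qed (simp add: bump_support[OF bump])
  then show ?thesis by blast
 qed
 then have "\<forall>k. \<exists>B. \<forall>t. \<bar>b k t\<bar> \<le> B" by blast
 from choice[OF this] obtain M where M: "\<forall>k t. \<bar>b k t\<bar> \<le> M k" by blast
 show thesis
 proof (rule that[of b M])
  show "b 0 0 = 1" unfolding b0 \<beta>_def flat_exp_def by (simp add: exp_add[symmetric])
 qed (use M step[OF bump] bump_support[OF bump] in auto)
qed

lemma second_order_remainder:
 fixes f g h :: "real => real"
 assumes f: "\<And>t. (f has_real_derivative g t) (at t)" and g: "\<And>t. (g has_real_derivative h t) (at t)" and h: "\<And>t. \<bar>h t\<bar> \<le> M"
 shows "\<bar>f (t + s) - f t - s * g t\<bar> \<le> M * s\<^sup>2"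
proof -
 have M: "M \<ge> 0" using h[of 0] by linarith
 have lip: "\<bar>g u - g t\<bar> \<le> M * \<bar>u - t\<bar>" for u
  using field_differentiable_bound[of UNIV g h M u t] g h by auto
 have d: "((\<lambda>u. f u - u * g t) has_real_derivative g u - g t) (at u within cball t \<bar>s\<bar>)" for u
  using f[of u] by (auto intro!: derivative_eq_intros DERIV_subset[OF f])
 have "norm ((f (t + s) - (t + s) * g t) - (f t - t * g t)) \<le> (M * \<bar>s\<bar>) * norm (t + s - t)"
 proof (rule field_differentiable_bound[OF convex_cball d])
  fix u assume "u \<in> cball t \<bar>s\<bar>"
  then have "\<bar>u - t\<bar> \<le> \<bar>s\<bar>" by (simp add: dist_real_def abs_minus_commute)
  then show "norm (g u - g t) \<le> M * \<bar>s\<bar>" using order_trans[OF lip[of u] mult_left_mono[OF _ M]] by simp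
 qed (auto simp: dist_real_def)
 then show ?thesis by (simp add: algebra_simps power2_eq_square)
qed

section \<open>The normed space spanned by a bounded absolutely convex set\<close>

context
 fixes B :: "'e::locally_convex_space set"
 assumes ac: "absolutely_convex B" and bd: "lcs_bounded B"
begin

abbreviation dilate :: "real => 'e set" where
 "dilate t \<equiv> (\<lambda>b. t *\<^sub>R b) ` B"

lemma B_convex: "x \<in> B ==> y \<in> B ==> u \<ge> 0 ==> v \<ge> 0 ==> u + v = 1 ==> u *\<^sub>R x + v *\<^sub>R y \<in> B"
 using ac unfolding absolutely_convex_def convex_def by blast

lemma B_scale: "x \<in> B ==> \<bar>a\<bar> \<le> 1 ==> a *\<^sub>R x \<in> B"
 using ac unfolding absolutely_convex_def by blast

lemma B_0: "0 \<in> B"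
 using ac B_scale[of _ 0] unfolding absolutely_convex_def by auto

lemma dilate_mono: "x \<in> dilate t ==> 0 < t ==> t \<le> s ==> x \<in> dilate s"
proof -
 assume "x \<in> dilate t" and t: "0 < t" "t \<le> s"
 then obtain b where b: "b \<in> B" "x = t *\<^sub>R b" by blast
 have "(t / s) *\<^sub>R b \<in> B" using t by (intro B_scale b) auto
 moreover have "x = s *\<^sub>R ((t / s) *\<^sub>R b)" using t b by simp
 ultimately show ?thesis by blast
qed

lemma dilate_add:
 assumes "x \<in> dilate t" "y \<in> dilate s" and t: "0 < t" "0 < s"
 shows "x + y \<in> dilate (t + s)"
proof -
 obtain b c where b: "b \<in> B" "x = t *\<^sub>R b" and c: "c \<in> B" "y = s *\<^sub>R c" using assms by blast
 have "(t / (t + s)) *\<^sub>R b + (s / (t + s)) *\<^sub>R c \<in> B"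
  using t by (intro B_convex b c) (auto simp: add_divide_distrib[symmetric])
 moreover have "x + y = (t + s) *\<^sub>R ((t / (t + s)) *\<^sub>R b + (s / (t + s)) *\<^sub>R c)"
  using t b c by (simp add: scaleR_right_distrib)
 ultimately show ?thesis by blast
qed

lemma dilate_scale:
 assumes "x \<in> dilate t" "a \<noteq> 0"
 shows "a *\<^sub>R x \<in> dilate (\<bar>a\<bar> * t)"
proof -
 obtain b where b: "b \<in> B" "x = t *\<^sub>R b" using assms by blast
 have "sgn a *\<^sub>R b \<in> B" by (intro B_scale b) (simp add: abs_sgn_eq)
 moreover have "a *\<^sub>R x = (\<bar>a\<bar> * t) *\<^sub>R (sgn a *\<^sub>R b)" using b by (simp add: sgn_if abs_if)
 ultimately show ?thesis by blast
qed

lemma span_dilate: "x \<in> span B ==> \<exists>t>0. x \<in> dilate t"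
proof -
 have "subspace {x. \<exists>t>0. x \<in> dilate t}"
 proof (rule subspaceI)
  show "0 \<in> {x. \<exists>t>0. x \<in> dilate t}" using B_0 by (auto intro!: exI[of _ 1])
  fix x y assume "x \<in> {x. \<exists>t>0. x \<in> dilate t}" "y \<in> {x. \<exists>t>0. x \<in> dilate t}"
  then obtain t s where "t > 0" "s > 0" "x \<in> dilate t" "y \<in> dilate s" by blast
  then have "t + s > 0" "x + y \<in> dilate (t + s)" using dilate_add by simp_all
  then show "x + y \<in> {x. \<exists>t>0. x \<in> dilate t}" by blast
 next
  fix a x assume "x \<in> {x. \<exists>t>0. x \<in> dilate t}"
  then obtain t where t: "t > 0" "x \<in> dilate t" by blast
  show "a *\<^sub>R x \<in> {x. \<exists>t>0. x \<in> dilate t}"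
  proof (cases "a = 0")
   case True
   then show ?thesis using B_0 by (auto intro!: exI[of _ 1])
  next
   case False
   then have "\<bar>a\<bar> * t > 0" using t by simp
   then show ?thesis using dilate_scale[OF t(2) False] by blast
  qed
 qed
 moreover have "B \<subseteq> {x. \<exists>t>0. x \<in> dilate t}" by (auto intro!: exI[of _ 1])
 ultimately show "x \<in> span B ==> \<exists>t>0. x \<in> dilate t" using span_minimal by blast
qed

lemma minkowski_le: "t > 0 ==> x \<in> dilate t ==> minkowski B x \<le> t"
 unfolding minkowski_def by (rule cInf_lower) (auto intro!: bdd_belowI[of _ 0])

lemma minkowski_less: "x \<in> span B ==> minkowski B x < t ==> x \<in> dilate t"
proof -
 assume x: "x \<in> span B" and lt: "minkowski B x < t"
 have ne: "{t. t > 0 \<and> x \<in> dilate t} \<noteq> {}" using span_dilate[OF x] by blast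
 from cInf_lessD[OF ne lt[unfolded minkowski_def]]
 obtain u where "u > 0" "x \<in> dilate u" "u < t" by auto
 then show ?thesis by (intro dilate_mono[of x u t]) auto
qed

lemma minkowski_nonneg: "x \<in> span B ==> 0 \<le> minkowski B x"
 unfolding minkowski_def using span_dilate by (intro cInf_greatest) auto

text \<open>This is boundedness of \<open>B\<close>: the norm topology is finer than the topology of
  the ambient space.\<close>

lemma minkowski_small_in_open:
 assumes "open S" "0 \<in> S"
 obtains \<delta> where "\<delta> > 0" "\<And>h. h \<in> span B ==> minkowski B h < \<delta> ==> h \<in> S"
proof -
 have "\<exists>r>0. \<forall>s\<ge>r. B \<subseteq> (\<lambda>x. s *\<^sub>R x) ` S" using bd assms unfolding lcs_bounded_def by simp
 then obtain r where r: "r > 0" "B \<subseteq> (\<lambda>x. r *\<^sub>R x) ` S" by blast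
 show thesis
 proof (rule that[of "1 / r"])
  fix h assume h: "h \<in> span B" "minkowski B h < 1 / r"
  then obtain b where b: "b \<in> B" "h = (1 / r) *\<^sub>R b" using minkowski_less by blast
  then obtain y where "y \<in> S" "b = r *\<^sub>R y" using r by blast
  then show "h \<in> S" using b r by simp
 qed (use r in simp)
qed

text \<open>A vector of norm 0 lies in every neighbourhood of 0, and the space is Hausdorff.\<close>

lemma minkowski_definite:
 assumes x: "x \<in> span B" "minkowski B x = 0"
 shows "x = 0"
proof (rule ccontr)
 assume "x \<noteq> 0"
 then obtain S where "open S" "0 \<in> S" "x \<notin> S" by (metis hausdorff disjoint_iff)
 then show False using minkowski_small_in_open[of S] x by metis
qed

lemma minkowski_add:
 assumes x: "x \<in> span B" and y: "y \<in> span B"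
 shows "minkowski B (x + y) \<le> minkowski B x + minkowski B y"
proof (rule field_le_epsilon)
 fix e :: real assume e: "e > 0"
 have "x \<in> dilate (minkowski B x + e / 2)" "y \<in> dilate (minkowski B y + e / 2)"
  using e by (auto intro!: minkowski_less x y)
 then have "x + y \<in> dilate (((minkowski B x + e / 2) + (minkowski B y + e / 2)))"
  using minkowski_nonneg[OF x] minkowski_nonneg[OF y] e by (intro dilate_add) auto
 then have "minkowski B (x + y) \<le> (minkowski B x + e / 2) + (minkowski B y + e / 2)"
  using minkowski_nonneg[OF x] minkowski_nonneg[OF y] e by (intro minkowski_le) auto
 then show "minkowski B (x + y) \<le> minkowski B x + minkowski B y + e" by simp
qed

lemma minkowski_scale_le:
 assumes x: "x \<in> span B" and a: "a \<noteq> 0"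
 shows "minkowski B (a *\<^sub>R x) \<le> \<bar>a\<bar> * minkowski B x"
proof (rule field_le_epsilon)
 fix e :: real assume e: "e > 0"
 define t where "t = minkowski B x + e / \<bar>a\<bar>"
 have "minkowski B x < t" using e a by (simp add: t_def)
 then have t: "x \<in> dilate t" "t > 0" using minkowski_less[OF x] minkowski_nonneg[OF x] by auto
 have "minkowski B (a *\<^sub>R x) \<le> \<bar>a\<bar> * t" using t a by (intro minkowski_le dilate_scale) auto
 also have "... = \<bar>a\<bar> * minkowski B x + e" using a by (simp add: t_def distrib_left)
 finally show "minkowski B (a *\<^sub>R x) \<le> \<bar>a\<bar> * minkowski B x + e" .
qed

lemma minkowski_scale:
 assumes x: "x \<in> span B"
 shows "minkowski B (a *\<^sub>R x) = \<bar>a\<bar> * minkowski B x"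
proof (cases "a = 0")
 case True
 have "minkowski B 0 \<le> e" if "e > 0" for e using B_0 that by (intro minkowski_le) (auto intro!: image_eqI[of _ _ 0])
 then have "minkowski B 0 \<le> 0" by (rule dense_ge)
 then show ?thesis using True minkowski_nonneg[OF span_zero] by simp
next
 case False
 have "minkowski B x \<le> \<bar>1 / a\<bar> * minkowski B (a *\<^sub>R x)"
  using minkowski_scale_le[OF span_scale[OF x], of "1 / a" a] False by simp
 then have "\<bar>a\<bar> * minkowski B x \<le> \<bar>a\<bar> * (\<bar>1 / a\<bar> * minkowski B (a *\<^sub>R x))" by (intro mult_left_mono) auto
 then have "\<bar>a\<bar> * minkowski B x \<le> minkowski B (a *\<^sub>R x)" using False by (simp add: abs_divide)
 then show ?thesis using minkowski_scale_le[OF x False] by simp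
qed

lemma minkowski_sum:
 assumes "finite S" "\<And>n. n \<in> S ==> h n \<in> span B"
 shows "minkowski B (\<Sum>n\<in>S. a n *\<^sub>R h n) \<le> (\<Sum>n\<in>S. \<bar>a n\<bar> * minkowski B (h n))"
 using assms
proof (induction rule: finite_induct)
 case empty
 then show ?case using minkowski_scale[OF span_zero, of 0] by simp
next
 case (insert n S)
 have "minkowski B (a n *\<^sub>R h n + (\<Sum>n\<in>S. a n *\<^sub>R h n)) \<le> minkowski B (a n *\<^sub>R h n) + minkowski B (\<Sum>n\<in>S. a n *\<^sub>R h n)"
  using insert.prems by (intro minkowski_add span_scale span_sum) auto
 then show ?case using insert minkowski_scale[of "h n" "a n"] by simp
qed

lemma tendsto_minkowski:
 fixes q :: "real => 'e"
 assumes q: "\<And>s. s \<noteq> 0 ==> q s - L \<in> span B" "\<And>s. s \<noteq> 0 ==> minkowski B (q s - L) \<le> C * \<bar>s\<bar>"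
 shows "(q \<longlongrightarrow> L) (at 0)"
proof -
 have "((\<lambda>s. q s - L) \<longlongrightarrow> 0) (at 0)"
 proof (rule topological_tendstoI)
  fix S :: "'e set" assume "open S" "0 \<in> S"
  then obtain \<delta> where \<delta>: "\<delta> > 0" "\<And>h. h \<in> span B ==> minkowski B h < \<delta> ==> h \<in> S" by (rule minkowski_small_in_open) blast
  have "((\<lambda>s. C * \<bar>s\<bar>) \<longlongrightarrow> C * \<bar>0\<bar>) (at 0)" by (intro tendsto_intros)
  then have "\<forall>\<^sub>F s in at 0. C * \<bar>s\<bar> < \<delta>" using \<delta>(1) by (intro order_tendstoD) auto
  moreover have "\<forall>\<^sub>F s in at (0::real). s \<noteq> 0" by (simp add: eventually_at_filter)
  ultimately show "\<forall>\<^sub>F s in at 0. q s - L \<in> S"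
  proof eventually_elim
   case (elim s)
   show ?case by (rule \<delta>(2)[OF q(1)[OF elim(2)] le_less_trans[OF q(2)[OF elim(2)] elim(1)]])
  qed
 qed
 then show ?thesis using tendsto_add[OF _ tendsto_const[of L]] by fastforce
qed

text \<open>A smooth curve through fast converging points: scaled bumps at \<open>2\<^sup>-\<^sup>n\<close> with disjoint supports.\<close>

lemma smooth_curve_through_points:
 fixes h :: "nat => 'e"
 assumes h: "\<And>n. h n \<in> span B" "\<And>n. minkowski B (h n) \<le> (1 / 2) ^ ((n + 2) * n + n)"
 obtains c where "smooth_curve c" "c 0 = x" "\<And>n. c ((1 / 2) ^ n) = x + h n"
proof -
 obtain b :: "nat => real => real" and M where b: "b 0 0 = 1" "\<And>k t. \<bar>t\<bar> \<ge> 1 ==> b k t = 0"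
  "\<And>k t. (b k has_real_derivative b (Suc k) t) (at t)" "\<And>k t. \<bar>b k t\<bar> \<le> M k" by (rule bump_function) blast
 have M0: "M k \<ge> 0" for k using b(4)[of k 0] by linarith
 define \<tau> where "\<tau> n = ((1 / 2) ^ n :: real)" for n :: nat
 \<comment> \<open>As \<open>\<tau> n * w n = 4\<close>, the n-th bump lives on
   \<open>|t - \<tau> n| < \<tau> n / 4\<close>, apart from its neighbours at
   \<open>2 \<tau> n\<close> and \<open>\<tau> n / 2\<close>.\<close>
 define w where "w n = (2 ^ (n + 2) :: real)" for n :: nat
 have \<tau>w: "\<tau> n * w n = 4" for n by (simp add: \<tau>_def w_def power_add power_divide)
 have w: "w n > 0" for n by (simp add: w_def)
 have \<tau>: "\<tau> n > 0" for n by (simp add: \<tau>_def)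
 define \<beta> where "\<beta> k n t = b k ((t - \<tau> n) * w n) * w n ^ k" for k n t
 \<comment> \<open>Indices of the bumps that are alive at \<open>t\<close>. The set is finite, so
   the curve is written with finite sums and no series in the space is needed.\<close>
 define F where "F t = {n. \<bar>(t - \<tau> n) * w n\<bar> < 1}" for t
 have \<beta>0: "\<beta> k n t = 0" if "n \<notin> F t" for k n t using that b(2) by (simp add: F_def \<beta>_def)
 have \<beta>d: "(\<beta> k n has_real_derivative \<beta> (Suc k) n t) (at t)" for k n t
 proof -
  have "((\<lambda>t. b k ((t - \<tau> n) * w n)) has_real_derivative b (Suc k) ((t - \<tau> n) * w n) * w n) (at t)"
   by (rule DERIV_chain2[OF b(3)]) (auto intro!: derivative_eq_intros)
  then have "((\<lambda>t. b k ((t - \<tau> n) * w n) * w n ^ k) has_real_derivative b (Suc k) ((t - \<tau> n) * w n) * w n * w n ^ k) (at t)"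
   by (rule DERIV_cmult_right)
  then show ?thesis unfolding \<beta>_def by (simp add: mult.assoc)
 qed
 have \<beta>b: "\<bar>\<beta> k n t\<bar> \<le> M k * w n ^ k" for k n t
  unfolding \<beta>_def abs_mult using b(4) w[of n] M0 by (intro mult_mono) auto
 have finF: "finite (F t)" for t
 proof (cases "t > 0")
  case True
  obtain m where m: "(1 / 2) ^ m < t / 5" using real_arch_pow_inv[of "t / 5" "1 / 2"] True by auto
  have "F t \<subseteq> {..m}"
  proof
   fix n assume "n \<in> F t"
   then have "t * w n < 5" using \<tau>w[of n] by (simp add: F_def algebra_simps abs_if split: if_splits)
   show "n \<in> {..m}"
   proof (rule ccontr)
    assume "n \<notin> {..m}"
    then have "(1 / 2 :: real) ^ n \<le> (1 / 2) ^ m" by (intro power_decreasing) auto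
    then have "5 * \<tau> n < t" using m unfolding \<tau>_def by linarith
    then have "5 * \<tau> n * w n < t * w n" using w by (intro mult_strict_right_mono) auto
    then show False using \<tau>w[of n] \<open>t * w n < 5\<close> by simp
   qed
  qed
  then show ?thesis by (rule finite_subset) simp
 next
  case False
  have "n \<notin> F t" for n
  proof -
   have "t * w n \<le> 0" using False w[of n] by (simp add: mult_nonpos_nonneg)
   then show ?thesis using \<tau>w[of n] by (simp add: F_def algebra_simps)
  qed
  then have "F t = {}" by blast
  then show ?thesis by simp
 qed
 define d where "d k t = (if k = 0 then x else 0) + (\<Sum>n\<in>F t. \<beta> k n t *\<^sub>R h n)" for k t
 have d_eq: "d k t = (if k = 0 then x else 0) + (\<Sum>n\<in>S. \<beta> k n t *\<^sub>R h n)" if "finite S" "F t \<subseteq> S" for k t S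
  unfolding d_def using sum.mono_neutral_left[OF that, of "\<lambda>n. \<beta> k n t *\<^sub>R h n"] \<beta>0 by simp
 \<comment> \<open>\<open>w n ^ k\<close> grows with an exponent linear in \<open>n\<close>, while
   the norm of \<open>h n\<close> decays with a quadratic one: the decay wins for
   \<open>n > k\<close>, and the other indices are covered by \<open>2^((k+2)k)\<close>. The extra
   \<open>2^-n\<close> makes the sum over \<open>n\<close> bounded.\<close>
 have wh: "w n ^ k * minkowski B (h n) \<le> 2 ^ ((k + 2) * k) * (1 / 2) ^ n" for n k
 proof -
  have "w n ^ k * minkowski B (h n) \<le> w n ^ k * (1 / 2) ^ ((n + 2) * n + n)" using h(2)[of n] w[of n] by (intro mult_left_mono) auto
  also have "... = 2 ^ ((n + 2) * k) * (1 / 2) ^ ((n + 2) * n) * (1 / 2) ^ n"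
  proof -
   have "w n ^ k = 2 ^ ((n + 2) * k)" by (simp only: w_def power_mult)
   then show ?thesis by (simp only: power_add[of _ "(n + 2) * n"] mult.assoc)
  qed
  also have "... \<le> 2 ^ ((k + 2) * k) * (1 / 2) ^ n"
  proof (intro mult_right_mono)
   show "2 ^ ((n + 2) * k) * (1 / 2) ^ ((n + 2) * n) \<le> (2 ^ ((k + 2) * k) :: real)"
   proof (cases "n \<le> k")
    case True
    have "2 ^ ((n + 2) * k) * (1 / 2) ^ ((n + 2) * n) \<le> 2 ^ ((n + 2) * k) * (1 :: real)" by (intro mult_left_mono power_le_one) auto
    also have "... \<le> 2 ^ ((k + 2) * k)" using True by (simp add: power_increasing mult_le_mono1)
    finally show ?thesis .
   next
    case False
    then have "(2::real) ^ ((n + 2) * k) \<le> 2 ^ ((n + 2) * n)" by (intro power_increasing mult_le_mono2) auto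
    then have "2 ^ ((n + 2) * k) * (1 / 2) ^ ((n + 2) * n) \<le> 2 ^ ((n + 2) * n) * (1 / 2 :: real) ^ ((n + 2) * n)" by (intro mult_right_mono) auto
    also have "... = 1" by (simp add: power_mult_distrib[symmetric])
    also have "(1::real) \<le> 2 ^ ((k + 2) * k)" by (rule one_le_power) simp
    finally show ?thesis .
   qed
  qed simp
  finally show ?thesis .
 qed
 have "smooth_curve (d 0)" unfolding smooth_curve_def
 proof (rule exI[of _ d], intro conjI allI refl)
  fix k t
  \<comment> \<open>A second-order remainder that is uniform in \<open>t\<close> also covers the
    accumulation point \<open>t = 0\<close> of the bumps.\<close>
  show "((\<lambda>s. (1 / s) *\<^sub>R (d k (t + s) - d k t)) \<longlongrightarrow> d (Suc k) t) (at 0)"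
  proof (rule tendsto_minkowski)
   fix s :: real assume s: "s \<noteq> 0"
   define S where "S = F t \<union> F (t + s)"
   have S: "finite S" "F t \<subseteq> S" "F (t + s) \<subseteq> S" using finF by (auto simp: S_def)
   define r where "r n = (\<beta> k n (t + s) - \<beta> k n t - s * \<beta> (Suc k) n t) / s" for n
   have eq: "(1 / s) *\<^sub>R (d k (t + s) - d k t) - d (Suc k) t = (\<Sum>n\<in>S. r n *\<^sub>R h n)"
   proof -
    have "r n *\<^sub>R h n = (1 / s) *\<^sub>R (\<beta> k n (t + s) *\<^sub>R h n - \<beta> k n t *\<^sub>R h n) - \<beta> (Suc k) n t *\<^sub>R h n" for n
     using s by (simp add: r_def diff_divide_distrib scaleR_diff_left scaleR_diff_right)
    then show ?thesis unfolding d_eq[OF S(1,2)] d_eq[OF S(1,3)]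
     by (simp add: sum_subtractf scaleR_sum_right scaleR_diff_right)
   qed
   show "(1 / s) *\<^sub>R (d k (t + s) - d k t) - d (Suc k) t \<in> span B"
    unfolding eq by (intro span_sum span_scale h)
   have "\<bar>r n\<bar> \<le> M (Suc (Suc k)) * w n ^ (Suc (Suc k)) * \<bar>s\<bar>" for n
   proof -
    have "\<bar>\<beta> k n (t + s) - \<beta> k n t - s * \<beta> (Suc k) n t\<bar> \<le> (M (Suc (Suc k)) * w n ^ (Suc (Suc k))) * s\<^sup>2"
     by (rule second_order_remainder[OF \<beta>d \<beta>d \<beta>b])
    also have "... = (M (Suc (Suc k)) * w n ^ (Suc (Suc k)) * \<bar>s\<bar>) * \<bar>s\<bar>" by (simp add: power2_eq_square mult.assoc)
    finally show ?thesis using s by (simp add: r_def pos_divide_le_eq)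
   qed
   then have "(\<Sum>n\<in>S. \<bar>r n\<bar> * minkowski B (h n)) \<le> (\<Sum>n\<in>S. (M (Suc (Suc k)) * w n ^ (Suc (Suc k)) * \<bar>s\<bar>) * minkowski B (h n))"
    using minkowski_nonneg[OF h(1)] by (intro sum_mono mult_right_mono) auto
   also have "... = (\<Sum>n\<in>S. (M (Suc (Suc k)) * \<bar>s\<bar>) * (w n ^ (Suc (Suc k)) * minkowski B (h n)))" by (simp add: mult_ac)
   also have "... \<le> (\<Sum>n\<in>S. (M (Suc (Suc k)) * \<bar>s\<bar>) * (2 ^ ((Suc (Suc k) + 2) * Suc (Suc k)) * (1 / 2) ^ n))"
    using M0 by (intro sum_mono mult_left_mono wh) auto
   also have "... = (M (Suc (Suc k)) * \<bar>s\<bar> * 2 ^ ((Suc (Suc k) + 2) * Suc (Suc k))) * (\<Sum>n\<in>S. (1 / 2) ^ n)"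
    by (simp only: sum_distrib_left mult.assoc)
   also have "... \<le> (M (Suc (Suc k)) * \<bar>s\<bar> * 2 ^ ((Suc (Suc k) + 2) * Suc (Suc k))) * 2"
   proof (intro mult_left_mono)
    have "(\<Sum>n\<in>S. (1 / 2) ^ n) \<le> (\<Sum>n. (1 / 2 :: real) ^ n)" by (rule sum_le_suminf) (use S summable_geometric[of "1 / 2 :: real"] in auto)
    also have "... = 2" using suminf_geometric[of "1 / 2 :: real"] by simp
    finally show "(\<Sum>n\<in>S. (1 / 2) ^ n) \<le> (2::real)" .
   qed (use M0 in auto)
   finally have "(\<Sum>n\<in>S. \<bar>r n\<bar> * minkowski B (h n)) \<le> (M (Suc (Suc k)) * 2 ^ ((Suc (Suc k) + 2) * Suc (Suc k)) * 2) * \<bar>s\<bar>" by (simp only: mult_ac)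
   then show "minkowski B ((1 / s) *\<^sub>R (d k (t + s) - d k t) - d (Suc k) t) \<le> (M (Suc (Suc k)) * 2 ^ ((Suc (Suc k) + 2) * Suc (Suc k)) * 2) * \<bar>s\<bar>"
    unfolding eq by (rule order_trans[OF minkowski_sum[OF S(1) h(1)]])
  qed
 qed
 moreover have "d 0 0 = x"
 proof -
  have "F 0 = {}" using \<tau>w by (auto simp: F_def)
  then show ?thesis by (simp add: d_def)
 qed
 moreover have "d 0 ((1 / 2) ^ m) = x + h m" for m
 proof -
  have "F (\<tau> m) = {m}"
  proof (intro set_eqI iffI)
   fix n assume "n \<in> F (\<tau> m)"
   then have n: "\<bar>\<tau> m * w n - 4\<bar> < 1" using \<tau>w[of n] by (simp add: F_def left_diff_distrib)
   have "\<not> n < m"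
   proof
    assume "n < m"
    then have "\<tau> m \<le> \<tau> (Suc n)" unfolding \<tau>_def by (intro power_decreasing) auto
    then have "\<tau> m * w n \<le> \<tau> (Suc n) * w n" using w[of n] by (intro mult_right_mono) auto
    also have "... = 2" using \<tau>w[of n] by (simp add: \<tau>_def)
    finally show False using n by simp
   qed
   moreover have "\<not> m < n"
   proof
    assume "m < n"
    then have "\<tau> (n - 1) \<le> \<tau> m" unfolding \<tau>_def by (intro power_decreasing) auto
    moreover have "\<tau> (n - 1) = 2 * \<tau> n" using \<open>m < n\<close> by (cases n) (auto simp: \<tau>_def)
    ultimately have "2 * \<tau> n * w n \<le> \<tau> m * w n" using w[of n] by (intro mult_right_mono) auto
    then show False using n \<tau>w[of n] by simp
   qed
   ultimately show "n \<in> {m}" by simp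
  qed (simp add: F_def)
  moreover have "\<beta> 0 m (\<tau> m) = 1" by (simp add: \<beta>_def b)
  ultimately show ?thesis by (simp add: d_def \<tau>_def)
 qed
 ultimately show thesis using that by blast
qed

text \<open>If no ball about \<open>x\<close> fits into \<open>U\<close>, choose
  \<open>x + h n\<close> outside \<open>U\<close> with \<open>h n\<close> tiny and a smooth curve
  through these points and \<open>x\<close>. The preimage of \<open>U\<close> is open and contains
  0, hence it contains some \<open>2^-n\<close>, a contradiction.\<close>

lemma normed_open_minkowski:
 assumes U: "c_infty_open U"
 shows "normed_open (span B) (minkowski B) (U \<inter> span B)"
proof
 show "subspace (span B)" by simp
 show "U \<inter> span B \<subseteq> span B" by simp
 fix x assume x: "x \<in> U \<inter> span B"
 show "\<exists>\<delta>>0. \<forall>h\<in>span B. minkowski B h < \<delta> --> x + h \<in> U \<inter> span B"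
 proof (rule ccontr)
  assume n: "\<not> ?thesis"
  have "\<exists>h. h \<in> span B \<and> minkowski B h < (1 / 2) ^ ((n + 2) * n + n) \<and> x + h \<notin> U" for n :: nat
  proof -
   have "(0::real) < (1 / 2) ^ ((n + 2) * n + n)" by simp
   then obtain h where h: "h \<in> span B" "minkowski B h < (1 / 2) ^ ((n + 2) * n + n)" "x + h \<notin> U \<inter> span B"
    using n by blast
   then have "x + h \<notin> U" using x by (auto intro: span_add)
   then show ?thesis using h by blast
  qed
  then have "\<forall>n. \<exists>h. h \<in> span B \<and> minkowski B h < (1 / 2) ^ ((n + 2) * n + n) \<and> x + h \<notin> U" by blast
  from choice[OF this] obtain h where h: "\<And>n. h n \<in> span B" "\<And>n. minkowski B (h n) < (1 / 2) ^ ((n + 2) * n + n)" "\<And>n. x + h n \<notin> U" by blast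
  obtain c where c: "smooth_curve c" "c 0 = x" "\<And>n. c ((1 / 2) ^ n) = x + h n"
   using smooth_curve_through_points[OF h(1) less_imp_le[OF h(2)]] by blast
  have "open (c -` U)" using U c(1) unfolding c_infty_open_def by blast
  moreover have "0 \<in> c -` U" using c x by simp
  moreover have "(\<lambda>n. (1 / 2 :: real) ^ n) \<longlonglongrightarrow> 0" by (rule LIMSEQ_realpow_zero) auto
  ultimately have "\<forall>\<^sub>F n in sequentially. (1 / 2) ^ n \<in> c -` U" by (blast dest: topological_tendstoD)
  then obtain n where "(1 / 2) ^ n \<in> c -` U" by (auto simp: eventually_sequentially)
  then show False using c(3)[of n] h(3)[of n] by simp
 qed
qed (auto intro: minkowski_nonneg minkowski_definite minkowski_add minkowski_scale)

end

lemma omega_norm_finite_iff: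
 "omega_norm V p W \<omega> K \<rho> f < \<infinity> \<longleftrightarrow> (\<exists>A. \<forall>x\<in>K. \<forall>k. op_norm V p k (frechet_deriv V p W f k x) \<le> ennreal (A * omega_weight \<omega> \<rho> k))"
proof -
 have "X * ennreal (exp (- (1 / \<rho>) * phi_conj \<omega> (\<rho> * real k))) = X / ennreal (omega_weight \<omega> \<rho> k)" for X k
  by (simp add: divide_ennreal_def inverse_ennreal omega_weight_def exp_minus)
 then show ?thesis unfolding omega_norm_def
  using SUP_divide_finite_iff[of "omega_weight \<omega> \<rho>" "\<lambda>k x. op_norm V p k (frechet_deriv V p W f k x)" K] by simp
qed

section \<open>The two kinds of classes on a single normed space\<close>

context normed_open
begin

text \<open>Each compact set comes with its own member of the matrix and its own \<rho>. The
  neighbourhood argument asks for one increasing sequence of weights above all of these: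
  \<open>(m + 1)^k S m k\<close> with a cofinal chain \<open>S\<close>.\<close>

lemma E_matrix_normed_Roumieu_powers:
 assumes R: "R_admissible \<MM>" and j: "j \<ge> 1"
  and f: "(\<lambda>x. f x ^ j) \<in> E_matrix_normed Roumieu \<MM> V p W" "(\<lambda>x. f x ^ (j + 1)) \<in> E_matrix_normed Roumieu \<MM> V p W"
 shows "f \<in> E_matrix_normed Roumieu \<MM> V p W"
proof -
 have wm: "weight_matrix \<MM>" using R by (simp add: R_admissible_def)
 have pos: "M k > 0" if "M \<in> \<MM>" for M k using wm that by (auto simp: weight_matrix_def weight_sequence_def)
 obtain S :: "nat => nat => real" where S': "\<forall>m. S m \<in> \<MM>" "mono S" "\<forall>M\<in>\<MM>. \<exists>m. M \<le> S m" by (rule weight_matrix_cofinal_chain[OF wm]) (rule that)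
 note S = S'(1)[rule_format] S'(2) S'(3)[rule_format]
 have "\<forall>m. \<exists>Nc. fst Nc \<in> \<MM> \<and> snd Nc > 0 \<and> (\<forall>\<rho>>0. transfer_weights j (\<lambda>k. \<rho> ^ k * S m k) (\<lambda>k. (snd Nc * \<rho>) ^ k * fst Nc k))"
 proof
  fix m
  obtain N c where "N \<in> \<MM>" "c > 0" "\<forall>\<rho>>0. transfer_weights j (\<lambda>k. \<rho> ^ k * S m k) (\<lambda>k. (c * \<rho>) ^ k * N k)"
   using R_admissible_transfer[OF R j S(1)[of m]] by (elim bexE exE conjE) (rule that)
  then show "\<exists>Nc. fst Nc \<in> \<MM> \<and> snd Nc > 0 \<and> (\<forall>\<rho>>0. transfer_weights j (\<lambda>k. \<rho> ^ k * S m k) (\<lambda>k. (snd Nc * \<rho>) ^ k * fst Nc k))"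
   by (intro exI[of _ "(N, c)"]) simp
 qed
 from choice[OF this] obtain Nc where Nc: "\<And>m. fst (Nc m) \<in> \<MM>" "\<And>m. snd (Nc m) > 0"
  "\<And>m. \<forall>\<rho>>0. transfer_weights j (\<lambda>k. \<rho> ^ k * S m k) (\<lambda>k. (snd (Nc m) * \<rho>) ^ k * fst (Nc m) k)" by blast
 define a where "a m k = (real m + 1) ^ k * S m k" for m k
 define b where "b m k = (snd (Nc m) * (real m + 1)) ^ k * fst (Nc m) k" for m k
 have a: "a m k \<le> a m' k" if "m \<le> m'" for m m' k
  unfolding a_def using that monoD[OF S(2) that] pos[OF S(1), of m k] by (intro mult_mono power_mono) (auto simp: le_fun_def)
 have a0: "0 < a m k" for m k using pos[OF S(1)] by (simp add: a_def)
 have bd: "\<exists>m A. \<forall>x\<in>K. \<forall>k. op_norm V p k (frechet_deriv V p W g k x) \<le> ennreal (A * a m k)"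
  if g: "g \<in> E_matrix_normed Roumieu \<MM> V p W" and K: "compactin (norm_topology V p) K" "K \<subseteq> W" for g K
 proof -
  obtain M \<rho> where M: "M \<in> \<MM>" "\<rho> > 0" "M_norm V p W M K \<rho> g < \<infinity>" using g K by auto
  then obtain A where A: "\<And>x k. x \<in> K ==> op_norm V p k (frechet_deriv V p W g k x) \<le> ennreal (A * (\<rho> ^ k * M k))"
   using M_norm_finite_iff[of M \<rho> V p W K g] pos[OF M(1)] by blast
  obtain m0 where m0: "M \<le> S m0" using S(3) M by blast
  obtain n :: nat where n: "\<rho> \<le> n" using real_arch_simple by blast
  define m where "m = max m0 n"
  have "A * (\<rho> ^ k * M k) \<le> max 0 A * a m k" for k
  proof -
   have "M k \<le> S m k" using m0 monoD[OF S(2), of m0 m] by (auto simp: le_fun_def m_def intro: order_trans)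
   moreover have "\<rho> \<le> real m + 1" using n by (simp add: m_def)
   ultimately have "\<rho> ^ k * M k \<le> a m k" unfolding a_def
    using M(2) pos[OF M(1), of k] by (intro mult_mono power_mono) (auto simp: less_imp_le)
   then show ?thesis using M(2) pos[OF M(1), of k] by (intro mult_mono) (auto simp: less_imp_le)
  qed
  then show ?thesis using order_trans[OF A ennreal_leI] by blast
 qed
 have tr: "transfer_weights j (a m) (b m)" for m unfolding a_def[abs_def] b_def[abs_def] by (rule Nc(3)[rule_format]) simp
 have sm: "frechet_smooth V p W (\<lambda>x. f x ^ j)" "frechet_smooth V p W (\<lambda>x. f x ^ (j + 1))" using f by simp_all
 have bdd: "\<exists>m A. \<forall>x\<in>K. \<forall>k. op_norm V p k (frechet_deriv V p W f k x) \<le> ennreal (A * b m k)"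
  if "compactin (norm_topology V p) K" "K \<subseteq> W" for K
  by (rule joris_transfer(2)[where a=a and b=b, OF j sm a a0 bd[OF f(1)] bd[OF f(2)] tr that])
 have "\<exists>M\<in>\<MM>. \<exists>\<rho>>0. M_norm V p W M K \<rho> f < \<infinity>" if K: "compactin (norm_topology V p) K" "K \<subseteq> W" for K
 proof -
  obtain m A where "\<forall>x\<in>K. \<forall>k. op_norm V p k (frechet_deriv V p W f k x) \<le> ennreal (A * b m k)" using bdd[OF K] by blast
  moreover have c: "snd (Nc m) * (real m + 1) > 0" using Nc(2) by simp
  ultimately have "M_norm V p W (fst (Nc m)) K (snd (Nc m) * (real m + 1)) f < \<infinity>"
   unfolding M_norm_finite_iff[OF pos[OF Nc(1)[of m]] c] b_def by blast
  then show ?thesis using c Nc(1) by blast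
 qed
 moreover have "frechet_smooth V p W f"
  by (rule joris_transfer(1)[where a=a and b=b, OF j sm a a0 bd[OF f(1)] bd[OF f(2)] tr])
 ultimately show ?thesis by simp
qed

text \<open>Each target pair \<open>N\<close>, \<sigma> is treated on its own, with a single source
  weight. Since \<open>c\<close> does not depend on \<rho>, the choice
  \<open>\<rho> = \<sigma> / c\<close> reaches every \<sigma>.\<close>

lemma E_matrix_normed_Beurling_powers:
 assumes B: "B_admissible \<MM>" and j: "j \<ge> 1"
  and f: "(\<lambda>x. f x ^ j) \<in> E_matrix_normed Beurling \<MM> V p W" "(\<lambda>x. f x ^ (j + 1)) \<in> E_matrix_normed Beurling \<MM> V p W"
 shows "f \<in> E_matrix_normed Beurling \<MM> V p W"
proof -
 have wm: "weight_matrix \<MM>" using B by (simp add: B_admissible_def)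
 have pos: "M k > 0" if "M \<in> \<MM>" for M k using wm that by (auto simp: weight_matrix_def weight_sequence_def)
 have sm: "frechet_smooth V p W (\<lambda>x. f x ^ j)" "frechet_smooth V p W (\<lambda>x. f x ^ (j + 1))" using f by simp_all
 have main: "frechet_smooth V p W f \<and> (\<forall>K. compactin (norm_topology V p) K \<and> K \<subseteq> W --> M_norm V p W N K \<sigma> f < \<infinity>)"
  if N: "N \<in> \<MM>" and \<sigma>: "\<sigma> > 0" for N \<sigma>
 proof -
  obtain M c where M: "M \<in> \<MM>" and c: "c > 0"
   and t': "\<forall>\<rho>>0. transfer_weights j (\<lambda>k. \<rho> ^ k * M k) (\<lambda>k. (c * \<rho>) ^ k * N k)"
   using B_admissible_transfer[OF B j N] by (elim bexE exE conjE) (rule that)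
  note t = t'[rule_format]
  define \<rho> where "\<rho> = \<sigma> / c"
  have \<rho>: "\<rho> > 0" "c * \<rho> = \<sigma>" using c \<sigma> by (simp_all add: \<rho>_def)
  define a where "a m k = \<rho> ^ k * M k" for m k :: nat
  define b where "b m k = \<sigma> ^ k * N k" for m k :: nat
  have a: "a m k \<le> a m' k" and a0: "0 < a m k" for m m' k using \<rho> pos[OF M] by (auto simp: a_def)
  have tr: "transfer_weights j (a m) (b m)" for m
   unfolding a_def[abs_def] b_def[abs_def] using t[OF \<rho>(1)] unfolding \<rho>(2) .
  have bd: "\<exists>m A. \<forall>x\<in>K. \<forall>k. op_norm V p k (frechet_deriv V p W g k x) \<le> ennreal (A * a m k)"
   if g: "g \<in> E_matrix_normed Beurling \<MM> V p W" and K: "compactin (norm_topology V p) K" "K \<subseteq> W" for g K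
  proof -
   have "M_norm V p W M K \<rho> g < \<infinity>" using g K M \<rho>(1) by simp
   then show ?thesis unfolding M_norm_finite_iff[OF pos[OF M] \<rho>(1)] a_def by blast
  qed
  have "frechet_smooth V p W f"
   by (rule joris_transfer(1)[where a=a and b=b, OF j sm a a0 bd[OF f(1)] bd[OF f(2)] tr])
  moreover have "M_norm V p W N K \<sigma> f < \<infinity>" if "compactin (norm_topology V p) K" "K \<subseteq> W" for K
   using joris_transfer(2)[where a=a and b=b, OF j sm a a0 bd[OF f(1)] bd[OF f(2)] tr that]
   unfolding b_def M_norm_finite_iff[OF pos[OF N] \<sigma>] by blast
  ultimately show ?thesis by blast
 qed
 obtain N where "N \<in> \<MM>" using wm by (auto simp: weight_matrix_def)
 then have "frechet_smooth V p W f" using main[of N 1] by simp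
 then show ?thesis using main by simp
qed

text \<open>The parameter \<rho> replaces the members of a matrix: the weights increase with \<rho>,
  so the integers give a cofinal chain in the Roumieu case, and \<open>\<rho> = \<sigma> / c\<close>
  serves the Beurling case.\<close>

lemma E_omega_normed_powers:
 assumes \<omega>: "weight_function \<omega>" "concave_on {0..} \<omega>" and j: "j \<ge> 1"
  and f: "(\<lambda>x. f x ^ j) \<in> E_omega_normed br \<omega> V p W" "(\<lambda>x. f x ^ (j + 1)) \<in> E_omega_normed br \<omega> V p W"
 shows "f \<in> E_omega_normed br \<omega> V p W"
proof -
 obtain c where c: "c > 0" and t: "\<And>\<rho>. \<rho> > 0 ==> transfer_weights j (omega_weight \<omega> \<rho>) (omega_weight \<omega> (c * \<rho>))"
  using transfer_weights_omega[OF \<omega> j] by blast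
 have sm: "frechet_smooth V p W (\<lambda>x. f x ^ j)" "frechet_smooth V p W (\<lambda>x. f x ^ (j + 1))" using f by (cases br; simp)+
 show ?thesis
 proof (cases br)
  case Roumieu
  define a where "a m = omega_weight \<omega> (real m + 1)" for m
  define b where "b m = omega_weight \<omega> (c * (real m + 1))" for m
  have a: "a m k \<le> a m' k" if "m \<le> m'" for m m' k
   unfolding a_def by (rule omega_weight_mono[OF \<omega>(1)]) (use that in auto)
  have a0: "0 < a m k" for m k by (simp add: a_def)
  have tr: "transfer_weights j (a m) (b m)" for m unfolding a_def b_def by (rule t) simp
  have bd: "\<exists>m A. \<forall>x\<in>K. \<forall>k. op_norm V p k (frechet_deriv V p W g k x) \<le> ennreal (A * a m k)"
   if g: "g \<in> E_omega_normed br \<omega> V p W" and K: "compactin (norm_topology V p) K" "K \<subseteq> W" for g K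
  proof -
   obtain \<rho> where \<rho>: "\<rho> > 0" "omega_norm V p W \<omega> K \<rho> g < \<infinity>" using g K Roumieu by auto
   then obtain A where A: "\<And>x k. x \<in> K ==> op_norm V p k (frechet_deriv V p W g k x) \<le> ennreal (A * omega_weight \<omega> \<rho> k)"
    unfolding omega_norm_finite_iff by blast
   obtain m :: nat where m: "\<rho> \<le> m" using real_arch_simple by blast
   have "A * omega_weight \<omega> \<rho> k \<le> max 0 A * a m k" for k
    unfolding a_def using m \<rho>(1) by (intro mult_mono omega_weight_mono \<omega>(1)) (auto simp: less_imp_le[OF omega_weight_pos])
   then show ?thesis using order_trans[OF A ennreal_leI] by blast
  qed
  have "frechet_smooth V p W f"
   by (rule joris_transfer(1)[where a=a and b=b, OF j sm a a0 bd[OF f(1)] bd[OF f(2)] tr])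
  moreover have "\<exists>\<rho>>0. omega_norm V p W \<omega> K \<rho> f < \<infinity>" if K: "compactin (norm_topology V p) K" "K \<subseteq> W" for K
  proof -
   obtain m A where "\<forall>x\<in>K. \<forall>k. op_norm V p k (frechet_deriv V p W f k x) \<le> ennreal (A * b m k)"
    using joris_transfer(2)[where a=a and b=b, OF j sm a a0 bd[OF f(1)] bd[OF f(2)] tr K] by blast
   then have "omega_norm V p W \<omega> K (c * (real m + 1)) f < \<infinity>" unfolding omega_norm_finite_iff b_def by blast
   moreover have "c * (real m + 1) > 0" using c by simp
   ultimately show ?thesis by blast
  qed
  ultimately show ?thesis using Roumieu by simp
 next
  case Beurling
  have main: "frechet_smooth V p W f \<and> (\<forall>K. compactin (norm_topology V p) K \<and> K \<subseteq> W --> omega_norm V p W \<omega> K \<sigma> f < \<infinity>)"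
   if \<sigma>: "\<sigma> > 0" for \<sigma>
  proof -
   define \<rho> where "\<rho> = \<sigma> / c"
   have \<rho>: "\<rho> > 0" "c * \<rho> = \<sigma>" using c \<sigma> by (simp_all add: \<rho>_def)
   define a where "a m = omega_weight \<omega> \<rho>" for m :: nat
   define b where "b m = omega_weight \<omega> \<sigma>" for m :: nat
   have a: "a m k \<le> a m' k" and a0: "0 < a m k" for m m' k by (auto simp: a_def)
   have tr: "transfer_weights j (a m) (b m)" for m using t[OF \<rho>(1)] unfolding \<rho>(2) by (simp add: a_def b_def)
   have bd: "\<exists>m A. \<forall>x\<in>K. \<forall>k. op_norm V p k (frechet_deriv V p W g k x) \<le> ennreal (A * a m k)"
    if g: "g \<in> E_omega_normed br \<omega> V p W" and K: "compactin (norm_topology V p) K" "K \<subseteq> W" for g K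
   proof -
    have "omega_norm V p W \<omega> K \<rho> g < \<infinity>" using g K Beurling \<rho>(1) by simp
    then show ?thesis unfolding omega_norm_finite_iff a_def by blast
   qed
   have "frechet_smooth V p W f"
    by (rule joris_transfer(1)[where a=a and b=b, OF j sm a a0 bd[OF f(1)] bd[OF f(2)] tr])
   moreover have "omega_norm V p W \<omega> K \<sigma> f < \<infinity>" if "compactin (norm_topology V p) K" "K \<subseteq> W" for K
    using joris_transfer(2)[where a=a and b=b, OF j sm a a0 bd[OF f(1)] bd[OF f(2)] tr that]
    unfolding b_def omega_norm_finite_iff by blast
   ultimately show ?thesis by blast
  qed
  then show ?thesis using Beurling main[of 1] by simp
 qed
qed

end

theorem theorem3p3:
  fixes U :: "'e::convenient_space set"
    and f :: "'e \<Rightarrow> complex"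
    and br :: bracket
  assumes "c_infty_open U"
  shows
    "(\<forall>(\<MM> :: (nat \<Rightarrow> real) set) (j :: nat).
        admissible br \<MM> \<longrightarrow> 0 < j \<longrightarrow>
        (\<lambda>x. f x ^ j) \<in> E_matrix br \<MM> U \<longrightarrow> (\<lambda>x. f x ^ (j + 1)) \<in> E_matrix br \<MM> U \<longrightarrow>
        f \<in> E_matrix br \<MM> U) \<and>
     (\<forall>(\<omega> :: real \<Rightarrow> real) (j :: nat).
        weight_function \<omega> \<longrightarrow> concave_on {0..} \<omega> \<longrightarrow> 0 < j \<longrightarrow>
        (\<lambda>x. f x ^ j) \<in> E_omega br \<omega> U \<longrightarrow> (\<lambda>x. f x ^ (j + 1)) \<in> E_omega br \<omega> U \<longrightarrow>
        f \<in> E_omega br \<omega> U)"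
proof (intro conjI allI impI)
 fix \<MM> :: "(nat => real) set" and j :: nat
 assume ad: "admissible br \<MM>" and j: "0 < j"
  and f: "(\<lambda>x. f x ^ j) \<in> E_matrix br \<MM> U" "(\<lambda>x. f x ^ (j + 1)) \<in> E_matrix br \<MM> U"
 have j1: "j \<ge> 1" using j by simp
 have "convenient_smooth U f"
  by (rule convenient_smooth_powers[OF j1]) (use f in \<open>auto simp: E_matrix_def\<close>)
 moreover have "f \<in> E_matrix_normed br \<MM> (span B) (minkowski B) (U \<inter> span B)"
  if B: "closed B" "absolutely_convex B" "lcs_bounded B" for B
 proof -
  interpret normed_open "span B" "minkowski B" "U \<inter> span B" by (rule normed_open_minkowski[OF B(2,3) assms])
  have g: "(\<lambda>x. f x ^ j) \<in> E_matrix_normed br \<MM> (span B) (minkowski B) (U \<inter> span B)"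
   "(\<lambda>x. f x ^ (j + 1)) \<in> E_matrix_normed br \<MM> (span B) (minkowski B) (U \<inter> span B)"
   using f B unfolding E_matrix_def by blast+
  show ?thesis
  proof (cases br)
   case Roumieu
   show ?thesis using E_matrix_normed_Roumieu_powers[of \<MM> j f] ad j1 g unfolding Roumieu by auto
  next
   case Beurling
   show ?thesis using E_matrix_normed_Beurling_powers[of \<MM> j f] ad j1 g unfolding Beurling by auto
  qed
 qed
 ultimately show "f \<in> E_matrix br \<MM> U" unfolding E_matrix_def by blast
next
 fix \<omega> :: "real => real" and j :: nat
 assume \<omega>: "weight_function \<omega>" "concave_on {0..} \<omega>" and j: "0 < j"
  and f: "(\<lambda>x. f x ^ j) \<in> E_omega br \<omega> U" "(\<lambda>x. f x ^ (j + 1)) \<in> E_omega br \<omega> U"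
 have j1: "j \<ge> 1" using j by simp
 have "convenient_smooth U f"
  by (rule convenient_smooth_powers[OF j1]) (use f in \<open>auto simp: E_omega_def\<close>)
 moreover have "f \<in> E_omega_normed br \<omega> (span B) (minkowski B) (U \<inter> span B)"
  if B: "closed B" "absolutely_convex B" "lcs_bounded B" for B
 proof -
  interpret normed_open "span B" "minkowski B" "U \<inter> span B" by (rule normed_open_minkowski[OF B(2,3) assms])
  have g: "(\<lambda>x. f x ^ j) \<in> E_omega_normed br \<omega> (span B) (minkowski B) (U \<inter> span B)"
   "(\<lambda>x. f x ^ (j + 1)) \<in> E_omega_normed br \<omega> (span B) (minkowski B) (U \<inter> span B)"
   using f B unfolding E_omega_def by blast+
  show ?thesis by (rule E_omega_normed_powers[OF \<omega> j1 g])
 qed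
 ultimately show "f \<in> E_omega br \<omega> U" unfolding E_omega_def by blast
qed

end
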